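(* Let $k$ be an algebraically closed field of characteristic zero, and let $G=\mathfrak{K}_4\cong C_2\times C_2$ be the Klein four-group. There exist smooth cubic threefolds $Y$ over $k$, with associated birational Fano threefolds $X$ of degree $14$, such that: (1) $Y$ and $X$ carry generically free regular actions of $G$; (2) $Y$ and $X$, with these actions, are not $G$-equivariantly birational; (3) $Y$ and $X$, with these actions, are twisted equivariantly stably birational.
   Context: Equivariant birationality: for varieties $Z,Z'$ with regular actions of $G$, write $Z\sim_G Z'$ if there is a $G$-equivariant birational map $Z\dashrightarrow Z'$. Twisted equivariant stable birationality: projective varieties $Y,X$ with regular, generically free actions of $G$ are twisted equivariantly stably birational if there are finitely many linear representations $V_j$ of extensions of $G$, such that $G$ acts (projectively) linearly on each $\mathbb{P}(V_j)$, with $$ Y\times\prod_j\mathbb{P}(V_j)\ \sim_G\ X\times \prod_j\mathbb{P}(V_j) $$ (diagonal actions). Associated threefolds: let $A$ and $V$ be $k$-vector spaces of dimensions $5$ and $6$, and let $f:A\to\wedge^2(V^\vee)$ be an injective linear map which is regular, i.e. $\mathrm{rk}(f(a))\ge 4$ for all nonzero $a\in A$. Let $\mathrm{Gr}(2,V)\subset\mathbb{P}(\wedge^2V)$ be the Grassmannian in its Plücker embedding and $\mathrm{Gr}(2,V)^\vee\subset\mathbb{P}(\wedge^2(V^\vee))$ its projective dual, the Pfaffian cubic hypersurface of skew forms of rank at most $4$. Let $f(A)^\perp\subset\wedge^2(V)$ be the annihilator of $f(A)$. Put $Y_f=\mathbb{P}(f(A))\cap\mathrm{Gr}(2,V)^\vee$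 (a cubic threefold in $\mathbb{P}^4$) and $X_f=\mathbb{P}(f(A)^\perp)\cap \mathrm{Gr}(2,V)$ (a Fano threefold of degree $14$ in $\mathbb{P}^9$). When $Y_f$ is smooth, $X_f$ is smooth as well, of Picard rank $1$. A degree $14$ Fano threefold $X$ is associated to the cubic threefold $Y$ if $Y=Y_f$ and $X=X_f$ for some such $f$. *)

theory Defs
  imports
    "Jordan_Normal_Form.DL_Rank"
    "HOL-Algebra.Group_Action"
    "HOL-Algebra.Elementary_Groups"
    "HOL-Analysis.Abstract_Topology"
    "HOL-Library.Poly_Mapping"
begin

section \<open>Polynomials in several blocks of variables\<close>

text \<open>The variable \<open>(j, i)\<close> is the \<open>i\<close>-th coordinate on the \<open>j\<close>-th factor of
  \<open>k^(ns!0) \<times> k^(ns!1) \<times> \<dots>\<close>.\<close>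

type_synonym 'k polynomial = "((nat \<times> nat) \<Rightarrow>\<^sub>0 nat) \<Rightarrow>\<^sub>0 'k"

definition evaluate :: "'k::field polynomial \<Rightarrow> 'k vec list \<Rightarrow> 'k" where
  "evaluate p v = (\<Sum>m\<in>Poly_Mapping.keys p. Poly_Mapping.lookup p m *
     (\<Prod>(j, i)\<in>Poly_Mapping.keys m. (v ! j) $ i ^ Poly_Mapping.lookup m (j, i)))"

definition partial_deriv :: "nat \<times> nat \<Rightarrow> 'k::field polynomial \<Rightarrow> 'k polynomial" where
  "partial_deriv x p = (\<Sum>m\<in>Poly_Mapping.keys p.
     Poly_Mapping.single (m - Poly_Mapping.single x 1)
       (of_nat (Poly_Mapping.lookup m x) * Poly_Mapping.lookup p m))"

definition multihomogeneous :: "nat list \<Rightarrow> (nat \<Rightarrow> nat) \<Rightarrow> 'k::field polynomial \<Rightarrow> bool" where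
  "multihomogeneous ns d p \<longleftrightarrow> (\<forall>m\<in>Poly_Mapping.keys p.
     Poly_Mapping.keys m \<subseteq> {(j, i). j < length ns \<and> i < ns ! j} \<and>
     (\<forall>j<length ns. (\<Sum>i<ns ! j. Poly_Mapping.lookup m (j, i)) = d j))"


section \<open>Products of projective spaces, Zariski topology, morphisms\<close>

text \<open>A point of the projective space of lines in \<open>k^n\<close> is a one-dimensional subspace.
  A point of \<open>multiproj [n\<^sub>1, \<dots>, n\<^sub>r] = P(k^n\<^sub>1) \<times> \<dots> \<times> P(k^n\<^sub>r)\<close> is a list of \<open>r\<close> such lines; a single
  projective space is \<open>multiproj [n]\<close>, and products are formed by appending lists.
  Note that \<open>n\<close> is the dimension of the vector space, not of the projective space.\<close>

type_synonym 'k point = "'k vec set list"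

definition line :: "'k::field vec \<Rightarrow> 'k vec set" where
  "line v = {c \<cdot>\<^sub>v v | c. True}"

definition hom_coords :: "nat list \<Rightarrow> 'k::field vec list set" where
  "hom_coords ns = {v. list_all2 (\<lambda>w n. w \<in> carrier_vec n - {0\<^sub>v n}) v ns}"

definition multiproj :: "nat list \<Rightarrow> 'k::field point set" where
  "multiproj ns = map line ` hom_coords ns"

definition zariski :: "nat list \<Rightarrow> 'k::field point topology" where
  "zariski ns = topology_generated_by
     {map line ` {v \<in> hom_coords ns. evaluate p v \<noteq> 0} | p d. multihomogeneous ns d p}"

text \<open>Subsets \<open>Z\<close> of \<open>multiproj ns\<close> carry the subspace topology; regular functions are
  those locally given by quotients of multihomogeneous polynomials of equal multidegree, and
  morphisms are the continuous maps pulling back regular functions to regular functions.\<close>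

abbreviation zariski_on :: "nat list \<Rightarrow> 'k::field point set \<Rightarrow> 'k point topology" where
  "zariski_on ns Z \<equiv> subtopology (zariski ns) Z"

definition regular_function ::
    "nat list \<Rightarrow> 'k::field point set \<Rightarrow> ('k point \<Rightarrow> 'k) \<Rightarrow> bool" where
  "regular_function ns Z h \<longleftrightarrow> (\<forall>x\<in>Z. \<exists>W a b d.
     openin (zariski_on ns Z) W \<and> x \<in> W \<and>
     multihomogeneous ns d a \<and> multihomogeneous ns d b \<and>
     (\<forall>v\<in>hom_coords ns. map line v \<in> W \<longrightarrow>
        evaluate b v \<noteq> 0 \<and> h (map line v) = evaluate a v / evaluate b v))"

definition morphism ::
    "nat list \<Rightarrow> 'k::field point set \<Rightarrow> nat list \<Rightarrow> 'k point set \<Rightarrow>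
     ('k point \<Rightarrow> 'k point) \<Rightarrow> bool" where
  "morphism ns Z ns' Z' \<phi> \<longleftrightarrow>
     continuous_map (zariski_on ns Z) (zariski_on ns' Z') \<phi> \<and>
     (\<forall>V h. openin (zariski_on ns' Z') V \<longrightarrow> regular_function ns' V h \<longrightarrow>
        regular_function ns {x \<in> Z. \<phi> x \<in> V} (h \<circ> \<phi>))"

definition isomorphism ::
    "nat list \<Rightarrow> 'k::field point set \<Rightarrow> nat list \<Rightarrow> 'k point set \<Rightarrow>
     ('k point \<Rightarrow> 'k point) \<Rightarrow> bool" where
  "isomorphism ns Z ns' Z' \<phi> \<longleftrightarrow> morphism ns Z ns' Z' \<phi> \<and>
     (\<exists>\<psi>. morphism ns' Z' ns Z \<psi> \<and> (\<forall>x\<in>Z. \<psi> (\<phi> x) = x) \<and> (\<forall>y\<in>Z'. \<phi> (\<psi> y) = y))"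

definition dense_open :: "nat list \<Rightarrow> 'k::field point set \<Rightarrow> 'k point set \<Rightarrow> bool" where
  "dense_open ns Z U \<longleftrightarrow>
     openin (zariski_on ns Z) U \<and> zariski_on ns Z closure_of U = Z"


section \<open>Group actions and birational maps\<close>

definition regular_action ::
    "('g, 'b) monoid_scheme \<Rightarrow> nat list \<Rightarrow> 'k::field point set \<Rightarrow>
     ('g \<Rightarrow> 'k point \<Rightarrow> 'k point) \<Rightarrow> bool" where
  "regular_action G ns Z \<alpha> \<longleftrightarrow>
     group_action G Z \<alpha> \<and> (\<forall>g\<in>carrier G. morphism ns Z ns Z (\<alpha> g))"

definition generically_free ::
    "('g, 'b) monoid_scheme \<Rightarrow> nat list \<Rightarrow> 'k::field point set \<Rightarrow>
     ('g \<Rightarrow> 'k point \<Rightarrow> 'k point) \<Rightarrow> bool" where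
  "generically_free G ns Z \<alpha> \<longleftrightarrow>
     (\<exists>U. dense_open ns Z U \<and> (\<forall>x\<in>U. stabilizer G \<alpha> x = {\<one>\<^bsub>G\<^esub>}))"

text \<open>A birational map is represented by an isomorphism \<open>\<phi>\<close> from a dense open
  \<open>U \<subseteq> Z\<close> onto a dense open subset of \<open>Z'\<close>.\<close>

definition birational_map ::
    "nat list \<Rightarrow> 'k::field point set \<Rightarrow> nat list \<Rightarrow> 'k point set \<Rightarrow>
     'k point set \<Rightarrow> ('k point \<Rightarrow> 'k point) \<Rightarrow> bool" where
  "birational_map ns Z ns' Z' U \<phi> \<longleftrightarrow> dense_open ns Z U \<and>
     (\<exists>U'. dense_open ns' Z' U' \<and> isomorphism ns U ns' U' \<phi>)"

definition birational ::
    "nat list \<Rightarrow> 'k::field point set \<Rightarrow> nat list \<Rightarrow> 'k point set \<Rightarrow> bool" where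
  "birational ns Z ns' Z' \<longleftrightarrow> (\<exists>U \<phi>. birational_map ns Z ns' Z' U \<phi>)"

text \<open>Equality of the rational maps \<open>\<phi> \<circ> g\<close> and \<open>g \<circ> \<phi>\<close> is equality at the points where both
  representatives are defined; \<open>U\<close> itself need not be invariant.\<close>

definition equivariantly_birational ::
    "('g, 'b) monoid_scheme \<Rightarrow>
     nat list \<Rightarrow> 'k::field point set \<Rightarrow> ('g \<Rightarrow> 'k point \<Rightarrow> 'k point) \<Rightarrow>
     nat list \<Rightarrow> 'k point set \<Rightarrow> ('g \<Rightarrow> 'k point \<Rightarrow> 'k point) \<Rightarrow> bool" where
  "equivariantly_birational G ns Z \<alpha> ns' Z' \<alpha>' \<longleftrightarrow>
     (\<exists>U \<phi>. birational_map ns Z ns' Z' U \<phi> \<and>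
        (\<forall>g\<in>carrier G. \<forall>x\<in>U. \<alpha> g x \<in> U \<longrightarrow> \<phi> (\<alpha> g x) = \<alpha>' g (\<phi> x)))"

text \<open>\<open>E\<close> is an extension of \<open>G\<close> via the surjection \<open>\<pi>\<close>, and \<open>\<rho>\<close> is a representation of \<open>E\<close> on
  \<open>k^n\<close> for which the induced action on lines factors through the action \<open>\<beta>\<close> of \<open>G\<close>. For finite \<open>G\<close>
  and algebraically closed \<open>k\<close>, taking the elements of \<open>E\<close> from \<open>nat\<close> loses nothing: by Schur, every
  such \<open>\<beta>\<close> already arises from a finite extension.\<close>

definition projectively_linear_action ::
    "('g, 'b) monoid_scheme \<Rightarrow> nat \<Rightarrow> ('g \<Rightarrow> 'k::field vec set \<Rightarrow> 'k vec set) \<Rightarrow> bool" where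
  "projectively_linear_action G n \<beta> \<longleftrightarrow>
     (\<exists>(E :: nat monoid) \<pi> \<rho>. group E \<and> \<pi> \<in> epi E G \<and>
        \<rho> \<in> hom E (units_of (ring_mat TYPE('k) n ())) \<and>
        (\<forall>e\<in>carrier E. \<forall>v\<in>carrier_vec n - {0\<^sub>v n}. \<beta> (\<pi> e) (line v) = line (\<rho> e *\<^sub>v v)))"

definition product :: "'k point set \<Rightarrow> 'k point set \<Rightarrow> 'k point set" where
  "product Z Z' = {z @ z' | z z'. z \<in> Z \<and> z' \<in> Z'}"

text \<open>The diagonal action on \<open>Z \<times> P(V\<^sub>0) \<times> P(V\<^sub>1) \<times> \<dots>\<close>, where \<open>Z\<close> lies in a product of \<open>l\<close>
  projective spaces and \<open>G\<close> acts on \<open>P(V\<^sub>j)\<close> through \<open>\<beta> j\<close>.\<close>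

definition diagonal_action ::
    "nat \<Rightarrow> ('g \<Rightarrow> 'k point \<Rightarrow> 'k point) \<Rightarrow> (nat \<Rightarrow> 'g \<Rightarrow> 'k vec set \<Rightarrow> 'k vec set) \<Rightarrow>
     'g \<Rightarrow> 'k point \<Rightarrow> 'k point" where
  "diagonal_action l \<alpha> \<beta> g x =
     \<alpha> g (take l x) @ map (\<lambda>j. \<beta> j g (x ! (l + j))) [0..<length x - l]"

text \<open>\<open>ms ! j\<close> is the dimension of \<open>V\<^sub>j\<close>; it must be positive, as \<open>P(0)\<close> is empty.\<close>

definition twisted_equivariantly_stably_birational ::
    "('g, 'b) monoid_scheme \<Rightarrow>
     nat list \<Rightarrow> 'k::field point set \<Rightarrow> ('g \<Rightarrow> 'k point \<Rightarrow> 'k point) \<Rightarrow>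
     nat list \<Rightarrow> 'k point set \<Rightarrow> ('g \<Rightarrow> 'k point \<Rightarrow> 'k point) \<Rightarrow> bool" where
  "twisted_equivariantly_stably_birational G ns Y \<alpha> ns' X \<alpha>' \<longleftrightarrow>
     (\<exists>ms \<beta>. (\<forall>j<length ms. 0 < ms ! j \<and> projectively_linear_action G (ms ! j) (\<beta> j)) \<and>
        equivariantly_birational G
          (ns @ ms) (product Y (multiproj ms)) (diagonal_action (length ns) \<alpha> \<beta>)
          (ns' @ ms) (product X (multiproj ms)) (diagonal_action (length ns') \<alpha>' \<beta>))"


section \<open>Cubic threefolds and the associated threefolds of degree 14\<close>

definition projectivization :: "nat \<Rightarrow> 'k::field vec set \<Rightarrow> 'k point set" where
  "projectivization n W = {[line w] | w. w \<in> W \<and> w \<noteq> 0\<^sub>v n}"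

text \<open>A smooth cubic hypersurface in a four-dimensional linear subspace
  \<open>\<iota>(P(k^5))\<close> of \<open>P(k^n)\<close>, with smoothness expressed by the Jacobian criterion.\<close>

definition smooth_cubic_threefold :: "nat \<Rightarrow> 'k::field point set \<Rightarrow> bool" where
  "smooth_cubic_threefold n Y \<longleftrightarrow>
     (\<exists>\<iota> F. linear_map class_ring (module_vec TYPE('k) 5) (module_vec TYPE('k) n) \<iota> \<and>
        inj_on \<iota> (carrier_vec 5) \<and>
        multihomogeneous [5] (\<lambda>_. 3) F \<and>
        (\<forall>a\<in>carrier_vec 5 - {0\<^sub>v 5}. evaluate F [a] = 0 \<longrightarrow>
           (\<exists>i<5. evaluate (partial_deriv (0, i) F) [a] \<noteq> 0)) \<and>
        Y = projectivization n (\<iota> ` {a \<in> carrier_vec 5. evaluate F [a] = 0}))"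

text \<open>With \<open>V = k^6\<close>, both skew forms on \<open>V\<close> and elements of the exterior square of \<open>V\<close> are
  skew \<open>6 \<times> 6\<close> matrices: a form \<open>\<omega>\<close> has entries \<open>\<omega>(e\<^sub>i, e\<^sub>j)\<close>, and the matrix \<open>B\<close> stands for the sum
  of the \<open>B\<^sub>i\<^sub>j e\<^sub>i \<and> e\<^sub>j\<close> over \<open>i < j\<close>. Both spaces are identified with \<open>k^15\<close> by the entries with
  \<open>i < j\<close>; the duality pairing then is the dot product of coordinate vectors.\<close>

definition skew_matrices :: "'k::field mat set" where
  "skew_matrices = {M \<in> carrier_mat 6 6. M\<^sup>T = - M}"

definition index_pairs :: "(nat \<times> nat) list" where
  "index_pairs = [(i, j). i \<leftarrow> [0..<6], j \<leftarrow> [Suc i..<6]]"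

definition coords :: "'k::field mat \<Rightarrow> 'k vec" where
  "coords M = vec 15 (\<lambda>l. M $$ (index_pairs ! l))"

definition wedge :: "'k::field vec \<Rightarrow> 'k vec \<Rightarrow> 'k mat" where
  "wedge v w = mat 6 6 (\<lambda>(i, j). v $ i * w $ j - v $ j * w $ i)"

definition grassmannian :: "'k::field point set" where
  "grassmannian =
     projectivization 15 (coords ` {wedge v w | v w. v \<in> carrier_vec 6 \<and> w \<in> carrier_vec 6})"

definition pfaffian_cubic :: "'k::field point set" where
  "pfaffian_cubic =
     projectivization 15 (coords ` {M \<in> skew_matrices. vec_space.rank 6 M \<le> 4})"

definition regular_embedding :: "('k::field vec \<Rightarrow> 'k mat) \<Rightarrow> bool" where
  "regular_embedding f \<longleftrightarrow>
     linear_map class_ring (module_vec TYPE('k) 5) (module_mat TYPE('k) 6 6) f \<and>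
     f ` carrier_vec 5 \<subseteq> skew_matrices \<and>
     inj_on f (carrier_vec 5) \<and>
     (\<forall>a\<in>carrier_vec 5 - {0\<^sub>v 5}. 4 \<le> vec_space.rank 6 (f a))"

definition annihilator :: "'k::field mat set \<Rightarrow> 'k vec set" where
  "annihilator L = {u \<in> carrier_vec 15. \<forall>M\<in>L. coords M \<bullet> u = 0}"

definition Y_of :: "('k::field vec \<Rightarrow> 'k mat) \<Rightarrow> 'k point set" where
  "Y_of f = projectivization 15 (coords ` f ` carrier_vec 5) \<inter> pfaffian_cubic"

definition X_of :: "('k::field vec \<Rightarrow> 'k mat) \<Rightarrow> 'k point set" where
  "X_of f = projectivization 15 (annihilator (f ` carrier_vec 5)) \<inter> grassmannian"

text \<open>These are the closed points of the linear sections. If \<open>Y_of f\<close> is a smooth cubic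
  threefold, both scheme-theoretic sections are smooth, hence reduced, so points suffice.\<close>

definition associated :: "'k::field point set \<Rightarrow> 'k point set \<Rightarrow> bool" where
  "associated Y X \<longleftrightarrow> (\<exists>f. regular_embedding f \<and> Y = Y_of f \<and> X = X_of f)"

end

(* On V = k^2 (x) k^3 we use the five-dimensional family of forms preserved by the dihedral group
   generated by diag(1, -1) and the swap of k^2; on forms and on bivectors it acts through the Klein four-group.

   A point a of the cubic Y has the kernel K of its form, a plane in V, and a point of X is a plane P in V. A
   vector v that lies in exactly one K and one P determines both, so it relates Y and X. For a fixed vector xi,
   K contains one vector orthogonal to xi up to scalar, and so does P; this gives a birational map from Y to X.
   It depends on xi. Taking xi = w (x) e0 with w in the projectivisation of the twisted representation k^2 gives
   an equivariant birational map from Y x P^1 to X x P^1.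

   Y contains rational surfaces parametrised by (a, b), on which the group acts by sign changes of a and b. An
   equivariant rational map to X, restricted to such a surface and expanded at a = b = 0, has an invariant lowest
   coefficient, that is, a fixed point of the group on X. There is none. *)

theory Submission
  imports Defs "HOL-Computational_Algebra.Fundamental_Theorem_Algebra" "HOL-Library.Product_Plus"
    "HOL-Library.Countable"
begin

section \<open>Multihomogeneous polynomial functions\<close>

text \<open>Neither threefold is known here to be irreducible, so a nonempty open set is not
  automatically dense. Density is proved by deformation: a plane section of the cubic joins any
  point of Y to the one point \<open>good_point\<close>. On X a vector of the plane P is deformed
  instead, which requires a vector of P annihilated by only one form. That every P contains such a
  vector is the hardest step; it rests on the smoothness of the cubic and on a case analysis of the
  pure tensors in P.

  No single vector xi can be equivariant: the two involutions anticommute on V, which is a sum of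
  three copies of their irreducible representation on \<open>k^2\<close> and has no invariant line.
  This is why a projective line of vectors xi, and with it a twisted factor, appears.

  Y does have fixed points, for instance x = 0, y = (1, 0). Near a smooth fixed point of a finite
  abelian group, limits taken one eigencoordinate at a time produce a fixed point in the target of
  any equivariant rational map to a projective variety. The surfaces in Y make this explicit with
  polynomials in two variables.\<close>

definition carr :: "nat list \<Rightarrow> 'k::field vec list set" where
  "carr ns = {v. list_all2 (\<lambda>w n. w \<in> carrier_vec n) v ns}"

text \<open>Degrees are attached to functions rather than to polynomials, so that determinants,
  adjugates and contractions can be handled without naming a polynomial. The domain
  \<open>carr\<close> allows zero vectors, unlike \<open>hom_coords\<close>, because the maps built
  below have points where all their coordinates vanish.\<close>

definition hompoly :: "nat list \<Rightarrow> (nat \<Rightarrow> nat) \<Rightarrow> ('k::field vec list \<Rightarrow> 'k) \<Rightarrow> bool" where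
  "hompoly ns d P \<longleftrightarrow> (\<exists>p. multihomogeneous ns d p \<and> (\<forall>v\<in>carr ns. evaluate p v = P v))"

definition monomial_value :: "((nat \<times> nat) \<Rightarrow>\<^sub>0 nat) \<Rightarrow> 'k::field vec list \<Rightarrow> 'k" where
  "monomial_value m v = (\<Prod>(j, i)\<in>Poly_Mapping.keys m. (v ! j) $ i ^ Poly_Mapping.lookup m (j, i))"

lemma hom_coords_subset_carr: "hom_coords ns \<subseteq> carr ns"
  by (auto simp: hom_coords_def carr_def elim: list_all2_mono)

lemma evaluate_superset:
  assumes "finite A" "Poly_Mapping.keys p \<subseteq> A"
  shows "evaluate p v = (\<Sum>m\<in>A. Poly_Mapping.lookup p m * monomial_value m v)"
  unfolding evaluate_def monomial_value_def
  by (rule sum.mono_neutral_left) (use assms in \<open>auto simp: in_keys_iff\<close>)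

lemma evaluate_zero [simp]: "evaluate 0 v = 0"
  by (simp add: evaluate_def)

lemma evaluate_add: "evaluate (p + q) v = evaluate p v + evaluate q v"
proof -
  let ?A = "Poly_Mapping.keys p \<union> Poly_Mapping.keys q"
  have "finite ?A" "Poly_Mapping.keys (p + q) \<subseteq> ?A"
    using keys_add[of p q] by auto
  then show ?thesis
    by (simp add: evaluate_superset[of ?A] lookup_add algebra_simps sum.distrib)
qed

lemma evaluate_single: "evaluate (Poly_Mapping.single m c) v = c * monomial_value m v"
  using evaluate_superset[of "{m}" "Poly_Mapping.single m c" v] by (simp add: lookup_single)

lemma monomial_value_superset:
  assumes "finite A" "Poly_Mapping.keys m \<subseteq> A"
  shows "monomial_value m v = (\<Prod>(j, i)\<in>A. (v ! j) $ i ^ Poly_Mapping.lookup m (j, i))"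
  unfolding monomial_value_def
  by (rule prod.mono_neutral_left) (use assms in \<open>auto simp: in_keys_iff\<close>)

lemma monomial_value_zero [simp]: "monomial_value 0 v = 1"
  by (simp add: monomial_value_def)

lemma monomial_value_add: "monomial_value (m + n) v = monomial_value m v * monomial_value n v"
proof -
  let ?A = "Poly_Mapping.keys m \<union> Poly_Mapping.keys n"
  have "finite ?A" "Poly_Mapping.keys (m + n) \<subseteq> ?A"
    using keys_add[of m n] by auto
  then show ?thesis
    by (simp add: monomial_value_superset[of ?A] lookup_add power_add prod.distrib case_prod_unfold)
qed

lemma monomial_value_single: "monomial_value (Poly_Mapping.single (j, i) e) v = (v ! j) $ i ^ e"
  using monomial_value_superset[of "{(j, i)}" "Poly_Mapping.single (j, i) e" v]
  by (simp add: lookup_single split: if_splits)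

lemma multihomogeneous_zero: "multihomogeneous ns d 0"
  by (simp add: multihomogeneous_def)

lemma multihomogeneous_add:
  assumes "multihomogeneous ns d p" "multihomogeneous ns d q"
  shows "multihomogeneous ns d (p + q)"
  using assms keys_add[of p q] unfolding multihomogeneous_def by blast

lemma hompolyI_multihomogeneous:
  "multihomogeneous ns d p \<Longrightarrow> hompoly ns d (evaluate p)"
  unfolding hompoly_def by blast

lemma hompoly_cong:
  assumes "hompoly ns d P" "\<And>v. v \<in> carr ns \<Longrightarrow> P v = Q v" "\<And>j. j < length ns \<Longrightarrow> d j = d' j"
  shows "hompoly ns d' Q"
proof -
  obtain p where p: "multihomogeneous ns d p" "\<forall>v\<in>carr ns. evaluate p v = P v"
    using assms(1) by (auto simp: hompoly_def)
  have "multihomogeneous ns d' p"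
    using p(1) assms(3) by (simp add: multihomogeneous_def)
  moreover have "\<forall>v\<in>carr ns. evaluate p v = Q v"
    using p(2) assms(2) by simp
  ultimately show ?thesis unfolding hompoly_def by blast
qed

lemma hompoly_zero [simp]: "hompoly ns d (\<lambda>v. 0)"
  unfolding hompoly_def by (intro exI[of _ 0]) (simp add: multihomogeneous_zero)

lemma hompoly_add:
  assumes "hompoly ns d P" "hompoly ns d Q"
  shows "hompoly ns d (\<lambda>v. P v + Q v)"
proof -
  obtain p q where "multihomogeneous ns d p" "\<forall>v\<in>carr ns. evaluate p v = P v"
    "multihomogeneous ns d q" "\<forall>v\<in>carr ns. evaluate q v = Q v"
    using assms by (auto simp: hompoly_def)
  then show ?thesis unfolding hompoly_def
    by (intro exI[of _ "p + q"]) (simp add: multihomogeneous_add evaluate_add)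
qed

lemma hompoly_sum:
  assumes "\<And>x. x \<in> A \<Longrightarrow> hompoly ns d (P x)"
  shows "hompoly ns d (\<lambda>v. \<Sum>x\<in>A. P x v)"
  using assms by (induction A rule: infinite_finite_induct) (auto intro: hompoly_add)

lemma multihomogeneous_single:
  assumes "c \<noteq> 0 \<Longrightarrow> Poly_Mapping.keys m \<subseteq> {(j, i). j < length ns \<and> i < ns ! j}"
    "\<And>j. c \<noteq> 0 \<Longrightarrow> j < length ns \<Longrightarrow> (\<Sum>i<ns ! j. Poly_Mapping.lookup m (j, i)) = d j"
  shows "multihomogeneous ns d (Poly_Mapping.single m c)"
  using assms by (auto simp: multihomogeneous_def split: if_splits)

lemma hompoly_monomial:
  assumes "Poly_Mapping.keys m \<subseteq> {(j, i). j < length ns \<and> i < ns ! j}"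
    "\<And>j. j < length ns \<Longrightarrow> (\<Sum>i<ns ! j. Poly_Mapping.lookup m (j, i)) = d j"
  shows "hompoly ns d (\<lambda>v. c * monomial_value m v)"
  unfolding hompoly_def
  by (intro exI[of _ "Poly_Mapping.single m c"])
    (use assms in \<open>auto intro!: multihomogeneous_single simp: evaluate_single\<close>)

lemma hompoly_const: "(\<And>j. j < length ns \<Longrightarrow> d j = 0) \<Longrightarrow> hompoly ns d (\<lambda>v. c)"
  using hompoly_monomial[of 0 ns d c] by simp

lemma hompoly_coord:
  assumes "j < length ns" "i < ns ! j" "\<And>l. l < length ns \<Longrightarrow> d l = (if l = j then 1 else 0)"
  shows "hompoly ns d (\<lambda>v. (v ! j) $ i)"
proof -
  have "hompoly ns d (\<lambda>v. 1 * monomial_value (Poly_Mapping.single (j, i) 1) v)"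
    by (rule hompoly_monomial) (use assms in \<open>auto simp: lookup_single when_def\<close>)
  then show ?thesis by (simp add: monomial_value_single)
qed

lemma hompoly_mult:
  assumes "hompoly ns d P" "hompoly ns e Q"
  shows "hompoly ns (\<lambda>j. d j + e j) (\<lambda>v. P v * Q v)"
proof -
  obtain p q where p: "multihomogeneous ns d p" "\<forall>v\<in>carr ns. evaluate p v = P v"
    and q: "multihomogeneous ns e q" "\<forall>v\<in>carr ns. evaluate q v = Q v"
    using assms by (auto simp: hompoly_def)
  let ?R = "\<lambda>v. \<Sum>m\<in>Poly_Mapping.keys p. \<Sum>n\<in>Poly_Mapping.keys q.
    (Poly_Mapping.lookup p m * Poly_Mapping.lookup q n) * monomial_value (m + n) v"
  have "hompoly ns (\<lambda>j. d j + e j) ?R"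
  proof (intro hompoly_sum hompoly_monomial)
    fix m n assume mn: "m \<in> Poly_Mapping.keys p" "n \<in> Poly_Mapping.keys q"
    show "Poly_Mapping.keys (m + n) \<subseteq> {(j, i). j < length ns \<and> i < ns ! j}"
      using keys_add[of m n] p(1) q(1) mn unfolding multihomogeneous_def by blast
    show "\<And>j. j < length ns \<Longrightarrow> (\<Sum>i<ns ! j. Poly_Mapping.lookup (m + n) (j, i)) = d j + e j"
      using p(1) q(1) mn by (auto simp: multihomogeneous_def lookup_add sum.distrib)
  qed
  moreover have "?R v = P v * Q v" if "v \<in> carr ns" for v
  proof -
    have "?R v = evaluate p v * evaluate q v"
      by (simp add: evaluate_superset[OF finite_keys order_refl] sum_product monomial_value_add mult_ac)
    then show ?thesis using p(2) q(2) that by simp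
  qed
  ultimately show ?thesis by (rule hompoly_cong) auto
qed

lemma hompoly_mult':
  assumes "hompoly ns d P" "hompoly ns e Q" "\<And>j. j < length ns \<Longrightarrow> f j = d j + e j"
  shows "hompoly ns f (\<lambda>v. P v * Q v)"
  by (rule hompoly_cong[OF hompoly_mult[OF assms(1,2)]]) (use assms(3) in auto)

lemma hompoly_scale: "hompoly ns d P \<Longrightarrow> hompoly ns d (\<lambda>v. c * P v)"
  by (rule hompoly_mult'[OF hompoly_const]) auto

lemma hompoly_uminus: "hompoly ns d P \<Longrightarrow> hompoly ns d (\<lambda>v. - P v)"
  using hompoly_scale[of ns d P "-1"] by simp

lemma hompoly_diff: "hompoly ns d P \<Longrightarrow> hompoly ns d Q \<Longrightarrow> hompoly ns d (\<lambda>v. P v - Q v)"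
  using hompoly_add[OF _ hompoly_uminus] by fastforce

lemma hompoly_prod:
  assumes "\<And>x. x \<in> A \<Longrightarrow> hompoly ns (d x) (P x)"
  shows "hompoly ns (\<lambda>j. \<Sum>x\<in>A. d x j) (\<lambda>v. \<Prod>x\<in>A. P x v)"
  using assms
  by (induction A rule: infinite_finite_induct) (auto intro: hompoly_mult hompoly_const)

lemma hompoly_power: "hompoly ns d P \<Longrightarrow> hompoly ns (\<lambda>j. n * d j) (\<lambda>v. P v ^ n)"
  by (induction n) (auto intro: hompoly_const hompoly_mult)

text \<open>Every monomial of \<open>P\<close> has degree \<open>d j\<close> in block
  \<open>j\<close>, and each coordinate of that block contributes multidegree
  \<open>\<delta> j\<close> after substitution; so all monomials end up with the same
  multidegree.\<close>

lemma hompoly_comp: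
  assumes P: "hompoly ns' d P"
    and Q: "\<And>v. v \<in> carr ns \<Longrightarrow> Q v \<in> carr ns'"
    and comp: "\<And>j i. j < length ns' \<Longrightarrow> i < ns' ! j \<Longrightarrow> hompoly ns (\<delta> j) (\<lambda>v. (Q v ! j) $ i)"
  shows "hompoly ns (\<lambda>l. \<Sum>j<length ns'. d j * \<delta> j l) (\<lambda>v. P (Q v))"
proof -
  obtain p where p: "multihomogeneous ns' d p" "\<forall>v\<in>carr ns'. evaluate p v = P v"
    using P by (auto simp: hompoly_def)
  have "hompoly ns (\<lambda>l. \<Sum>j<length ns'. d j * \<delta> j l) (\<lambda>v. evaluate p (Q v))"
    unfolding evaluate_def
  proof (intro hompoly_sum hompoly_scale)
    fix m assume m: "m \<in> Poly_Mapping.keys p"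
    have km: "Poly_Mapping.keys m \<subseteq> {(j, i). j < length ns' \<and> i < ns' ! j}"
      and dm: "\<And>j. j < length ns' \<Longrightarrow> (\<Sum>i<ns' ! j. Poly_Mapping.lookup m (j, i)) = d j"
      using p(1) m by (auto simp: multihomogeneous_def)
    have "hompoly ns (\<lambda>l. \<Sum>x\<in>Poly_Mapping.keys m. Poly_Mapping.lookup m x * \<delta> (fst x) l)
        (\<lambda>v. \<Prod>x\<in>Poly_Mapping.keys m. (Q v ! fst x) $ snd x ^ Poly_Mapping.lookup m x)"
      by (rule hompoly_prod, rule hompoly_power, rule comp) (use km in auto)
    moreover have "(\<Sum>x\<in>Poly_Mapping.keys m. Poly_Mapping.lookup m x * \<delta> (fst x) l)
        = (\<Sum>j<length ns'. d j * \<delta> j l)" for l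
    proof -
      have "(\<Sum>x\<in>Poly_Mapping.keys m. Poly_Mapping.lookup m x * \<delta> (fst x) l)
          = (\<Sum>x\<in>(SIGMA j:{..<length ns'}. {..<ns' ! j}). Poly_Mapping.lookup m x * \<delta> (fst x) l)"
        by (rule sum.mono_neutral_left) (use km in \<open>auto simp: in_keys_iff\<close>)
      also have "\<dots> = (\<Sum>j<length ns'. \<Sum>i<ns' ! j. Poly_Mapping.lookup m (j, i) * \<delta> j l)"
        by (subst sum.Sigma) (auto simp: case_prod_unfold)
      also have "\<dots> = (\<Sum>j<length ns'. d j * \<delta> j l)"
        by (intro sum.cong refl) (simp add: dm[symmetric] sum_distrib_right)
      finally show ?thesis .
    qed
    ultimately show "hompoly ns (\<lambda>l. \<Sum>j<length ns'. d j * \<delta> j l)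
        (\<lambda>v. \<Prod>(j, i)\<in>Poly_Mapping.keys m. (Q v ! j) $ i ^ Poly_Mapping.lookup m (j, i))"
      by (simp add: case_prod_unfold)
  qed
  then show ?thesis by (rule hompoly_cong) (use p(2) Q in auto)
qed

text \<open>The degree of an entry may depend on its row: each term of the Leibniz expansion takes
  one entry from every row, so all terms have the same degree.\<close>

lemma hompoly_det:
  assumes A: "\<And>v. A v \<in> carrier_mat n n"
    and comp: "\<And>i j. i < n \<Longrightarrow> j < n \<Longrightarrow> hompoly ns (\<delta> i) (\<lambda>v. A v $$ (i, j))"
  shows "hompoly ns (\<lambda>l. \<Sum>i\<in>{0..<n}. \<delta> i l) (\<lambda>v. det (A v))"
proof -
  have "hompoly ns (\<lambda>l. \<Sum>i\<in>{0..<n}. \<delta> i l)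
    (\<lambda>v. \<Sum>p\<in>{p. p permutes {0..<n}}. signof p * (\<Prod>i = 0..<n. A v $$ (i, p i)))"
    by (intro hompoly_sum hompoly_scale hompoly_prod comp)
      auto
  then show ?thesis
    by (rule hompoly_cong) (simp_all add: det_def'[OF A])
qed

section \<open>Polynomial functions of two variables\<close>

text \<open>A polynomial is read as an element of \<open>k[s][t]\<close>, with \<open>t\<close> the
  outer variable. Division by a cubic monic in \<open>t\<close>, extraction of powers of
  \<open>t\<close> and specialisation of \<open>s\<close> are then operations on
  coefficients.\<close>

definition poly2 :: "('k::field \<Rightarrow> 'k \<Rightarrow> 'k) \<Rightarrow> bool" where
  "poly2 f \<longleftrightarrow> (\<exists>R::'k poly poly. \<forall>s t. f s t = poly (poly R [:t:]) s)"

lemma poly2_const [simp]: "poly2 (\<lambda>s t. c)"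
  unfolding poly2_def by (intro exI[of _ "[:[:c:]:]"]) simp

lemma poly2_fst [simp]: "poly2 (\<lambda>s t. s)"
  unfolding poly2_def by (intro exI[of _ "[:[:0,1:]:]"]) simp

lemma poly2_snd [simp]: "poly2 (\<lambda>s t. t)"
  unfolding poly2_def by (intro exI[of _ "[:0,1:]"]) simp

lemma poly2_add [intro]: assumes "poly2 f" "poly2 g" shows "poly2 (\<lambda>s t. f s t + g s t)"
proof -
  obtain R S where "\<forall>s t. f s t = poly (poly R [:t:]) s" "\<forall>s t. g s t = poly (poly S [:t:]) s"
    using assms by (auto simp: poly2_def)
  then show ?thesis unfolding poly2_def by (intro exI[of _ "R + S"]) simp
qed

lemma poly2_mult [intro]: assumes "poly2 f" "poly2 g" shows "poly2 (\<lambda>s t. f s t * g s t)"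
proof -
  obtain R S where "\<forall>s t. f s t = poly (poly R [:t:]) s" "\<forall>s t. g s t = poly (poly S [:t:]) s"
    using assms by (auto simp: poly2_def)
  then show ?thesis unfolding poly2_def by (intro exI[of _ "R * S"]) simp
qed

lemma poly2_uminus [intro]: assumes "poly2 f" shows "poly2 (\<lambda>s t. - f s t)"
  using poly2_mult[OF poly2_const[of "-1"] assms] by simp

lemma poly2_diff [intro]: assumes "poly2 f" "poly2 g" shows "poly2 (\<lambda>s t. f s t - g s t)"
  using poly2_add[OF assms(1) poly2_uminus[OF assms(2)]] by simp

lemma poly2_sum [intro]: "(\<And>x. x \<in> A \<Longrightarrow> poly2 (f x)) \<Longrightarrow> poly2 (\<lambda>s t. \<Sum>x\<in>A. f x s t)"
  by (induction A rule: infinite_finite_induct) (auto intro: poly2_add)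

lemma poly2_prod [intro]: "(\<And>x. x \<in> A \<Longrightarrow> poly2 (f x)) \<Longrightarrow> poly2 (\<lambda>s t. \<Prod>x\<in>A. f x s t)"
  by (induction A rule: infinite_finite_induct) (auto intro: poly2_mult)

lemma poly2_power [intro]: "poly2 f \<Longrightarrow> poly2 (\<lambda>s t. f s t ^ n)"
  by (induction n) (auto intro: poly2_mult)

lemma poly2_det:
  assumes A: "\<And>s t. A s t \<in> carrier_mat n n"
    and comp: "\<And>i j. i < n \<Longrightarrow> j < n \<Longrightarrow> poly2 (\<lambda>s t. A s t $$ (i, j))"
  shows "poly2 (\<lambda>s t. det (A s t))"
  unfolding det_def'[OF A]
  by (intro poly2_sum poly2_mult poly2_prod comp poly2_const) auto

lemma poly2_evaluate:
  assumes p: "multihomogeneous ns d p"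
    and comp: "\<And>j i. j < length ns \<Longrightarrow> i < ns ! j \<Longrightarrow> poly2 (\<lambda>s t. (v s t ! j) $ i)"
  shows "poly2 (\<lambda>s t. evaluate p (v s t))"
  unfolding evaluate_def case_prod_unfold
  by (intro poly2_sum poly2_mult poly2_const poly2_prod poly2_power comp)
    (use p in \<open>force simp: multihomogeneous_def\<close>)+

section \<open>The Zariski topology on products of projective spaces\<close>

lemma line_smult: "c \<noteq> 0 \<Longrightarrow> line (c \<cdot>\<^sub>v v) = line (v :: 'k::field vec)"
proof -
  assume c: "c \<noteq> 0"
  have "d \<cdot>\<^sub>v v \<in> line (c \<cdot>\<^sub>v v)" for d
    unfolding line_def using c by (auto intro!: exI[of _ "d / c"] simp: smult_smult_assoc)
  moreover have "d \<cdot>\<^sub>v (c \<cdot>\<^sub>v v) \<in> line v" for d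
    unfolding line_def by (auto intro!: exI[of _ "d * c"] simp: smult_smult_assoc)
  ultimately show ?thesis unfolding line_def by blast
qed

lemma line_self: "v \<in> line (v :: 'k::field vec)"
  unfolding line_def by (auto intro!: exI[of _ 1])

lemma line_eqD:
  assumes "line v = line (w :: 'k::field vec)" "w \<in> carrier_vec n" "w \<noteq> 0\<^sub>v n"
  shows "\<exists>c. c \<noteq> 0 \<and> w = c \<cdot>\<^sub>v v"
proof -
  obtain c where c: "w = c \<cdot>\<^sub>v v"
    using assms(1) line_self[of w] unfolding line_def by blast
  have "c \<noteq> 0"
  proof
    assume "c = 0"
    then have "w = 0\<^sub>v n" using c assms(2) by (auto simp: vec_eq_iff)
    with assms(3) show False by simp
  qed
  with c show ?thesis by blast
qed

lemma monomial_value_scale: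
  assumes km: "Poly_Mapping.keys m \<subseteq> {(j, i). j < length ns \<and> i < ns ! j}"
    and dm: "\<And>j. j < length ns \<Longrightarrow> (\<Sum>i<ns ! j. Poly_Mapping.lookup m (j, i)) = d j"
    and v: "v \<in> carr ns" and w: "\<And>j. j < length ns \<Longrightarrow> w ! j = c j \<cdot>\<^sub>v (v ! j)"
  shows "monomial_value m w = (\<Prod>j<length ns. c j ^ d j) * monomial_value m v"
proof -
  let ?S = "SIGMA j:{..<length ns}. {..<ns ! j}"
  have S: "finite ?S" "Poly_Mapping.keys m \<subseteq> ?S" using km by auto
  have "monomial_value m w = (\<Prod>x\<in>?S. c (fst x) ^ Poly_Mapping.lookup m x *
      (v ! fst x) $ snd x ^ Poly_Mapping.lookup m x)"
    unfolding monomial_value_superset[OF S] case_prod_unfold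
  proof (rule prod.cong[OF refl])
    fix x assume x: "x \<in> ?S"
    have "v ! fst x \<in> carrier_vec (ns ! fst x)" "length v = length ns"
      using v x by (auto simp: carr_def list_all2_conv_all_nth)
    then show "(w ! fst x) $ snd x ^ Poly_Mapping.lookup m (fst x, snd x) =
        c (fst x) ^ Poly_Mapping.lookup m x * (v ! fst x) $ snd x ^ Poly_Mapping.lookup m x"
      using x w by (auto simp: power_mult_distrib)
  qed
  also have "\<dots> = (\<Prod>x\<in>?S. c (fst x) ^ Poly_Mapping.lookup m x) * monomial_value m v"
    unfolding monomial_value_superset[OF S] by (simp add: prod.distrib case_prod_unfold)
  also have "(\<Prod>x\<in>?S. c (fst x) ^ Poly_Mapping.lookup m x)
      = (\<Prod>j<length ns. \<Prod>i<ns ! j. c j ^ Poly_Mapping.lookup m (j, i))"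
    by (subst prod.Sigma) (auto simp: case_prod_unfold)
  also have "\<dots> = (\<Prod>j<length ns. c j ^ d j)"
    by (intro prod.cong refl) (simp add: power_sum[symmetric] dm)
  finally show ?thesis .
qed

lemma hompoly_rescale:
  assumes P: "hompoly ns d P" and v: "v \<in> carr ns" and lw: "length w = length ns"
    and w: "\<And>j. j < length ns \<Longrightarrow> w ! j = c j \<cdot>\<^sub>v (v ! j)"
  shows "P w = (\<Prod>j<length ns. c j ^ d j) * P v"
proof -
  obtain p where p: "multihomogeneous ns d p" "\<And>v. v \<in> carr ns \<Longrightarrow> evaluate p v = P v"
    using P by (auto simp: hompoly_def)
  have wc: "w \<in> carr ns"
    using v w lw by (auto simp: carr_def list_all2_conv_all_nth)
  have "evaluate p w = (\<Sum>m\<in>Poly_Mapping.keys p. Poly_Mapping.lookup p m *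
      ((\<Prod>j<length ns. c j ^ d j) * monomial_value m v))"
    unfolding evaluate_superset[OF finite_keys order_refl]
  proof (rule sum.cong[OF refl])
    fix m assume m: "m \<in> Poly_Mapping.keys p"
    have "monomial_value m w = (\<Prod>j<length ns. c j ^ d j) * monomial_value m v"
      by (rule monomial_value_scale[OF _ _ v w]) (use p(1) m in \<open>auto simp: multihomogeneous_def\<close>)
    then show "Poly_Mapping.lookup p m * monomial_value m w =
        Poly_Mapping.lookup p m * ((\<Prod>j<length ns. c j ^ d j) * monomial_value m v)" by simp
  qed
  also have "\<dots> = (\<Prod>j<length ns. c j ^ d j) * evaluate p v"
    unfolding evaluate_superset[OF finite_keys order_refl] by (simp add: sum_distrib_left mult_ac)
  finally show ?thesis using p(2) v wc by simp
qed

text \<open>One factor serves all \<open>P\<close> of multidegree \<open>d\<close>. This is what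
  makes quotients of two such functions, and the line spanned by a vector of them, independent of
  the representative.\<close>

lemma hom_coords_rescale:
  assumes "v \<in> hom_coords ns" "w \<in> hom_coords ns" "map line v = map line (w :: 'k::field vec list)"
  shows "\<exists>c. c \<noteq> 0 \<and> (\<forall>P. hompoly ns d P \<longrightarrow> P w = c * P v)"
proof -
  have l: "length v = length ns" "length w = length ns"
    using assms by (auto simp: hom_coords_def list_all2_conv_all_nth)
  have "\<exists>c. c \<noteq> 0 \<and> w ! j = c \<cdot>\<^sub>v (v ! j)" if j: "j < length ns" for j
  proof (rule line_eqD)
    show "line (v ! j) = line (w ! j)" using assms(3) l j by (metis nth_map)
    show "w ! j \<in> carrier_vec (ns ! j)" "w ! j \<noteq> 0\<^sub>v (ns ! j)"
      using assms(2) j by (auto simp: hom_coords_def list_all2_conv_all_nth)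
  qed
  then obtain c where c: "\<And>j. j < length ns \<Longrightarrow> c j \<noteq> 0 \<and> w ! j = c j \<cdot>\<^sub>v (v ! j)" by metis
  have "(\<Prod>j<length ns. c j ^ d j) \<noteq> 0" using c by auto
  moreover have "P w = (\<Prod>j<length ns. c j ^ d j) * P v" if "hompoly ns d P" for P
    by (rule hompoly_rescale[OF that]) (use assms(1) hom_coords_subset_carr l c in auto)
  ultimately show ?thesis by blast
qed

definition nonvanishing :: "nat list \<Rightarrow> ('k::field vec list \<Rightarrow> 'k) \<Rightarrow> 'k point set" where
  "nonvanishing ns P = map line ` {v \<in> hom_coords ns. P v \<noteq> 0}"

lemma map_line_in_nonvanishing:
  assumes "hompoly ns d P" "v \<in> hom_coords ns"
  shows "map line v \<in> nonvanishing ns P \<longleftrightarrow> P v \<noteq> 0"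
proof
  assume "map line v \<in> nonvanishing ns P"
  then obtain w where w: "w \<in> hom_coords ns" "P w \<noteq> 0" "map line v = map line w"
    by (auto simp: nonvanishing_def)
  then show "P v \<noteq> 0" using hom_coords_rescale[OF assms(2) w(1,3), of d] assms(1) by auto
qed (use assms in \<open>auto simp: nonvanishing_def\<close>)

lemma nonvanishing_cong:
  "(\<And>v. v \<in> hom_coords ns \<Longrightarrow> P v = Q v) \<Longrightarrow> nonvanishing ns P = nonvanishing ns Q"
  unfolding nonvanishing_def by (metis (mono_tags, lifting) Collect_cong)

lemma openin_nonvanishing:
  assumes "hompoly ns d P" shows "openin (zariski ns) (nonvanishing ns P)"
proof -
  obtain p where p: "multihomogeneous ns d p" "\<And>v. v \<in> carr ns \<Longrightarrow> evaluate p v = P v"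
    using assms by (auto simp: hompoly_def)
  have "nonvanishing ns P = nonvanishing ns (evaluate p)"
    by (rule nonvanishing_cong) (use p(2) hom_coords_subset_carr in fastforce)
  then show ?thesis
    unfolding zariski_def using p(1) by (auto intro!: topology_generated_by_Basis simp: nonvanishing_def)
qed

lemma nonvanishing_one: "nonvanishing ns (\<lambda>v. 1) = multiproj ns"
  by (auto simp: nonvanishing_def multiproj_def)

lemma topspace_zariski [simp]: "topspace (zariski ns) = multiproj ns"
proof
  show "topspace (zariski ns) \<subseteq> multiproj ns"
    unfolding zariski_def topology_generated_by_topspace by (auto simp: multiproj_def)
  have "hompoly ns (\<lambda>j. 0) (\<lambda>v. 1)" by (rule hompoly_const) simp
  from openin_subset[OF openin_nonvanishing[OF this]]
  show "multiproj ns \<subseteq> topspace (zariski ns)" by (simp add: nonvanishing_one)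
qed

text \<open>The generating sets form a basis and not merely a subbasis: two nonvanishing loci
  intersect in the nonvanishing locus of the product.\<close>

lemma openin_zariski_basis:
  assumes "openin (zariski ns) U" "x \<in> U"
  shows "\<exists>d P. hompoly ns d P \<and> x \<in> nonvanishing ns P \<and> nonvanishing ns P \<subseteq> U"
proof -
  let ?B = "{map line ` {v \<in> hom_coords ns. evaluate p v \<noteq> 0} | p d. multihomogeneous ns d p}"
  have "generate_topology_on ?B U"
    using assms(1) unfolding zariski_def by (rule openin_topology_generated_by)
  then show ?thesis using assms(2)
  proof (induction arbitrary: x)
    case Empty
    then show ?case by simp
  next
    case (Int a b)
    then obtain d P e Q where P: "hompoly ns d P" "x \<in> nonvanishing ns P" "nonvanishing ns P \<subseteq> a"
      and Q: "hompoly ns e Q" "x \<in> nonvanishing ns Q" "nonvanishing ns Q \<subseteq> b"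
      by (meson IntD1 IntD2)
    obtain v where v: "v \<in> hom_coords ns" "x = map line v" using P(2) by (auto simp: nonvanishing_def)
    have "P v \<noteq> 0" "Q v \<noteq> 0"
      using v P(2) Q(2) map_line_in_nonvanishing[OF P(1) v(1)] map_line_in_nonvanishing[OF Q(1) v(1)]
      by auto
    then have "x \<in> nonvanishing ns (\<lambda>v. P v * Q v)"
      using v by (auto simp: nonvanishing_def)
    moreover have "nonvanishing ns (\<lambda>v. P v * Q v) \<subseteq> a \<inter> b"
      using P(3) Q(3) by (auto simp: nonvanishing_def)
    ultimately show ?case using hompoly_mult[OF P(1) Q(1)] by blast
  next
    case (UN K)
    then show ?case by (meson UnionE UnionI Union_upper subset_trans)
  next
    case (Basis s)
    then show ?case using hompolyI_multihomogeneous by (fastforce simp: nonvanishing_def)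
  qed
qed

lemma openin_zariski_onD:
  assumes "openin (zariski_on ns Z) W" "x \<in> W"
  shows "W \<subseteq> Z \<and> (\<exists>d P. hompoly ns d P \<and> x \<in> nonvanishing ns P \<and> Z \<inter> nonvanishing ns P \<subseteq> W)"
proof -
  obtain T where T: "openin (zariski ns) T" "W = T \<inter> Z"
    using assms(1) by (auto simp: openin_subtopology)
  with openin_zariski_basis[OF T(1), of x] assms(2) show ?thesis by blast
qed

lemma openin_zariski_on_nonvanishing:
  "hompoly ns d P \<Longrightarrow> openin (zariski_on ns Z) (Z \<inter> nonvanishing ns P)"
  using openin_subtopology_Int2[OF openin_nonvanishing] by blast

text \<open>Density in a form that makes sense without irreducibility: near every point of
  \<open>Z\<close>, every basic neighbourhood \<open>P \<noteq> 0\<close> has to contain a point of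
  \<open>Z\<close> with \<open>h \<noteq> 0\<close>.\<close>

lemma dense_openI:
  assumes Z: "Z \<subseteq> multiproj ns" and h: "hompoly ns e h"
    and dense: "\<And>v d P. v \<in> hom_coords ns \<Longrightarrow> map line v \<in> Z \<Longrightarrow> hompoly ns d P \<Longrightarrow> P v \<noteq> 0 \<Longrightarrow>
      \<exists>w\<in>hom_coords ns. map line w \<in> Z \<and> P w \<noteq> 0 \<and> h w \<noteq> 0"
  shows "dense_open ns Z (Z \<inter> nonvanishing ns h)"
proof -
  have top: "topspace (zariski_on ns Z) = Z" using Z by auto
  have "z \<in> zariski_on ns Z closure_of (Z \<inter> nonvanishing ns h)" if z: "z \<in> Z" for z
    unfolding in_closure_of top
  proof (intro conjI allI impI z)
    fix T assume T: "z \<in> T \<and> openin (zariski_on ns Z) T"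
    then obtain d P where P: "hompoly ns d P" "z \<in> nonvanishing ns P" "Z \<inter> nonvanishing ns P \<subseteq> T"
      using openin_zariski_onD by blast
    then obtain v where v: "v \<in> hom_coords ns" "z = map line v" "P v \<noteq> 0"
      by (auto simp: nonvanishing_def)
    obtain w where "w \<in> hom_coords ns" "map line w \<in> Z" "P w \<noteq> 0" "h w \<noteq> 0"
      using dense[OF v(1) _ P(1) v(3)] z v(2) by blast
    then show "\<exists>y. y \<in> Z \<inter> nonvanishing ns h \<and> y \<in> T"
      using P(3) by (auto simp: nonvanishing_def)
  qed
  moreover have "zariski_on ns Z closure_of (Z \<inter> nonvanishing ns h) \<subseteq> Z"
    using closure_of_subset_topspace top by metis
  ultimately show ?thesis
    unfolding dense_open_def using openin_zariski_on_nonvanishing[OF h] by blast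
qed

text \<open>Basic open sets and local quotients pull back along \<open>Q\<close> by
  \<open>hompoly_comp\<close>. The blocks of \<open>Q\<close> may have different degrees
  \<open>\<delta> j\<close>, and \<open>Q\<close> has to avoid zero vectors only over
  \<open>Z\<close>.\<close>

lemma morphismI:
  assumes Z: "Z \<subseteq> multiproj ns" and Z': "Z' \<subseteq> multiproj ns'"
    and Q: "\<And>v. v \<in> carr ns \<Longrightarrow> Q v \<in> carr ns'"
    and comp: "\<And>j i. j < length ns' \<Longrightarrow> i < ns' ! j \<Longrightarrow> hompoly ns (\<delta> j) (\<lambda>v. (Q v ! j) $ i)"
    and \<phi>: "\<And>v. v \<in> hom_coords ns \<Longrightarrow> map line v \<in> Z \<Longrightarrow>
      Q v \<in> hom_coords ns' \<and> \<phi> (map line v) = map line (Q v) \<and> map line (Q v) \<in> Z'"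
  shows "morphism ns Z ns' Z' \<phi>"
proof -
  have top: "topspace (zariski_on ns Z) = Z" "topspace (zariski_on ns' Z') = Z'" using Z Z' by auto
  have rep: "\<exists>v\<in>hom_coords ns. x = map line v" if "x \<in> Z" for x
    using that Z by (auto simp: multiproj_def)
  have op: "openin (zariski_on ns Z) {x \<in> Z. \<phi> x \<in> U}" if U: "openin (zariski_on ns' Z') U" for U
  proof (subst openin_subopen, intro ballI)
    fix x assume "x \<in> {x \<in> Z. \<phi> x \<in> U}"
    then have x: "x \<in> Z" "\<phi> x \<in> U" by auto
    obtain d P where P: "hompoly ns' d P" "\<phi> x \<in> nonvanishing ns' P" "Z' \<inter> nonvanishing ns' P \<subseteq> U"
      using openin_zariski_onD[OF U x(2)] by blast
    have PQ: "hompoly ns (\<lambda>l. \<Sum>j<length ns'. d j * \<delta> j l) (\<lambda>v. P (Q v))"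
      by (rule hompoly_comp[OF P(1) Q comp])
    have mem: "map line v \<in> nonvanishing ns (\<lambda>v. P (Q v)) \<longleftrightarrow> \<phi> (map line v) \<in> nonvanishing ns' P"
      if "v \<in> hom_coords ns" "map line v \<in> Z" for v
      using map_line_in_nonvanishing[OF PQ that(1)] map_line_in_nonvanishing[OF P(1)] \<phi>[OF that]
      by auto
    show "\<exists>T. openin (zariski_on ns Z) T \<and> x \<in> T \<and> T \<subseteq> {x \<in> Z. \<phi> x \<in> U}"
    proof (intro exI[of _ "Z \<inter> nonvanishing ns (\<lambda>v. P (Q v))"] conjI subsetI)
      show "openin (zariski_on ns Z) (Z \<inter> nonvanishing ns (\<lambda>v. P (Q v)))"
        by (rule openin_zariski_on_nonvanishing[OF PQ])
      show "x \<in> Z \<inter> nonvanishing ns (\<lambda>v. P (Q v))"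
        using rep[OF x(1)] mem x(1) P(2) by auto
      fix y assume y: "y \<in> Z \<inter> nonvanishing ns (\<lambda>v. P (Q v))"
      then obtain v where v: "v \<in> hom_coords ns" "y = map line v" using rep by blast
      have "\<phi> y \<in> Z'" using \<phi>[OF v(1)] y v(2) by auto
      with mem[OF v(1)] y v(2) P(3) show "y \<in> {x \<in> Z. \<phi> x \<in> U}" by auto
    qed
  qed
  have into: "\<phi> x \<in> Z'" if "x \<in> Z" for x
    using rep[OF that] \<phi> that by auto
  have cont: "continuous_map (zariski_on ns Z) (zariski_on ns' Z') \<phi>"
    unfolding continuous_map_def top using op into by blast
  have "regular_function ns {x \<in> Z. \<phi> x \<in> V} (h \<circ> \<phi>)"
    if V: "openin (zariski_on ns' Z') V" and h: "regular_function ns' V h" for V h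
    unfolding regular_function_def
  proof (intro ballI)
    fix x assume "x \<in> {x \<in> Z. \<phi> x \<in> V}"
    then have x: "x \<in> Z" "\<phi> x \<in> V" by auto
    obtain W a b d where W: "openin (zariski_on ns' V) W" "\<phi> x \<in> W"
      and a: "multihomogeneous ns' d a" and b: "multihomogeneous ns' d b"
      and ab: "\<And>v. v \<in> hom_coords ns' \<Longrightarrow> map line v \<in> W \<Longrightarrow>
        evaluate b v \<noteq> 0 \<and> h (map line v) = evaluate a v / evaluate b v"
      using h x(2) unfolding regular_function_def by metis
    let ?e = "\<lambda>l. \<Sum>j<length ns'. d j * \<delta> j l"
    obtain a' where a': "multihomogeneous ns ?e a'" "\<And>v. v \<in> carr ns \<Longrightarrow> evaluate a' v = evaluate a (Q v)"
      using hompoly_comp[OF hompolyI_multihomogeneous[OF a] Q comp] unfolding hompoly_def by metis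
    obtain b' where b': "multihomogeneous ns ?e b'" "\<And>v. v \<in> carr ns \<Longrightarrow> evaluate b' v = evaluate b (Q v)"
      using hompoly_comp[OF hompolyI_multihomogeneous[OF b] Q comp] unfolding hompoly_def by metis
    have WV: "W \<subseteq> V" using openin_subset[OF W(1)] by simp
    have "openin (zariski_on ns' Z') W"
    proof -
      obtain T where T: "openin (zariski ns') T" "W = T \<inter> V" using W(1) by (auto simp: openin_subtopology)
      obtain T' where T': "openin (zariski ns') T'" "V = T' \<inter> Z'" using V by (auto simp: openin_subtopology)
      have "openin (zariski ns') (T \<inter> T')" using T(1) T'(1) by blast
      moreover have "W = (T \<inter> T') \<inter> Z'" using T T' by blast
      ultimately show ?thesis unfolding openin_subtopology by blast
    qed
    from op[OF this] obtain T where T: "openin (zariski ns) T" "{x \<in> Z. \<phi> x \<in> W} = T \<inter> Z"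
      by (auto simp: openin_subtopology)
    let ?W = "{x \<in> Z. \<phi> x \<in> W}"
    have "?W = T \<inter> {x \<in> Z. \<phi> x \<in> V}" using T(2) WV by blast
    then have "openin (zariski_on ns {x \<in> Z. \<phi> x \<in> V}) ?W"
      unfolding openin_subtopology using T(1) by blast
    moreover have "evaluate b' v \<noteq> 0 \<and> (h \<circ> \<phi>) (map line v) = evaluate a' v / evaluate b' v"
      if v: "v \<in> hom_coords ns" "map line v \<in> ?W" for v
    proof -
      have "v \<in> carr ns" using v(1) hom_coords_subset_carr by blast
      moreover have "Q v \<in> hom_coords ns'" "\<phi> (map line v) = map line (Q v)" "map line (Q v) \<in> W"
        using \<phi>[OF v(1)] v(2) by auto
      ultimately show ?thesis using ab[of "Q v"] a'(2) b'(2) by auto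
    qed
    ultimately show "\<exists>W a b d. openin (zariski_on ns {x \<in> Z. \<phi> x \<in> V}) W \<and> x \<in> W \<and>
        multihomogeneous ns d a \<and> multihomogeneous ns d b \<and>
        (\<forall>v\<in>hom_coords ns. map line v \<in> W \<longrightarrow>
          evaluate b v \<noteq> 0 \<and> (h \<circ> \<phi>) (map line v) = evaluate a v / evaluate b v)"
      using a'(1) b'(1) x W(2) by (intro exI[of _ ?W] exI[of _ a'] exI[of _ b'] exI[of _ ?e]) auto
  qed
  with cont show ?thesis unfolding morphism_def by blast
qed

section \<open>Hypersurface slices\<close>

text \<open>The Nullstellensatz in one variable: no root of \<open>f\<close> has multiplicity above
  \<open>degree f\<close>, so this exponent suffices.\<close>

lemma dvd_power_degree_if_roots:
  fixes f g :: "'k::alg_closed_field poly"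
  assumes "f \<noteq> 0" "\<And>t. poly f t = 0 \<Longrightarrow> poly g t = 0"
  shows "f dvd g ^ degree f"
  using assms
proof (induction "degree f" arbitrary: f)
  case 0
  then show ?case by (metis is_unit_iff_degree power_0)
next
  case (Suc n)
  then obtain a where a: "poly f a = 0"
    using alg_closed_imp_poly_has_root[of f] by auto
  then obtain f' where f': "f = [:- a, 1:] * f'"
    by (auto simp: poly_eq_0_iff_dvd elim: dvdE)
  have "f' \<noteq> 0" using Suc.prems(1) f' by auto
  moreover from this have n: "n = degree f'"
    using Suc.hyps(2) unfolding f' by (subst (asm) degree_mult_eq) auto
  ultimately have "f' dvd g ^ n"
    using Suc.hyps(1)[of f'] Suc.prems(2) f' by auto
  moreover have "[:- a, 1:] dvd g"
    using Suc.prems(2)[OF a] by (simp add: poly_eq_0_iff_dvd)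
  ultimately have "f dvd g * g ^ n" unfolding f' by (rule mult_dvd_mono[rotated])
  then show ?case unfolding Suc.hyps(2)[symmetric] by simp
qed

lemma poly_map_poly_at: "poly (map_poly (\<lambda>c. poly c s) R) t = poly (poly R [:t:]) s"
  by (induction R) (auto simp: map_poly_pCons)

text \<open>The first hypothesis keeps some root over a general \<open>s\<close> outside \<open>p = 0\<close>, since otherwise
  the cubic would divide \<open>p\<^sup>3\<close>; the second keeps all roots over a general \<open>s\<close> outside
  \<open>h = 0\<close>, since the norm of \<open>h\<close> is nonzero at \<open>s = 1\<close>.\<close>

lemma monic_cubic_slice:
  fixes m0 m1 m2 :: "'k::{alg_closed_field, field_char_0} poly"
  assumes m0: "poly m0 0 = 0"
    and m1: "poly m0 1 = 0" "poly m1 1 = 0" "poly m2 1 = 0"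
    and p: "poly2 p" "p 0 0 \<noteq> 0" and h: "poly2 h" "h 1 0 \<noteq> 0"
  shows "\<exists>s t. poly m0 s + poly m1 s * t + poly m2 s * t ^ 2 + t ^ 3 = 0 \<and> p s t \<noteq> 0 \<and> h s t \<noteq> 0"
proof -
  define M where "M = [:m0, m1, m2, 1:]"
  have M: "degree M = 3" "lead_coeff M = 1" "M \<noteq> 0" by (auto simp: M_def)
  have evM: "poly (poly M [:t:]) s = poly m0 s + poly m1 s * t + poly m2 s * t ^ 2 + t ^ 3" for s t
    by (simp add: M_def algebra_simps power2_eq_square power3_eq_cube)
  \<comment> \<open>\<open>M\<close> has leading coefficient 1, so pseudo-division over
    \<open>k[s]\<close> is honest division.\<close>
  have division: "\<exists>Q R. A = M * Q + R \<and> degree R < 3" for A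
  proof -
    obtain Q R where "pseudo_divmod A M = (Q, R)" by fastforce
    from pseudo_divmod[OF M(3) this] show ?thesis
      using M by (intro exI[of _ Q] exI[of _ R]) auto
  qed
  obtain P where P: "\<And>s t. p s t = poly (poly P [:t:]) s" using p(1) by (auto simp: poly2_def)
  obtain H where H: "\<And>s t. h s t = poly (poly H [:t:]) s" using h(1) by (auto simp: poly2_def)
  obtain Q R where QR: "P ^ 3 = M * Q + R" "degree R < 3" using division by blast
  have R_ev: "poly (poly R [:t:]) s = p s t ^ 3 - poly (poly M [:t:]) s * poly (poly Q [:t:]) s" for s t
    using arg_cong[OF QR(1), of "\<lambda>A. poly (poly A [:t:]) s"] by (simp add: P)
  \<comment> \<open>The cubic vanishes at \<open>(0, 0)\<close>, so the remainder \<open>R\<close>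
    takes the value \<open>p 0 0 ^ 3\<close> there, and its constant coefficient is a nonzero
    polynomial in \<open>s\<close>.\<close>
  define r where "r = coeff R 0"
  have "poly r 0 = poly (poly R [:0:]) 0" unfolding r_def by (metis poly_0_coeff_0 pCons_0_0)
  then have r0: "r \<noteq> 0"
    using R_ev[of 0 0] evM[of 0 0] m0 p(2) by auto
  have generic_p: "\<exists>t. poly (poly M [:t:]) s = 0 \<and> p s t \<noteq> 0" if s: "poly r s \<noteq> 0" for s
  proof (rule ccontr)
    assume neg: "\<nexists>t. poly (poly M [:t:]) s = 0 \<and> p s t \<noteq> 0"
    let ?at = "map_poly (\<lambda>c. poly c s)"
    have Ms: "?at M = [:poly m0 s, poly m1 s, poly m2 s, 1:]" by (simp add: M_def map_poly_pCons)
    have "?at M dvd ?at P ^ degree (?at M)"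
    proof (rule dvd_power_degree_if_roots)
      show "?at M \<noteq> 0" using Ms by simp
      show "poly (?at P) t = 0" if "poly (?at M) t = 0" for t
        using neg that by (simp add: poly_map_poly_at P[symmetric])
    qed
    moreover have "degree (?at M) = 3" by (simp add: Ms)
    ultimately have "?at M dvd ?at P ^ 3" by metis
    moreover have "?at R = ?at P ^ 3 - ?at M * ?at Q"
      by (rule poly_ext) (simp add: poly_map_poly_at R_ev P)
    ultimately have "?at M dvd ?at R" by auto
    moreover have "degree (?at R) < degree (?at M)"
      using map_poly_degree_leq[of "\<lambda>c. poly c s" R] QR(2) by (simp add: Ms)
    ultimately have "?at R = 0" by (meson dvd_imp_degree_le leD)
    then have "coeff (?at R) 0 = 0" by simp
    then show False using s by (simp add: coeff_map_poly r_def)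
  qed
  obtain Q' R' where QR': "H = M * Q' + R'" "degree R' < 3" using division by blast
  define h0 h1 h2 where "h0 = coeff R' 0" "h1 = coeff R' 1" "h2 = coeff R' 2"
  have R': "R' = [:h0, h1, h2:]"
  proof (rule poly_eqI)
    fix n show "coeff R' n = coeff [:h0, h1, h2:] n"
    proof (cases "n < 3")
      case True
      then have "n = 0 \<or> n = 1 \<or> n = 2" by auto
      then show ?thesis by (auto simp: h0_h1_h2_def numeral_2_eq_2)
    next
      case False
      then show ?thesis using QR'(2)
        by (simp add: coeff_eq_0 coeff_pCons split: nat.splits)
    qed
  qed
  have h_ev: "h s t = poly h0 s + poly h1 s * t + poly h2 s * t ^ 2"
    if "poly (poly M [:t:]) s = 0" for s t
    using that by (simp add: H QR'(1) R' algebra_simps power2_eq_square)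
  \<comment> \<open>Coefficients of \<open>t h\<close> and then of \<open>t^2 h\<close> modulo the
    cubic. \<open>N\<close>, the determinant of the three coefficient rows, is the norm of
    \<open>h\<close>; at \<open>s = 1\<close> the cubic is \<open>t^3\<close> and the matrix is
    triangular.\<close>
  define b1 b2 b3 where "b1 = - h2 * m0" "b2 = h0 - h2 * m1" "b3 = h1 - h2 * m2"
  define c1 c2 c3 where "c1 = - b3 * m0" "c2 = b1 - b3 * m1" "c3 = b2 - b3 * m2"
  define N where "N = h0 * (b2 * c3 - b3 * c2) - h1 * (b1 * c3 - b3 * c1) + h2 * (b1 * c2 - b2 * c1)"
  have h01: "poly h0 1 \<noteq> 0" using h_ev[of 0 1] h(2) evM[of 0 1] m1 by simp
  have "poly N 1 = poly h0 1 ^ 3"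
    by (simp add: N_def b1_b2_b3_def c1_c2_c3_def m1 power3_eq_cube)
  then have N0: "N \<noteq> 0" using h01 by auto
  have generic_h: "h s t \<noteq> 0" if s: "poly N s \<noteq> 0" and t: "poly (poly M [:t:]) s = 0" for s t
  proof
    assume "h s t = 0"
    then have e1: "poly h0 s + poly h1 s * t + poly h2 s * t ^ 2 = 0" using h_ev[OF t] by simp
    have cube: "t ^ 3 = - poly m0 s - poly m1 s * t - poly m2 s * t ^ 2"
      using t evM[of t s] by (simp add: eq_neg_iff_add_eq_0 algebra_simps)
    have "t * (poly h0 s + poly h1 s * t + poly h2 s * t ^ 2)
        = poly h0 s * t + poly h1 s * t ^ 2 + poly h2 s * t ^ 3"
      by (simp add: algebra_simps power2_eq_square power3_eq_cube)
    then have e2: "poly b1 s + poly b2 s * t + poly b3 s * t ^ 2 = 0"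
      unfolding e1 cube by (simp add: b1_b2_b3_def algebra_simps)
    have "t * (poly b1 s + poly b2 s * t + poly b3 s * t ^ 2)
        = poly b1 s * t + poly b2 s * t ^ 2 + poly b3 s * t ^ 3"
      by (simp add: algebra_simps power2_eq_square power3_eq_cube)
    then have e3: "poly c1 s + poly c2 s * t + poly c3 s * t ^ 2 = 0"
      unfolding e2 cube by (simp add: c1_c2_c3_def algebra_simps)
    \<comment> \<open>Cofactors of the first column: at a common root the three rows annihilate
      \<open>(1, t, t^2)\<close>, whose first entry is 1.\<close>
    have "poly N s = (poly b2 s * poly c3 s - poly b3 s * poly c2 s) * (poly h0 s + poly h1 s * t + poly h2 s * t ^ 2)
      - (poly h1 s * poly c3 s - poly h2 s * poly c2 s) * (poly b1 s + poly b2 s * t + poly b3 s * t ^ 2)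
      + (poly h1 s * poly b3 s - poly h2 s * poly b2 s) * (poly c1 s + poly c2 s * t + poly c3 s * t ^ 2)"
      by (simp add: N_def algebra_simps)
    then show False using s by (simp only: e1 e2 e3) simp
  qed
  have "r * N \<noteq> 0" using r0 N0 by simp
  then have "finite {s. poly (r * N) s = 0}" by (rule poly_roots_finite)
  then obtain s where "poly (r * N) s \<noteq> 0"
    using ex_new_if_finite[OF infinite_UNIV_char_0] by blast
  then show ?thesis using generic_p[of s] generic_h[of s] evM by auto
qed

definition cubic :: "'k::field vec \<Rightarrow> 'k" where
  "cubic a = (a $ 0 + a $ 1) ^ 3 + 6 * a $ 0 * a $ 1 * a $ 2 + 2 * a $ 2 ^ 3
    + a $ 1 * a $ 3 ^ 2 - a $ 0 * a $ 4 ^ 2"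

text \<open>A point of the cubic at which \<open>free_Y\<close> is nonzero and whose vector and
  plane are off the zero loci of \<open>admissible\<close> and \<open>free_X\<close>. It serves as
  the target of every deformation below.\<close>

definition good_point :: "'k::field vec" where
  "good_point = vec 5 (\<lambda>i. [1, 1, 0, 1, 3] ! i)"

text \<open>The cubic takes the value -8 on this direction. That value is the coefficient of
  \<open>t^3\<close> in every slice, whence the factor \<open>- 1 / 8\<close> that makes the slices
  monic.\<close>

definition good_direction :: "'k::field vec" where
  "good_direction = vec 5 (\<lambda>i. [1, -1, 1, 2, 0] ! i)"

definition slice :: "'k::field vec \<Rightarrow> 'k \<Rightarrow> 'k \<Rightarrow> 'k vec" where
  "slice a s t = vec 5 (\<lambda>i. a $ i + s * (good_point $ i - a $ i) + t * good_direction $ i)"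

text \<open>The line through \<open>good_point\<close> in the direction \<open>good_direction\<close> meets the cubic only in
  \<open>good_point\<close>, with multiplicity three.\<close>

lemma cubic_slice:
  fixes a :: "'k::{alg_closed_field, field_char_0} vec"
  assumes a: "a \<in> carrier_vec 5" "cubic a = 0"
    and p: "poly2 p" "p 0 0 \<noteq> 0" and h: "poly2 h" "h 1 0 \<noteq> 0"
  shows "\<exists>s t. cubic (slice a s t) = 0 \<and> p s t \<noteq> 0 \<and> h s t \<noteq> 0"
proof -
  define b0 b1 b2 b3 b4 where b: "b0 = [:a $ 0, 1 - a $ 0:]" "b1 = [:a $ 1, 1 - a $ 1:]"
    "b2 = [:a $ 2, - a $ 2:]" "b3 = [:a $ 3, 1 - a $ 3:]" "b4 = [:a $ 4, 3 - a $ 4:]"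
  define m0 where "m0 = (b0 + b1) ^ 3 + 6 * b0 * b1 * b2 + 2 * b2 ^ 3 + b1 * b3 ^ 2 - b0 * b4 ^ 2"
  define m1 where "m1 = 6 * b0 * b1 - 6 * b0 * b2 + 6 * b1 * b2 + 6 * b2 ^ 2
    + 4 * b1 * b3 - b3 ^ 2 - b4 ^ 2"
  define m2 where "m2 = 10 * b1 - 6 * b0 - 4 * b3"
  let ?m = "smult (- 1 / 8)"
  have key: "cubic (slice a s t) = -8 * (poly (?m m0) s + poly (?m m1) s * t
      + poly (?m m2) s * t ^ 2 + t ^ 3)" for s t
    by (simp add: cubic_def slice_def good_point_def good_direction_def m0_def m1_def m2_def b
        field_simps power2_eq_square power3_eq_cube)
  have "poly (?m m0) 0 = 0"
    using a(2) by (simp add: m0_def b cubic_def mult_ac)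
  moreover have "poly (?m m0) 1 = 0" "poly (?m m1) 1 = 0" "poly (?m m2) 1 = 0"
    by (simp_all add: m0_def m1_def m2_def b)
  ultimately obtain s t where zero: "poly (?m m0) s + poly (?m m1) s * t + poly (?m m2) s * t ^ 2 + t ^ 3 = 0"
    and "p s t \<noteq> 0" "h s t \<noteq> 0"
    using monic_cubic_slice[OF _ _ _ _ p h] by blast
  moreover have "cubic (slice a s t) = 0" unfolding key zero by simp
  ultimately show ?thesis by blast
qed

lemma slice_carrier [simp]: "slice a s t \<in> carrier_vec 5"
  by (simp add: slice_def)

lemma slice_0_0: "a \<in> carrier_vec 5 \<Longrightarrow> slice a 0 0 = a"
  by (auto simp: slice_def)

lemma slice_1_0: "slice a 1 0 = good_point"
  by (auto simp: slice_def good_point_def)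

lemma poly2_slice: "i < 5 \<Longrightarrow> poly2 (\<lambda>s t. slice a s t $ i)"
  by (simp add: slice_def) (intro poly2_add poly2_mult poly2_fst poly2_snd poly2_const)

section \<open>Rank of a matrix through its kernel\<close>

lemma mat_of_cols_mult_vec:
  assumes M: "M \<in> carrier_mat n nc" and ks: "distinct ks" "set ks \<subseteq> {..<nc}"
    and w: "w \<in> carrier_vec nc" "\<And>k. k < nc \<Longrightarrow> k \<notin> set ks \<Longrightarrow> w $ k = (0::'k::field)"
  shows "mat_of_cols n (map (col M) ks) *\<^sub>v vec (length ks) (\<lambda>i. w $ (ks ! i)) = M *\<^sub>v w"
proof (rule eq_vecI)
  fix r assume "r < dim_vec (M *\<^sub>v w)"
  then have r: "r < n" using M by simp
  have "(mat_of_cols n (map (col M) ks) *\<^sub>v vec (length ks) (\<lambda>i. w $ (ks ! i))) $ r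
      = (\<Sum>i<length ks. M $$ (r, ks ! i) * w $ (ks ! i))"
  proof -
    have "ks ! i < nc" if "i < length ks" for i using ks(2) that nth_mem by blast
    then show ?thesis
      using r M by (auto simp: scalar_prod_def mat_of_cols_def atLeast0LessThan intro!: sum.cong)
  qed
  also have "\<dots> = (\<Sum>k\<in>set ks. M $$ (r, k) * w $ k)"
    by (rule sum.reindex_bij_betw[OF bij_betw_nth]) (use ks(1) in auto)
  also have "\<dots> = (\<Sum>k<nc. M $$ (r, k) * w $ k)"
    by (rule sum.mono_neutral_left) (use ks w in auto)
  also have "\<dots> = (M *\<^sub>v w) $ r"
    using r M w by (auto simp: scalar_prod_def atLeast0LessThan intro!: sum.cong)
  finally show "(mat_of_cols n (map (col M) ks) *\<^sub>v vec (length ks) (\<lambda>i. w $ (ks ! i))) $ r = (M *\<^sub>v w) $ r" .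
qed (use M in auto)

lemma mult_mat_unit_vec:
  "M \<in> carrier_mat n nc \<Longrightarrow> a < nc \<Longrightarrow> M *\<^sub>v unit_vec nc a = col (M :: 'k::field mat) a"
  by (auto intro!: eq_vecI simp: scalar_prod_right_unit)

text \<open>The columns with index in \<open>J\<close> are independent: a relation among them is a
  kernel vector supported on \<open>J\<close>.\<close>

lemma rank_ge_card:
  fixes M :: "'k::field mat"
  assumes M: "M \<in> carrier_mat n nc" and J: "J \<subseteq> {..<nc}"
    and inj: "\<And>w. w \<in> carrier_vec nc \<Longrightarrow> M *\<^sub>v w = 0\<^sub>v n \<Longrightarrow>
      (\<And>k. k < nc \<Longrightarrow> k \<notin> J \<Longrightarrow> w $ k = 0) \<Longrightarrow> w = 0\<^sub>v nc"
  shows "card J \<le> vec_space.rank n M"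
proof -
  interpret vec_space "TYPE('k)" n .
  have fin: "finite J" using J finite_subset by blast
  \<comment> \<open>\<open>lin_indpt\<close> speaks of a set of columns, so coinciding columns have
    to be excluded separately.\<close>
  have inj_col: "inj_on (col M) J"
  proof (rule inj_onI, rule ccontr)
    fix a b assume ab: "a \<in> J" "b \<in> J" "col M a = col M b" "a \<noteq> b"
    let ?w = "unit_vec nc a - unit_vec nc b :: 'k vec"
    have lt: "a < nc" "b < nc" using ab J by auto
    have "M *\<^sub>v ?w = M *\<^sub>v unit_vec nc a - M *\<^sub>v unit_vec nc b"
      using M by (intro mult_minus_distrib_mat_vec) auto
    also have "\<dots> = 0\<^sub>v n"
      using M lt ab(3) mult_mat_unit_vec[OF M lt(1)] mult_mat_unit_vec[OF M lt(2)] by auto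
    finally have "?w = 0\<^sub>v nc" using ab lt by (intro inj) auto
    then have "?w $ a = 0" using lt by simp
    then show False using lt ab(4) by simp
  qed
  obtain ks where ks: "distinct ks" "set ks = J" using finite_distinct_list[OF fin] by blast
  let ?B = "mat_of_cols n (map (col M) ks)"
  have B: "?B \<in> carrier_mat n (length ks)" by (simp add: mat_of_cols_def)
  have colsB: "cols ?B = map (col M) ks"
    by (rule cols_mat_of_cols) (use M ks J in auto)
  have dist: "distinct (cols ?B)" unfolding colsB using ks inj_col by (simp add: distinct_map)
  have "lin_indpt (set (cols ?B))"
  proof
    assume "lin_dep (set (cols ?B))"
    then obtain v where v: "v \<in> carrier_vec (length ks)" "v \<noteq> 0\<^sub>v (length ks)" "?B *\<^sub>v v = 0\<^sub>v n"
      using lin_depE[OF B _ dist] by blast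
    define w where "w = vec nc (\<lambda>k. \<Sum>i<length ks. if ks ! i = k then v $ i else 0)"
    have wk: "w $ (ks ! i) = v $ i" if i: "i < length ks" for i
    proof -
      have "ks ! i < nc" using ks J i nth_mem by blast
      then have "w $ (ks ! i) = (\<Sum>i'<length ks. if i' = i then v $ i' else 0)"
        unfolding w_def using i ks(1) by (auto simp: nth_eq_iff_index_eq intro!: sum.cong)
      then show ?thesis using i by simp
    qed
    have w0: "w $ k = 0" if "k < nc" "k \<notin> J" for k
      using that ks by (auto simp: w_def intro!: sum.neutral)
    have "v = vec (length ks) (\<lambda>i. w $ (ks ! i))" using v(1) wk by auto
    then have "M *\<^sub>v w = 0\<^sub>v n"
      using mat_of_cols_mult_vec[OF M ks(1), of w] ks J w0 v(3) by (simp add: w_def)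
    then have "w = 0\<^sub>v nc" using w0 by (intro inj) (auto simp: w_def)
    have "v $ i = 0" if i: "i < length ks" for i
    proof -
      have "ks ! i < nc" using ks J i nth_mem by blast
      then show ?thesis using wk[OF i] \<open>w = 0\<^sub>v nc\<close> by simp
    qed
    then have "v = 0\<^sub>v (length ks)" using v(1) by auto
    with v(2) show False by simp
  qed
  then have "lin_indpt (col M ` J)" unfolding colsB using ks by simp
  moreover have "col M ` J \<subseteq> set (cols M)" using J M by (auto simp: cols_def)
  ultimately have "card (col M ` J) \<le> rank M" by (intro rank_ge_card_indpt[OF M])
  then show ?thesis using card_image[OF inj_col] by simp
qed

text \<open>A kernel of dimension two is expressed by nonzero kernel vectors that vanish at a
  prescribed coordinate. An independent set of \<open>nc - 1\<close> columns would omit at most one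
  index \<open>t\<close>, and a kernel vector vanishing at \<open>t\<close> is a relation among its
  members.\<close>

lemma rank_le_diff_2:
  fixes M :: "'k::field mat"
  assumes M: "M \<in> carrier_mat n nc" and nc: "2 \<le> nc"
    and ker: "\<And>t. t < nc \<Longrightarrow> \<exists>w. w \<in> carrier_vec nc \<and> w \<noteq> 0\<^sub>v nc \<and> M *\<^sub>v w = 0\<^sub>v n \<and> w $ t = 0"
  shows "vec_space.rank n M \<le> nc - 2"
proof (rule ccontr)
  interpret vec_space "TYPE('k)" n .
  assume "\<not> rank M \<le> nc - 2"
  then have big: "nc - 1 \<le> rank M" by simp
  obtain S where max: "maximal S (\<lambda>T. T \<subseteq> set (cols M) \<and> lin_indpt T)"
    using maximal_exists_superset[of "set (cols M)" "\<lambda>T. T \<subseteq> set (cols M) \<and> lin_indpt T" "{}"]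
      finite_lin_indpt2 by auto
  have S: "S \<subseteq> set (cols M)" "lin_indpt S" "rank M = card S"
    using max rank_card_indpt[OF M max] by (auto simp: maximal_def)
  have "\<exists>k<nc. x = col M k" if "x \<in> S" for x
  proof -
    have "x \<in> col M ` {0..<nc}" using S(1) that M by (auto simp: cols_def)
    then show ?thesis by (metis atLeastLessThan_iff imageE)
  qed
  then obtain \<kappa> where \<kappa>: "\<And>x. x \<in> S \<Longrightarrow> \<kappa> x < nc \<and> x = col M (\<kappa> x)" by metis
  have fin: "finite S" using S(1) finite_subset by blast
  have inj\<kappa>: "inj_on \<kappa> S" using \<kappa> by (metis inj_onI)
  obtain ks where ks: "distinct ks" "set ks = \<kappa> ` S" using finite_distinct_list[OF finite_imageI[OF fin, of \<kappa>]] by blast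
  have ks_lt: "set ks \<subseteq> {..<nc}" using ks \<kappa> by auto
  have cardks: "card (set ks) \<ge> nc - 1" using ks inj\<kappa> big S(3) by (simp add: card_image)
  have "\<exists>t<nc. {..<nc} - set ks \<subseteq> {t}"
  proof -
    have "card ({..<nc} - set ks) \<le> 1"
      using cardks card_Diff_subset[of "set ks" "{..<nc}"] ks_lt by simp
    then have "{..<nc} - set ks = {} \<or> (\<exists>t. {..<nc} - set ks = {t})"
      by (metis card_0_eq card_1_singletonE finite_Diff finite_lessThan le_eq_less_or_eq less_one)
    then show ?thesis
    proof
      assume "\<exists>t. {..<nc} - set ks = {t}"
      then show ?thesis by (metis Diff_iff insertI1 lessThan_iff order_refl)
    qed (use nc in \<open>auto intro!: exI[of _ 0]\<close>)
  qed
  then obtain t where t: "t < nc" "{..<nc} - set ks \<subseteq> {t}" by blast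
  obtain w where w: "w \<in> carrier_vec nc" "w \<noteq> 0\<^sub>v nc" "M *\<^sub>v w = 0\<^sub>v n" "w $ t = 0"
    using ker[OF t(1)] by blast
  have w0: "w $ k = 0" if "k < nc" "k \<notin> set ks" for k using t w(4) that by auto
  let ?B = "mat_of_cols n (map (col M) ks)"
  let ?v = "vec (length ks) (\<lambda>i. w $ (ks ! i))"
  have B: "?B \<in> carrier_mat n (length ks)" by (simp add: mat_of_cols_def)
  have colsB: "cols ?B = map (col M) ks"
    by (rule cols_mat_of_cols) (use M ks_lt in auto)
  have inj_col: "inj_on (col M) (\<kappa> ` S)" using \<kappa> by (auto simp: inj_on_def)
  have dist: "distinct (cols ?B)" unfolding colsB using ks inj_col by (simp add: distinct_map)
  have setB: "set (cols ?B) = S" unfolding colsB using ks(2) \<kappa> by (force simp: image_image)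
  have "?v \<noteq> 0\<^sub>v (length ks)"
  proof
    assume v0: "?v = 0\<^sub>v (length ks)"
    have "w $ k = 0" if k: "k < nc" for k
    proof (cases "k \<in> set ks")
      case True
      then obtain i where "i < length ks" "ks ! i = k" by (auto simp: in_set_conv_nth)
      then show ?thesis using arg_cong[OF v0, of "\<lambda>u. u $ i"] by simp
    qed (use w0 k in auto)
    then have "w = 0\<^sub>v nc" using w(1) by auto
    with w(2) show False by simp
  qed
  moreover have "?B *\<^sub>v ?v = 0\<^sub>v n"
    using mat_of_cols_mult_vec[OF M ks(1) ks_lt w(1) w0] w(3) by simp
  ultimately have "lin_dep (set (cols ?B))" by (intro lin_depI[OF B _ _ _ dist]) auto
  then show False using S(2) setB by simp
qed

section \<open>Skew forms in six variables\<close>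

lemma less_5_cases: "i < 5 \<Longrightarrow> i = 0 \<or> i = 1 \<or> i = 2 \<or> i = 3 \<or> i = (4::nat)"
  by auto

lemma less_6_cases: "i < 6 \<Longrightarrow> i = 0 \<or> i = 1 \<or> i = 2 \<or> i = 3 \<or> i = 4 \<or> i = (5::nat)"
  by auto

lemma less_15_cases: "i < 15 \<Longrightarrow> i = 0 \<or> i = 1 \<or> i = 2 \<or> i = 3 \<or> i = 4 \<or> i = 5 \<or> i = 6 \<or> i = 7 \<or> i = 8
    \<or> i = 9 \<or> i = 10 \<or> i = 11 \<or> i = 12 \<or> i = 13 \<or> i = (14::nat)"
  by presburger

lemma sum_lessThan_6: "(\<Sum>j<6. f j) = f 0 + f 1 + f 2 + f 3 + f 4 + (f (5::nat) :: 'a::comm_monoid_add)"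
  by (simp add: eval_nat_numeral lessThan_Suc add_ac)

lemma vec_5_eqI:
  assumes "v \<in> carrier_vec 5" "w \<in> carrier_vec 5"
    "v $ 0 = w $ 0" "v $ 1 = w $ 1" "v $ 2 = w $ 2" "v $ 3 = w $ 3" "v $ 4 = w $ 4"
  shows "v = w"
  using assms by (intro eq_vecI) (auto dest!: less_5_cases)

lemma vec_6_eqI:
  assumes "v \<in> carrier_vec 6" "w \<in> carrier_vec 6"
    "v $ 0 = w $ 0" "v $ 1 = w $ 1" "v $ 2 = w $ 2" "v $ 3 = w $ 3" "v $ 4 = w $ 4" "v $ 5 = w $ 5"
  shows "v = w"
  using assms by (intro eq_vecI) (auto dest!: less_6_cases)

lemma vec_15_eqI:
  assumes "v \<in> carrier_vec 15" "w \<in> carrier_vec 15"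
    "v $ 0 = w $ 0" "v $ 1 = w $ 1" "v $ 2 = w $ 2" "v $ 3 = w $ 3" "v $ 4 = w $ 4" "v $ 5 = w $ 5" "v $ 6 = w $ 6" "v $ 7 = w $ 7" "v $ 8 = w $ 8" "v $ 9 = w $ 9" "v $ 10 = w $ 10" "v $ 11 = w $ 11" "v $ 12 = w $ 12" "v $ 13 = w $ 13" "v $ 14 = w $ 14"
  shows "v = w"
  using assms by (intro eq_vecI) (auto dest!: less_15_cases)

text \<open>The position of \<open>(i, j)\<close> in \<open>index_pairs\<close> for
  \<open>i < j\<close>: the term \<open>i * (11 - i) div 2\<close> counts the pairs whose first
  entry is below \<open>i\<close>.\<close>

definition pair_index :: "nat \<Rightarrow> nat \<Rightarrow> nat" where
  "pair_index i j = i * (11 - i) div 2 + j - i - 1"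

definition skew_entry :: "'k::field vec \<Rightarrow> nat \<Rightarrow> nat \<Rightarrow> 'k" where
  "skew_entry u i j = (if i < j then u $ pair_index i j else if j < i then - u $ pair_index j i else 0)"

definition skew_mat :: "'k::field vec \<Rightarrow> 'k mat" where
  "skew_mat u = mat 6 6 (\<lambda>(i, j). skew_entry u i j)"

definition skew_apply :: "'k::field vec \<Rightarrow> 'k vec \<Rightarrow> 'k vec" where
  "skew_apply u v = vec 6 (\<lambda>i. \<Sum>j<6. skew_entry u i j * v $ j)"

definition pfaffian :: "'k::field vec \<Rightarrow> 'k" where
  "pfaffian u = u $ 0 * u $ 9 * u $ 14 - u $ 0 * u $ 10 * u $ 13 + u $ 0 * u $ 11 * u $ 12 - u $ 1 * u $ 6 * u $ 14 + u $ 1 * u $ 7 * u $ 13 - u $ 1 * u $ 8 * u $ 12 + u $ 2 * u $ 5 * u $ 14 - u $ 2 * u $ 7 * u $ 11 + u $ 2 * u $ 8 * u $ 10 - u $ 3 * u $ 5 * u $ 13 + u $ 3 * u $ 6 * u $ 11 - u $ 3 * u $ 8 * u $ 9 + u $ 4 * u $ 5 * u $ 12 - u $ 4 * u $ 6 * u $ 10 + u $ 4 * u $ 7 * u $ 9"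

text \<open>The Pfaffian adjugate: entry \<open>(i, j)\<close> is, up to sign, the Pfaffian of the \<open>4 \<times> 4\<close> minor
  without the indices \<open>i\<close> and \<open>j\<close>.\<close>

definition pfaffian_adjoint :: "'k::field vec \<Rightarrow> 'k vec" where
  "pfaffian_adjoint u = vec 15 (\<lambda>l.
    [- u $ 9 * u $ 14 + u $ 10 * u $ 13 - u $ 11 * u $ 12,
     u $ 6 * u $ 14 - u $ 7 * u $ 13 + u $ 8 * u $ 12,
     - u $ 5 * u $ 14 + u $ 7 * u $ 11 - u $ 8 * u $ 10,
     u $ 5 * u $ 13 - u $ 6 * u $ 11 + u $ 8 * u $ 9,
     - u $ 5 * u $ 12 + u $ 6 * u $ 10 - u $ 7 * u $ 9,
     - u $ 2 * u $ 14 + u $ 3 * u $ 13 - u $ 4 * u $ 12,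
     u $ 1 * u $ 14 - u $ 3 * u $ 11 + u $ 4 * u $ 10,
     - u $ 1 * u $ 13 + u $ 2 * u $ 11 - u $ 4 * u $ 9,
     u $ 1 * u $ 12 - u $ 2 * u $ 10 + u $ 3 * u $ 9,
     - u $ 0 * u $ 14 + u $ 3 * u $ 8 - u $ 4 * u $ 7,
     u $ 0 * u $ 13 - u $ 2 * u $ 8 + u $ 4 * u $ 6,
     - u $ 0 * u $ 12 + u $ 2 * u $ 7 - u $ 3 * u $ 6,
     - u $ 0 * u $ 11 + u $ 1 * u $ 8 - u $ 4 * u $ 5,
     u $ 0 * u $ 10 - u $ 1 * u $ 7 + u $ 3 * u $ 5,
     - u $ 0 * u $ 9 + u $ 1 * u $ 6 - u $ 2 * u $ 5] ! l)"

lemma skew_apply_carrier [simp]: "skew_apply u v \<in> carrier_vec 6"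
  by (simp add: skew_apply_def)

lemma pfaffian_adjoint_carrier [simp]: "pfaffian_adjoint u \<in> carrier_vec 15"
  by (simp add: pfaffian_adjoint_def)

lemma skew_mat_carrier [simp]: "skew_mat u \<in> carrier_mat 6 6"
  by (simp add: skew_mat_def)

lemma skew_mat_mult_vec: "v \<in> carrier_vec 6 \<Longrightarrow> skew_mat u *\<^sub>v v = skew_apply u v"
  by (auto simp: skew_mat_def skew_apply_def scalar_prod_def atLeast0LessThan intro!: eq_vecI)

lemma skew_apply_index:
  shows "skew_apply u v $ 0 = u $ 0 * v $ Suc 0 + u $ Suc 0 * v $ 2 + u $ 2 * v $ 3 + u $ 3 * v $ 4 + u $ 4 * v $ 5" and
    "skew_apply u v $ Suc 0 = - u $ 0 * v $ 0 + u $ 5 * v $ 2 + u $ 6 * v $ 3 + u $ 7 * v $ 4 + u $ 8 * v $ 5" and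
    "skew_apply u v $ 2 = - u $ Suc 0 * v $ 0 - u $ 5 * v $ Suc 0 + u $ 9 * v $ 3 + u $ 10 * v $ 4 + u $ 11 * v $ 5" and
    "skew_apply u v $ 3 = - u $ 2 * v $ 0 - u $ 6 * v $ Suc 0 - u $ 9 * v $ 2 + u $ 12 * v $ 4 + u $ 13 * v $ 5" and
    "skew_apply u v $ 4 = - u $ 3 * v $ 0 - u $ 7 * v $ Suc 0 - u $ 10 * v $ 2 - u $ 12 * v $ 3 + u $ 14 * v $ 5" and
    "skew_apply u v $ 5 = - u $ 4 * v $ 0 - u $ 8 * v $ Suc 0 - u $ 11 * v $ 2 - u $ 13 * v $ 3 - u $ 14 * v $ 4"
  by (simp_all add: skew_apply_def skew_entry_def pair_index_def sum_lessThan_6 algebra_simps)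

lemma skew_entry_swap: "skew_entry u j i = - skew_entry u i j"
  by (simp add: skew_entry_def)

lemma index_pairs_eq:
  "index_pairs = [(0,1),(0,2),(0,3),(0,4),(0,5),(1,2),(1,3),(1,4),(1,5),(2,3),(2,4),(2,5),(3,4),(3,5),(4,5)]"
  by (simp add: index_pairs_def upt_rec)

lemma index_pairs_nth:
  assumes "i < j" "j < 6"
  shows "index_pairs ! pair_index i j = (i, j)" "pair_index i j < 15"
proof -
  have "\<forall>j\<in>{0, 1, 2, 3, 4, 5}. \<forall>i\<in>{0, 1, 2, 3, 4, 5}. i < j \<longrightarrow>
      index_pairs ! pair_index i j = (i, j) \<and> pair_index i j < 15"
    by (simp add: pair_index_def index_pairs_eq)
  moreover have "i \<in> {0, 1, 2, 3, 4, 5}" "j \<in> {0, 1, 2, 3, 4, 5}"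
    using assms less_6_cases[of i] less_6_cases[of j] by auto
  ultimately show "index_pairs ! pair_index i j = (i, j)" "pair_index i j < 15"
    using assms by blast+
qed

lemma coords_index:
  shows "coords M $ 0 = M $$ (0, Suc 0)" "coords M $ Suc 0 = M $$ (0, 2)" "coords M $ 2 = M $$ (0, 3)" "coords M $ 3 = M $$ (0, 4)" "coords M $ 4 = M $$ (0, 5)" "coords M $ 5 = M $$ (Suc 0, 2)" "coords M $ 6 = M $$ (Suc 0, 3)" "coords M $ 7 = M $$ (Suc 0, 4)" "coords M $ 8 = M $$ (Suc 0, 5)" "coords M $ 9 = M $$ (2, 3)" "coords M $ 10 = M $$ (2, 4)" "coords M $ 11 = M $$ (2, 5)" "coords M $ 12 = M $$ (3, 4)" "coords M $ 13 = M $$ (3, 5)" "coords M $ 14 = M $$ (4, 5)"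
  by (simp_all add: coords_def index_pairs_eq)

lemma coords_carrier [simp]: "coords M \<in> carrier_vec 15"
  by (simp add: coords_def)

lemma coords_skew_mat: "u \<in> carrier_vec 15 \<Longrightarrow> coords (skew_mat u) = u"
  by (rule vec_15_eqI) (simp_all add: coords_index skew_mat_def skew_entry_def pair_index_def)

lemma skew_mat_skew: "skew_mat u \<in> skew_matrices"
  unfolding skew_matrices_def
  by (auto intro!: eq_matI simp: skew_mat_def skew_entry_def)

lemma skew_mat_coords:
  assumes "M \<in> skew_matrices" shows "skew_mat (coords M) = (M :: 'k::field_char_0 mat)"
proof -
  have M: "M \<in> carrier_mat 6 6" "M\<^sup>T = - M" using assms by (auto simp: skew_matrices_def)
  have sk: "M $$ (j, i) = - M $$ (i, j)" if "i < 6" "j < 6" for i j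
    using arg_cong[OF M(2), of "\<lambda>A. A $$ (i, j)"] that M(1) by simp
  then have dg: "M $$ (i, i) = 0" if "i < 6" for i
  proof -
    have "M $$ (i, i) + M $$ (i, i) = 0"
      using sk[OF that that] by (rule eq_neg_iff_add_eq_0[THEN iffD1])
    then have "2 * M $$ (i, i) = 0" by (simp only: mult_2)
    then show ?thesis by simp
  qed
  have up: "coords M $ pair_index i j = M $$ (i, j)" if "i < j" "j < 6" for i j
    using index_pairs_nth[OF that] by (simp add: coords_def)
  show ?thesis
  proof (rule eq_matI)
    fix i j assume "i < dim_row M" "j < dim_col M"
    then have ij: "i < 6" "j < 6" using M(1) by auto
    consider "i < j" | "i = j" | "j < i" by linarith
    then show "skew_mat (coords M) $$ (i, j) = M $$ (i, j)"
    proof cases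
      case 3
      then show ?thesis using ij up[of j i] sk[of j i] by (simp add: skew_mat_def skew_entry_def)
    qed (use ij up dg in \<open>auto simp: skew_mat_def skew_entry_def\<close>)
  qed (use M in \<open>auto simp: skew_mat_def\<close>)
qed

lemma pfaffian_adjoint_index:
  shows "pfaffian_adjoint u $ 0 = - u $ 9 * u $ 14 + u $ 10 * u $ 13 - u $ 11 * u $ 12" and "pfaffian_adjoint u $ Suc 0 = u $ 6 * u $ 14 - u $ 7 * u $ 13 + u $ 8 * u $ 12" and "pfaffian_adjoint u $ 2 = - u $ 5 * u $ 14 + u $ 7 * u $ 11 - u $ 8 * u $ 10" and "pfaffian_adjoint u $ 3 = u $ 5 * u $ 13 - u $ 6 * u $ 11 + u $ 8 * u $ 9" and "pfaffian_adjoint u $ 4 = - u $ 5 * u $ 12 + u $ 6 * u $ 10 - u $ 7 * u $ 9" and "pfaffian_adjoint u $ 5 = - u $ 2 * u $ 14 + u $ 3 * u $ 13 - u $ 4 * u $ 12" and "pfaffian_adjoint u $ 6 = u $ Suc 0 * u $ 14 - u $ 3 * u $ 11 + u $ 4 * u $ 10" and "pfaffian_adjoint u $ 7 = - u $ Suc 0 * u $ 13 + u $ 2 * u $ 11 - u $ 4 * u $ 9" and "pfaffian_adjoint u $ 8 = u $ Suc 0 * u $ 12 - u $ 2 * u $ 10 + u $ 3 * u $ 9" and "pfaffian_adjoint u $ 9 = - u $ 0 * u $ 14 + u $ 3 * u $ 8 - u $ 4 * u $ 7" and "pfaffian_adjoint u $ 10 = u $ 0 * u $ 13 - u $ 2 *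 u $ 8 + u $ 4 * u $ 6" and "pfaffian_adjoint u $ 11 = - u $ 0 * u $ 12 + u $ 2 * u $ 7 - u $ 3 * u $ 6" and "pfaffian_adjoint u $ 12 = - u $ 0 * u $ 11 + u $ Suc 0 * u $ 8 - u $ 4 * u $ 5" and "pfaffian_adjoint u $ 13 = u $ 0 * u $ 10 - u $ Suc 0 * u $ 7 + u $ 3 * u $ 5" and "pfaffian_adjoint u $ 14 = - u $ 0 * u $ 9 + u $ Suc 0 * u $ 6 - u $ 2 * u $ 5"
  by (simp_all add: pfaffian_adjoint_def)

text \<open>The Pfaffian analogue of matrix times adjugate equals determinant. Where the Pfaffian
  vanishes, the range of the adjoint thus lies in the kernel of the form.\<close>

lemma skew_apply_pfaffian_adjoint:
  "skew_apply u (skew_apply (pfaffian_adjoint u) v) = pfaffian u \<cdot>\<^sub>v (vec 6 (\<lambda>i. v $ i))"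
  by (rule vec_6_eqI) (simp_all add: skew_apply_index pfaffian_adjoint_index pfaffian_def algebra_simps)

text \<open>Up to a factor, \<open>pfaffian_adjoint u\<close> is the bivector dual to the square of
  \<open>u\<close> in the exterior algebra, and its wedge product with a kernel vector of
  \<open>u\<close> vanishes. Each of the 20 components with increasing indices is an explicit
  combination of entries of \<open>skew_apply u v\<close>; alternation gives the others.\<close>

lemma skew_entry_plucker:
  assumes "skew_apply u v = 0\<^sub>v 6" "i < 6" "j < 6" "k < 6"
  defines "P \<equiv> skew_entry (pfaffian_adjoint u)"
  shows "P i j * v $ k + P j k * v $ i + P k i * v $ j = 0"
proof -
  let ?Q = "\<lambda>i j k. P i j * v $ k + P j k * v $ i + P k i * v $ j"
  have z: "skew_apply u v $ i = 0" if "i < 6" for i using assms(1) that by simp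
  have e:
    "?Q 0 1 2 = u $ 12 * skew_apply u v $ 5 - u $ 13 * skew_apply u v $ 4 + u $ 14 * skew_apply u v $ 3"
    "?Q 0 1 3 = - (u $ 10 * skew_apply u v $ 5 - u $ 11 * skew_apply u v $ 4 + u $ 14 * skew_apply u v $ 2)"
    "?Q 0 1 4 = u $ 9 * skew_apply u v $ 5 - u $ 11 * skew_apply u v $ 3 + u $ 13 * skew_apply u v $ 2"
    "?Q 0 1 5 = - (u $ 9 * skew_apply u v $ 4 - u $ 10 * skew_apply u v $ 3 + u $ 12 * skew_apply u v $ 2)"
    "?Q 0 2 3 = u $ 7 * skew_apply u v $ 5 - u $ 8 * skew_apply u v $ 4 + u $ 14 * skew_apply u v $ 1"
    "?Q 0 2 4 = - (u $ 6 * skew_apply u v $ 5 - u $ 8 * skew_apply u v $ 3 + u $ 13 * skew_apply u v $ 1)"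
    "?Q 0 2 5 = u $ 6 * skew_apply u v $ 4 - u $ 7 * skew_apply u v $ 3 + u $ 12 * skew_apply u v $ 1"
    "?Q 0 3 4 = u $ 5 * skew_apply u v $ 5 - u $ 8 * skew_apply u v $ 2 + u $ 11 * skew_apply u v $ 1"
    "?Q 0 3 5 = - (u $ 5 * skew_apply u v $ 4 - u $ 7 * skew_apply u v $ 2 + u $ 10 * skew_apply u v $ 1)"
    "?Q 0 4 5 = u $ 5 * skew_apply u v $ 3 - u $ 6 * skew_apply u v $ 2 + u $ 9 * skew_apply u v $ 1"
    "?Q 1 2 3 = - (u $ 3 * skew_apply u v $ 5 - u $ 4 * skew_apply u v $ 4 + u $ 14 * skew_apply u v $ 0)"
    "?Q 1 2 4 = u $ 2 * skew_apply u v $ 5 - u $ 4 * skew_apply u v $ 3 + u $ 13 * skew_apply u v $ 0"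
    "?Q 1 2 5 = - (u $ 2 * skew_apply u v $ 4 - u $ 3 * skew_apply u v $ 3 + u $ 12 * skew_apply u v $ 0)"
    "?Q 1 3 4 = - (u $ Suc 0 * skew_apply u v $ 5 - u $ 4 * skew_apply u v $ 2 + u $ 11 * skew_apply u v $ 0)"
    "?Q 1 3 5 = u $ Suc 0 * skew_apply u v $ 4 - u $ 3 * skew_apply u v $ 2 + u $ 10 * skew_apply u v $ 0"
    "?Q 1 4 5 = - (u $ Suc 0 * skew_apply u v $ 3 - u $ 2 * skew_apply u v $ 2 + u $ 9 * skew_apply u v $ 0)"
    "?Q 2 3 4 = u $ 0 * skew_apply u v $ 5 - u $ 4 * skew_apply u v $ 1 + u $ 8 * skew_apply u v $ 0"
    "?Q 2 3 5 = - (u $ 0 * skew_apply u v $ 4 - u $ 3 * skew_apply u v $ 1 + u $ 7 * skew_apply u v $ 0)"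
    "?Q 2 4 5 = u $ 0 * skew_apply u v $ 3 - u $ 2 * skew_apply u v $ 1 + u $ 6 * skew_apply u v $ 0"
    "?Q 3 4 5 = - (u $ 0 * skew_apply u v $ 2 - u $ Suc 0 * skew_apply u v $ 1 + u $ 5 * skew_apply u v $ 0)"
    by (simp_all add: P_def skew_entry_def pair_index_def pfaffian_adjoint_index skew_apply_index algebra_simps)
  have base:
    "?Q 0 1 2 = 0" "?Q 0 1 3 = 0" "?Q 0 1 4 = 0" "?Q 0 1 5 = 0" "?Q 0 2 3 = 0"
    "?Q 0 2 4 = 0" "?Q 0 2 5 = 0" "?Q 0 3 4 = 0" "?Q 0 3 5 = 0" "?Q 0 4 5 = 0"
    "?Q 1 2 3 = 0" "?Q 1 2 4 = 0" "?Q 1 2 5 = 0" "?Q 1 3 4 = 0" "?Q 1 3 5 = 0"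
    "?Q 1 4 5 = 0" "?Q 2 3 4 = 0" "?Q 2 3 5 = 0" "?Q 2 4 5 = 0" "?Q 3 4 5 = 0"
    unfolding e by (simp_all add: z)
  have P: "P j i = - P i j" for i j unfolding P_def by (rule skew_entry_swap)
  have rot: "?Q i j k = ?Q j k i" for i j k by (simp add: algebra_simps)
  have swap: "?Q i j k = - ?Q j i k" for i j k by (simp add: P[of i j] P[of j k] P[of k i])
  have same: "?Q i i k = 0" "?Q i k i = 0" "?Q k i i = 0" for i k
    using P[of i i] P[of i k] by (simp_all add: P_def skew_entry_def)
  define Z where "Z i j k \<longleftrightarrow> ?Q i j k = 0" for i j k
  note base_Z = base[folded Z_def]
  have "\<forall>k<6. \<forall>j<k. \<forall>i<j. Z i j k"
    using base_Z by (simp add: eval_nat_numeral All_less_Suc)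
  then have ord: "?Q i j k = 0" if "i < j" "j < k" "k < 6" for i j k
    using that by (simp only: Z_def)
  consider "i = j" | "j = k" | "i = k" | "i < j" "j < k" | "j < k" "k < i" | "k < i" "i < j"
    | "j < i" "i < k" | "i < k" "k < j" | "k < j" "j < i" by linarith
  then show ?thesis
  proof cases
    case 1 then show ?thesis using same(1)[of i k] by simp
  next
    case 2 then show ?thesis using same(3)[of i j] by simp
  next
    case 3 then show ?thesis using same(2)[of i j] by simp
  next
    case 4 then show ?thesis using ord assms(2-4) by blast
  next
    case 5 then show ?thesis unfolding rot[of i j k] using ord[of j k i] assms(2-4) by simp
  next
    case 6 then show ?thesis unfolding rot[of i j k] rot[of j k i] using ord[of k i j] assms(2-4) by simp
  next
    case 7 then show ?thesis unfolding swap[of i j k] using ord[of j i k] assms(2-4) by simp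
  next
    case 8 then show ?thesis unfolding swap[of i j k] rot[of j i k] using ord[of i k j] assms(2-4) by simp
  next
    case 9 then show ?thesis unfolding swap[of i j k] rot[of j i k] rot[of i k j]
      using ord[of k j i] assms(2-4) by simp
  qed
qed

text \<open>A nonzero bivector whose wedge product with a nonzero \<open>v\<close> vanishes has
  \<open>v\<close> as a factor, so \<open>v\<close> is one of its contractions; for
  \<open>v = 0\<close> nothing is to be shown.\<close>

lemma kernel_in_range_pfaffian_adjoint:
  assumes u: "skew_apply u v = 0\<^sub>v 6" and v: "v \<in> carrier_vec 6" and A: "pfaffian_adjoint u \<noteq> 0\<^sub>v 15"
  shows "\<exists>\<xi>. \<xi> \<in> carrier_vec 6 \<and> v = skew_apply (pfaffian_adjoint u) \<xi>"
proof -
  let ?P = "skew_entry (pfaffian_adjoint u)"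
  obtain l where l: "l < 15" "pfaffian_adjoint u $ l \<noteq> 0"
    using A pfaffian_adjoint_carrier by (metis carrier_vecD eq_vecI index_zero_vec)
  have "\<exists>i j. i < j \<and> j < 6 \<and> pair_index i j = l"
    using less_15_cases[OF l(1)]
    by (elim disjE)
      (rule exI[of _ 0], rule exI[of _ 1], simp add: pair_index_def, rule exI[of _ 0], rule exI[of _ 2], simp add: pair_index_def, rule exI[of _ 0], rule exI[of _ 3], simp add: pair_index_def, rule exI[of _ 0], rule exI[of _ 4], simp add: pair_index_def, rule exI[of _ 0], rule exI[of _ 5], simp add: pair_index_def, rule exI[of _ 1], rule exI[of _ 2], simp add: pair_index_def, rule exI[of _ 1], rule exI[of _ 3], simp add: pair_index_def, rule exI[of _ 1], rule exI[of _ 4], simp add: pair_index_def, rule exI[of _ 1], rule exI[of _ 5], simp add: pair_index_def, rule exI[of _ 2], rule exI[of _ 3], simp add: pair_index_def, rule exI[of _ 2], rule exI[of _ 4], simp add: pair_index_def, rule exI[of _ 2], rule exI[of _ 5], simp add: pair_index_def, rule exI[of _ 3], rule exI[of _ 4], simp add: pair_index_def, rule exI[of _ 3], rule exI[of _ 5], simp add: pair_index_def, rule exI[of _ 4], rule exI[of _ 5], simp add: pair_index_def)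
  then obtain i j where ij: "i < j" "j < 6" "pair_index i j = l" by blast
  then have P: "?P i j \<noteq> 0" using l(2) by (simp add: skew_entry_def)
  \<comment> \<open>A covector supported on \<open>i\<close> and \<open>j\<close>, where the
    bivector has a nonzero entry; at coordinate \<open>k\<close> the claim is the three-term
    relation for \<open>i\<close>, \<open>j\<close>, \<open>k\<close>.\<close>
  define \<xi> where "\<xi> = vec 6 (\<lambda>m. if m = j then v $ i / ?P i j else if m = i then - v $ j / ?P i j else 0)"
  have "v = skew_apply (pfaffian_adjoint u) \<xi>"
  proof (rule eq_vecI)
    fix k assume "k < dim_vec (skew_apply (pfaffian_adjoint u) \<xi>)"
    then have k: "k < 6" by (simp add: skew_apply_def)
    have "(\<Sum>m<6. ?P k m * \<xi> $ m) = (\<Sum>m\<in>{i, j}. ?P k m * \<xi> $ m)"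
      by (rule sum.mono_neutral_right) (use ij in \<open>auto simp: \<xi>_def\<close>)
    also have "\<dots> = ?P k j * (v $ i / ?P i j) - ?P k i * (v $ j / ?P i j)"
      using ij by (simp add: \<xi>_def)
    also have "\<dots> = v $ k"
    proof -
      have "?P i j * v $ k + ?P j k * v $ i + ?P k i * v $ j = 0"
        by (rule skew_entry_plucker[OF u]) (use ij k in auto)
      moreover have "?P k j * v $ i - ?P k i * v $ j = v $ k * ?P i j
          - (?P i j * v $ k + ?P j k * v $ i + ?P k i * v $ j)"
        by (simp add: skew_entry_swap[of _ j k] algebra_simps)
      ultimately have "?P k j * v $ i - ?P k i * v $ j = v $ k * ?P i j" by simp
      then show ?thesis using P by (simp add: field_simps)
    qed
    finally show "v $ k = skew_apply (pfaffian_adjoint u) \<xi> $ k" using k by (simp add: skew_apply_def)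
  qed (use v in \<open>simp add: skew_apply_def\<close>)
  moreover have "\<xi> \<in> carrier_vec 6" by (simp add: \<xi>_def)
  ultimately show ?thesis by blast
qed

lemma dim_skew_apply [simp]: "dim_vec (skew_apply u v) = 6"
  by (simp add: skew_apply_def)

lemma dim_pfaffian_adjoint [simp]: "dim_vec (pfaffian_adjoint u) = 15"
  by (simp add: pfaffian_adjoint_def)

lemma dim_coords [simp]: "dim_vec (coords M) = 15"
  by (simp add: coords_def)

lemma numeral_mult_eq_0D: "numeral n * x = 0 \<Longrightarrow> x = (0 :: 'k::field_char_0)"
  by simp

lemma pfaffian_adjoint_nonzeroE:
  assumes "pfaffian_adjoint u \<noteq> 0\<^sub>v 15"
  obtains i j where "i < j" "j < 6" "skew_entry (pfaffian_adjoint u) i j \<noteq> 0"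
proof -
  obtain l where l: "l < 15" "pfaffian_adjoint u $ l \<noteq> 0"
    using assms pfaffian_adjoint_carrier by (metis carrier_vecD eq_vecI index_zero_vec)
  have "\<exists>i j. i < j \<and> j < 6 \<and> pair_index i j = l"
  proof -
    have "index_pairs ! l \<in> set index_pairs" using l(1) by (intro nth_mem) (simp add: index_pairs_eq)
    then obtain i j where ij: "index_pairs ! l = (i, j)" "i < j" "j < 6"
      by (auto simp: index_pairs_eq)
    have "distinct index_pairs" "length index_pairs = 15" by (simp_all add: index_pairs_eq)
    then have "pair_index i j = l"
      using index_pairs_nth[OF ij(2,3)] ij(1) l(1) by (metis nth_eq_iff_index_eq)
    with ij show ?thesis by blast
  qed
  then obtain i j where "i < j" "j < 6" "pair_index i j = l" by blast
  with l(2) show ?thesis by (intro that[of i j]) (auto simp: skew_entry_def)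
qed

text \<open>If the adjoint has a nonzero entry at \<open>(i, j)\<close>, the three-term relation
  shows that a kernel vector vanishing at \<open>i\<close> and \<open>j\<close> is zero. So the
  other four columns are independent.\<close>

lemma rank_skew_ge_4:
  assumes "pfaffian_adjoint u \<noteq> 0\<^sub>v 15"
  shows "4 \<le> vec_space.rank 6 (skew_mat u)"
proof -
  obtain i j where ij: "i < j" "j < 6" "skew_entry (pfaffian_adjoint u) i j \<noteq> 0"
    using pfaffian_adjoint_nonzeroE[OF assms] by blast
  let ?J = "{..<6} - {i, j}"
  have "card ?J \<le> vec_space.rank 6 (skew_mat u)"
  proof (rule rank_ge_card[OF skew_mat_carrier])
    fix w :: "'a vec" assume w: "w \<in> carrier_vec 6" "skew_mat u *\<^sub>v w = 0\<^sub>v 6"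
      "\<And>k. k < 6 \<Longrightarrow> k \<notin> ?J \<Longrightarrow> w $ k = 0"
    have 0: "skew_apply u w = 0\<^sub>v 6" using w by (simp add: skew_mat_mult_vec)
    have "w $ k = 0" if "k < 6" for k
      using skew_entry_plucker[OF 0, of i j k] w(3)[of i] w(3)[of j] ij that by simp
    then show "w = 0\<^sub>v 6" using w(1) by auto
  qed auto
  moreover have "card ?J = 4" using ij by simp
  ultimately show ?thesis by simp
qed

lemma rank_skew_le_4:
  assumes A: "pfaffian_adjoint u \<noteq> 0\<^sub>v 15" and pf: "pfaffian u = 0"
  shows "vec_space.rank 6 (skew_mat u) \<le> 4"
proof -
  let ?P = "skew_entry (pfaffian_adjoint u)"
  obtain i j where ij: "i < j" "j < 6" "?P i j \<noteq> 0"
    using pfaffian_adjoint_nonzeroE[OF A] by blast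
  have ker: "skew_mat u *\<^sub>v skew_apply (pfaffian_adjoint u) \<xi> = 0\<^sub>v 6" for \<xi>
    by (subst skew_mat_mult_vec) (auto simp: skew_apply_pfaffian_adjoint pf)
  have comp: "skew_apply (pfaffian_adjoint u) (vec 6 (\<lambda>m. if m = i then c else if m = j then d else 0)) $ k
      = c * ?P k i + d * ?P k j" if "k < 6" for c d k
  proof -
    let ?\<xi> = "vec 6 (\<lambda>m. if m = i then c else if m = j then d else 0)"
    have "(\<Sum>m<6. ?P k m * ?\<xi> $ m) = (\<Sum>m\<in>{i, j}. ?P k m * ?\<xi> $ m)"
      by (rule sum.mono_neutral_right) (use ij in auto)
    then show ?thesis using ij that by (simp add: skew_apply_def mult.commute)
  qed
  have "vec_space.rank 6 (skew_mat u) \<le> 6 - 2"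
  proof (rule rank_le_diff_2[OF skew_mat_carrier])
    fix t :: nat assume t: "t < 6"
    \<comment> \<open>Columns \<open>i\<close> and \<open>j\<close> of the adjoint are two
      independent kernel vectors; this combination of them vanishes at coordinate
      \<open>t\<close>.\<close>
    define c d where "c = (if ?P t i = 0 then 1 else ?P t j)" and "d = (if ?P t i = 0 then 0 else - ?P t i)"
    let ?w = "skew_apply (pfaffian_adjoint u) (vec 6 (\<lambda>m. if m = i then c else if m = j then d else 0))"
    have Pji: "?P j i \<noteq> 0" using ij(3) skew_entry_swap[of "pfaffian_adjoint u" j i] by simp
    have dg: "?P k k = 0" for k by (simp add: skew_entry_def)
    have "?w $ t = 0" using comp[OF t] by (simp add: c_def d_def)
    moreover have "?w $ i \<noteq> 0 \<or> ?w $ j \<noteq> 0"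
      using comp[of i c d] comp[of j c d] ij Pji dg by (auto simp: c_def d_def)
    then have "?w \<noteq> 0\<^sub>v 6" using ij by auto
    ultimately show "\<exists>w. w \<in> carrier_vec 6 \<and> w \<noteq> 0\<^sub>v 6 \<and> skew_mat u *\<^sub>v w = 0\<^sub>v 6 \<and> w $ t = 0"
      by (intro exI[of _ ?w] conjI ker skew_apply_carrier)
  qed simp
  then show ?thesis by simp
qed

lemma pfaffian_zero_if_rank_le_4:
  assumes "vec_space.rank 6 (skew_mat u) \<le> 4"
  shows "pfaffian u = 0"
proof (rule ccontr)
  assume pf: "pfaffian u \<noteq> 0"
  have "card {..<6::nat} \<le> vec_space.rank 6 (skew_mat u)"
  proof (rule rank_ge_card[OF skew_mat_carrier])
    fix w :: "'a vec" assume w: "w \<in> carrier_vec 6" "skew_mat u *\<^sub>v w = 0\<^sub>v 6"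
    have 0: "skew_apply u w = 0\<^sub>v 6" using w by (simp add: skew_mat_mult_vec)
    have "skew_apply (pfaffian_adjoint u) (skew_apply u w) = pfaffian u \<cdot>\<^sub>v w"
      by (rule vec_6_eqI)
        (use w(1) in \<open>simp_all add: skew_apply_index pfaffian_adjoint_index pfaffian_def algebra_simps\<close>)
    moreover have "skew_apply (pfaffian_adjoint u) (0\<^sub>v 6) = 0\<^sub>v 6"
      by (auto simp: skew_apply_def)
    ultimately have "pfaffian u \<cdot>\<^sub>v w = 0\<^sub>v 6" using 0 by simp
    then have "pfaffian u * w $ k = 0" if "k < 6" for k
      using that w(1) by (metis carrier_vecD index_smult_vec(1) index_zero_vec(1))
    then show "w = 0\<^sub>v 6" using pf w(1) by auto
  qed auto
  with assms show False by simp
qed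

section \<open>The five-dimensional space of skew forms\<close>

definition form_coords :: "'k::field vec \<Rightarrow> 'k vec" where
  "form_coords a = vec 15 (\<lambda>l. [0, a $ 4, a $ 1, a $ 0 + a $ 1 + a $ 2, a $ 1 - a $ 2,
     - a $ 3, a $ 0 + a $ 1 + a $ 2, a $ 0, a $ 0 - a $ 2,
     a $ 1 - a $ 2, a $ 0 - a $ 2, - a $ 0 - a $ 1, 0, a $ 4, a $ 3] ! l)"

text \<open>On \<open>V = k\<^sup>2 \<otimes> k\<^sup>3\<close> with coordinates \<open>(p, q)\<close>, the form of \<open>(x, y)\<close> has the block matrix
  with rows \<open>(N\<^sub>+, S)\<close> and \<open>(-S, N\<^sub>-)\<close>. Here \<open>S\<close> is the symmetric matrix of the polar conic of \<open>x\<close> with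
  respect to a fixed plane cubic, and \<open>N\<^sub>\<plusminus>\<close> is the cross product with \<open>(\<plusminus>y\<^sub>1, y\<^sub>2, 0)\<close>.
  Up to sign, \<open>cubic\<close> is the Pfaffian.\<close>

definition form :: "'k::field vec \<Rightarrow> 'k mat" where
  "form a = skew_mat (form_coords a)"

lemma form_coords_carrier [simp]: "form_coords a \<in> carrier_vec 15"
  by (simp add: form_coords_def)

lemma dim_form_coords [simp]: "dim_vec (form_coords a) = 15"
  by (simp add: form_coords_def)

lemma form_coords_index:
  shows "form_coords a $ 0 = 0" and "form_coords a $ Suc 0 = a $ 4" and "form_coords a $ 2 = a $ Suc 0"
    and "form_coords a $ 3 = a $ 0 + a $ Suc 0 + a $ 2" and "form_coords a $ 4 = a $ Suc 0 - a $ 2"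
    and "form_coords a $ 5 = - a $ 3" and "form_coords a $ 6 = a $ 0 + a $ Suc 0 + a $ 2"
    and "form_coords a $ 7 = a $ 0" and "form_coords a $ 8 = a $ 0 - a $ 2"
    and "form_coords a $ 9 = a $ Suc 0 - a $ 2" and "form_coords a $ 10 = a $ 0 - a $ 2"
    and "form_coords a $ 11 = - a $ 0 - a $ Suc 0" and "form_coords a $ 12 = 0"
    and "form_coords a $ 13 = a $ 4" and "form_coords a $ 14 = a $ 3"
  by (simp_all add: form_coords_def)

lemma form_coords_add:
  "a \<in> carrier_vec 5 \<Longrightarrow> b \<in> carrier_vec 5 \<Longrightarrow> form_coords (a + b) = form_coords a + form_coords b"
  by (rule vec_15_eqI) (simp_all add: form_coords_index)

lemma form_coords_smult: "a \<in> carrier_vec 5 \<Longrightarrow> form_coords (c \<cdot>\<^sub>v a) = c \<cdot>\<^sub>v form_coords a"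
  by (rule vec_15_eqI) (simp_all add: form_coords_index algebra_simps)

lemma form_coords_zero [simp]: "form_coords (0\<^sub>v 5) = 0\<^sub>v 15"
  by (rule vec_15_eqI) (simp_all add: form_coords_index)

lemma form_coords_eq_zeroD:
  assumes "a \<in> carrier_vec 5" "form_coords a = 0\<^sub>v 15" shows "a = 0\<^sub>v 5"
proof -
  have "form_coords a $ l = 0" if "l < 15" for l using assms(2) that by simp
  note z = this[of 7] this[of 2] this[of 4] this[of 14] this[of 13]
  show ?thesis by (rule vec_5_eqI) (use assms(1) z in \<open>simp_all add: form_coords_index\<close>)
qed

lemma form_coords_inj:
  assumes "a \<in> carrier_vec 5" "b \<in> carrier_vec 5" "form_coords a = form_coords b" shows "a = b"
proof -
  have "form_coords a $ l = form_coords b $ l" for l using assms(3) by simp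
  note z = this[of 7] this[of 2] this[of 4] this[of 14] this[of 13]
  show ?thesis by (rule vec_5_eqI) (use assms(1,2) z in \<open>simp_all add: form_coords_index\<close>)
qed

lemma pfaffian_form_coords: "pfaffian (form_coords a) = - cubic a"
  by (simp add: pfaffian_def form_coords_index cubic_def algebra_simps power2_eq_square power3_eq_cube)

definition cubic_deriv :: "'k::field vec \<Rightarrow> nat \<Rightarrow> 'k" where
  "cubic_deriv a i = [3 * (a $ 0 + a $ 1) ^ 2 + 6 * a $ 1 * a $ 2 - a $ 4 ^ 2,
     3 * (a $ 0 + a $ 1) ^ 2 + 6 * a $ 0 * a $ 2 + a $ 3 ^ 2,
     6 * a $ 0 * a $ 1 + 6 * a $ 2 ^ 2, 2 * a $ 1 * a $ 3, - 2 * a $ 0 * a $ 4] ! i"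

lemma cubic_smooth:
  fixes a :: "'k::field_char_0 vec"
  assumes a: "a \<in> carrier_vec 5" and d: "\<And>i. i < 5 \<Longrightarrow> cubic_deriv a i = 0"
  shows "a = 0\<^sub>v 5"
proof -
  define x0 x1 x2 y1 y2 where x: "x0 = a $ 0" "x1 = a $ 1" "x2 = a $ 2" "y1 = a $ 3" "y2 = a $ 4"
  have d0: "3 * (x0 + x1)\<^sup>2 + 6 * x1 * x2 - y2\<^sup>2 = 0" and d1: "3 * (x0 + x1)\<^sup>2 + 6 * x0 * x2 + y1\<^sup>2 = 0"
    and d2: "6 * x0 * x1 + 6 * x2\<^sup>2 = 0" and d3: "x1 = 0 \<or> y1 = 0" and d4: "x0 = 0 \<or> y2 = 0"
    using d[of 0] d[of 1] d[of 2] d[of 3] d[of 4] by (simp_all add: cubic_deriv_def x)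
  have "6 * (x0 * x1 + x2\<^sup>2) = 0" using d2 by (simp add: algebra_simps)
  then have d2': "x0 * x1 + x2\<^sup>2 = 0" by (rule numeral_mult_eq_0D)
  have "x0 = 0 \<and> x1 = 0"
  proof (cases "x0 = 0 \<or> x1 = 0")
    case True
    then have x2: "x2 = 0" using d2' by auto
    show ?thesis
    proof (cases "x0 = 0")
      case True
      then show ?thesis using d0 d1 d3 x2 by auto
    next
      case False
      then have "x1 = 0" "y2 = 0" using True d4 by auto
      then show ?thesis using d0 x2 by auto
    qed
  next
    case False
    then have y: "y1 = 0" "y2 = 0" using d3 d4 by auto
    have "6 * ((x1 - x0) * x2) = (3 * (x0 + x1)\<^sup>2 + 6 * x1 * x2 - y2\<^sup>2)
        - (3 * (x0 + x1)\<^sup>2 + 6 * x0 * x2 + y1\<^sup>2)"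
      by (simp add: y algebra_simps)
    then have "6 * ((x1 - x0) * x2) = 0" by (simp only: d0 d1) simp
    then consider "x1 = x0" | "x2 = 0" by auto
    then show ?thesis
    proof cases
      case 1
      have "6 * (x0 * (2 * x0 + x2)) = 3 * (x0 + x1)\<^sup>2 + 6 * x1 * x2 - y2\<^sup>2"
        by (simp add: y 1 algebra_simps power2_eq_square)
      then have "6 * (x0 * (2 * x0 + x2)) = 0" by (simp only: d0)
      then have "x0 * (2 * x0 + x2) = 0" by (rule numeral_mult_eq_0D)
      then have "2 * x0 + x2 = 0" using False by (simp only: mult_eq_0_iff) simp
      then have "x2 = - 2 * x0" by (simp add: eq_neg_iff_add_eq_0 add.commute)
      then have "5 * (x0 * x0) = x0 * x1 + x2\<^sup>2" by (simp add: 1 algebra_simps power2_eq_square)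
      then have "5 * (x0 * x0) = 0" by (simp only: d2')
      then show ?thesis using 1 by simp
    next
      case 2
      then show ?thesis using d2' by auto (use False in auto)
    qed
  qed
  moreover from this have "x2 = 0" using d2' by simp
  moreover from calculation have "y1 = 0" "y2 = 0" using d0 d1 by auto
  ultimately show ?thesis by (intro vec_5_eqI) (use a x in auto)
qed

text \<open>Regularity of the embedding comes from the smoothness of the cubic: the derivatives of
  the Pfaffian along the family are linear in the entries of the adjoint, so a zero adjoint would
  mean a singular point.\<close>

lemma pfaffian_adjoint_form_nonzero:
  fixes a :: "'k::field_char_0 vec"
  assumes a: "a \<in> carrier_vec 5" "a \<noteq> 0\<^sub>v 5"
  shows "pfaffian_adjoint (form_coords a) \<noteq> 0\<^sub>v 15"
proof
  assume 0: "pfaffian_adjoint (form_coords a) = 0\<^sub>v 15"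
  let ?A = "pfaffian_adjoint (form_coords a)"
  have z: "?A $ l = 0" if "l < 15" for l using 0 that by simp
  have "cubic_deriv a 0 = ?A $ 3 + ?A $ 6 + ?A $ 7 + ?A $ 8 + ?A $ 10 - ?A $ 11"
    "cubic_deriv a 1 = ?A $ 2 + ?A $ 3 + ?A $ 4 + ?A $ 6 + ?A $ 9 - ?A $ 11"
    "cubic_deriv a 2 = ?A $ 3 - ?A $ 4 + ?A $ 6 - ?A $ 8 - ?A $ 9 - ?A $ 10"
    "cubic_deriv a 3 = ?A $ 14 - ?A $ 5" "cubic_deriv a 4 = ?A $ 1 + ?A $ 13"
    by (simp_all add: cubic_deriv_def pfaffian_adjoint_index form_coords_index algebra_simps power2_eq_square)
  then have "cubic_deriv a i = 0" if "i < 5" for i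
    using less_5_cases[OF that] z by auto
  with cubic_smooth[OF a(1)] a(2) show False by blast
qed

lemma rank_form_le_4_iff:
  fixes a :: "'k::field_char_0 vec"
  assumes "a \<in> carrier_vec 5" "a \<noteq> 0\<^sub>v 5"
  shows "vec_space.rank 6 (form a) \<le> 4 \<longleftrightarrow> cubic a = 0"
  using rank_skew_le_4[OF pfaffian_adjoint_form_nonzero[OF assms]]
    pfaffian_zero_if_rank_le_4[of "form_coords a"]
  by (auto simp: form_def pfaffian_form_coords)

lemma linear_mapI:
  assumes "vectorspace K V" "vectorspace K W" "f \<in> LinearCombinations.module_hom K V W"
  shows "linear_map K V W f"
  using assms by (simp add: linear_map_def mod_hom_def mod_hom_axioms_def vectorspace_def)

lemma form_linear:
  "linear_map class_ring (module_vec TYPE('k::field_char_0) 5) (module_mat TYPE('k) 6 6) form"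
proof -
  have add: "form (a + b) = form a + form b" if "a \<in> carrier_vec 5" "b \<in> carrier_vec 5" for a b :: "'k vec"
    using that index_pairs_nth(2)
    by (auto intro!: eq_matI simp: form_def form_coords_add skew_mat_def skew_entry_def)
  have smult: "form (c \<cdot>\<^sub>v a) = c \<cdot>\<^sub>m form a" if "a \<in> carrier_vec 5" for c and a :: "'k vec"
    using that index_pairs_nth(2)
    by (auto intro!: eq_matI simp: form_def form_coords_smult skew_mat_def skew_entry_def)
  have car: "form a \<in> carrier_mat 6 6" for a :: "'k vec" by (simp add: form_def)
  have "form \<in> LinearCombinations.module_hom class_ring (module_vec TYPE('k) 5) (module_mat TYPE('k) 6 6)"
    unfolding LinearCombinations.module_hom_def module_vec_simps module_mat_simps class_ring_simps
    using add smult car by blast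
  then show ?thesis by (intro linear_mapI vec_vs matrix_vs)
qed

lemma form_coords_linear:
  "linear_map class_ring (module_vec TYPE('k::field) 5) (module_vec TYPE('k) 15) form_coords"
proof -
  have "form_coords \<in> LinearCombinations.module_hom class_ring (module_vec TYPE('k) 5) (module_vec TYPE('k) 15)"
    unfolding LinearCombinations.module_hom_def module_vec_simps class_ring_simps
    using form_coords_add form_coords_smult form_coords_carrier by blast
  then show ?thesis by (intro linear_mapI vec_vs)
qed

lemma coords_form: "coords (form a) = form_coords a"
  by (simp add: form_def coords_skew_mat)

lemma regular_embedding_form: "regular_embedding (form :: 'k::field_char_0 vec \<Rightarrow> 'k mat)"
  unfolding regular_embedding_def
proof (intro conjI ballI)
  show "form ` carrier_vec 5 \<subseteq> (skew_matrices :: 'k mat set)"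
    by (auto simp: form_def skew_mat_skew)
  show "inj_on form (carrier_vec 5 :: 'k vec set)"
    by (metis coords_form form_coords_inj inj_onI)
  show "4 \<le> vec_space.rank 6 (form a)" if "a \<in> carrier_vec 5 - {0\<^sub>v 5}" for a :: "'k vec"
    unfolding form_def by (rule rank_skew_ge_4) (use pfaffian_adjoint_form_nonzero that in auto)
qed (rule form_linear)

lemma cubic_smult: "a \<in> carrier_vec 5 \<Longrightarrow> cubic (c \<cdot>\<^sub>v a) = c ^ 3 * cubic a"
  by (simp add: cubic_def algebra_simps power2_eq_square power3_eq_cube)

lemma Y_of_form:
  "Y_of (form :: 'k::field_char_0 vec \<Rightarrow> 'k mat) =
    {[line (form_coords a)] | a. a \<in> carrier_vec 5 \<and> a \<noteq> 0\<^sub>v 5 \<and> cubic a = 0}"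
proof (intro equalityI subsetI)
  fix x assume "x \<in> Y_of (form :: 'k vec \<Rightarrow> 'k mat)"
  then obtain a and M :: "'k mat" where a: "a \<in> carrier_vec 5" "x = [line (form_coords a)]" "form_coords a \<noteq> 0\<^sub>v 15"
    and M: "M \<in> skew_matrices" "vec_space.rank 6 M \<le> 4" "x = [line (coords M)]" "coords M \<noteq> 0\<^sub>v 15"
    by (auto simp: Y_of_def projectivization_def pfaffian_cubic_def coords_form)
  have "a \<noteq> 0\<^sub>v 5" using a(3) by auto
  moreover have "cubic a = 0"
  proof -
    obtain c where c: "c \<noteq> 0" "coords M = c \<cdot>\<^sub>v form_coords a"
      using line_eqD[OF _ coords_carrier M(4), of "form_coords a"] a(2) M(3) by auto
    then have "M = form (c \<cdot>\<^sub>v a)"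
      using skew_mat_coords[OF M(1)] a(1) by (simp add: form_def form_coords_smult)
    moreover have "form_coords (c \<cdot>\<^sub>v a) = coords M" using c(2) a(1) by (simp add: form_coords_smult)
    then have "c \<cdot>\<^sub>v a \<noteq> 0\<^sub>v 5" using M(4) by auto
    ultimately have "cubic (c \<cdot>\<^sub>v a) = 0" using rank_form_le_4_iff[of "c \<cdot>\<^sub>v a"] M(2) a(1) by simp
    then show ?thesis using c(1) a(1) by (simp add: cubic_smult)
  qed
  ultimately show "x \<in> {[line (form_coords a)] | a. a \<in> carrier_vec 5 \<and> a \<noteq> 0\<^sub>v 5 \<and> cubic a = 0}"
    using a by blast
next
  fix x assume "x \<in> {[line (form_coords a)] | a. a \<in> carrier_vec 5 \<and> a \<noteq> 0\<^sub>v 5 \<and> cubic (a :: 'k vec) = 0}"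
  then obtain a :: "'k vec" where a: "a \<in> carrier_vec 5" "a \<noteq> 0\<^sub>v 5" "cubic a = 0" "x = [line (form_coords a)]"
    by blast
  have "form_coords a \<noteq> 0\<^sub>v 15" using form_coords_eq_zeroD a by blast
  moreover have "form_coords a \<in> coords ` form ` carrier_vec 5"
    using a(1) by (auto simp: image_iff coords_form)
  moreover have "form_coords a \<in> coords ` {M \<in> skew_matrices. vec_space.rank 6 M \<le> 4}"
    using rank_form_le_4_iff[OF a(1,2)] a(3)
    by (intro image_eqI[of _ _ "form a"]) (auto simp: form_def skew_mat_skew coords_skew_mat)
  ultimately show "x \<in> Y_of form"
    unfolding Y_of_def projectivization_def pfaffian_cubic_def a(4) by blast
qed

definition xmonomial :: "nat \<Rightarrow> nat \<Rightarrow> nat \<Rightarrow> nat \<Rightarrow> nat \<Rightarrow> (nat \<times> nat) \<Rightarrow>\<^sub>0 nat" where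
  "xmonomial a b c d e = Poly_Mapping.single (0, 0) a + Poly_Mapping.single (0, 1) b +
     Poly_Mapping.single (0, 2) c + Poly_Mapping.single (0, 3) d + Poly_Mapping.single (0, 4) e"

definition cubic_poly :: "'k::field polynomial" where
  "cubic_poly = Poly_Mapping.single (xmonomial 3 0 0 0 0) 1 + Poly_Mapping.single (xmonomial 0 3 0 0 0) 1
     + Poly_Mapping.single (xmonomial 2 1 0 0 0) 3 + Poly_Mapping.single (xmonomial 1 2 0 0 0) 3
     + Poly_Mapping.single (xmonomial 1 1 1 0 0) 6 + Poly_Mapping.single (xmonomial 0 0 3 0 0) 2
     + Poly_Mapping.single (xmonomial 0 1 0 2 0) 1 + Poly_Mapping.single (xmonomial 1 0 0 0 2) (- 1)"

lemma lookup_xmonomial_if: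
  "Poly_Mapping.lookup (xmonomial a b c d e) k = (if k = (0, 0) then a else if k = (0, Suc 0) then b
     else if k = (0, 2) then c else if k = (0, 3) then d else if k = (0, 4) then e else 0)"
  by (simp add: xmonomial_def lookup_add lookup_single when_def)

lemma lookup_xmonomial:
  shows "Poly_Mapping.lookup (xmonomial a b c d e) (0, 0) = a"
    and "Poly_Mapping.lookup (xmonomial a b c d e) (0, Suc 0) = b"
    and "Poly_Mapping.lookup (xmonomial a b c d e) (0, 2) = c"
    and "Poly_Mapping.lookup (xmonomial a b c d e) (0, 3) = d"
    and "Poly_Mapping.lookup (xmonomial a b c d e) (0, 4) = e"
  by (simp_all add: lookup_xmonomial_if)

text \<open>For a zero exponent truncated subtraction leaves the monomial unchanged; in a partial
  derivative its coefficient is then zero.\<close>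

lemma xmonomial_diff:
  shows "xmonomial a b c d e - Poly_Mapping.single (0, 0) (Suc 0) = xmonomial (a - 1) b c d e"
    and "xmonomial a b c d e - Poly_Mapping.single (0, Suc 0) (Suc 0) = xmonomial a (b - 1) c d e"
    and "xmonomial a b c d e - Poly_Mapping.single (0, 2) (Suc 0) = xmonomial a b (c - 1) d e"
    and "xmonomial a b c d e - Poly_Mapping.single (0, 3) (Suc 0) = xmonomial a b c (d - 1) e"
    and "xmonomial a b c d e - Poly_Mapping.single (0, 4) (Suc 0) = xmonomial a b c d (e - 1)"
  by (rule poly_mapping_eqI, simp add: lookup_xmonomial_if lookup_minus lookup_single when_def)+

lemma monomial_value_xmonomial:
  "monomial_value (xmonomial a b c d e) [v] = v $ 0 ^ a * v $ 1 ^ b * v $ 2 ^ c * v $ 3 ^ d * v $ 4 ^ e"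
  by (simp add: xmonomial_def monomial_value_add monomial_value_single)

lemma keys_xmonomial: "Poly_Mapping.keys (xmonomial a b c d e) \<subseteq> {(j, i). j < length [5::nat] \<and> i < [5] ! j}"
  unfolding xmonomial_def
  by (intro order_trans[OF keys_add] Un_least) (auto split: if_splits)

lemma sum_xmonomial: "(\<Sum>i<5. Poly_Mapping.lookup (xmonomial a b c d e) (0, i)) = a + b + c + d + e"
proof -
  have "{..<5::nat} = {0, 1, 2, 3, 4}" by auto
  then show ?thesis by (simp add: lookup_xmonomial)
qed

lemma cubic_poly_multihomogeneous: "multihomogeneous [5] (\<lambda>_. 3) cubic_poly"
  unfolding cubic_poly_def
  by (intro multihomogeneous_add multihomogeneous_single keys_xmonomial) (simp_all add: sum_xmonomial)

lemma evaluate_cubic_poly: "evaluate cubic_poly [a] = cubic a"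
  by (simp add: cubic_poly_def evaluate_add evaluate_single monomial_value_xmonomial cubic_def
      algebra_simps power2_eq_square power3_eq_cube)

lemma partial_deriv_superset:
  assumes "finite A" "Poly_Mapping.keys p \<subseteq> A"
  shows "partial_deriv x p = (\<Sum>m\<in>A. Poly_Mapping.single (m - Poly_Mapping.single x 1)
       (of_nat (Poly_Mapping.lookup m x) * Poly_Mapping.lookup p m))"
  unfolding partial_deriv_def
  by (rule sum.mono_neutral_left) (use assms in \<open>auto simp: in_keys_iff\<close>)

lemma partial_deriv_add: "partial_deriv x (p + q) = partial_deriv x p + partial_deriv x q"
proof -
  let ?A = "Poly_Mapping.keys p \<union> Poly_Mapping.keys q"
  have "finite ?A" "Poly_Mapping.keys (p + q) \<subseteq> ?A"
    using keys_add[of p q] by auto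
  then show ?thesis
    by (simp add: partial_deriv_superset[of ?A] lookup_add algebra_simps sum.distrib single_add)
qed

lemma partial_deriv_single:
  "partial_deriv x (Poly_Mapping.single m c) =
    Poly_Mapping.single (m - Poly_Mapping.single x 1) (of_nat (Poly_Mapping.lookup m x) * c)"
  using partial_deriv_superset[of "{m}" "Poly_Mapping.single m c" x] by (simp add: lookup_single)

lemma evaluate_partial_deriv_cubic_poly:
  assumes "i < 5" shows "evaluate (partial_deriv (0, i) cubic_poly) [a] = cubic_deriv a i"
  using less_5_cases[OF assms]
  by (elim disjE) (simp_all add: cubic_poly_def partial_deriv_add partial_deriv_single evaluate_add
      evaluate_single lookup_xmonomial xmonomial_diff monomial_value_xmonomial cubic_deriv_def
      algebra_simps power2_eq_square)

lemma smooth_cubic_threefold_Y_of_form: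
  "smooth_cubic_threefold 15 (Y_of (form :: 'k::field_char_0 vec \<Rightarrow> 'k mat))"
  unfolding smooth_cubic_threefold_def
proof (rule exI[of _ form_coords], rule exI[of _ cubic_poly], intro conjI ballI impI)
  show "inj_on form_coords (carrier_vec 5 :: 'k vec set)"
    by (meson form_coords_inj inj_onI)
  show "Y_of (form :: 'k vec \<Rightarrow> 'k mat) =
    projectivization 15 (form_coords ` {a \<in> carrier_vec 5. evaluate cubic_poly [a] = 0})"
    unfolding Y_of_form projectivization_def evaluate_cubic_poly
    using form_coords_eq_zeroD form_coords_zero by fastforce
  fix a :: "'k vec" assume "a \<in> carrier_vec 5 - {0\<^sub>v 5}"
  then show "\<exists>i<5. evaluate (partial_deriv (0, i) cubic_poly) [a] \<noteq> 0"
    using cubic_smooth[of a] evaluate_partial_deriv_cubic_poly by (metis DiffD1 DiffD2 singletonI)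
qed (rule form_coords_linear cubic_poly_multihomogeneous)+

section \<open>Planes in the degree 14 threefold\<close>

type_synonym 'k v3 = "'k \<times> 'k \<times> 'k"

fun sc :: "'k::field \<Rightarrow> 'k v3 \<Rightarrow> 'k v3" where
  "sc c (p0, p1, p2) = (c * p0, c * p1, c * p2)"

fun cr :: "'k::field v3 \<Rightarrow> 'k v3 \<Rightarrow> 'k v3" where
  "cr (p0, p1, p2) (q0, q1, q2) = (p1 * q2 - p2 * q1, p2 * q0 - p0 * q2, p0 * q1 - p1 * q0)"

fun dt :: "'k::field v3 \<Rightarrow> 'k v3 \<Rightarrow> 'k" where
  "dt (p0, p1, p2) (q0, q1, q2) = p0 * q0 + p1 * q1 + p2 * q2"

text \<open>\<open>sm x\<close> is the block S of the form. It polarises the plane cubic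
  \<open>x0^2 x1 + x0 x1^2 + 2 x0 x1 x2 - x0 x2^2 - x1 x2^2\<close>: the trilinear form
  \<open>dt e (sm x p)\<close> is symmetric in all three arguments, and on the diagonal it is 3
  times this cubic.\<close>

fun sm :: "'k::field v3 \<Rightarrow> 'k v3 \<Rightarrow> 'k v3" where
  "sm (x0, x1, x2) (p0, p1, p2) =
    (x1 * p0 + (x0 + x1 + x2) * p1 + (x1 - x2) * p2,
     (x0 + x1 + x2) * p0 + x0 * p1 + (x0 - x2) * p2,
     (x1 - x2) * p0 + (x0 - x2) * p1 - (x0 + x1) * p2)"

text \<open>The determinant of the symmetric matrix of \<open>sm x\<close>, that is, up to a factor,
  the Hessian of the cubic polarised by \<open>sm\<close>. It is also the restriction of
  \<open>cubic\<close> to y = 0.\<close>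

fun plane_cubic :: "'k::field v3 \<Rightarrow> 'k" where
  "plane_cubic (x0, x1, x2) = (x0 + x1) ^ 3 + 6 * x0 * x1 * x2 + 2 * x2 ^ 3"

lemma v3_zero: "(0 :: 'k::field v3) = (0, 0, 0)"
  by (simp add: zero_prod_def)

lemmas v3_simps = v3_zero plus_prod_def minus_prod_def uminus_prod_def

lemma sm_commute: "sm x p = sm p x"
  by (cases x; cases p) (simp add: algebra_simps)

lemma sm_linear:
  "sm x (p + q) = sm x p + sm x q" "sm x (p - q) = sm x p - sm x q" "sm x (sc c p) = sc c (sm x p)"
  "sm (x + y) p = sm x p + sm y p" "sm (x - y) p = sm x p - sm y p" "sm (sc c x) p = sc c (sm x p)"
  "sm x 0 = 0" "sm 0 p = 0"
  by (cases x; cases y; cases p; cases q; simp add: v3_simps algebra_simps)+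

lemma cr_linear:
  "cr x (p + q) = cr x p + cr x q" "cr x (p - q) = cr x p - cr x q" "cr x (sc c p) = sc c (cr x p)"
  "cr (x + y) p = cr x p + cr y p" "cr (x - y) p = cr x p - cr y p" "cr (sc c x) p = sc c (cr x p)"
  "cr x x = 0" "cr x 0 = 0" "cr 0 x = 0"
  by (cases x; cases y; cases p; cases q; simp add: v3_simps algebra_simps)+

lemma dt_linear:
  "dt x (p + q) = dt x p + dt x q" "dt x (p - q) = dt x p - dt x q" "dt x (sc c p) = c * dt x p"
  "dt (x + y) p = dt x p + dt y p" "dt (x - y) p = dt x p - dt y p" "dt (sc c x) p = c * dt x p"
  "dt x 0 = 0" "dt 0 x = 0"
  by (cases x; cases y; cases p; cases q; simp add: v3_simps algebra_simps)+

lemma sc_simps: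
  "sc c (p + q) = sc c p + sc c q" "sc c (p - q) = sc c p - sc c q" "sc c (sc d p) = sc (c * d) p"
  "sc (c + d) p = sc c p + sc d p" "sc (c - d) p = sc c p - sc d p" "sc 1 p = p" "sc 0 p = 0"
  "sc c 0 = 0" "sc (- c) p = - sc c p"
  by (cases p; cases q; simp add: v3_simps algebra_simps)+

lemma sc_eq_0_iff: "sc c p = 0 \<longleftrightarrow> c = 0 \<or> p = 0"
  by (cases p) (auto simp: v3_simps)

lemma cr_swap: "cr p q = - cr q p"
  by (cases p; cases q) (simp add: v3_simps)

lemma dt_cr_self: "dt p (cr p q) = 0" "dt q (cr p q) = 0" "dt (cr p q) p = 0" "dt (cr p q) q = 0"
  by (cases p; cases q; simp add: algebra_simps)+

lemma parallelE:
  assumes "m \<noteq> 0" "cr p m = 0" obtains c where "p = sc c m"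
proof -
  obtain p0 p1 p2 m0 m1 m2 where pm: "p = (p0, p1, p2)" "m = (m0, m1, m2)" by (metis prod_cases3)
  have e: "p1 * m2 = p2 * m1" "p2 * m0 = p0 * m2" "p0 * m1 = p1 * m0"
    using assms(2) by (auto simp: pm v3_simps)
  consider "m0 \<noteq> 0" | "m1 \<noteq> 0" | "m2 \<noteq> 0" using assms(1) by (auto simp: pm v3_simps)
  then show ?thesis
  proof cases
    case 1 then show ?thesis using e by (intro that[of "p0 / m0"]) (simp add: pm field_simps)
  next
    case 2 then show ?thesis using e by (intro that[of "p1 / m1"]) (simp add: pm field_simps)
  next
    case 3 then show ?thesis using e by (intro that[of "p2 / m2"]) (simp add: pm field_simps)
  qed
qed

lemma parallel_trans:
  assumes "m \<noteq> 0" "cr p m = 0" "cr q m = 0" shows "cr p q = 0"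
  using parallelE[OF assms(1,2)] parallelE[OF assms(1,3)]
  by (metis cr_linear(3,6,7) sc_simps(8))

lemma in_spanE:
  assumes "cr p q \<noteq> 0" "dt r (cr p q) = 0" obtains a b where "r = sc a p + sc b q"
proof -
  obtain p0 p1 p2 q0 q1 q2 r0 r1 r2 where v: "p = (p0, p1, p2)" "q = (q0, q1, q2)" "r = (r0, r1, r2)"
    by (metis prod_cases3)
  define m0 m1 m2 where m: "m0 = p1 * q2 - p2 * q1" "m1 = p2 * q0 - p0 * q2" "m2 = p0 * q1 - p1 * q0"
  have d: "r0 * m0 + r1 * m1 + r2 * m2 = 0" using assms(2) by (simp add: v m)
  consider "m0 \<noteq> 0" | "m1 \<noteq> 0" | "m2 \<noteq> 0" using assms(1) by (auto simp: v m v3_simps)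
  then show ?thesis
  proof cases
    case 1
    define A B where AB: "A = r1 * q2 - r2 * q1" "B = p1 * r2 - p2 * r1"
    have "r0 * m0 = A * p0 + B * q0" "r1 * m0 = A * p1 + B * q1" "r2 * m0 = A * p2 + B * q2"
      using d by (simp_all add: AB m algebra_simps eq_neg_iff_add_eq_0)
    then show ?thesis using 1
      by (intro that[of "A / m0" "B / m0"]) (simp add: v v3_simps field_simps)
  next
    case 2
    define A B where AB: "A = r2 * q0 - r0 * q2" "B = p2 * r0 - p0 * r2"
    have "r0 * m1 = A * p0 + B * q0" "r1 * m1 = A * p1 + B * q1" "r2 * m1 = A * p2 + B * q2"
      using d by (simp_all add: AB m algebra_simps eq_neg_iff_add_eq_0)
    then show ?thesis using 2
      by (intro that[of "A / m1" "B / m1"]) (simp add: v v3_simps field_simps)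
  next
    case 3
    define A B where AB: "A = r0 * q1 - r1 * q0" "B = p0 * r1 - p1 * r0"
    have "r0 * m2 = A * p0 + B * q0" "r1 * m2 = A * p1 + B * q1" "r2 * m2 = A * p2 + B * q2"
      using d by (simp_all add: AB m algebra_simps eq_neg_iff_add_eq_0)
    then show ?thesis using 3
      by (intro that[of "A / m2" "B / m2"]) (simp add: v v3_simps field_simps)
  qed
qed

text \<open>If \<open>sm x\<close> annihilates two independent vectors, its matrix has rank at most
  one and all its 2 by 2 minors vanish. The derivatives of its determinant are combinations of these
  minors, so \<open>x\<close> would be a singular point of \<open>cubic\<close> with y = 0.\<close>

lemma sm_kernel_le_1:
  fixes x p q :: "'k::field_char_0 v3"
  assumes pq: "cr p q \<noteq> 0" and x: "sm x p = 0" "sm x q = 0"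
  shows "x = 0"
proof -
  obtain x0 x1 x2 where v: "x = (x0, x1, x2)" by (metis prod_cases3)
  define R0 R1 R2 where R: "R0 = (x1, x0 + x1 + x2, x1 - x2)" "R1 = (x0 + x1 + x2, x0, x0 - x2)"
    "R2 = (x1 - x2, x0 - x2, - (x0 + x1))"
  have z: "dt r p = 0" "dt r q = 0" if "r \<in> {R0, R1, R2}" for r
  proof -
    have "sm x s = (dt R0 s, dt R1 s, dt R2 s)" for s
      by (cases s) (simp add: v R algebra_simps)
    then show "dt r p = 0" "dt r q = 0" using x that by (auto simp: v3_zero)
  qed
  have par: "cr r r' = 0" if r: "r \<in> {R0, R1, R2}" "r' \<in> {R0, R1, R2}" for r r'
  proof (rule ccontr)
    assume n: "cr r r' \<noteq> 0"
    have triple: "cr s (cr r r') = sc (dt r' s) r - sc (dt r s) r'" for s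
      by (cases s; cases r; cases r') (simp add: v3_simps algebra_simps)
    have "cr p (cr r r') = 0" "cr q (cr r r') = 0"
      unfolding triple using z[OF r(1)] z[OF r(2)] by (simp_all add: sc_simps)
    from parallel_trans[OF n this] pq show False by simp
  qed
  have minors: "cr R1 R2 = 0" "cr R2 R0 = 0" "cr R0 R1 = 0" by (simp_all add: par)
  let ?a = "vec 5 (\<lambda>i. [x0, x1, x2, 0, 0] ! i)"
  define C00 C01 C02 C11 C12 C22 where C: "C00 = fst (cr R1 R2)" "C01 = fst (snd (cr R1 R2))"
    "C02 = snd (snd (cr R1 R2))" "C11 = fst (snd (cr R2 R0))" "C12 = snd (snd (cr R2 R0))"
    "C22 = snd (snd (cr R0 R1))"
  have C0: "C00 = 0" "C01 = 0" "C02 = 0" "C11 = 0" "C12 = 0" "C22 = 0"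
    by (simp_all add: C minors v3_zero)
  have "cubic_deriv ?a 0 = 2 * C01 + C11 + 2 * C12 - C22"
    "cubic_deriv ?a 1 = C00 + 2 * C01 + 2 * C02 - C22"
    "cubic_deriv ?a 2 = 2 * C01 - 2 * C02 - 2 * C12" "cubic_deriv ?a 3 = 0" "cubic_deriv ?a 4 = 0"
    by (simp_all add: cubic_deriv_def C R algebra_simps power2_eq_square)
  then have "cubic_deriv ?a i = 0" if "i < 5" for i
    using less_5_cases[OF that] C0 by (elim disjE) simp_all
  then have "?a = 0\<^sub>v 5" by (intro cubic_smooth) auto
  then have "?a $ 0 = 0" "?a $ 1 = 0" "?a $ 2 = 0" by simp_all
  then show ?thesis by (simp add: v v3_simps)
qed

text \<open>\<open>sm p p\<close> is, up to a factor, the gradient of the plane cubic polarised by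
  \<open>sm\<close>; the statement is the smoothness of that curve.\<close>

lemma sm_self_eq_0D:
  fixes p :: "'k::field_char_0 v3"
  assumes "sm p p = 0" shows "p = 0"
proof -
  obtain p0 p1 p2 where v: "p = (p0, p1, p2)" by (metis prod_cases3)
  have raw: "p1 * p0 + (p0 + p1 + p2) * p1 + (p1 - p2) * p2 = 0"
    "(p0 + p1 + p2) * p0 + p0 * p1 + (p0 - p2) * p2 = 0"
    "(p1 - p2) * p0 + (p0 - p2) * p1 - (p0 + p1) * p2 = 0"
    using assms unfolding v sm.simps v3_zero prod.inject by blast+
  have "2 * p0 * p1 + p1\<^sup>2 + 2 * p1 * p2 - p2\<^sup>2 = p1 * p0 + (p0 + p1 + p2) * p1 + (p1 - p2) * p2"
    "p0\<^sup>2 + 2 * p0 * p1 + 2 * p0 * p2 - p2\<^sup>2 = (p0 + p1 + p2) * p0 + p0 * p1 + (p0 - p2) * p2"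
    "2 * (p0 * p1 - p0 * p2 - p1 * p2) = (p1 - p2) * p0 + (p0 - p2) * p1 - (p0 + p1) * p2"
    by (simp_all add: algebra_simps power2_eq_square)
  note e = this[unfolded raw]
  have e3: "p0 * p1 - p0 * p2 - p1 * p2 = 0" using e(3) by (rule numeral_mult_eq_0D)
  have "(p1 - p0) * (p1 + p0 + 2 * p2) = (2 * p0 * p1 + p1\<^sup>2 + 2 * p1 * p2 - p2\<^sup>2)
      - (p0\<^sup>2 + 2 * p0 * p1 + 2 * p0 * p2 - p2\<^sup>2)"
    by (simp add: algebra_simps power2_eq_square)
  then have "(p1 - p0) * (p1 + p0 + 2 * p2) = 0" by (simp only: e) simp
  then have "p1 - p0 = 0 \<or> p1 + p0 + 2 * p2 = 0" by (simp only: mult_eq_0_iff)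
  then consider "p1 = p0" | "p1 = - p0 - 2 * p2"
    by (metis add.commute add_diff_cancel_right' diff_0 eq_iff_diff_eq_0 minus_add_distrib uminus_add_conv_diff)
  then show ?thesis
  proof cases
    case 1
    have "p0 * (p0 - 2 * p2) = 0" using e3 unfolding 1 by (simp add: algebra_simps)
    then consider "p0 = 0" | "p0 = 2 * p2" by auto
    then show ?thesis
    proof cases
      case 1
      then show ?thesis using e(2) \<open>p1 = p0\<close> by (simp add: v v3_simps)
    next
      case 2
      have "15 * (p2 * p2) = p0\<^sup>2 + 2 * p0 * p1 + 2 * p0 * p2 - p2\<^sup>2"
        unfolding \<open>p1 = p0\<close> unfolding 2 by (simp add: algebra_simps power2_eq_square)
      then have "15 * (p2 * p2) = 0" by (simp only: e)
      then have "p2 * p2 = 0" by (rule numeral_mult_eq_0D)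
      then show ?thesis using 1 2 by (simp add: v v3_simps)
    qed
  next
    case 2
    have "3 * (p2 * p2) = (p0 * p1 - p0 * p2 - p1 * p2) + - (p0\<^sup>2 + 2 * p0 * p1 + 2 * p0 * p2 - p2\<^sup>2) + 0"
      unfolding 2 by (simp add: algebra_simps power2_eq_square)
    then have "3 * (p2 * p2) = 0" by (simp only: e e3) simp
    then have "p2 * p2 = 0" by (rule numeral_mult_eq_0D)
    then have "p2 = 0" by simp
    moreover from this 2 e(2) have "p0 = 0" by (simp add: algebra_simps power2_eq_square)
    ultimately show ?thesis using 2 by (simp add: v v3_simps)
  qed
qed

text \<open>The curve \<open>plane_cubic = 0\<close> contains no line. A line that avoids
  \<open>(0, 0, 1)\<close> is a graph \<open>x2 = \<alpha> x0 + \<beta> x1\<close>; evaluation at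
  four points isolates the coefficients of the restricted binary cubic, which cannot all
  vanish.\<close>

lemma plane_cubic_nonzero_on_plane:
  fixes p q :: "'k::field_char_0 v3"
  assumes pq: "cr p q \<noteq> 0"
  shows "\<exists>s t. plane_cubic (sc s p + sc t q) \<noteq> 0"
proof (rule ccontr)
  assume "\<not> ?thesis"
  then have all: "plane_cubic (sc s p + sc t q) = 0" for s t by blast
  obtain p0 p1 p2 q0 q1 q2 where v: "p = (p0, p1, p2)" "q = (q0, q1, q2)" by (metis prod_cases3)
  define m where "m = p0 * q1 - p1 * q0"
  show False
  proof (cases "m = 0")
    case True
    then have "dt (0, 0, 1) (cr p q) = 0" by (simp add: v m_def)
    then obtain s t where "(0, 0, 1) = sc s p + sc t q" using in_spanE[OF pq] by blast
    then have "plane_cubic (0, 0, 1 :: 'k) = 0" using all by metis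
    then show False by simp
  next
    case False
    define \<alpha> \<beta> where "\<alpha> = (q1 * p2 - p1 * q2) / m" and "\<beta> = (p0 * q2 - q0 * p2) / m"
    have pt: "plane_cubic (c, d, c * \<alpha> + d * \<beta>) = 0" for c d
    proof -
      have "dt (c, d, c * \<alpha> + d * \<beta>) (cr p q) = 0"
        using False unfolding \<alpha>_def \<beta>_def by (simp add: v field_simps) (simp add: m_def algebra_simps)
      then obtain s t where "(c, d, c * \<alpha> + d * \<beta>) = sc s p + sc t q" using in_spanE[OF pq] by blast
      then show ?thesis using all by metis
    qed
    have a: "1 + 2 * \<alpha> ^ 3 = 0" and b: "1 + 2 * \<beta> ^ 3 = 0"
      using pt[of 1 0] pt[of 0 1] by simp_all
    have s: "(1 + 1) ^ 3 + 6 * (\<alpha> + \<beta>) + 2 * (\<alpha> + \<beta>) ^ 3 = 0" using pt[of 1 1] by simp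
    have d: "- 6 * (\<alpha> - \<beta>) + 2 * (\<alpha> - \<beta>) ^ 3 = 0" using pt[of 1 "-1"] by simp
    have "6 * (1 + 2 * \<beta> + 2 * \<alpha> * \<beta>\<^sup>2) = ((1 + 1) ^ 3 + 6 * (\<alpha> + \<beta>) + 2 * (\<alpha> + \<beta>) ^ 3)
        + (- 6 * (\<alpha> - \<beta>) + 2 * (\<alpha> - \<beta>) ^ 3) - 2 * (1 + 2 * \<alpha> ^ 3)"
      by (simp add: algebra_simps power2_eq_square power3_eq_cube)
    then have "6 * (1 + 2 * \<beta> + 2 * \<alpha> * \<beta>\<^sup>2) = 0" by (simp only: a s d) simp
    then have e1: "1 + 2 * \<beta> + 2 * \<alpha> * \<beta>\<^sup>2 = 0" by (rule numeral_mult_eq_0D)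
    have "6 * (1 + 2 * \<alpha> + 2 * \<alpha>\<^sup>2 * \<beta>) = ((1 + 1) ^ 3 + 6 * (\<alpha> + \<beta>) + 2 * (\<alpha> + \<beta>) ^ 3)
        - (- 6 * (\<alpha> - \<beta>) + 2 * (\<alpha> - \<beta>) ^ 3) - 2 * (1 + 2 * \<beta> ^ 3)"
      by (simp add: algebra_simps power2_eq_square power3_eq_cube)
    then have "6 * (1 + 2 * \<alpha> + 2 * \<alpha>\<^sup>2 * \<beta>) = 0" by (simp only: b s d) simp
    then have e2: "1 + 2 * \<alpha> + 2 * \<alpha>\<^sup>2 * \<beta> = 0" by (rule numeral_mult_eq_0D)
    have "\<beta> * (1 + 2 * \<beta> + 2 * \<alpha> * \<beta>\<^sup>2) = \<beta> + 2 * \<beta>\<^sup>2 - \<alpha> + \<alpha> * (1 + 2 * \<beta> ^ 3)"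
      by (simp add: algebra_simps power2_eq_square power3_eq_cube)
    then have f1: "\<beta> + 2 * \<beta>\<^sup>2 - \<alpha> = 0" by (simp add: e1 b)
    have "\<alpha> * (1 + 2 * \<alpha> + 2 * \<alpha>\<^sup>2 * \<beta>) = \<alpha> + 2 * \<alpha>\<^sup>2 - \<beta> + \<beta> * (1 + 2 * \<alpha> ^ 3)"
      by (simp add: algebra_simps power2_eq_square power3_eq_cube)
    then have f2: "\<alpha> + 2 * \<alpha>\<^sup>2 - \<beta> = 0" by (simp add: e2 a)
    have "2 * (\<alpha>\<^sup>2 + \<beta>\<^sup>2) = (\<beta> + 2 * \<beta>\<^sup>2 - \<alpha>) + (\<alpha> + 2 * \<alpha>\<^sup>2 - \<beta>)" by (simp add: algebra_simps)
    then have "2 * (\<alpha>\<^sup>2 + \<beta>\<^sup>2) = 0" by (simp only: f1 f2) simp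
    then have "\<alpha>\<^sup>2 + \<beta>\<^sup>2 = 0" by (rule numeral_mult_eq_0D)
    then have g: "\<beta>\<^sup>2 = - (\<alpha>\<^sup>2)" by (simp add: eq_neg_iff_add_eq_0 add.commute)
    have "2 * (\<alpha>\<^sup>2 * (\<alpha> + \<beta>)) = (1 + 2 * \<alpha> ^ 3) - (1 + 2 * \<beta> ^ 3)"
      using g by (simp add: algebra_simps power2_eq_square power3_eq_cube)
    then have "2 * (\<alpha>\<^sup>2 * (\<alpha> + \<beta>)) = 0" by (simp only: a b) simp
    moreover have "\<alpha> \<noteq> 0" using a by auto
    ultimately have "\<beta> = - \<alpha>" by (auto simp: eq_neg_iff_add_eq_0 add.commute)
    then have "2 * \<alpha>\<^sup>2 = \<alpha>\<^sup>2 + \<beta>\<^sup>2" by simp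
    then have "2 * \<alpha>\<^sup>2 = 0" unfolding g by simp
    then show False using \<open>\<alpha> \<noteq> 0\<close> by simp
  qed
qed

text \<open>The form of \<open>(x, y\<^sub>1, y\<^sub>2)\<close> annihilates the vector \<open>(p, q)\<close>. A vector is bad if two independent forms annihilate it.\<close>

definition kills :: "'k::field v3 \<Rightarrow> 'k \<Rightarrow> 'k \<Rightarrow> 'k v3 \<Rightarrow> 'k v3 \<Rightarrow> bool" where
  "kills x y1 y2 p q \<longleftrightarrow> sm x q = - cr (y1, y2, 0) p \<and> sm x p = cr (- y1, y2, 0) q"

definition bad :: "'k::field v3 \<Rightarrow> 'k v3 \<Rightarrow> bool" where
  "bad p q \<longleftrightarrow> (\<exists>x y1 y2 x' y1' y2'. kills x y1 y2 p q \<and> kills x' y1' y2' p q \<and>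
     (\<forall>c d. sc c x + sc d x' = 0 \<and> c * y1 + d * y1' = 0 \<and> c * y2 + d * y2' = 0 \<longrightarrow> c = 0 \<and> d = 0))"

lemma kills_combine_left:
  assumes "kills x y1 y2 p q" "kills x' y1' y2' p q"
  shows "kills (sc c x + sc d x') (c * y1 + d * y1') (c * y2 + d * y2') p q"
proof -
  have "cr (c * y1 + d * y1', c * y2 + d * y2', 0) p = sc c (cr (y1, y2, 0) p) + sc d (cr (y1', y2', 0) p)"
    "cr (- (c * y1 + d * y1'), c * y2 + d * y2', 0) q = sc c (cr (- y1, y2, 0) q) + sc d (cr (- y1', y2', 0) q)"
    by (cases p; cases q; simp add: v3_simps algebra_simps)+
  moreover have "- (sc c a + sc d b) = sc c (- a) + sc d (- b)" for a b :: "'a v3"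
    by (cases a; cases b) (simp add: v3_simps)
  ultimately show ?thesis using assms by (simp add: kills_def sm_linear)
qed

lemma kills_combine_right:
  assumes "kills x y1 y2 p q" "kills x y1 y2 p' q'"
  shows "kills x y1 y2 (sc c p + sc d p') (sc c q + sc d q')"
proof -
  have "- (sc c a + sc d b) = sc c (- a) + sc d (- b)" for a b :: "'a v3"
    by (cases a; cases b) (simp add: v3_simps)
  then show ?thesis using assms by (simp add: kills_def sm_linear cr_linear)
qed

text \<open>If only \<open>x = 0\<close> annihilates both \<open>p\<close> and \<open>q\<close>
  under \<open>sm\<close>, a form annihilating \<open>(p, q)\<close> is determined by its y-part. A
  two-dimensional space of such forms then maps isomorphically onto the y-plane, so both unit
  vectors occur.\<close>

lemma bad_imp_kills:
  fixes p q :: "'k::field_char_0 v3"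
  assumes inj: "\<And>x. sm x p = 0 \<Longrightarrow> sm x q = 0 \<Longrightarrow> x = 0" and "bad p q"
  shows "\<exists>x. kills x 1 0 p q" "\<exists>x. kills x 0 1 p q"
proof -
  obtain x y1 y2 x' y1' y2' where k: "kills x y1 y2 p q" "kills x' y1' y2' p q"
    and ind: "\<And>c d. sc c x + sc d x' = 0 \<Longrightarrow> c * y1 + d * y1' = 0 \<Longrightarrow> c * y2 + d * y2' = 0 \<Longrightarrow> c = 0 \<and> d = 0"
    using assms(2) unfolding bad_def by blast
  have y0: "c = 0 \<and> d = 0" if y: "c * y1 + d * y1' = 0" "c * y2 + d * y2' = 0" for c d
  proof -
    have "kills (sc c x + sc d x') 0 0 p q" using kills_combine_left[OF k, of c d] y by simp
    then have "sm (sc c x + sc d x') q = 0" "sm (sc c x + sc d x') p = 0"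
      by (cases p; cases q; simp add: kills_def v3_simps)+
    then have "sc c x + sc d x' = 0" using inj by blast
    with ind y show ?thesis by blast
  qed
  define D where "D = y1 * y2' - y2 * y1'"
  have D: "D \<noteq> 0"
  proof
    assume "D = 0"
    then have "y1' = 0 \<and> - y1 = 0" "y2' = 0 \<and> - y2 = 0"
      by (intro y0; simp add: D_def algebra_simps)+
    then show False using y0[of 1 0] by simp
  qed
  have "kills (sc (y2' / D) x + sc (- y2 / D) x') (y2' / D * y1 + (- y2 / D) * y1')
      (y2' / D * y2 + (- y2 / D) * y2') p q" by (rule kills_combine_left[OF k])
  moreover have "y2' / D * y1 + (- y2 / D) * y1' = 1" "y2' / D * y2 + (- y2 / D) * y2' = 0"
    using D by (simp_all add: field_simps) (simp add: D_def algebra_simps)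
  ultimately show "\<exists>x. kills x 1 0 p q" by metis
  have "kills (sc (- y1' / D) x + sc (y1 / D) x') (- y1' / D * y1 + y1 / D * y1')
      (- y1' / D * y2 + y1 / D * y2') p q" by (rule kills_combine_left[OF k])
  moreover have "- y1' / D * y1 + y1 / D * y1' = 0" "- y1' / D * y2 + y1 / D * y2' = 1"
    using D by (simp_all add: field_simps) (simp add: D_def algebra_simps)
  ultimately show "\<exists>x. kills x 0 1 p q" by metis
qed

section \<open>Pencils of vectors that are each annihilated by two forms\<close>

definition poly1 :: "('k::field \<Rightarrow> 'k) \<Rightarrow> bool" where
  "poly1 f \<longleftrightarrow> (\<exists>P. \<forall>t. f t = poly P t)"

lemma poly1_intros:
  "poly1 (\<lambda>t. c)" "poly1 (\<lambda>t. t)"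
  "poly1 f \<Longrightarrow> poly1 g \<Longrightarrow> poly1 (\<lambda>t. f t + g t)"
  "poly1 f \<Longrightarrow> poly1 g \<Longrightarrow> poly1 (\<lambda>t. f t - g t)"
  "poly1 f \<Longrightarrow> poly1 g \<Longrightarrow> poly1 (\<lambda>t. f t * g t)"
  "poly1 f \<Longrightarrow> poly1 (\<lambda>t. - f t)"
  "poly1 f \<Longrightarrow> poly1 (\<lambda>t. f t ^ n)"
proof -
  show "poly1 (\<lambda>t. c)" unfolding poly1_def by (intro exI[of _ "[:c:]"]) simp
  show "poly1 (\<lambda>t. t)" unfolding poly1_def by (intro exI[of _ "[:0, 1:]"]) simp
  show "poly1 f \<Longrightarrow> poly1 g \<Longrightarrow> poly1 (\<lambda>t. f t + g t)" unfolding poly1_def by (metis poly_add)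
  show "poly1 f \<Longrightarrow> poly1 g \<Longrightarrow> poly1 (\<lambda>t. f t - g t)" unfolding poly1_def by (metis poly_diff)
  show "poly1 f \<Longrightarrow> poly1 g \<Longrightarrow> poly1 (\<lambda>t. f t * g t)" unfolding poly1_def by (metis poly_mult)
  show "poly1 f \<Longrightarrow> poly1 (\<lambda>t. - f t)" unfolding poly1_def by (metis poly_minus)
  show "poly1 f \<Longrightarrow> poly1 (\<lambda>t. f t ^ n)" unfolding poly1_def by (metis poly_power)
qed

lemma poly_eq_if_eq_off_point:
  fixes A B :: "'k::field_char_0 poly"
  assumes "\<And>t. t \<noteq> t0 \<Longrightarrow> poly A t = poly B t" shows "A = B"
proof (rule ccontr)
  assume "A \<noteq> B"
  then have "finite {t. poly (A - B) t = 0}" by (intro poly_roots_finite) simp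
  then have "finite (insert t0 {t. poly (A - B) t = 0})" by simp
  moreover have "insert t0 {t. poly (A - B) t = 0} = UNIV" using assms by auto
  ultimately show False using infinite_UNIV_char_0 by metis
qed

text \<open>A denominator of minimal degree has no root.\<close>

lemma poly1_if_locally_rational:
  fixes X :: "'k::{alg_closed_field, field_char_0} \<Rightarrow> 'k"
  assumes loc: "\<And>t0. \<exists>\<Delta> g. poly \<Delta> t0 \<noteq> 0 \<and> (\<forall>t. X t * poly \<Delta> t = poly g t)"
  shows "poly1 X"
proof -
  define D where "D \<Delta> \<longleftrightarrow> \<Delta> \<noteq> 0 \<and> (\<exists>g. \<forall>t. X t * poly \<Delta> t = poly g t)" for \<Delta>
  have "\<exists>\<Delta>. D \<Delta>" using loc[of 0] unfolding D_def by (metis poly_0)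
  then obtain \<Delta> where \<Delta>: "D \<Delta>" "\<And>\<Delta>'. D \<Delta>' \<Longrightarrow> degree \<Delta> \<le> degree \<Delta>'"
    by (metis arg_min_natI arg_min_nat_le)
  obtain g where g: "\<And>t. X t * poly \<Delta> t = poly g t" using \<Delta>(1) by (auto simp: D_def)
  show ?thesis
  proof (cases "degree \<Delta> = 0")
    case True
    then obtain c where c: "\<Delta> = [:c:]" by (metis degree_eq_zeroE)
    then have "c \<noteq> 0" using \<Delta>(1) by (simp add: D_def)
    then have "X t = poly (smult (1 / c) g) t" for t using g[of t] c by (simp add: field_simps)
    then show ?thesis unfolding poly1_def by blast
  next
    case False
    then obtain t0 where t0: "poly \<Delta> t0 = 0" using alg_closed_imp_poly_has_root by auto
    then have "poly g t0 = 0" using g[of t0] by simp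
    with t0 obtain \<Delta>' g' where f: "\<Delta> = [:- t0, 1:] * \<Delta>'" "g = [:- t0, 1:] * g'"
      by (metis poly_eq_0_iff_dvd dvdE)
    have \<Delta>'0: "\<Delta>' \<noteq> 0" using \<Delta>(1) f by (auto simp: D_def)
    have off: "X t * poly \<Delta>' t = poly g' t" if "t \<noteq> t0" for t
    proof -
      have "(t - t0) * (X t * poly \<Delta>' t) = (t - t0) * poly g' t"
        using g[of t] f by (simp add: algebra_simps)
      then show ?thesis using that by simp
    qed
    obtain \<Delta>1 g1 where 1: "poly \<Delta>1 t0 \<noteq> 0" "\<And>t. X t * poly \<Delta>1 t = poly g1 t" using loc by blast
    have "\<Delta>' * g1 = g' * \<Delta>1"
    proof (rule poly_eq_if_eq_off_point)
      show "poly (\<Delta>' * g1) t = poly (g' * \<Delta>1) t" if "t \<noteq> t0" for t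
        using off[OF that] 1(2)[of t] by (metis mult.assoc mult.commute poly_mult)
    qed
    then have "poly \<Delta>' t0 * (X t0 * poly \<Delta>1 t0) = poly g' t0 * poly \<Delta>1 t0"
      using 1(2)[of t0] by (metis poly_mult)
    then have "X t0 * poly \<Delta>' t0 = poly g' t0" using 1(1) by (simp add: mult_ac)
    then have "D \<Delta>'" unfolding D_def using off \<Delta>'0 by metis
    then have "degree \<Delta> \<le> degree \<Delta>'" by (rule \<Delta>(2))
    moreover have "degree \<Delta> = Suc (degree \<Delta>')" unfolding f(1) using \<Delta>'0 by (subst degree_mult_eq) auto
    ultimately show ?thesis by simp
  qed
qed

lemma sm_cramer:
  fixes z0 z1 z2 :: "'k::field"
  defines "R0 \<equiv> (z1, z0 + z1 + z2, z1 - z2)" and "R1 \<equiv> (z0 + z1 + z2, z0, z0 - z2)"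
    and "R2 \<equiv> (z1 - z2, z0 - z2, - (z0 + z1))"
  assumes "sm (z0, z1, z2) (x0, x1, x2) = (b0, b1, b2)"
  shows "(x0 * plane_cubic (z0, z1, z2), x1 * plane_cubic (z0, z1, z2), x2 * plane_cubic (z0, z1, z2))
    = sc b0 (cr R1 R2) + sc b1 (cr R2 R0) + sc b2 (cr R0 R1)"
proof -
  have b: "b0 = z1 * x0 + (z0 + z1 + z2) * x1 + (z1 - z2) * x2"
    "b1 = (z0 + z1 + z2) * x0 + z0 * x1 + (z0 - z2) * x2"
    "b2 = (z1 - z2) * x0 + (z0 - z2) * x1 - (z0 + z1) * x2"
    using assms(4) by simp_all
  show ?thesis unfolding b R0_def R1_def R2_def
    by (simp add: v3_simps algebra_simps power2_eq_square power3_eq_cube)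
qed

lemma dt_eqI: "(\<And>e. dt e a = dt e b) \<Longrightarrow> a = (b :: 'k::field v3)"
proof -
  assume e: "\<And>e. dt e a = dt e b"
  show ?thesis using e[of "(1, 0, 0)"] e[of "(0, 1, 0)"] e[of "(0, 0, 1)"]
    by (cases a; cases b) simp
qed

text \<open>The pencil \<open>(p2 + t p1, q2 + t q1)\<close> contains no point with \<open>p \<parallel> q\<close>; then the solution \<open>x\<close> is
  a polynomial in \<open>t\<close>, and its two highest coefficients show that it is linear.\<close>

lemma pencil_solution_linear:
  fixes p1 p2 q1 q2 a b :: "'k::{alg_closed_field, field_char_0} v3"
  assumes npar: "\<And>t. cr (p2 + sc t p1) (q2 + sc t q1) \<noteq> 0"
    and sol: "\<And>t. \<exists>x. sm x (q2 + sc t q1) = - cr a (p2 + sc t p1) \<and> sm x (p2 + sc t p1) = cr b (q2 + sc t q1)"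
    and iso: "sm p1 q2 = sm q1 p2" and nz: "p1 \<noteq> 0 \<or> q1 \<noteq> 0"
  shows "\<exists>n m. sm n p1 = 0 \<and> sm n q1 = 0 \<and>
    (\<forall>t. sm (m + sc t n) (q2 + sc t q1) = - cr a (p2 + sc t p1) \<and> sm (m + sc t n) (p2 + sc t p1) = cr b (q2 + sc t q1))"
proof -
  obtain X where X: "\<And>t. sm (X t) (q2 + sc t q1) = - cr a (p2 + sc t p1)"
    "\<And>t. sm (X t) (p2 + sc t p1) = cr b (q2 + sc t q1)"
    using sol by metis
  have rat: "\<exists>\<Delta> g0 g1 g2. poly \<Delta> t0 \<noteq> 0 \<and> (\<forall>t. fst (X t) * poly \<Delta> t = poly g0 t \<and>
      fst (snd (X t)) * poly \<Delta> t = poly g1 t \<and> snd (snd (X t)) * poly \<Delta> t = poly g2 t)" for t0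
  proof -
    \<comment> \<open>A combination of the two equations has an invertible matrix at
      \<open>t0\<close>; Cramer's rule then gives a denominator that does not vanish there.\<close>
    obtain c d where cd: "plane_cubic (sc c (p2 + sc t0 p1) + sc d (q2 + sc t0 q1)) \<noteq> 0"
      using plane_cubic_nonzero_on_plane[OF npar] by blast
    define z where "z t = sc c (p2 + sc t p1) + sc d (q2 + sc t q1)" for t
    define r where "r t = sc c (cr b (q2 + sc t q1)) + sc d (- cr a (p2 + sc t p1))" for t
    have zX: "sm (z t) (X t) = r t" for t
      by (simp only: sm_commute[of _ "X t"] z_def r_def sm_linear(1,3) X[symmetric])
    define z0 z1 z2 where zi: "z0 = (\<lambda>t. fst (z t))" "z1 = (\<lambda>t. fst (snd (z t)))" "z2 = (\<lambda>t. snd (snd (z t)))"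
    define r0 r1 r2 where ri: "r0 = (\<lambda>t. fst (r t))" "r1 = (\<lambda>t. fst (snd (r t)))" "r2 = (\<lambda>t. snd (snd (r t)))"
    have pz: "poly1 z0" "poly1 z1" "poly1 z2" unfolding zi z_def
      by (cases p1; cases p2; cases q1; cases q2; simp add: v3_simps; intro poly1_intros)+
    have pr: "poly1 r0" "poly1 r1" "poly1 r2" unfolding ri r_def
      by (cases p1; cases p2; cases q1; cases q2; cases a; cases b; simp add: v3_simps; intro poly1_intros)+
    define \<Delta> where "\<Delta> t = plane_cubic (z0 t, z1 t, z2 t)" for t
    have p\<Delta>: "poly1 \<Delta>" unfolding \<Delta>_def plane_cubic.simps by (intro poly1_intros pz)
    define g where "g t = sc (r0 t) (cr (z0 t + z1 t + z2 t, z0 t, z0 t - z2 t) (z1 t - z2 t, z0 t - z2 t, - (z0 t + z1 t)))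
      + sc (r1 t) (cr (z1 t - z2 t, z0 t - z2 t, - (z0 t + z1 t)) (z1 t, z0 t + z1 t + z2 t, z1 t - z2 t))
      + sc (r2 t) (cr (z1 t, z0 t + z1 t + z2 t, z1 t - z2 t) (z0 t + z1 t + z2 t, z0 t, z0 t - z2 t))" for t
    have pg: "poly1 (\<lambda>t. fst (g t))" "poly1 (\<lambda>t. fst (snd (g t)))" "poly1 (\<lambda>t. snd (snd (g t)))"
      unfolding g_def by (simp_all add: v3_simps, (intro poly1_intros pz pr)+)
    have eq: "(fst (X t) * \<Delta> t, fst (snd (X t)) * \<Delta> t, snd (snd (X t)) * \<Delta> t) = g t" for t
      unfolding \<Delta>_def g_def
      by (rule sm_cramer) (use zX[of t] in \<open>simp add: zi ri\<close>)
    have eqs: "fst (X t) * \<Delta> t = fst (g t)" "fst (snd (X t)) * \<Delta> t = fst (snd (g t))"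
      "snd (snd (X t)) * \<Delta> t = snd (snd (g t))" for t
      unfolding eq[symmetric] by simp_all
    obtain \<Delta>p where \<Delta>p: "\<And>t. \<Delta> t = poly \<Delta>p t" using p\<Delta> by (auto simp: poly1_def)
    obtain g0 g1 g2 where gp: "\<And>t. fst (g t) = poly g0 t" "\<And>t. fst (snd (g t)) = poly g1 t"
      "\<And>t. snd (snd (g t)) = poly g2 t"
      using pg unfolding poly1_def by blast
    have "\<Delta> t0 \<noteq> 0"
      using cd unfolding \<Delta>_def zi prod.collapse z_def .
    then show ?thesis using eqs unfolding \<Delta>p gp by blast
  qed
  have "poly1 (\<lambda>t. fst (X t))" "poly1 (\<lambda>t. fst (snd (X t)))" "poly1 (\<lambda>t. snd (snd (X t)))"
    by (rule poly1_if_locally_rational, use rat in meson)+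
  then obtain P0 P1 P2 where P: "\<And>t. X t = (poly P0 t, poly P1 t, poly P2 t)"
    unfolding poly1_def by (metis prod.collapse)
  define n where "n k = (coeff P0 k, coeff P1 k, coeff P2 k)" for k
  \<comment> \<open>Comparison of the coefficients of powers of \<open>t\<close>, where
    \<open>n k\<close> is the vector coefficient of \<open>t^k\<close> in the solution. Pairing with
    test vectors \<open>e\<close> reduces it to scalar polynomials.\<close>
  have coeffs: "sm (n 0) v2 = r2 \<and> (\<forall>k. sm (n (Suc k)) v2 + sm (n k) v1 = (if k = 0 then r1 else 0))"
    if id: "\<And>t. sm (X t) (v2 + sc t v1) = r2 + sc t r1" for v1 v2 r1 r2
  proof -
    have de: "dt e (sm (n 0) v2) = dt e r2 \<and>
      (\<forall>k. dt e (sm (n (Suc k)) v2 + sm (n k) v1) = dt e (if k = 0 then r1 else 0))" for e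
    proof -
      define L where "L v = (case v of (c0, c1, c2) \<Rightarrow> smult c0 P0 + smult c1 P1 + smult c2 P2)" for v
      have Lc: "coeff (L v) k = dt v (n k)" for v k by (cases v) (simp add: L_def n_def)
      have Lp: "poly (L v) t = dt v (X t)" for v t by (cases v) (simp add: L_def P)
      have e: "dt e (sm x v) = dt (sm e v) x" for x v
        by (cases e; cases x; cases v) (simp add: algebra_simps)
      have "L (sm e v2) + pCons 0 (L (sm e v1)) = [:dt e r2, dt e r1:]"
      proof (rule poly_ext)
        fix t
        have "poly (L (sm e v2) + pCons 0 (L (sm e v1))) t = dt e (sm (X t) (v2 + sc t v1))"
          by (simp add: Lp e[symmetric] sm_linear dt_linear)
        then show "poly (L (sm e v2) + pCons 0 (L (sm e v1))) t = poly [:dt e r2, dt e r1:] t"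
          by (simp add: id dt_linear)
      qed
      then have c: "coeff (L (sm e v2) + pCons 0 (L (sm e v1))) k = coeff [:dt e r2, dt e r1:] k" for k by simp
      show ?thesis
      proof (intro conjI allI)
        show "dt e (sm (n 0) v2) = dt e r2" using c[of 0] by (simp add: Lc e)
        show "dt e (sm (n (Suc k)) v2 + sm (n k) v1) = dt e (if k = 0 then r1 else 0)" for k
          using c[of "Suc k"] by (cases k) (simp_all add: Lc e dt_linear)
      qed
    qed
    show ?thesis
    proof (intro conjI allI)
      show "sm (n 0) v2 = r2" by (rule dt_eqI) (use de in blast)
      show "sm (n (Suc k)) v2 + sm (n k) v1 = (if k = 0 then r1 else 0)" for k
        by (rule dt_eqI) (use de in blast)
    qed
  qed
  have minus_linear: "- cr a (p2 + sc t p1) = - cr a p2 + sc t (- cr a p1)" for t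
    by (cases a; cases p1; cases p2) (simp add: v3_simps algebra_simps)
  have Cq: "sm (n 0) q2 = - cr a p2" "\<And>k. sm (n (Suc k)) q2 + sm (n k) q1 = (if k = 0 then - cr a p1 else 0)"
    using coeffs[of q2 q1 "- cr a p2" "- cr a p1"] X(1) by (simp_all add: minus_linear)
  have Cp: "sm (n 0) p2 = cr b q2" "\<And>k. sm (n (Suc k)) p2 + sm (n k) p1 = (if k = 0 then cr b q1 else 0)"
    using coeffs[of p2 p1 "cr b q2" "cr b q1"] X(2) by (simp_all add: cr_linear)
  \<comment> \<open>A top coefficient of degree at least 2 annihilates \<open>p1\<close> and
    \<open>q1\<close>, which are therefore multiples of one \<open>p\<close>. The next coefficient
    shows that \<open>r\<close> lies in the same kernel, so \<open>r\<close> is a multiple of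
    \<open>p\<close>; isotropy and \<open>sm p p \<noteq> 0\<close> force \<open>r = 0\<close>. Then
    \<open>p2\<close> and \<open>q2\<close> are parallel, against \<open>npar\<close> at
    \<open>t = 0\<close>.\<close>
  have top: False if d: "2 \<le> d" "n d \<noteq> 0" "n (Suc d) = 0" for d
  proof -
    have e1: "sm (n d) q1 = 0" "sm (n d) p1 = 0"
      using Cq(2)[of d] Cp(2)[of d] d by (simp_all add: sm_linear)
    obtain d' where d': "d = Suc d'" "d' \<noteq> 0" using d(1) by (cases d) auto
    have e2: "sm (n d) q2 = - sm (n d') q1" "sm (n d) p2 = - sm (n d') p1"
      using Cq(2)[of d'] Cp(2)[of d'] d' by (simp_all add: eq_neg_iff_add_eq_0)
    have par: "cr p1 q1 = 0"
      using sm_kernel_le_1[of p1 q1 "n d"] e1 d(2) by blast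
    obtain p w0 w1 where w: "p \<noteq> 0" "p1 = sc w0 p" "q1 = sc w1 p" "w0 \<noteq> 0 \<or> w1 \<noteq> 0"
    proof (cases "p1 = 0")
      case True
      then show ?thesis using nz by (intro that[of q1 0 1]) (simp_all add: sc_simps)
    next
      case False
      moreover have "cr q1 p1 = 0" using par cr_swap[of q1 p1] by simp
      ultimately obtain c where "q1 = sc c p1" using parallelE by blast
      then show ?thesis using False by (intro that[of p1 1 c]) (simp_all add: sc_simps)
    qed
    define r where "r = sc w0 q2 - sc w1 p2"
    have np: "sm (n d) p = 0" using e1 w by (auto simp: sm_linear sc_eq_0_iff)
    have "sm (n d) r = 0" unfolding r_def
      by (simp add: sm_linear e2 w(2,3)) (cases "sm (n d') p"; simp add: v3_simps algebra_simps)
    then have "cr r p = 0" using sm_kernel_le_1[of r p "n d"] np d(2) by blast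
    then obtain \<kappa> where \<kappa>: "r = sc \<kappa> p" using parallelE w(1) by blast
    have "sm p r = sm p1 q2 - sm q1 p2" by (simp add: r_def w(2,3) sm_linear)
    then have "sc \<kappa> (sm p p) = 0" using iso \<kappa> by (simp add: sm_linear)
    then have "\<kappa> = 0" using sm_self_eq_0D[of p] w(1) by (auto simp: sc_eq_0_iff)
    then have r0: "sc w0 q2 = sc w1 p2" using \<kappa> by (simp add: r_def sc_simps)
    have "sc w0 (cr p2 q2) = 0" "sc w1 (cr p2 q2) = 0"
      using arg_cong[OF r0, of "cr p2"] arg_cong[OF r0, of "\<lambda>v. cr v q2"] by (simp_all add: cr_linear sc_simps)
    then have "cr p2 q2 = 0" using w(4) by (auto simp: sc_eq_0_iff)
    then show False using npar[of 0] by (simp add: sc_simps)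
  qed
  have big: "n k = 0" if "k > max (degree P0) (max (degree P1) (degree P2))" for k
    using that by (simp add: n_def v3_zero coeff_eq_0)
  have n2: "n k = 0" if k: "2 \<le> k" for k
  proof (rule ccontr)
    assume nk: "n k \<noteq> 0"
    let ?S = "{j. n j \<noteq> 0}"
    have fin: "finite ?S"
      by (rule finite_subset[of _ "{..max (degree P0) (max (degree P1) (degree P2))}"])
        (use big in \<open>auto simp: not_le[symmetric]\<close>)
    have mem: "Max ?S \<in> ?S" using fin nk by (intro Max_in) auto
    moreover have "2 \<le> Max ?S" using Max_ge[OF fin, of k] nk k by simp
    moreover have "n (Suc (Max ?S)) = 0"
    proof (rule ccontr)
      assume "n (Suc (Max ?S)) \<noteq> 0"
      then have "Suc (Max ?S) \<le> Max ?S" using fin by (intro Max_ge) auto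
      then show False by simp
    qed
    ultimately show False using top by blast
  qed
  have lin: "X t = n 0 + sc t (n 1)" for t
  proof -
    have "poly Q t = coeff Q 0 + t * coeff Q 1" if "\<And>k. 2 \<le> k \<Longrightarrow> coeff Q k = 0" for Q :: "'k poly"
    proof -
      have "Q = [:coeff Q 0, coeff Q 1:]"
        by (rule poly_eqI) (use that in \<open>auto simp: coeff_pCons split: nat.splits\<close>)
      then have "poly Q t = poly [:coeff Q 0, coeff Q 1:] t" by simp
      then show ?thesis by simp
    qed
    then show ?thesis using n2 by (simp add: P n_def v3_simps)
  qed
  have "sm (n 1) q1 = 0" "sm (n 1) p1 = 0"
    using Cq(2)[of 1] Cp(2)[of 1] n2[of 2] by (simp_all add: sm_linear numeral_2_eq_2)
  then show ?thesis using X unfolding lin by blast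
qed

text \<open>For both unit vectors y the annihilating form is linear in \<open>t\<close>. The slopes
  \<open>n\<close> and \<open>n'\<close> both annihilate \<open>p1\<close> and \<open>q1\<close>
  under \<open>sm\<close>, hence are proportional; the combination that cancels the slope is a
  single nonzero form annihilating the whole pencil, which \<open>K\<close> excludes.\<close>

lemma double_pencil_contradiction:
  fixes p1 p2 q1 q2 :: "'k::{alg_closed_field, field_char_0} v3"
  assumes npar: "\<And>t. cr (p2 + sc t p1) (q2 + sc t q1) \<noteq> 0"
    and bad: "\<And>t. bad (p2 + sc t p1) (q2 + sc t q1)"
    and iso: "sm p1 q2 = sm q1 p2" and nz: "p1 \<noteq> 0 \<or> q1 \<noteq> 0"
    and K: "\<And>x y1 y2. kills x y1 y2 p1 q1 \<Longrightarrow> kills x y1 y2 p2 q2 \<Longrightarrow> x = 0 \<and> y1 = 0 \<and> y2 = 0"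
  shows False
proof -
  have const: "x = 0 \<and> y1 = 0 \<and> y2 = 0" if k: "\<And>t. kills x y1 y2 (p2 + sc t p1) (q2 + sc t q1)" for x y1 y2
  proof (rule K)
    show "kills x y1 y2 p2 q2" using k[of 0] by (simp add: sc_simps)
    show "kills x y1 y2 p1 q1"
      using kills_combine_right[OF k[of 1] k[of 0], of 1 "- 1"] by (simp add: sc_simps)
  qed
  have "\<exists>n m. sm n p1 = 0 \<and> sm n q1 = 0 \<and> (\<forall>t. kills (m + sc t n) 1 0 (p2 + sc t p1) (q2 + sc t q1))"
    unfolding kills_def by (rule pencil_solution_linear[OF npar _ iso nz])
      (use bad_imp_kills(1)[OF sm_kernel_le_1[OF npar] bad] in \<open>simp add: kills_def\<close>)
  then obtain n m where n: "sm n p1 = 0" "sm n q1 = 0" "\<And>t. kills (m + sc t n) 1 0 (p2 + sc t p1) (q2 + sc t q1)"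
    by blast
  have "\<exists>n m. sm n p1 = 0 \<and> sm n q1 = 0 \<and> (\<forall>t. kills (m + sc t n) 0 1 (p2 + sc t p1) (q2 + sc t q1))"
    unfolding kills_def by (rule pencil_solution_linear[OF npar _ iso nz])
      (use bad_imp_kills(2)[OF sm_kernel_le_1[OF npar] bad] in \<open>simp add: kills_def\<close>)
  then obtain n' m' where n': "sm n' p1 = 0" "sm n' q1 = 0" "\<And>t. kills (m' + sc t n') 0 1 (p2 + sc t p1) (q2 + sc t q1)"
    by blast
  have n0: "n \<noteq> 0"
  proof
    assume "n = 0"
    then have "kills m 1 0 (p2 + sc t p1) (q2 + sc t q1)" for t using n(3)[of t] by (simp add: sc_simps)
    from const[OF this] show False by simp
  qed
  have "cr n' n = 0"
  proof (rule ccontr)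
    assume "cr n' n \<noteq> 0"
    from sm_kernel_le_1[OF this, of p1] sm_kernel_le_1[OF this, of q1] n n' nz
    show False by (simp add: sm_commute)
  qed
  then obtain \<kappa> where \<kappa>: "n' = sc \<kappa> n" using parallelE[OF n0] by blast
  have "kills (m' - sc \<kappa> m) (- \<kappa>) 1 (p2 + sc t p1) (q2 + sc t q1)" for t
    using kills_combine_left[OF n'(3)[of t] n(3)[of t], of 1 "- \<kappa>"]
    by (simp add: \<kappa> sc_simps mult.commute)
  from const[OF this] show False by simp
qed

section \<open>Planes that contain pure tensors\<close>

lemma sc_uminus: "sc c (- p) = - sc c p"
  by (cases p) (simp add: v3_simps)

text \<open>The plane is \<open>w\<close> tensored with the span of \<open>p\<close> and
  \<open>p'\<close>. For \<open>z\<close> in the span with \<open>plane_cubic z \<noteq> 0\<close>,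
  a form with y = (1, 0) forces \<open>w0^2 = w1^2\<close> or \<open>z\<close> parallel to the first
  unit vector, and one with y = (0, 1) forces \<open>w0^2 = - w1^2\<close> or \<open>z\<close>
  parallel to the second. The two conditions on \<open>w\<close> exclude each other, and the
  admissible \<open>z\<close> are not all parallel.\<close>

lemma two_parallel_contradiction_same:
  fixes p p' :: "'k::{alg_closed_field, field_char_0} v3"
  assumes pp': "cr p p' \<noteq> 0" and w: "w0 \<noteq> 0 \<or> w1 \<noteq> 0"
    and bad: "\<And>s t. s \<noteq> 0 \<or> t \<noteq> 0 \<Longrightarrow> bad (sc w0 (sc s p + sc t p')) (sc w1 (sc s p + sc t p'))"
  shows False
proof -
  have par: "(w0\<^sup>2 = w1\<^sup>2 \<or> cr (1, 0, 0) z = 0) \<and> (w0\<^sup>2 = - (w1\<^sup>2) \<or> cr (0, 1, 0) z = 0)"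
    if z: "z = sc s p + sc t p'" "plane_cubic z \<noteq> 0" for z s t
  proof -
    have st: "s \<noteq> 0 \<or> t \<noteq> 0" using z by (auto simp: sc_simps v3_simps)
    have inj: "x = 0" if "sm x (sc w0 z) = 0" "sm x (sc w1 z) = 0" for x
    proof -
      have "sm z x = 0" using that w by (auto simp: sm_linear sc_eq_0_iff sm_commute)
      then show ?thesis using z(2)
        by (cases z; cases x) (use sm_cramer in \<open>fastforce simp: v3_simps\<close>)
    qed
    have b: "bad (sc w0 z) (sc w1 z)" using bad[OF st] z(1) by simp
    obtain x where x: "kills x 1 0 (sc w0 z) (sc w1 z)" using bad_imp_kills(1)[OF inj b] by blast
    obtain y where y: "kills y 0 1 (sc w0 z) (sc w1 z)" using bad_imp_kills(2)[OF inj b] by blast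
    have neg: "- v = sc (- 1) v" for v :: "'k v3" by (cases v) (simp add: v3_simps)
    have cneg: "cr (- 1, 0, 0) v = sc (- 1) (cr (1, 0, 0) v)" for v :: "'k v3"
      by (cases v) simp
    have x': "sc w1 (sm x z) = sc (- w0) (cr (1, 0, 0) z)" "sc w0 (sm x z) = sc (- w1) (cr (1, 0, 0) z)"
      using x unfolding kills_def neg cneg by (simp_all add: sm_linear cr_linear sc_simps)
    have y': "sc w1 (sm y z) = sc (- w0) (cr (0, 1, 0) z)" "sc w0 (sm y z) = sc w1 (cr (0, 1, 0) z)"
      using y unfolding kills_def neg by (simp_all add: sm_linear cr_linear sc_simps)
    have "sc (w0 * - w0) (cr (1, 0, 0) z) = sc (w1 * - w1) (cr (1, 0, 0) z)"
      using arg_cong[OF x'(1), of "sc w0"] arg_cong[OF x'(2), of "sc w1"]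
      by (simp add: sc_simps sc_uminus mult.commute)
    then have "sc (w0\<^sup>2 - w1\<^sup>2) (cr (1, 0, 0) z) = 0"
      by (simp add: sc_simps power2_eq_square)
    moreover have "sc (w0 * - w0) (cr (0, 1, 0) z) = sc (w1 * w1) (cr (0, 1, 0) z)"
      using arg_cong[OF y'(1), of "sc w0"] arg_cong[OF y'(2), of "sc w1"]
      by (simp add: sc_simps sc_uminus mult.commute)
    then have "sc (w0\<^sup>2 + w1\<^sup>2) (cr (0, 1, 0) z) = 0"
      by (cases "cr (0, 1, 0) z") (simp add: v3_simps power2_eq_square algebra_simps neg_eq_iff_add_eq_0)
    ultimately show ?thesis by (auto simp: sc_eq_0_iff eq_neg_iff_add_eq_0)
  qed
  obtain s t where "plane_cubic (sc s p + sc t p') \<noteq> 0" using plane_cubic_nonzero_on_plane[OF pp'] by blast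
  define z where "z = sc s p + sc t p'"
  have z: "plane_cubic z \<noteq> 0" by (simp add: z_def) fact
  then have z0: "z \<noteq> 0" by (auto simp: v3_simps)
  have "\<exists>e. e \<noteq> 0 \<and> (\<forall>s t. plane_cubic (sc s p + sc t p') \<noteq> 0 \<longrightarrow> cr e (sc s p + sc t p') = 0)"
  proof (cases "w0\<^sup>2 = w1\<^sup>2")
    case True
    have "w0\<^sup>2 \<noteq> - (w1\<^sup>2)"
    proof
      assume "w0\<^sup>2 = - (w1\<^sup>2)"
      then have "2 * w1\<^sup>2 = 0" using True by (simp add: eq_neg_iff_add_eq_0)
      then have "w1 = 0" "w0 = 0" using True by simp_all
      with w show False by simp
    qed
    then show ?thesis using par by (intro exI[of _ "(0, 1, 0)"]) (auto simp: v3_zero)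
  next
    case False
    then show ?thesis using par by (intro exI[of _ "(1, 0, 0)"]) (auto simp: v3_zero)
  qed
  then obtain e where e: "e \<noteq> 0" "\<And>s t. plane_cubic (sc s p + sc t p') \<noteq> 0 \<Longrightarrow> cr e (sc s p + sc t p') = 0" by blast
  \<comment> \<open>From a direction \<open>d\<close> not parallel to \<open>z\<close>, a general
    \<open>z + k d\<close> gives a second vector off the plane cubic that is not parallel to
    \<open>z\<close>.\<close>
  have "\<exists>a b. cr (sc a p + sc b p') z \<noteq> 0"
  proof (cases "t = 0")
    case True
    then have "s \<noteq> 0" using z0 by (auto simp: z_def sc_simps)
    then have "cr (sc 0 p + sc 1 p') z \<noteq> 0"
      using pp' cr_swap[of p' p] True by (auto simp: z_def sc_simps cr_linear sc_eq_0_iff)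
    then show ?thesis by blast
  next
    case False
    then have "cr (sc 1 p + sc 0 p') z \<noteq> 0"
      using pp' by (auto simp: z_def sc_simps cr_linear sc_eq_0_iff)
    then show ?thesis by blast
  qed
  then obtain a b where ab: "cr (sc a p + sc b p') z \<noteq> 0" by blast
  define d where "d = sc a p + sc b p'"
  have "poly1 (\<lambda>k. plane_cubic (z + sc k d))"
    by (cases z; cases d) (simp add: v3_simps, intro poly1_intros)
  then obtain g where g: "\<And>k. plane_cubic (z + sc k d) = poly g k" by (auto simp: poly1_def)
  have "poly g 0 \<noteq> 0" using g[of 0] z by (simp add: sc_simps)
  then have "g \<noteq> 0" by auto
  then have "finite (insert 0 {k. poly g k = 0})" using poly_roots_finite by blast
  then obtain k where l: "k \<noteq> 0" "poly g k \<noteq> 0"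
    using ex_new_if_finite[OF infinite_UNIV_char_0, of "insert 0 {k. poly g k = 0}"] by auto
  have "z + sc k d = sc (s + k * a) p + sc (t + k * b) p'"
    by (simp add: z_def d_def sc_simps algebra_simps)
  then have 1: "cr e (z + sc k d) = 0" using e(2)[of "s + k * a" "t + k * b"] l(2) g[of k] by simp
  have 2: "cr e z = 0" using e(2)[of s t] z by (simp add: z_def)
  have "cr e d = 0" using 1 2 l(1) by (simp add: cr_linear sc_eq_0_iff)
  then have "cr d z = 0" using 2 parallel_trans[OF e(1), of d z] cr_swap[of d e] cr_swap[of z e] by simp
  then show False using ab by (simp add: d_def)
qed

lemma sm_unit_eq_0D: "e \<in> {(1, 0, 0), (0, 1, 0)} \<Longrightarrow> sm e p = 0 \<Longrightarrow> p = (0 :: 'k::field v3)"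
  by (cases p) (auto simp: v3_simps)

text \<open>The kernel of \<open>sm p'\<close> has dimension at most one by
  \<open>sm_kernel_le_1\<close>, and \<open>p\<close> lies in it.\<close>

lemma sm_kernel_parallel:
  fixes p :: "'k::field_char_0 v3"
  assumes "p \<noteq> 0" "p' \<noteq> 0" "sm p p' = 0" "sm x p' = 0" obtains c where "x = sc c p"
proof -
  have "cr x p = 0"
    using sm_kernel_le_1[of x p p'] assms by (auto simp: sm_commute[of p'])
  then show ?thesis using parallelE assms(1) that by blast
qed

text \<open>Comparing the solutions at two points of the pencil spanned by \<open>w \<otimes> p\<close> and \<open>w' \<otimes> p'\<close> shows
  that the solution lies in the span of \<open>p\<close> and \<open>p'\<close>.\<close>

lemma conjugate_solution_in_span:
  fixes p p' :: "'k::field_char_0 v3"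
  assumes p: "p \<noteq> 0" "p' \<noteq> 0" "sm p p' = 0"
    and 1: "sc j (sm x p') = sc (- \<mu>) (cr e p)" "sc j (sm x p) = sc \<mu>' (cr e p')"
    and 2: "sc (2 * j) (sm y p') = sc (- \<mu>) (cr e p)" "sc j (sm y p) = sc (2 * \<mu>') (cr e p')"
    and j: "j \<noteq> 0"
  shows "\<exists>\<alpha> \<beta>. sc (j * \<beta>) (sm p' p') = sc (- \<mu>) (cr e p) \<and> sc (j * \<alpha>) (sm p p) = sc \<mu>' (cr e p')"
proof -
  \<comment> \<open>Hypotheses 1 and 2 are the equations at the parameters 1 and 2 of the pencil.
    \<open>2 y - x\<close> annihilates \<open>p'\<close> and \<open>y - 2 x\<close> annihilates
    \<open>p\<close>, so these are multiples of \<open>p\<close> and of \<open>p'\<close>, and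
    together they give \<open>3 x\<close>.\<close>
  have "sc j (sm (sc 2 y - x) p') = 0" using 1(1) 2(1) by (simp add: sm_linear sc_simps mult.commute)
  then have "sm (sc 2 y - x) p' = 0" using j by (simp add: sc_eq_0_iff)
  then obtain c where c: "sc 2 y - x = sc c p" using sm_kernel_parallel[OF p] by blast
  have "sc j (sm (y - sc 2 x) p) = sc j (sm y p) - sc 2 (sc j (sm x p))"
    by (simp add: sm_linear sc_simps mult.commute)
  also have "\<dots> = 0" unfolding 1(2) 2(2) by (simp add: sc_simps)
  finally have "sm (y - sc 2 x) p = 0" using j by (simp add: sc_eq_0_iff)
  then obtain d where d: "y - sc 2 x = sc d p'"
    using sm_kernel_parallel[OF p(2,1), of "y - sc 2 x"] p(3) sm_commute[of p p'] by metis
  have "sc 3 x = (sc 2 y - x) - sc 2 (y - sc 2 x)" by (cases x; cases y) (simp add: v3_simps)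
  then have "sc 3 x = sc c p - sc (2 * d) p'" unfolding c d by (simp add: sc_simps)
  then have "sc (1 / 3) (sc 3 x) = sc (1 / 3) (sc c p - sc (2 * d) p')" by simp
  then have x: "x = sc (c / 3) p + sc (- 2 * d / 3) p'"
    by (cases p; cases p') (simp add: sc_simps v3_simps)
  have "sm x p' = sc (- 2 * d / 3) (sm p' p')" "sm x p = sc (c / 3) (sm p p)"
    unfolding x using p(3) sm_commute[of p' p] by (simp_all add: sm_linear sc_simps)
  then show ?thesis using 1
    by - (rule exI[of _ "c / 3"], rule exI[of _ "- 2 * d / 3"], simp add: sc_simps sc_uminus)
qed

text \<open>The plane is spanned by \<open>w \<otimes> p\<close> and \<open>w' \<otimes> p'\<close>
  with independent \<open>w\<close>, \<open>w'\<close>. Isotropy gives \<open>sm p p' = 0\<close>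
  and, for each of the two y-directions, either orthogonality of \<open>w\<close> and
  \<open>w'\<close> for one of the forms \<open>w0^2 - w1^2\<close>, \<open>w0^2 + w1^2\<close> or
  the vanishing of one coordinate of \<open>cr p p'\<close>. The four combinations are refuted
  separately.\<close>

lemma two_parallel_contradiction_distinct:
  fixes p p' :: "'k::{alg_closed_field, field_char_0} v3"
  assumes p: "p \<noteq> 0" "p' \<noteq> 0" and j: "w0 * w1' - w1 * w0' \<noteq> 0"
    and iso: "sm (sc w0 p) (sc w1' p') = sm (sc w1 p) (sc w0' p')"
    and iso1: "fst (cr (sc w0 p) (sc w0' p')) = fst (cr (sc w1 p) (sc w1' p'))"
    and iso2: "fst (snd (cr (sc w0 p) (sc w0' p'))) = - fst (snd (cr (sc w1 p) (sc w1' p')))"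
    and bad: "\<And>t. bad (sc w0 p + sc t (sc w0' p')) (sc w1 p + sc t (sc w1' p'))"
  shows False
proof -
  define j where "j = w0 * w1' - w1 * w0'"
  have j0: "j \<noteq> 0" using assms(3) by (simp add: j_def)
  have "sc j (sm p p') = sm (sc w0 p) (sc w1' p') - sm (sc w1 p) (sc w0' p')"
    by (simp add: j_def sm_linear sc_simps mult.commute)
  then have sp: "sm p p' = 0" using iso j0 by (simp add: sc_eq_0_iff)
  have pp': "cr p p' \<noteq> 0"
  proof
    assume "cr p p' = 0"
    then obtain c where c: "p = sc c p'" using parallelE[OF p(2)] by blast
    then have "sc c (sm p p) = 0" using sp by (metis sm_commute sm_linear(3) sc_simps(8))
    then show False using sm_self_eq_0D[of p] p(1) c by (auto simp: sc_eq_0_iff sc_simps)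
  qed
  have neg: "- v = sc (- 1) v" for v :: "'k v3" by (cases v) (simp add: v3_simps)
  define sol where "sol e \<epsilon> t x \<longleftrightarrow> sm x (sc w1 p + sc t (sc w1' p')) = - cr e (sc w0 p + sc t (sc w0' p')) \<and>
    sm x (sc w0 p + sc t (sc w0' p')) = sc \<epsilon> (cr e (sc w1 p + sc t (sc w1' p')))" for e and \<epsilon> t :: 'k and x
  have npar: "cr (sc w0 p + sc t (sc w0' p')) (sc w1 p + sc t (sc w1' p')) \<noteq> 0" if "t \<noteq> 0" for t
  proof -
    have "cr (sc w0 p + sc t (sc w0' p')) (sc w1 p + sc t (sc w1' p')) = sc (t * j) (cr p p')"
      by (cases p; cases p') (simp add: j_def v3_simps algebra_simps)
    then show ?thesis using that j0 pp' by (simp add: sc_eq_0_iff)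
  qed
  have cneg: "cr (- 1, 0, 0) v = sc (- 1) (cr (1, 0, 0) v)" for v :: "'k v3"
    by (cases v) simp
  have sol0: "\<exists>x. sol (1, 0, 0) (- 1) t x" and sol1: "\<exists>x. sol (0, 1, 0) 1 t x" if "t \<noteq> 0" for t
    using bad_imp_kills[OF sm_kernel_le_1[OF npar[OF that]] bad[of t]]
    unfolding kills_def sol_def by (simp_all add: cneg sc_simps)
  \<comment> \<open>The Gram matrix of \<open>w\<close> and \<open>w'\<close> for the form
    \<open>w0^2 + \<epsilon> w1^2\<close>; \<open>\<epsilon> = - 1\<close> belongs to y1 and
    \<open>\<epsilon> = 1\<close> to y2.\<close>
  define \<mu> \<nu> \<mu>' where "\<mu> \<epsilon> = w0\<^sup>2 + \<epsilon> * w1\<^sup>2" "\<nu> \<epsilon> = w0 * w0' + \<epsilon> * (w1 * w1')"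
    "\<mu>' \<epsilon> = w0'\<^sup>2 + \<epsilon> * w1'\<^sup>2" for \<epsilon> :: 'k
  have reduce: "sc (t * j) (sm x p') = - (sc (\<mu> \<epsilon>) (cr e p) + sc (t * \<nu> \<epsilon>) (cr e p'))"
    "sc (- j) (sm x p) = - (sc (\<nu> \<epsilon>) (cr e p) + sc (t * \<mu>' \<epsilon>) (cr e p'))" if "sol e \<epsilon> t x" for e \<epsilon> t x
  proof -
    let ?P = "sc w0 p + sc t (sc w0' p')" and ?Q = "sc w1 p + sc t (sc w1' p')"
    have s: "sm x ?Q = - cr e ?P" "sm x ?P = sc \<epsilon> (cr e ?Q)" using that by (simp_all add: sol_def)
    have "sc (t * j) (sm x p') = sc w0 (sm x ?Q) - sc w1 (sm x ?P)"
      "sc (- j) (sm x p) = sc w0' (sm x ?Q) - sc w1' (sm x ?P)"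
    proof -
      have g: "sc (t * j) B = sc w0 (sc w1 A + sc t (sc w1' B)) - sc w1 (sc w0 A + sc t (sc w0' B))"
        "sc (- j) A = sc w0' (sc w1 A + sc t (sc w1' B)) - sc w1' (sc w0 A + sc t (sc w0' B))" for A B :: "'k v3"
        unfolding j_def by (cases A, cases B, simp add: minus_prod_def plus_prod_def algebra_simps)+
      show "sc (t * j) (sm x p') = sc w0 (sm x ?Q) - sc w1 (sm x ?P)"
        unfolding sm_linear by (rule g(1))
      show "sc (- j) (sm x p) = sc w0' (sm x ?Q) - sc w1' (sm x ?P)"
        unfolding sm_linear by (rule g(2))
    qed
    moreover
    have "sc w0 (- cr e ?P) - sc w1 (sc \<epsilon> (cr e ?Q)) = - (sc (\<mu> \<epsilon>) (cr e p) + sc (t * \<nu> \<epsilon>) (cr e p'))"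
      "sc w0' (- cr e ?P) - sc w1' (sc \<epsilon> (cr e ?Q)) = - (sc (\<nu> \<epsilon>) (cr e p) + sc (t * \<mu>' \<epsilon>) (cr e p'))"
    proof -
      have g: "sc w0 (- (sc w0 A + sc t (sc w0' B))) - sc w1 (sc \<epsilon> (sc w1 A + sc t (sc w1' B)))
          = - (sc (\<mu> \<epsilon>) A + sc (t * \<nu> \<epsilon>) B)"
        "sc w0' (- (sc w0 A + sc t (sc w0' B))) - sc w1' (sc \<epsilon> (sc w1 A + sc t (sc w1' B)))
          = - (sc (\<nu> \<epsilon>) A + sc (t * \<mu>' \<epsilon>) B)" for A B :: "'k v3"
        unfolding \<mu>_\<nu>_\<mu>'_def
        by (cases A, cases B, simp add: minus_prod_def plus_prod_def uminus_prod_def algebra_simps power2_eq_square)+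
      show "sc w0 (- cr e ?P) - sc w1 (sc \<epsilon> (cr e ?Q)) = - (sc (\<mu> \<epsilon>) (cr e p) + sc (t * \<nu> \<epsilon>) (cr e p'))"
        unfolding cr_linear by (rule g(1))
      show "sc w0' (- cr e ?P) - sc w1' (sc \<epsilon> (cr e ?Q)) = - (sc (\<nu> \<epsilon>) (cr e p) + sc (t * \<mu>' \<epsilon>) (cr e p'))"
        unfolding cr_linear by (rule g(2))
    qed
    ultimately show "sc (t * j) (sm x p') = - (sc (\<mu> \<epsilon>) (cr e p) + sc (t * \<nu> \<epsilon>) (cr e p'))"
      "sc (- j) (sm x p) = - (sc (\<nu> \<epsilon>) (cr e p) + sc (t * \<mu>' \<epsilon>) (cr e p'))"
      by (simp_all only: s)
  qed
  have span: "\<exists>\<alpha> \<beta>. sc (j * \<beta>) (sm p' p') = sc (- \<mu> \<epsilon>) (cr e p) \<and> sc (j * \<alpha>) (sm p p) = sc (\<mu>' \<epsilon>) (cr e p')"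
    if \<nu>: "\<nu> \<epsilon> = 0" and ex: "\<And>t. t \<noteq> 0 \<Longrightarrow> \<exists>x. sol e \<epsilon> t x" for e \<epsilon>
  proof -
    obtain x y where xy: "sol e \<epsilon> 1 x" "sol e \<epsilon> 2 y" using ex[of 1] ex[of 2] by auto
    have flip: "a = b" if "sc (- c) a' = - b" "a = sc c a'" for a a' b :: "'k v3" and c
      using that by (cases a; cases a'; cases b) (simp add: v3_simps)
    show ?thesis
    proof (rule conjugate_solution_in_span[OF p sp _ _ _ _ j0])
      show "sc j (sm x p') = sc (- \<mu> \<epsilon>) (cr e p)" "sc (2 * j) (sm y p') = sc (- \<mu> \<epsilon>) (cr e p)"
        using reduce(1)[OF xy(1)] reduce(1)[OF xy(2)] \<nu> by (simp_all add: sc_simps)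
      show "sc j (sm x p) = sc (\<mu>' \<epsilon>) (cr e p')" "sc j (sm y p) = sc (2 * \<mu>' \<epsilon>) (cr e p')"
        using reduce(2)[OF xy(1)] reduce(2)[OF xy(2)] \<nu> by (auto simp: sc_simps)
    qed
  qed
  \<comment> \<open>The Gram determinant is \<open>\<epsilon> * j^2\<close>, which is
    nonzero.\<close>
  have \<mu>\<mu>': "\<mu> \<epsilon> \<noteq> 0 \<and> \<mu>' \<epsilon> \<noteq> 0" if "\<nu> \<epsilon> = 0" "\<epsilon> = 1 \<or> \<epsilon> = - 1" for \<epsilon>
  proof -
    have "\<mu> \<epsilon> * \<mu>' \<epsilon> = (\<nu> \<epsilon>)\<^sup>2 + \<epsilon> * j\<^sup>2"
      using that(2) by (auto simp: \<mu>_\<nu>_\<mu>'_def j_def algebra_simps power2_eq_square)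
    then show ?thesis using that j0 by auto
  qed
  have cre: "cr e p \<noteq> 0" "cr e p' \<noteq> 0" if e: "e \<in> {(1, 0, 0), (0, 1, 0)}" for e
  proof -
    have e0: "e \<noteq> 0" using e by (auto simp: v3_zero)
    have "r' = 0" if r: "cr e r = 0" "r \<noteq> 0" "sm r r' = 0" for r r' :: "'k v3"
    proof -
      obtain c where c: "r = sc c e" using parallelE[OF e0, of r] r(1) cr_swap[of r e] by auto
      then have "sm e r' = 0" using r by (auto simp: sm_linear sc_eq_0_iff)
      then show ?thesis using sm_unit_eq_0D[OF e] by blast
    qed
    then show "cr e p \<noteq> 0" "cr e p' \<noteq> 0" using p sp sm_commute[of p p'] by metis+
  qed
  \<comment> \<open>Up to nonzero factors \<open>sm p' p'\<close> is \<open>cr e p\<close> and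
    \<open>sm p p\<close> is \<open>cr e p'\<close>, and both cross products are orthogonal to
    \<open>e\<close>.\<close>
  have polar: "dt e (sm p p) = 0 \<and> dt e (sm p' p') = 0"
    if e: "e \<in> {(1, 0, 0), (0, 1, 0)}" and \<epsilon>: "\<epsilon> = 1 \<or> \<epsilon> = - 1" "\<nu> \<epsilon> = 0"
      and ex: "\<And>t. t \<noteq> 0 \<Longrightarrow> \<exists>x. sol e \<epsilon> t x" for e \<epsilon>
  proof -
    obtain \<alpha> \<beta> where ab: "sc (j * \<beta>) (sm p' p') = sc (- \<mu> \<epsilon>) (cr e p)" "sc (j * \<alpha>) (sm p p) = sc (\<mu>' \<epsilon>) (cr e p')"
      using span[OF \<epsilon>(2) ex] by blast
    have "\<beta> \<noteq> 0" "\<alpha> \<noteq> 0"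
      using ab \<mu>\<mu>'[OF \<epsilon>(2,1)] cre[OF e] by (auto simp: sc_simps sc_eq_0_iff)
    moreover have "j * \<beta> * dt e (sm p' p') = 0" "j * \<alpha> * dt e (sm p p) = 0"
      using arg_cong[OF ab(1), of "dt e"] arg_cong[OF ab(2), of "dt e"] by (simp_all add: dt_linear dt_cr_self)
    ultimately show ?thesis using j0 by simp
  qed
  \<comment> \<open>Since also \<open>sm p p' = 0\<close>, the quadratic form
    \<open>dt e (sm f f)\<close> vanishes on the whole span of \<open>p\<close> and
    \<open>p'\<close>. It is 1 when \<open>e\<close> and \<open>f\<close> are the first two unit
    vectors in either order.\<close>
  have no_span: False if f: "dt f (cr p p') = 0" and e: "dt e (sm f f) \<noteq> 0"
    and z: "dt e (sm p p) = 0 \<and> dt e (sm p' p') = 0" for e f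
  proof -
    obtain a b where "f = sc a p + sc b p'" using in_spanE[OF pp' f] by blast
    then have "dt e (sm f f) = 0"
      using z sp sm_commute[of p' p] by (simp add: sm_linear dt_linear)
    then show False using e by simp
  qed
  have z0: "\<nu> (- 1) * dt (1, 0, 0) (cr p p') = 0"
    using iso1 by (cases p; cases p') (simp add: \<mu>_\<nu>_\<mu>'_def algebra_simps)
  have z1: "\<nu> 1 * dt (0, 1, 0) (cr p p') = 0"
    using iso2 by (cases p; cases p') (simp add: \<mu>_\<nu>_\<mu>'_def algebra_simps)
  have II: False if "\<nu> 1 = 0" "dt (1, 0, 0) (cr p p') = 0"
    using no_span[OF that(2), of "(0, 1, 0)"] polar[of "(0, 1, 0)" 1] that(1) sol1 by auto
  have III: False if "\<nu> (- 1) = 0" "dt (0, 1, 0) (cr p p') = 0"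
    using no_span[OF that(2), of "(1, 0, 0)"] polar[of "(1, 0, 0)" "- 1"] that(1) sol0 by auto
  consider "\<nu> (- 1) = 0" "\<nu> 1 = 0" | "dt (1, 0, 0) (cr p p') = 0" "dt (0, 1, 0) (cr p p') = 0"
    using z0 z1 II III by auto
  then show False
  proof cases
    case 1
    \<comment> \<open>\<open>sm p' p'\<close> is proportional to \<open>cr (1, 0, 0) p\<close> and
      to \<open>cr (0, 1, 0) p\<close>, which forces the last coordinate of \<open>p\<close> to
      vanish; the same holds for \<open>p'\<close>. This leads back to \<open>II\<close>.\<close>
    obtain \<alpha> \<beta> where A: "sc (j * \<beta>) (sm p' p') = sc (- \<mu> (- 1)) (cr (1, 0, 0) p)"
      "sc (j * \<alpha>) (sm p p) = sc (\<mu>' (- 1)) (cr (1, 0, 0) p')"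
      using span[OF 1(1) sol0] by blast
    obtain \<gamma> \<delta> where B: "sc (j * \<delta>) (sm p' p') = sc (- \<mu> 1) (cr (0, 1, 0) p)"
      "sc (j * \<gamma>) (sm p p) = sc (\<mu>' 1) (cr (0, 1, 0) p')"
      using span[OF 1(2) sol1] by blast
    have m: "\<mu> (- 1) \<noteq> 0" "\<mu>' (- 1) \<noteq> 0" "\<mu> 1 \<noteq> 0" "\<mu>' 1 \<noteq> 0" using \<mu>\<mu>' 1 by auto
    have third: "snd (snd r) = 0" if "sc b s = sc m (cr (1, 0, 0) r)" "sc d s = sc n (cr (0, 1, 0) r)"
      "m \<noteq> 0" "n \<noteq> 0" "cr (1, 0, 0) r \<noteq> 0" for b d m n :: 'k and r s :: "'k v3"
    proof -
      have "b \<noteq> 0" using that by (auto simp: sc_simps sc_eq_0_iff)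
      then have "fst s = 0" using that(1) by (cases r; cases s) auto
      then show ?thesis using that(2,4) by (cases r; cases s) auto
    qed
    have "snd (snd p) = 0" using third[OF A(1) B(1)] m cre(1) by auto
    moreover have "snd (snd p') = 0" using third[OF A(2) B(2)] m cre(2) by auto
    ultimately have "dt (1, 0, 0) (cr p p') = 0" by (cases p; cases p') simp
    then show False using II 1 by blast
  next
    case 2
    \<comment> \<open>Here \<open>cr p p'\<close> is a multiple of the third unit vector, so
      \<open>p\<close> and \<open>p'\<close> lie in the span of the first two, where
      \<open>sm p p' = 0\<close> can be solved by hand.\<close>
    obtain a b c a' b' c' where v: "p = (a, b, c)" "p' = (a', b', c')" by (metis prod_cases3)
    define m where "m = a * b' - b * a'"
    have e: "b * c' - c * b' = 0" "c * a' - a * c' = 0" using 2 by (simp_all add: v)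
    have m0: "m \<noteq> 0" using pp' e by (simp add: v m_def v3_zero)
    have "c * m = - a * (b * c' - c * b') - b * (c * a' - a * c')"
      "c' * m = - a' * (b * c' - c * b') - b' * (c * a' - a * c')"
      by (simp_all add: m_def algebra_simps)
    then have c: "c = 0" "c' = 0" using e m0 by auto
    have s: "b * a' + (a + b) * b' = 0" "(a + b) * a' + a * b' = 0" "b * a' + a * b' = 0"
      using sp unfolding v c by (simp_all add: v3_zero)
    have "b * b' = (b * a' + (a + b) * b') - (b * a' + a * b')" "a * a' = ((a + b) * a' + a * b') - (b * a' + a * b')"
      by (simp_all add: algebra_simps)
    then have "b * b' = 0" "a * a' = 0" by (simp_all only: s) simp_all
    then show False using s(3) m0 p by (auto simp: v c m_def v3_zero)
  qed
qed

lemma nonzero_parallelE: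
  assumes "cr p q = 0" "p \<noteq> 0 \<or> q \<noteq> (0 :: 'k::field v3)"
  obtains r a b where "r \<noteq> 0" "p = sc a r" "q = sc b r" "a \<noteq> 0 \<or> b \<noteq> 0"
proof (cases "p = 0")
  case True
  then show ?thesis using assms(2) by (intro that[of q 0 1]) (simp_all add: sc_simps)
next
  case False
  moreover have "cr q p = 0" using assms(1) cr_swap[of q p] by simp
  ultimately obtain c where "q = sc c p" using parallelE by blast
  then show ?thesis using False by (intro that[of p 1 c]) (simp_all add: sc_simps)
qed

text \<open>The hypothesis \<open>par\<close> says that \<open>(p1, q1)\<close> is a pure tensor
  \<open>w \<otimes> p\<close>. Either the remaining pencil contains no pure tensor, or it contains
  some \<open>w' \<otimes> p'\<close>, and then \<open>w'\<close> is proportional to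
  \<open>w\<close> or not.\<close>

lemma plane_not_all_bad_parallel:
  fixes p1 p2 q1 q2 :: "'k::{alg_closed_field, field_char_0} v3"
  assumes indep: "\<And>s t. sc s p1 + sc t p2 = 0 \<Longrightarrow> sc s q1 + sc t q2 = 0 \<Longrightarrow> s = 0 \<and> t = 0"
    and iso: "sm p1 q2 = sm q1 p2" and iso1: "fst (cr p1 p2) = fst (cr q1 q2)"
    and iso2: "fst (snd (cr p1 p2)) = - fst (snd (cr q1 q2))"
    and K: "\<And>x y1 y2. kills x y1 y2 p1 q1 \<Longrightarrow> kills x y1 y2 p2 q2 \<Longrightarrow> x = 0 \<and> y1 = 0 \<and> y2 = 0"
    and bad: "\<And>s t. s \<noteq> 0 \<or> t \<noteq> 0 \<Longrightarrow> bad (sc s p1 + sc t p2) (sc s q1 + sc t q2)"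
    and par: "cr p1 q1 = 0"
  shows False
proof (cases "\<forall>t. cr (p2 + sc t p1) (q2 + sc t q1) \<noteq> 0")
  case True
  show False
  proof (rule double_pencil_contradiction[OF _ _ iso _ K])
    show "cr (p2 + sc t p1) (q2 + sc t q1) \<noteq> 0" for t using True by blast
    show "bad (p2 + sc t p1) (q2 + sc t q1)" for t using bad[of t 1] by (simp add: sc_simps add.commute)
    show "p1 \<noteq> 0 \<or> q1 \<noteq> 0" using indep[of 1 0] by (auto simp: sc_simps)
  qed
next
  case False
  then obtain t where t: "cr (p2 + sc t p1) (q2 + sc t q1) = 0" by blast
  have "p1 \<noteq> 0 \<or> q1 \<noteq> 0" using indep[of 1 0] by (auto simp: sc_simps)
  then obtain p w0 w1 where w: "p \<noteq> 0" "p1 = sc w0 p" "q1 = sc w1 p" "w0 \<noteq> 0 \<or> w1 \<noteq> 0"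
    using nonzero_parallelE[OF par] by metis
  have "p2 + sc t p1 \<noteq> 0 \<or> q2 + sc t q1 \<noteq> 0" using indep[of t 1] by (auto simp: sc_simps add.commute)
  then obtain p' w0' w1' where w': "p' \<noteq> 0" "p2 + sc t p1 = sc w0' p'" "q2 + sc t q1 = sc w1' p'" "w0' \<noteq> 0 \<or> w1' \<noteq> 0"
    using nonzero_parallelE[OF t] by metis
  have bad': "bad (sc a p1 + sc b (sc w0' p')) (sc a q1 + sc b (sc w1' p'))" if "a \<noteq> 0 \<or> b \<noteq> 0" for a b
  proof -
    have "sc a p1 + sc b (p2 + sc t p1) = sc (a + b * t) p1 + sc b p2"
      "sc a q1 + sc b (q2 + sc t q1) = sc (a + b * t) q1 + sc b q2"
      by (simp_all add: sc_simps algebra_simps)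
    moreover have "bad (sc (a + b * t) p1 + sc b p2) (sc (a + b * t) q1 + sc b q2)"
      by (rule bad) (use that in auto)
    ultimately show ?thesis unfolding w'(2,3) by simp
  qed
  show False
  proof (cases "w0 * w1' - w1 * w0' = 0")
    case False
    show False
    proof (rule two_parallel_contradiction_distinct[OF w(1) w'(1) False])
      have i: "sm p1 (q2 + sc t q1) = sm q1 (p2 + sc t p1)"
        using iso by (simp add: sm_linear sm_commute[of p1 q1])
      then show "sm (sc w0 p) (sc w1' p') = sm (sc w1 p) (sc w0' p')" unfolding w'(2,3)[symmetric] w(2,3)[symmetric] .
      have "cr p1 (p2 + sc t p1) = cr p1 p2" "cr q1 (q2 + sc t q1) = cr q1 q2"
        by (simp_all add: cr_linear sc_simps)
      then show "fst (cr (sc w0 p) (sc w0' p')) = fst (cr (sc w1 p) (sc w1' p'))"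
        "fst (snd (cr (sc w0 p) (sc w0' p'))) = - fst (snd (cr (sc w1 p) (sc w1' p')))"
        unfolding w'(2,3)[symmetric] w(2,3)[symmetric] using iso1 iso2 by simp_all
      show "bad (sc w0 p + sc b (sc w0' p')) (sc w1 p + sc b (sc w1' p'))" for b
        using bad'[of 1 b] unfolding w(2,3) by (simp add: sc_simps)
    qed
  next
    case True
    have "\<exists>c. c \<noteq> 0 \<and> w0' = c * w0 \<and> w1' = c * w1"
    proof (cases "w0 = 0")
      case True': True
      then have "w1 \<noteq> 0" "w0' = 0" using w(4) True by auto
      then show ?thesis using w'(4) True' by (intro exI[of _ "w1' / w1"]) auto
    next
      case False
      then have "w1' = w0' / w0 * w1" using True by (simp add: field_simps)
      then show ?thesis using w'(4) False by (intro exI[of _ "w0' / w0"]) auto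
    qed
    then obtain c where c: "c \<noteq> 0" "w0' = c * w0" "w1' = c * w1" by blast
    show False
    proof (rule two_parallel_contradiction_same[OF _ w(4)])
      show "cr p p' \<noteq> 0"
      proof
        assume "cr p p' = 0"
        then obtain d where d: "p = sc d p'" using parallelE[OF w'(1)] by blast
        have "sc c p1 + sc (- d) (p2 + sc t p1) = 0" "sc c q1 + sc (- d) (q2 + sc t q1) = 0"
          unfolding w'(2,3) unfolding w(2,3) c(2,3) d by (simp_all add: sc_simps mult_ac)
        then have "sc (c - d * t) p1 + sc (- d) p2 = 0" "sc (c - d * t) q1 + sc (- d) q2 = 0"
          by (simp_all add: sc_simps algebra_simps)
        then have "c - d * t = 0 \<and> - d = 0" by (rule indep)
        then show False using c(1) by auto
      qed
      show "bad (sc w0 (sc a p + sc b p')) (sc w1 (sc a p + sc b p'))" if "a \<noteq> 0 \<or> b \<noteq> 0" for a b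
        using bad'[of a "b / c"] that c unfolding w(2,3) by (simp add: sc_simps mult_ac)
    qed
  qed
qed

text \<open>A plane without pure tensors is handled as a single pencil. Otherwise a change of basis
  makes a pure tensor the first basis vector; all hypotheses are stable under it.\<close>

lemma plane_not_all_bad:
  fixes p1 p2 q1 q2 :: "'k::{alg_closed_field, field_char_0} v3"
  assumes indep: "\<And>s t. sc s p1 + sc t p2 = 0 \<Longrightarrow> sc s q1 + sc t q2 = 0 \<Longrightarrow> s = 0 \<and> t = 0"
    and iso: "sm p1 q2 = sm q1 p2" and iso1: "fst (cr p1 p2) = fst (cr q1 q2)"
    and iso2: "fst (snd (cr p1 p2)) = - fst (snd (cr q1 q2))"
    and K: "\<And>x y1 y2. kills x y1 y2 p1 q1 \<Longrightarrow> kills x y1 y2 p2 q2 \<Longrightarrow> x = 0 \<and> y1 = 0 \<and> y2 = 0"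
  shows "\<exists>s t. (s \<noteq> 0 \<or> t \<noteq> 0) \<and> \<not> bad (sc s p1 + sc t p2) (sc s q1 + sc t q2)"
proof (rule ccontr)
  assume "\<not> ?thesis"
  then have bad: "bad (sc s p1 + sc t p2) (sc s q1 + sc t q2)" if "s \<noteq> 0 \<or> t \<noteq> 0" for s t
    using that by blast
  show False
  proof (cases "cr p1 q1 = 0")
    case True
    then show False using plane_not_all_bad_parallel[OF indep iso iso1 iso2 K bad] by blast
  next
    case np: False
    show False
    proof (cases "\<forall>t. cr (p1 + sc t p2) (q1 + sc t q2) \<noteq> 0")
      case True
      show False
      proof (rule double_pencil_contradiction[of p1 p2 q1 q2])
        show "cr (p1 + sc t p2) (q1 + sc t q2) \<noteq> 0" for t using True by blast
        show "bad (p1 + sc t p2) (q1 + sc t q2)" for t using bad[of 1 t] by (simp add: sc_simps)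
        show "p2 \<noteq> 0 \<or> q2 \<noteq> 0" using indep[of 0 1] by (auto simp: sc_simps)
        show "sm p2 q1 = sm q2 p1" using iso by (metis sm_commute)
      qed (use K in blast)
    next
      case False
      then obtain t where t: "cr (p1 + sc t p2) (q1 + sc t q2) = 0" by blast
      show False
      proof (rule plane_not_all_bad_parallel[of "p1 + sc t p2" p2 "q1 + sc t q2" q2])
        fix a b
        assume "sc a (p1 + sc t p2) + sc b p2 = 0" "sc a (q1 + sc t q2) + sc b q2 = 0"
        then have "sc a p1 + sc (a * t + b) p2 = 0" "sc a q1 + sc (a * t + b) q2 = 0"
          by (simp_all add: sc_simps algebra_simps)
        then have "a = 0 \<and> a * t + b = 0" by (rule indep)
        then show "a = 0 \<and> b = 0" by auto
      next
        show "sm (p1 + sc t p2) q2 = sm (q1 + sc t q2) p2"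
          using iso by (simp add: sm_linear sm_commute[of p2 q2])
        show "fst (cr (p1 + sc t p2) p2) = fst (cr (q1 + sc t q2) q2)"
          "fst (snd (cr (p1 + sc t p2) p2)) = - fst (snd (cr (q1 + sc t q2) q2))"
          using iso1 iso2 by (simp_all add: cr_linear sc_simps)
      next
        fix x y1 y2 assume k: "kills x y1 y2 (p1 + sc t p2) (q1 + sc t q2)" "kills x y1 y2 p2 q2"
        then have "kills x y1 y2 p1 q1"
          using kills_combine_right[OF k, of 1 "- t"] by (simp add: sc_simps)
        then show "x = 0 \<and> y1 = 0 \<and> y2 = 0" using k(2) by (rule K)
      next
        fix a b :: 'k assume ab: "a \<noteq> 0 \<or> b \<noteq> 0"
        have "sc a (p1 + sc t p2) + sc b p2 = sc a p1 + sc (a * t + b) p2"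
          "sc a (q1 + sc t q2) + sc b q2 = sc a q1 + sc (a * t + b) q2"
          by (simp_all add: sc_simps algebra_simps)
        then show "bad (sc a (p1 + sc t p2) + sc b p2) (sc a (q1 + sc t q2) + sc b q2)"
          using bad[of a "a * t + b"] ab by auto
      qed (rule t)
    qed
  qed
qed

section \<open>From pairs of triples to vectors of V, and the points of X\<close>

lemma scalar_prod_6:
  "v \<in> carrier_vec 6 \<Longrightarrow> w \<in> carrier_vec 6 \<Longrightarrow>
    v \<bullet> w = v $ 0 * w $ 0 + v $ 1 * w $ 1 + v $ 2 * w $ 2 + v $ 3 * w $ 3 + v $ 4 * w $ 4 + v $ 5 * w $ (5::nat)"
  by (simp add: scalar_prod_def atLeast0LessThan sum_lessThan_6)

lemma sum_lessThan_15: "(\<Sum>j<15. f j) = f 0 + f 1 + f 2 + f 3 + f 4 + f 5 + f 6 + f 7 + f 8 + f 9 + f 10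
    + f 11 + f 12 + f 13 + (f (14::nat) :: 'a::comm_monoid_add)"
  by (simp add: eval_nat_numeral lessThan_Suc add_ac)

lemma sum_lessThan_5: "(\<Sum>j<5. f j) = f 0 + f 1 + f 2 + f 3 + (f (4::nat) :: 'a::comm_monoid_add)"
  by (simp add: eval_nat_numeral lessThan_Suc add_ac)

lemma scalar_prod_15:
  "w \<in> carrier_vec 15 \<Longrightarrow> v \<bullet> w = (\<Sum>j<15. v $ j * w $ j)"
  by (simp add: scalar_prod_def atLeast0LessThan)

lemma wedge_index: "i < 6 \<Longrightarrow> j < 6 \<Longrightarrow> wedge v w $$ (i, j) = v $ i * w $ j - v $ j * w $ i"
  by (simp add: wedge_def)

lemmas coords_wedge_index = coords_index[of "wedge v w" for v w, simplified wedge_index, simplified]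

lemma scalar_prod_coords_wedge:
  assumes "v \<in> carrier_vec 6" "w \<in> carrier_vec 6"
  shows "u \<bullet> coords (wedge v w) = v \<bullet> skew_apply u w"
  unfolding scalar_prod_15[OF coords_carrier] scalar_prod_6[OF assms(1) skew_apply_carrier]
  by (simp add: sum_lessThan_15 coords_wedge_index skew_apply_index algebra_simps)

lemma skew_apply_coords_wedge:
  assumes "v \<in> carrier_vec 6" "w \<in> carrier_vec 6" "\<xi> \<in> carrier_vec 6"
  shows "skew_apply (coords (wedge v w)) \<xi> = (w \<bullet> \<xi>) \<cdot>\<^sub>v v - (v \<bullet> \<xi>) \<cdot>\<^sub>v w"
  by (rule vec_6_eqI) (use assms in \<open>simp_all add: skew_apply_index coords_wedge_index scalar_prod_6 algebra_simps\<close>)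

lemma skew_apply_linear:
  shows "v \<in> carrier_vec 6 \<Longrightarrow> w \<in> carrier_vec 6 \<Longrightarrow> skew_apply u (v + w) = skew_apply u v + skew_apply u w"
    and "v \<in> carrier_vec 6 \<Longrightarrow> skew_apply u (c \<cdot>\<^sub>v v) = c \<cdot>\<^sub>v skew_apply u v"
    and "u \<in> carrier_vec 15 \<Longrightarrow> u' \<in> carrier_vec 15 \<Longrightarrow> skew_apply (u + u') v = skew_apply u v + skew_apply u' v"
    and "u \<in> carrier_vec 15 \<Longrightarrow> skew_apply (c \<cdot>\<^sub>v u) v = c \<cdot>\<^sub>v skew_apply u v"
  by (rule vec_6_eqI, simp_all add: skew_apply_index algebra_simps)+

lemma skew_apply_self_orthogonal: "v \<in> carrier_vec 6 \<Longrightarrow> v \<bullet> skew_apply u v = 0"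
  by (simp add: scalar_prod_6 skew_apply_index algebra_simps)

lemma skew_apply_adjoint:
  "v \<in> carrier_vec 6 \<Longrightarrow> w \<in> carrier_vec 6 \<Longrightarrow> w \<bullet> skew_apply u v = - (v \<bullet> skew_apply u w)"
  by (simp add: scalar_prod_6 skew_apply_index algebra_simps)

definition isotropic :: "'k::field vec \<Rightarrow> 'k vec \<Rightarrow> bool" where
  "isotropic v w \<longleftrightarrow> (\<forall>a\<in>carrier_vec 5. v \<bullet> skew_apply (form_coords a) w = 0)"

lemma X_of_form:
  "X_of (form :: 'k::field_char_0 vec \<Rightarrow> 'k mat) = {[line (coords (wedge v w))] | v w.
     v \<in> carrier_vec 6 \<and> w \<in> carrier_vec 6 \<and> coords (wedge v w) \<noteq> 0\<^sub>v 15 \<and> isotropic v w}"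
proof (intro equalityI subsetI)
  fix x assume "x \<in> X_of (form :: 'k vec \<Rightarrow> 'k mat)"
  then obtain u v w where u: "u \<in> annihilator (form ` carrier_vec 5)" "u \<noteq> 0\<^sub>v 15" "x = [line u]"
    and vw: "v \<in> carrier_vec 6" "w \<in> carrier_vec 6" "coords (wedge v w) \<noteq> 0\<^sub>v 15" "x = [line (coords (wedge v w))]"
    by (auto simp: X_of_def projectivization_def grassmannian_def)
  then obtain c where c: "coords (wedge v w) = c \<cdot>\<^sub>v u"
    using line_eqD[of u "coords (wedge v w)" 15] by auto
  have "v \<bullet> skew_apply (form_coords a) w = 0" if "a \<in> carrier_vec 5" for a
  proof -
    have "form_coords a \<bullet> u = 0" "u \<in> carrier_vec 15"
      using u(1) that by (auto simp: annihilator_def coords_form)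
    then show ?thesis
      using scalar_prod_coords_wedge[OF vw(1,2), of "form_coords a"] unfolding c by simp
  qed
  then show "x \<in> {[line (coords (wedge v w))] | v w. v \<in> carrier_vec 6 \<and> w \<in> carrier_vec 6 \<and>
      coords (wedge v w) \<noteq> 0\<^sub>v 15 \<and> isotropic v w}"
    using vw unfolding isotropic_def by blast
next
  fix x :: "'k vec set list"
  assume "x \<in> {[line (coords (wedge v w))] | v w. v \<in> carrier_vec 6 \<and> w \<in> carrier_vec 6 \<and>
      coords (wedge v w) \<noteq> 0\<^sub>v 15 \<and> isotropic v w}"
  then obtain v w :: "'k vec" where vw: "v \<in> carrier_vec 6" "w \<in> carrier_vec 6" "coords (wedge v w) \<noteq> 0\<^sub>v 15"
    "x = [line (coords (wedge v w))]" "isotropic v w" by blast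
  have "coords (wedge v w) \<in> annihilator (form ` carrier_vec 5)"
    using vw(5) by (auto simp: annihilator_def coords_form isotropic_def scalar_prod_coords_wedge[OF vw(1,2)])
  then show "x \<in> X_of form"
    using vw by (auto simp: X_of_def projectivization_def grassmannian_def)
qed

lemma isotropic_commute: "v \<in> carrier_vec 6 \<Longrightarrow> w \<in> carrier_vec 6 \<Longrightarrow> isotropic v w \<longleftrightarrow> isotropic w v"
  unfolding isotropic_def using skew_apply_adjoint[of v w] by auto

lemma isotropic_self: "v \<in> carrier_vec 6 \<Longrightarrow> isotropic v v"
  by (simp add: isotropic_def skew_apply_self_orthogonal)

lemma isotropic_combine:
  assumes "v \<in> carrier_vec 6" "w \<in> carrier_vec 6" "x \<in> carrier_vec 6" "isotropic x v" "isotropic x w"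
  shows "isotropic x (c \<cdot>\<^sub>v v + d \<cdot>\<^sub>v w)"
  using assms unfolding isotropic_def
  by (simp add: skew_apply_linear scalar_prod_add_distrib[of _ 6])

lemma coords_wedge_smult:
  "v \<in> carrier_vec 6 \<Longrightarrow> w \<in> carrier_vec 6 \<Longrightarrow> coords (wedge (c \<cdot>\<^sub>v v) (d \<cdot>\<^sub>v w)) = (c * d) \<cdot>\<^sub>v coords (wedge v w)"
  by (rule vec_15_eqI) (simp_all add: coords_wedge_index algebra_simps)

lemma coords_wedge_combine:
  assumes "v \<in> carrier_vec 6" "w \<in> carrier_vec 6"
  shows "coords (wedge (a \<cdot>\<^sub>v v + b \<cdot>\<^sub>v w) (c \<cdot>\<^sub>v v + d \<cdot>\<^sub>v w)) = (a * d - b * c) \<cdot>\<^sub>v coords (wedge v w)"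
  by (rule vec_15_eqI) (use assms in \<open>simp_all add: coords_wedge_index algebra_simps\<close>)

lemma coords_wedge_eq_zeroD:
  assumes "coords (wedge v w) = 0\<^sub>v 15" "i < 6" "j < 6"
  shows "v $ i * w $ j = v $ j * w $ i"
proof -
  have lt: "v $ i * w $ j - v $ j * w $ i = 0" if "i < j" "j < 6" for i j
  proof -
    have "coords (wedge v w) $ pair_index i j = 0" using assms(1) index_pairs_nth(2)[OF that] by simp
    then show ?thesis using index_pairs_nth[OF that] that by (simp add: coords_def wedge_index)
  qed
  consider "i < j" | "i = j" | "j < i" by linarith
  then show ?thesis using lt[of i j] lt[of j i] assms(2,3) by cases (simp_all add: mult.commute)
qed

lemma coords_wedge_eq_zeroI:
  "(\<And>i j. i < 6 \<Longrightarrow> j < 6 \<Longrightarrow> v $ i * w $ j = v $ j * w $ i) \<Longrightarrow> coords (wedge v w) = 0\<^sub>v 15"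
  by (rule vec_15_eqI) (simp_all add: coords_wedge_index)

lemma coords_wedge_nonzeroE:
  assumes "coords (wedge v w) \<noteq> 0\<^sub>v 15"
  obtains i j where "i < 6" "j < 6" "v $ i * w $ j - v $ j * w $ i \<noteq> 0"
  using coords_wedge_eq_zeroI[of v w] assms by (auto simp: right_minus_eq)

text \<open>A bivector whose wedge products with two independent vectors both vanish is a multiple
  of the product of these vectors.\<close>

lemma pfaffian_adjoint_if_two_kernel_vectors:
  assumes k: "skew_apply u v = 0\<^sub>v 6" "skew_apply u w = 0\<^sub>v 6" and nz: "coords (wedge v w) \<noteq> 0\<^sub>v 15"
  shows "\<exists>c. pfaffian_adjoint u = c \<cdot>\<^sub>v coords (wedge v w)"
proof -
  let ?P = "skew_entry (pfaffian_adjoint u)"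
  obtain k l where kl: "k < 6" "l < 6" "v $ k * w $ l - v $ l * w $ k \<noteq> 0"
    using coords_wedge_nonzeroE[OF nz] by blast
  have "pfaffian_adjoint u $ n = ?P k l / (v $ k * w $ l - v $ l * w $ k) * coords (wedge v w) $ n" if n: "n < 15" for n
  proof -
    have "index_pairs ! n \<in> set index_pairs" using n by (intro nth_mem) (simp add: index_pairs_eq)
    then obtain i j where ij: "index_pairs ! n = (i, j)" "i < j" "j < 6"
      by (auto simp: index_pairs_eq)
    have "distinct index_pairs" "length index_pairs = 15" by (simp_all add: index_pairs_eq)
    then have "pair_index i j = n"
      using index_pairs_nth[OF ij(2,3)] ij(1) n by (metis nth_eq_iff_index_eq)
    then have P: "pfaffian_adjoint u $ n = ?P i j" using ij(2) by (simp add: skew_entry_def)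
    have W: "coords (wedge v w) $ n = v $ i * w $ j - v $ j * w $ i"
      using n ij by (simp add: coords_def wedge_index)
    have i6: "i < 6" using ij by simp
    have s: "?P j l = - ?P l j" "?P l i = - ?P i l" "?P l k = - ?P k l"
      by (rule skew_entry_swap)+
    note H = skew_entry_plucker[OF k(1) i6 ij(3) kl(1)] skew_entry_plucker[OF k(1) i6 ij(3) kl(2)]
      skew_entry_plucker[OF k(2) ij(3) kl(1,2)] skew_entry_plucker[OF k(2) kl(1,2) i6]
    have "?P i j * (v $ k * w $ l - v $ l * w $ k) - ?P k l * (v $ i * w $ j - v $ j * w $ i)
      = (?P i j * v $ k + ?P j k * v $ i + ?P k i * v $ j) * w $ l
      - (?P i j * v $ l + ?P j l * v $ i + ?P l i * v $ j) * w $ k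
      - v $ i * (?P j k * w $ l + ?P k l * w $ j + ?P l j * w $ k)
      + v $ j * (?P k l * w $ i + ?P l i * w $ k + ?P i k * w $ l)"
      using skew_entry_swap[of "pfaffian_adjoint u" k i] skew_entry_swap[of "pfaffian_adjoint u" j l]
      by (simp add: algebra_simps)
    also have "\<dots> = 0" by (simp only: H) simp
    finally show ?thesis using kl(3) unfolding P W by (simp add: field_simps)
  qed
  then have "pfaffian_adjoint u = (?P k l / (v $ k * w $ l - v $ l * w $ k)) \<cdot>\<^sub>v coords (wedge v w)"
    by (intro eq_vecI) auto
  then show ?thesis by blast
qed

lemma cubic_deriv_eq_scalar_prod:
  assumes "i < 5" shows "cubic_deriv a i = form_coords (unit_vec 5 i) \<bullet> pfaffian_adjoint (form_coords a)"
  using less_5_cases[OF assms]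
  by (elim disjE) (simp_all add: scalar_prod_15[OF pfaffian_adjoint_carrier] sum_lessThan_15 cubic_deriv_def
      pfaffian_adjoint_index form_coords_index algebra_simps power2_eq_square)

text \<open>The adjoint of such a form is a multiple of the bivector of \<open>v\<close> and
  \<open>w\<close>. The derivatives of the cubic are the pairings of the five basis forms with the
  adjoint, so isotropy makes them all vanish and smoothness gives \<open>a = 0\<close>.\<close>

lemma no_common_killer:
  fixes a :: "'k::field_char_0 vec"
  assumes a: "a \<in> carrier_vec 5" and vw: "v \<in> carrier_vec 6" "w \<in> carrier_vec 6"
    and k: "skew_apply (form_coords a) v = 0\<^sub>v 6" "skew_apply (form_coords a) w = 0\<^sub>v 6"
    and nz: "coords (wedge v w) \<noteq> 0\<^sub>v 15" and iso: "isotropic v w"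
  shows "a = 0\<^sub>v 5"
proof (rule cubic_smooth[OF a])
  fix i :: nat assume i: "i < 5"
  obtain c where c: "pfaffian_adjoint (form_coords a) = c \<cdot>\<^sub>v coords (wedge v w)"
    using pfaffian_adjoint_if_two_kernel_vectors[OF k nz] by blast
  have "form_coords (unit_vec 5 i) \<bullet> coords (wedge v w) = 0"
    using iso unfolding isotropic_def scalar_prod_coords_wedge[OF vw] by auto
  then show "cubic_deriv a i = 0"
    unfolding cubic_deriv_eq_scalar_prod[OF i] c by simp
qed

definition upper :: "'k vec \<Rightarrow> 'k v3" where "upper v = (v $ 0, v $ 1, v $ 2)"
definition lower :: "'k vec \<Rightarrow> 'k v3" where "lower v = (v $ 3, v $ 4, v $ 5)"

lemma kills_iff:
  "kills (x0, x1, x2) y1 y2 (upper v) (lower v) \<longleftrightarrow>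
    skew_apply (form_coords (vec 5 (\<lambda>i. [x0, x1, x2, y1, y2] ! i))) v = 0\<^sub>v 6"
proof -
  let ?w = "skew_apply (form_coords (vec 5 (\<lambda>i. [x0, x1, x2, y1, y2] ! i))) v"
  have "?w = 0\<^sub>v 6 \<longleftrightarrow> ?w $ 0 = 0 \<and> ?w $ 1 = 0 \<and> ?w $ 2 = 0 \<and> ?w $ 3 = 0 \<and> ?w $ 4 = 0 \<and> ?w $ 5 = 0"
    by (auto intro!: vec_6_eqI)
  also have "\<dots> \<longleftrightarrow> sm (x0, x1, x2) (lower v) + cr (y1, y2, 0) (upper v) = 0 \<and>
      sm (x0, x1, x2) (upper v) - cr (- y1, y2, 0) (lower v) = 0"
  proof -
    have e: "?w $ 0 = fst (sm (x0, x1, x2) (lower v) + cr (y1, y2, 0) (upper v))"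
      "?w $ 1 = fst (snd (sm (x0, x1, x2) (lower v) + cr (y1, y2, 0) (upper v)))"
      "?w $ 2 = snd (snd (sm (x0, x1, x2) (lower v) + cr (y1, y2, 0) (upper v)))"
      "?w $ 3 = - fst (sm (x0, x1, x2) (upper v) - cr (- y1, y2, 0) (lower v))"
      "?w $ 4 = - fst (snd (sm (x0, x1, x2) (upper v) - cr (- y1, y2, 0) (lower v)))"
      "?w $ 5 = - snd (snd (sm (x0, x1, x2) (upper v) - cr (- y1, y2, 0) (lower v)))"
      by (simp_all add: skew_apply_index form_coords_index upper_def lower_def v3_simps algebra_simps)
    show ?thesis unfolding e by (auto simp: v3_zero prod_eq_iff)
  qed
  also have "\<dots> \<longleftrightarrow> kills (x0, x1, x2) y1 y2 (upper v) (lower v)"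
    by (simp add: kills_def eq_neg_iff_add_eq_0)
  finally show ?thesis ..
qed

lemma isotropic_v3:
  assumes "v \<in> carrier_vec 6" "w \<in> carrier_vec 6" and iso: "isotropic v w"
  shows "sm (upper v) (lower w) = sm (lower v) (upper w)"
    "fst (cr (upper v) (upper w)) = fst (cr (lower v) (lower w))"
    "fst (snd (cr (upper v) (upper w))) = - fst (snd (cr (lower v) (lower w)))"
proof -
  let ?b = "\<lambda>i. v \<bullet> skew_apply (form_coords (unit_vec 5 i)) w"
  have z: "?b i = 0" for i using iso by (simp add: isotropic_def)
  let ?s = "sm (upper v) (lower w) - sm (lower v) (upper w)"
  have "fst ?s = ?b 0" "fst (snd ?s) = ?b 1" "snd (snd ?s) = ?b 2"
    "fst (cr (lower v) (lower w)) - fst (cr (upper v) (upper w)) = ?b 3"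
    "fst (snd (cr (upper v) (upper w))) + fst (snd (cr (lower v) (lower w))) = - ?b 4"
    unfolding scalar_prod_6[OF assms(1) skew_apply_carrier]
    by (simp_all add: skew_apply_index form_coords_index upper_def lower_def v3_simps algebra_simps)
  note e = this[unfolded z]
  have "?s = 0" using e(1-3) by (simp add: prod_eq_iff v3_zero)
  then show "sm (upper v) (lower w) = sm (lower v) (upper w)" by simp
  show "fst (cr (upper v) (upper w)) = fst (cr (lower v) (lower w))"
    "fst (snd (cr (upper v) (upper w))) = - fst (snd (cr (lower v) (lower w)))"
    using e(4,5) by (simp_all add: eq_neg_iff_add_eq_0)
qed

text \<open>The values of the five basis forms on \<open>x\<close> are orthogonal to the independent
  vectors \<open>v\<close> and \<open>w\<close>; they lie in a space of dimension four and are
  dependent.\<close>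

lemma killer_exists:
  fixes v w x :: "'k::field vec"
  assumes vw: "v \<in> carrier_vec 6" "w \<in> carrier_vec 6" and x: "x \<in> carrier_vec 6"
    and nz: "coords (wedge v w) \<noteq> 0\<^sub>v 15" and iso: "isotropic v x" "isotropic w x"
  shows "\<exists>a. a \<in> carrier_vec 5 \<and> a \<noteq> 0\<^sub>v 5 \<and> skew_apply (form_coords a) x = 0\<^sub>v 6"
proof -
  obtain i j where ij: "i < 6" "j < 6" "v $ i * w $ j - v $ j * w $ i \<noteq> 0"
    using coords_wedge_nonzeroE[OF nz] by blast
  have "i \<noteq> j" using ij(3) by auto
  obtain ks where ks: "set ks = {..<6} - {i, j}" "distinct ks"
    using finite_distinct_list[of "{..<6} - {i, j}"] by auto
  have "length ks = card ({..<6} - {i, j})" using ks distinct_card by metis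
  also have "\<dots> = 4" using ij(1,2) \<open>i \<noteq> j\<close> by (subst card_Diff_subset) auto
  finally have lks: "length ks = 4" .
  \<comment> \<open>Four equations, one for each coordinate other than \<open>i\<close> and
    \<open>j\<close>, in five unknowns. The zero last row makes the matrix square, so that its
    determinant vanishes.\<close>
  define A where "A = mat 5 5 (\<lambda>(r, c). if r < 4 then skew_apply (form_coords (unit_vec 5 c)) x $ (ks ! r) else 0)"
  have A: "A \<in> carrier_mat 5 5" by (simp add: A_def)
  have AT: "A\<^sup>T \<in> carrier_mat 5 5" using A by simp
  have "A\<^sup>T *\<^sub>v unit_vec 5 4 = 0\<^sub>v 5"
    unfolding mult_mat_unit_vec[OF AT, of 4, simplified] by (auto simp: A_def)
  moreover have "(unit_vec 5 4 :: 'k vec) \<noteq> 0\<^sub>v 5"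
  proof
    assume "(unit_vec 5 4 :: 'k vec) = 0\<^sub>v 5"
    then have "(unit_vec 5 4 :: 'k vec) $ 4 = 0" by simp
    then show False by simp
  qed
  ultimately have "det A\<^sup>T = 0" using det_0_iff_vec_prod_zero_field[OF AT] unit_vec_carrier by blast
  then have "det A = 0" using det_transpose[OF A] by simp
  then obtain a where a: "a \<in> carrier_vec 5" "a \<noteq> 0\<^sub>v 5" "A *\<^sub>v a = 0\<^sub>v 5"
    using det_0_iff_vec_prod_zero_field[OF A] by blast
  have lin: "skew_apply (form_coords a) x $ r = (\<Sum>c<5. skew_apply (form_coords (unit_vec 5 c)) x $ r * a $ c)" if "r < 6" for r
    using less_6_cases[OF that]
    by (elim disjE) (simp_all add: sum_lessThan_5 skew_apply_index form_coords_index algebra_simps)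
  let ?y = "skew_apply (form_coords a) x"
  have y0: "?y $ (ks ! r) = 0" if r: "r < 4" for r
  proof -
    have "ks ! r < 6" using ks(1) lks r nth_mem by fastforce
    moreover have "(A *\<^sub>v a) $ r = (\<Sum>c<5. skew_apply (form_coords (unit_vec 5 c)) x $ (ks ! r) * a $ c)"
      using r a(1) A by (auto simp: A_def scalar_prod_def atLeast0LessThan intro!: sum.cong)
    ultimately show ?thesis using lin a(3) r by simp
  qed
  have y1: "?y $ r = 0" if "r < 6" "r \<noteq> i" "r \<noteq> j" for r
  proof -
    have "r \<in> set ks" using that ks by auto
    then show ?thesis using y0 lks by (metis in_set_conv_nth)
  qed
  have sp: "z $ i * ?y $ i + z $ j * ?y $ j = 0" if z: "z \<in> carrier_vec 6" "isotropic z x" for z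
  proof -
    have "z \<bullet> ?y = (\<Sum>r<6. z $ r * ?y $ r)" by (simp add: scalar_prod_def atLeast0LessThan)
    also have "\<dots> = (\<Sum>r\<in>{i, j}. z $ r * ?y $ r)"
      by (rule sum.mono_neutral_right) (use ij y1 in auto)
    finally show ?thesis using z(2) a(1) \<open>i \<noteq> j\<close> by (simp add: isotropic_def)
  qed
  have e: "v $ i * ?y $ i + v $ j * ?y $ j = 0" "w $ i * ?y $ i + w $ j * ?y $ j = 0"
    using sp vw iso by blast+
  have "(v $ i * w $ j - v $ j * w $ i) * ?y $ i = (v $ i * ?y $ i + v $ j * ?y $ j) * w $ j - (w $ i * ?y $ i + w $ j * ?y $ j) * v $ j"
    "(v $ i * w $ j - v $ j * w $ i) * ?y $ j = (w $ i * ?y $ i + w $ j * ?y $ j) * v $ i - (v $ i * ?y $ i + v $ j * ?y $ j) * w $ i"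
    by (simp_all add: algebra_simps)
  then have "?y $ i = 0" "?y $ j = 0" using ij(3) unfolding e by simp_all
  then have "?y $ r = 0" if "r < 6" for r using y1 that by (cases "r = i \<or> r = j") auto
  then have "?y = 0\<^sub>v 6" by (intro eq_vecI) simp_all
  with a show ?thesis by blast
qed

text \<open>Take a vector of the plane that is not bad: \<open>killer_exists\<close> provides one
  form annihilating it, and a second independent one would make it bad.\<close>

lemma good_vector_exists:
  fixes v w :: "'k::{alg_closed_field, field_char_0} vec"
  assumes vw: "v \<in> carrier_vec 6" "w \<in> carrier_vec 6"
    and nz: "coords (wedge v w) \<noteq> 0\<^sub>v 15" and iso: "isotropic v w"
  shows "\<exists>s t a. (s \<noteq> 0 \<or> t \<noteq> 0) \<and> a \<in> carrier_vec 5 \<and> a \<noteq> 0\<^sub>v 5 \<and>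
    skew_apply (form_coords a) (s \<cdot>\<^sub>v v + t \<cdot>\<^sub>v w) = 0\<^sub>v 6 \<and>
    (\<forall>b\<in>carrier_vec 5. skew_apply (form_coords b) (s \<cdot>\<^sub>v v + t \<cdot>\<^sub>v w) = 0\<^sub>v 6 \<longrightarrow> (\<exists>c. b = c \<cdot>\<^sub>v a))"
proof -
  let ?c = "\<lambda>s t. s \<cdot>\<^sub>v v + t \<cdot>\<^sub>v w"
  have comb: "upper (?c s t) = sc s (upper v) + sc t (upper w)" "lower (?c s t) = sc s (lower v) + sc t (lower w)" for s t
    using vw by (simp_all add: upper_def lower_def v3_simps)
  let ?V = "\<lambda>x y1 y2. vec 5 (\<lambda>i. [fst x, fst (snd x), snd (snd x), y1, y2] ! i)"
  have kills: "kills x y1 y2 (upper z) (lower z) \<longleftrightarrow> skew_apply (form_coords (?V x y1 y2)) z = 0\<^sub>v 6" for x :: "'k v3" and y1 y2 z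
    by (cases x) (simp add: kills_iff)
  have V0: "x = 0 \<and> y1 = 0 \<and> y2 = 0" if V: "?V x y1 y2 = 0\<^sub>v 5" for x :: "'k v3" and y1 y2
  proof -
    have "?V x y1 y2 $ i = 0" if "i < 5" for i using V that by simp
    from this[of 0] this[of 1] this[of 2] this[of 3] this[of 4] show ?thesis by (cases x) (simp add: v3_zero)
  qed
  have "\<exists>s t. (s \<noteq> 0 \<or> t \<noteq> 0) \<and> \<not> bad (sc s (upper v) + sc t (upper w)) (sc s (lower v) + sc t (lower w))"
  proof (rule plane_not_all_bad)
    fix s t assume st: "sc s (upper v) + sc t (upper w) = 0" "sc s (lower v) + sc t (lower w) = 0"
    then have "s * v $ i + t * w $ i = 0" if "i < 6" for i
      using less_6_cases[OF that] by (auto simp: upper_def lower_def v3_simps)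
    moreover obtain i j where ij: "i < 6" "j < 6" "v $ i * w $ j - v $ j * w $ i \<noteq> 0"
      using coords_wedge_nonzeroE[OF nz] by blast
    ultimately have e: "s * v $ i + t * w $ i = 0" "s * v $ j + t * w $ j = 0" by blast+
    have "s * (v $ i * w $ j - v $ j * w $ i) = (s * v $ i + t * w $ i) * w $ j - (s * v $ j + t * w $ j) * w $ i"
      "t * (v $ i * w $ j - v $ j * w $ i) = (s * v $ j + t * w $ j) * v $ i - (s * v $ i + t * w $ i) * v $ j"
      by (simp_all add: algebra_simps)
    then show "s = 0 \<and> t = 0" using ij(3) unfolding e by simp
  next
    fix x y1 y2 assume "kills x y1 y2 (upper v) (lower v)" "kills x y1 y2 (upper w) (lower w)"
    then have "?V x y1 y2 = 0\<^sub>v 5" unfolding kills by (intro no_common_killer[OF _ vw _ _ nz iso]) auto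
    then show "x = 0 \<and> y1 = 0 \<and> y2 = 0" by (rule V0)
  qed (rule isotropic_v3[OF vw iso])+
  then obtain s t where st: "s \<noteq> 0 \<or> t \<noteq> 0" and nb: "\<not> bad (upper (?c s t)) (lower (?c s t))"
    unfolding comb by blast
  have vc: "?c s t \<in> carrier_vec 6" using vw by simp
  have "isotropic v (?c s t)" "isotropic w (?c s t)"
    using vw iso by (auto intro!: isotropic_combine isotropic_self simp: isotropic_commute[of w v])
  then obtain a where a: "a \<in> carrier_vec 5" "a \<noteq> 0\<^sub>v 5" "skew_apply (form_coords a) (?c s t) = 0\<^sub>v 6"
    using killer_exists[OF vw vc nz] by blast
  have "\<exists>c. b = c \<cdot>\<^sub>v a" if b: "b \<in> carrier_vec 5" "skew_apply (form_coords b) (?c s t) = 0\<^sub>v 6" for b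
  proof -
    have eta: "?V (z $ 0, z $ 1, z $ 2) (z $ 3) (z $ 4) = z" if "z \<in> carrier_vec 5" for z
      by (rule vec_5_eqI) (use that in simp_all)
    have k: "kills (a $ 0, a $ 1, a $ 2) (a $ 3) (a $ 4) (upper (?c s t)) (lower (?c s t))"
      "kills (b $ 0, b $ 1, b $ 2) (b $ 3) (b $ 4) (upper (?c s t)) (lower (?c s t))"
      unfolding kills eta[OF a(1)] eta[OF b(1)] using a(3) b(2) .
    then obtain c d where cd: "sc c (a $ 0, a $ 1, a $ 2) + sc d (b $ 0, b $ 1, b $ 2) = 0"
      "c * a $ 3 + d * b $ 3 = 0" "c * a $ 4 + d * b $ 4 = 0" "c \<noteq> 0 \<or> d \<noteq> 0"
      using nb unfolding bad_def by blast
    have e: "c * a $ i + d * b $ i = 0" if "i < 5" for i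
      using less_5_cases[OF that] cd by (auto simp: v3_simps)
    have d: "d \<noteq> 0"
    proof
      assume "d = 0"
      then have "a $ i = 0" if "i < 5" for i using e[OF that] cd(4) by simp
      then have "a = 0\<^sub>v 5" using a(1) by auto
      with a(2) show False by simp
    qed
    have "b = (- c / d) \<cdot>\<^sub>v a"
    proof (rule eq_vecI)
      fix i assume "i < dim_vec ((- c / d) \<cdot>\<^sub>v a)"
      then have i: "i < 5" using a(1) by simp
      have "d * b $ i = - (c * a $ i)" using e[OF i] by (simp add: eq_neg_iff_add_eq_0 add.commute)
      then show "b $ i = ((- c / d) \<cdot>\<^sub>v a) $ i" using d i a(1) by (simp add: field_simps)
    qed (use a(1) b(1) in simp)
    then show ?thesis by blast
  qed
  with st a show ?thesis by blast
qed

section \<open>Recovering the plane from one of its vectors\<close>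

text \<open>The rows of the chart matrix at \<open>v\<close> are linear equations for the vectors \<open>w\<close> for which \<open>v \<and> w\<close> lies in the
  threefold, together with two normalising coordinates. By Cramer's rule, a second vector of the
  plane through \<open>v\<close> and the form that annihilates \<open>v\<close> are polynomials in \<open>v\<close>.\<close>

definition chart_mat :: "nat \<Rightarrow> nat \<Rightarrow> nat \<Rightarrow> 'k::field vec \<Rightarrow> 'k mat" where
  "chart_mat m i j v = mat 6 6 (\<lambda>(r, c). if r = m then (if c = i then 1 else 0)
     else if r = 5 then (if c = j then 1 else 0)
     else skew_apply (form_coords (unit_vec 5 r)) v $ c)"

definition partner :: "nat \<Rightarrow> nat \<Rightarrow> nat \<Rightarrow> 'k::field vec \<Rightarrow> 'k vec" where
  "partner m i j v = vec 6 (\<lambda>r. adj_mat (chart_mat m i j v) $$ (r, m))"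

definition killer :: "nat \<Rightarrow> nat \<Rightarrow> nat \<Rightarrow> 'k::field vec \<Rightarrow> 'k vec" where
  "killer m i j v = vec 5 (\<lambda>k. if k = m then det (chart_mat m i j v)
     else - (\<Sum>l<6. skew_apply (form_coords (unit_vec 5 m)) v $ l * adj_mat (chart_mat m i j v) $$ (l, k)))"

lemma chart_mat_carrier [simp]: "chart_mat m i j v \<in> carrier_mat 6 6"
  by (simp add: chart_mat_def)

lemma partner_carrier [simp]: "partner m i j v \<in> carrier_vec 6"
  by (simp add: partner_def)

lemma killer_carrier [simp]: "killer m i j v \<in> carrier_vec 5"
  by (simp add: killer_def)

lemma skew_apply_form_coords_sum:
  assumes "l < 6"
  shows "skew_apply (form_coords a) v $ l = (\<Sum>k<5. a $ k * skew_apply (form_coords (unit_vec 5 k)) v $ l)"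
  using less_6_cases[OF assms]
  by (elim disjE) (simp_all add: sum_lessThan_5 skew_apply_index form_coords_index algebra_simps)

lemma dim_partner [simp]: "dim_vec (partner m i j v) = 6"
  by (simp add: partner_def)

lemma scalar_prod_form_coords_sum:
  assumes "w \<in> carrier_vec 6"
  shows "w \<bullet> skew_apply (form_coords a) v = (\<Sum>k<5. a $ k * (w \<bullet> skew_apply (form_coords (unit_vec 5 k)) v))"
  unfolding scalar_prod_6[OF assms skew_apply_carrier]
  by (simp add: sum_lessThan_5 skew_apply_index form_coords_index algebra_simps)

lemma chart_mat_mult:
  assumes "x \<in> carrier_vec 6" "i < 6" "j < 6" "r < 6"
  shows "(chart_mat m i j v *\<^sub>v x) $ r =
    (if r = m then x $ i else if r = 5 then x $ j else x \<bullet> skew_apply (form_coords (unit_vec 5 r)) v)"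
proof -
  have "(chart_mat m i j v *\<^sub>v x) $ r = (\<Sum>c<6. chart_mat m i j v $$ (r, c) * x $ c)"
    using assms by (simp add: scalar_prod_def atLeast0LessThan chart_mat_def)
  also have "\<dots> = (if r = m then x $ i else if r = 5 then x $ j else x \<bullet> skew_apply (form_coords (unit_vec 5 r)) v)"
  proof -
    have d: "(\<Sum>c<6. (if c = l then 1 else 0) * x $ c) = x $ l" if "l < 6" for l
      using that by (simp add: if_distrib[of "\<lambda>y. y * _"] cong: if_cong)
    show ?thesis using assms d
      by (auto simp: chart_mat_def scalar_prod_def atLeast0LessThan mult.commute intro!: sum.cong)
  qed
  finally show ?thesis .
qed

lemma isotropic_iff_unit:
  assumes "w \<in> carrier_vec 6"
  shows "isotropic w v \<longleftrightarrow> (\<forall>k<5. w \<bullet> skew_apply (form_coords (unit_vec 5 k)) v = 0)"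
proof
  assume z: "\<forall>k<5. w \<bullet> skew_apply (form_coords (unit_vec 5 k)) v = 0"
  show "isotropic w v"
    unfolding isotropic_def by (subst scalar_prod_form_coords_sum[OF assms]) (simp add: z)
qed (simp add: isotropic_def)

text \<open>\<open>m\<close> is the equation implied by the others, \<open>i\<close> and
  \<open>j\<close> are the normalising coordinates. A nonzero determinant makes \<open>b\<close> the
  only form annihilating \<open>v\<close> up to a factor, and the plane of X through
  \<open>v\<close> unique.\<close>

locale chart =
  fixes m i j :: nat and v b :: "'k::field vec"
  assumes m: "m < 5" and i: "i < 6" and j: "j < 6" and v: "v \<in> carrier_vec 6"
    and det: "det (chart_mat m i j v) \<noteq> 0" and vj: "v $ j \<noteq> 0"
    and b: "b \<in> carrier_vec 5" "b \<noteq> 0\<^sub>v 5" "skew_apply (form_coords b) v = 0\<^sub>v 6"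
begin

abbreviation "N \<equiv> chart_mat m i j v"

lemma kernel: "x \<in> carrier_vec 6 \<Longrightarrow> N *\<^sub>v x = 0\<^sub>v 6 \<Longrightarrow> x = 0\<^sub>v 6"
  using det det_0_iff_vec_prod_zero_field[OF chart_mat_carrier] by blast

lemma relation:
  assumes "l < 6"
  shows "b $ m * skew_apply (form_coords (unit_vec 5 m)) v $ l =
    - (\<Sum>r<6. (if r < 5 \<and> r \<noteq> m then b $ r else 0) * N $$ (r, l))"
proof -
  have "0 = (\<Sum>k<5. b $ k * skew_apply (form_coords (unit_vec 5 k)) v $ l)"
    using skew_apply_form_coords_sum[OF assms, of b v] b(3) assms by simp
  also have "\<dots> = b $ m * skew_apply (form_coords (unit_vec 5 m)) v $ l
      + (\<Sum>k\<in>{..<5} - {m}. b $ k * skew_apply (form_coords (unit_vec 5 k)) v $ l)"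
    using m by (subst sum.remove[of _ m]) auto
  also have "(\<Sum>k\<in>{..<5} - {m}. b $ k * skew_apply (form_coords (unit_vec 5 k)) v $ l)
      = (\<Sum>r<6. (if r < 5 \<and> r \<noteq> m then b $ r else 0) * N $$ (r, l))"
    by (rule sum.mono_neutral_cong_left) (use assms in \<open>auto simp: chart_mat_def\<close>)
  finally show ?thesis by (simp add: eq_neg_iff_add_eq_0)
qed

text \<open>Otherwise the relation that \<open>b\<close> gives among the five equations would not
  involve equation \<open>m\<close>, and rows of the chart matrix would be dependent.\<close>

lemma b_m: "b $ m \<noteq> 0"
proof
  assume z: "b $ m = 0"
  define c where "c = vec 6 (\<lambda>r. if r < 5 \<and> r \<noteq> m then b $ r else 0)"
  have NT: "N\<^sup>T \<in> carrier_mat 6 6" by simp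
  have "N\<^sup>T *\<^sub>v c = 0\<^sub>v 6"
  proof (rule eq_vecI)
    fix l assume "l < dim_vec (0\<^sub>v 6 :: 'k vec)"
    then have l: "l < 6" by simp
    have "(N\<^sup>T *\<^sub>v c) $ l = (\<Sum>r<6. (if r < 5 \<and> r \<noteq> m then b $ r else 0) * N $$ (r, l))"
      using l by (simp add: c_def scalar_prod_def atLeast0LessThan chart_mat_def mult.commute)
    then show "(N\<^sup>T *\<^sub>v c) $ l = 0\<^sub>v 6 $ l" using relation[OF l] z l by simp
  qed (simp add: chart_mat_def)
  moreover have "det N\<^sup>T \<noteq> 0" using det det_transpose[OF chart_mat_carrier] by metis
  ultimately have "c = 0\<^sub>v 6" using det_0_iff_vec_prod_zero_field[OF NT] vec_carrier unfolding c_def by blast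
  have "b $ r = 0" if "r < 5" for r
  proof (cases "r = m")
    case False
    have "c $ r = 0" using \<open>c = 0\<^sub>v 6\<close> that by simp
    then show ?thesis using False that by (simp add: c_def)
  qed (use z in simp)
  then have "b = 0\<^sub>v 5" using b(1) by auto
  with b(2) show False by simp
qed

lemma isotropicI:
  assumes w: "w \<in> carrier_vec 6" and z: "\<And>k. k < 5 \<Longrightarrow> k \<noteq> m \<Longrightarrow> w \<bullet> skew_apply (form_coords (unit_vec 5 k)) v = 0"
  shows "isotropic w v"
proof -
  let ?C = "\<lambda>k. w \<bullet> skew_apply (form_coords (unit_vec 5 k)) v"
  have "0 = w \<bullet> skew_apply (form_coords b) v" using b(3) w by simp
  also have "\<dots> = (\<Sum>k<5. b $ k * ?C k)"
    by (rule scalar_prod_form_coords_sum[OF w])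
  also have "\<dots> = b $ m * ?C m" using m z by (subst sum.remove[of _ m]) auto
  finally have "?C m = 0" using b_m by simp
  then show ?thesis unfolding isotropic_iff_unit[OF w] using z by metis
qed

lemma mult_partner: "N *\<^sub>v partner m i j v = det N \<cdot>\<^sub>v unit_vec 6 m"
proof -
  have A: "adj_mat N \<in> carrier_mat 6 6" by (rule adj_mat[OF chart_mat_carrier])
  have "partner m i j v = col (adj_mat N) m" using A m by (auto simp: partner_def)
  moreover have "N *\<^sub>v col (adj_mat N) m = col (N * adj_mat N) m"
    using m A by (intro col_mult2[symmetric, of _ 6 6 _ 6]) auto
  ultimately have "N *\<^sub>v partner m i j v = col (det N \<cdot>\<^sub>m 1\<^sub>m 6) m"
    using adj_mat(2)[OF chart_mat_carrier, of m i j v] by simp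
  then show ?thesis using m by auto
qed

lemma partner_i: "partner m i j v $ i = det N" and partner_j: "partner m i j v $ j = 0"
  and isotropic_partner: "isotropic (partner m i j v) v"
proof -
  have e: "(det N \<cdot>\<^sub>v unit_vec 6 m) $ r = (if r = m then partner m i j v $ i else if r = 5 then partner m i j v $ j
      else partner m i j v \<bullet> skew_apply (form_coords (unit_vec 5 r)) v)" if "r < 6" for r
    using chart_mat_mult[OF partner_carrier i j that] mult_partner by metis
  show "partner m i j v $ i = det N" using e[of m] m by simp
  show "partner m i j v $ j = 0" using e[of 5] m by simp
  show "isotropic (partner m i j v) v"
  proof (rule isotropicI)
    fix k assume "k < 5" "k \<noteq> m"
    then show "partner m i j v \<bullet> skew_apply (form_coords (unit_vec 5 k)) v = 0" using e[of k] m by simp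
  qed simp
qed

lemma wedge_partner: "coords (wedge v (partner m i j v)) \<noteq> 0\<^sub>v 15"
  using coords_wedge_eq_zeroD[of v "partner m i j v" i j] i j det vj partner_i partner_j by auto

text \<open>Since the partner vanishes at \<open>j\<close> and not at \<open>i\<close>, suitable
  multiples of \<open>v\<close> and the partner clear both normalising coordinates of
  \<open>w\<close>; what remains satisfies all equations of the chart matrix and is zero.\<close>

lemma isotropic_in_span:
  assumes w: "w \<in> carrier_vec 6" "isotropic w v"
  shows "\<exists>c d. w = c \<cdot>\<^sub>v v + d \<cdot>\<^sub>v partner m i j v"
proof -
  let ?V = "partner m i j v"
  define c where "c = w $ j / v $ j"
  define d where "d = (w $ i - c * v $ i) / det N"
  define x where "x = w - (c \<cdot>\<^sub>v v + d \<cdot>\<^sub>v ?V)"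
  have x: "x \<in> carrier_vec 6" using w v by (simp add: x_def)
  have "N *\<^sub>v x = 0\<^sub>v 6"
  proof (rule eq_vecI)
    fix r assume "r < dim_vec (0\<^sub>v 6 :: 'k vec)"
    then have r: "r < 6" by simp
    have ort: "x \<bullet> skew_apply (form_coords (unit_vec 5 k)) v = 0" for k
    proof -
      have "w \<bullet> skew_apply (form_coords (unit_vec 5 k)) v = 0" "v \<bullet> skew_apply (form_coords (unit_vec 5 k)) v = 0"
        "?V \<bullet> skew_apply (form_coords (unit_vec 5 k)) v = 0"
        using w(2) isotropic_self[OF v] isotropic_partner by (simp_all add: isotropic_def)
      then show ?thesis using w v
        by (simp add: x_def minus_scalar_prod_distrib[of _ 6] add_scalar_prod_distrib[of _ 6])
    qed
    have "x $ i = 0" "x $ j = 0"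
      using i j w(1) v partner_i partner_j det vj by (simp_all add: x_def c_def d_def field_simps)
    then show "(N *\<^sub>v x) $ r = 0\<^sub>v 6 $ r" using chart_mat_mult[OF x i j r, of m v] ort r by simp
  qed (simp add: chart_mat_def)
  then have "x = 0\<^sub>v 6" by (rule kernel[OF x])
  have "w = c \<cdot>\<^sub>v v + d \<cdot>\<^sub>v ?V"
  proof (rule eq_vecI)
    fix r assume "r < dim_vec (c \<cdot>\<^sub>v v + d \<cdot>\<^sub>v ?V)"
    then have r: "r < 6" by (simp add: partner_def)
    have "x $ r = 0" using \<open>x = 0\<^sub>v 6\<close> r by simp
    then show "w $ r = (c \<cdot>\<^sub>v v + d \<cdot>\<^sub>v ?V) $ r" using r w(1) v by (simp add: x_def)
  qed (use w(1) in \<open>simp add: partner_def\<close>)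
  then show ?thesis by blast
qed

lemma coords_wedge_partner:
  assumes xy: "x \<in> carrier_vec 6" "y \<in> carrier_vec 6" "isotropic x v" "isotropic y v"
  shows "\<exists>c. coords (wedge x y) = c \<cdot>\<^sub>v coords (wedge v (partner m i j v))"
proof -
  obtain c d c' d' where "x = c \<cdot>\<^sub>v v + d \<cdot>\<^sub>v partner m i j v" "y = c' \<cdot>\<^sub>v v + d' \<cdot>\<^sub>v partner m i j v"
    using isotropic_in_span xy by metis
  then show ?thesis using coords_wedge_combine[OF v partner_carrier] by metis
qed

text \<open>Up to the factor \<open>b $ m\<close>, equation \<open>m\<close> is the combination of
  the other rows with coefficients \<open>- b $ k\<close>; multiplication by the adjugate reads
  these coefficients off.\<close>

lemma killer_eq: "killer m i j v = (det N / b $ m) \<cdot>\<^sub>v b"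
proof (rule eq_vecI)
  fix k assume "k < dim_vec ((det N / b $ m) \<cdot>\<^sub>v b)"
  then have k: "k < 5" using b(1) by simp
  have A: "adj_mat N \<in> carrier_mat 6 6" by (rule adj_mat[OF chart_mat_carrier])
  show "killer m i j v $ k = ((det N / b $ m) \<cdot>\<^sub>v b) $ k"
  proof (cases "k = m")
    case True
    then show ?thesis using k b(1) b_m by (simp add: killer_def)
  next
    case False
    let ?c = "\<lambda>r. if r < 5 \<and> r \<noteq> m then b $ r else 0"
    have NA: "(\<Sum>l<6. N $$ (r, l) * adj_mat N $$ (l, k)) = (if r = k then det N else 0)" if r: "r < 6" for r
    proof -
      have "(\<Sum>l<6. N $$ (r, l) * adj_mat N $$ (l, k)) = (N * adj_mat N) $$ (r, k)"
        using r k A by (simp add: scalar_prod_def atLeast0LessThan chart_mat_def)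
      also have "\<dots> = (det N \<cdot>\<^sub>m 1\<^sub>m 6) $$ (r, k)" by (simp only: adj_mat(2)[OF chart_mat_carrier])
      finally show ?thesis using r k by simp
    qed
    have "b $ m * (\<Sum>l<6. skew_apply (form_coords (unit_vec 5 m)) v $ l * adj_mat N $$ (l, k))
        = (\<Sum>l<6. (b $ m * skew_apply (form_coords (unit_vec 5 m)) v $ l) * adj_mat N $$ (l, k))"
      by (simp add: sum_distrib_left mult_ac)
    also have "\<dots> = (\<Sum>l<6. - (\<Sum>r<6. ?c r * N $$ (r, l)) * adj_mat N $$ (l, k))"
      by (intro sum.cong refl) (simp add: relation)
    also have "\<dots> = - (\<Sum>l<6. \<Sum>r<6. ?c r * (N $$ (r, l) * adj_mat N $$ (l, k)))"
      by (simp add: sum_negf sum_distrib_right sum_distrib_left mult_ac)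
    also have "(\<Sum>l<6. \<Sum>r<6. ?c r * (N $$ (r, l) * adj_mat N $$ (l, k))) = (\<Sum>r<6. ?c r * (\<Sum>l<6. N $$ (r, l) * adj_mat N $$ (l, k)))"
      by (subst sum.swap) (simp only: sum_distrib_left)
    also have "\<dots> = (\<Sum>r<6. if r = k then ?c r * det N else 0)"
      by (intro sum.cong refl) (simp add: NA)
    also have "\<dots> = b $ k * det N" using k False by simp
    finally show ?thesis using k b(1) b_m False by (simp add: killer_def field_simps)
  qed
qed (use b(1) in \<open>simp add: killer_def\<close>)

lemma killer_kills: "skew_apply (form_coords (killer m i j v)) v = 0\<^sub>v 6"
  unfolding killer_eq using b by (auto simp: form_coords_smult skew_apply_linear intro!: eq_vecI)

lemma killer_nonzero: "killer m i j v \<noteq> 0\<^sub>v 5"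
proof
  assume "killer m i j v = 0\<^sub>v 5"
  then have "killer m i j v $ m = 0" using m by simp
  then show False using det m by (simp add: killer_def)
qed

end

text \<open>A left kernel vector \<open>c\<close> of the chart matrix is tested on \<open>v\<close>
  and \<open>w\<close>: this kills its entries at the rows \<open>m\<close> and 5. The remaining
  entries form a form annihilating \<open>v\<close> with zero coefficient at \<open>m\<close>, where
  \<open>a\<close> is nonzero, so it is the zero multiple of \<open>a\<close>.\<close>

lemma chart_exists:
  fixes v w :: "'k::field vec"
  assumes vw: "v \<in> carrier_vec 6" "w \<in> carrier_vec 6" "coords (wedge v w) \<noteq> 0\<^sub>v 15" "isotropic v w"
    and a: "a \<in> carrier_vec 5" "a \<noteq> 0\<^sub>v 5" "skew_apply (form_coords a) v = 0\<^sub>v 6"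
    and unique: "\<And>b. b \<in> carrier_vec 5 \<Longrightarrow> skew_apply (form_coords b) v = 0\<^sub>v 6 \<Longrightarrow> \<exists>c. b = c \<cdot>\<^sub>v a"
  shows "\<exists>m i j. chart m i j v a"
proof -
  obtain m where m: "m < 5" "a $ m \<noteq> 0" using a(1,2) by (metis carrier_vecD eq_vecI index_zero_vec)
  have "v \<noteq> 0\<^sub>v 6" using vw(3) coords_wedge_eq_zeroI[of v w] by auto
  then obtain j where j: "j < 6" "v $ j \<noteq> 0" using vw(1) by (metis carrier_vecD eq_vecI index_zero_vec)
  have "\<exists>i<6. v $ i * w $ j - v $ j * w $ i \<noteq> 0"
  proof (rule ccontr)
    assume "\<not> ?thesis"
    then have e: "v $ j * w $ i = v $ i * w $ j" if "i < 6" for i using that by auto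
    have "coords (wedge v w) = 0\<^sub>v 15"
    proof (rule coords_wedge_eq_zeroI)
      fix r c assume rc: "r < (6::nat)" "c < (6::nat)"
      have "v $ j * (v $ r * w $ c) = v $ r * (v $ j * w $ c)" by (rule mult.left_commute)
      also have "\<dots> = v $ c * (v $ r * w $ j)" unfolding e[OF rc(2)] by (rule mult.left_commute)
      also have "\<dots> = v $ j * (v $ c * w $ r)" unfolding e[OF rc(1), symmetric] by (rule mult.left_commute)
      finally have "v $ j * (v $ r * w $ c) = v $ j * (v $ c * w $ r)" .
      then show "v $ r * w $ c = v $ c * w $ r" using j by simp
    qed
    with vw(3) show False by simp
  qed
  then obtain i where i: "i < 6" "v $ i * w $ j - v $ j * w $ i \<noteq> 0" by blast
  let ?N = "chart_mat m i j v"
  have NT: "?N\<^sup>T \<in> carrier_mat 6 6" by simp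
  have "det ?N\<^sup>T \<noteq> 0"
  proof
    assume "det ?N\<^sup>T = 0"
    then obtain c where c: "c \<in> carrier_vec 6" "c \<noteq> 0\<^sub>v 6" "?N\<^sup>T *\<^sub>v c = 0\<^sub>v 6"
      using det_0_iff_vec_prod_zero_field[OF NT] by blast
    have dual: "(?N *\<^sub>v x) \<bullet> c = 0" if "x \<in> carrier_vec 6" for x
    proof -
      have "(?N *\<^sub>v x) \<bullet> c = x \<bullet> (?N\<^sup>T *\<^sub>v c)"
        using transpose_vec_mult_scalar[of "?N\<^sup>T" 6 6 c x] that c(1) by (simp add: comm_scalar_prod[of _ 6])
      then show ?thesis using c(3) that by simp
    qed
    have m6: "m < 6" "m \<noteq> 5" using m by auto
    have special: "x $ i * c $ m + x $ j * c $ 5 = 0" if x: "x \<in> carrier_vec 6" "isotropic x v" for x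
    proof -
      have nv: "(?N *\<^sub>v x) $ r = (if r = m then x $ i else if r = 5 then x $ j else 0)" if "r < 6" for r
        using chart_mat_mult[OF x(1) i(1) j(1) that, of m v] x(2) by (simp add: isotropic_def)
      have "0 = (\<Sum>r<6. (?N *\<^sub>v x) $ r * c $ r)"
        using dual[OF x(1)] c(1) by (simp add: scalar_prod_def atLeast0LessThan)
      also have "\<dots> = (\<Sum>r\<in>{m, 5}. (?N *\<^sub>v x) $ r * c $ r)"
        by (rule sum.mono_neutral_right) (use m6 nv in auto)
      also have "\<dots> = x $ i * c $ m + x $ j * c $ 5" using m6 nv by simp
      finally show ?thesis by simp
    qed
    have e: "v $ i * c $ m + v $ j * c $ 5 = 0" "w $ i * c $ m + w $ j * c $ 5 = 0"
      using special[OF vw(1) isotropic_self[OF vw(1)]] special[OF vw(2)] vw isotropic_commute by blast+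
    have "(v $ i * w $ j - v $ j * w $ i) * c $ m = (v $ i * c $ m + v $ j * c $ 5) * w $ j - (w $ i * c $ m + w $ j * c $ 5) * v $ j"
      "(v $ i * w $ j - v $ j * w $ i) * c $ 5 = (w $ i * c $ m + w $ j * c $ 5) * v $ i - (v $ i * c $ m + v $ j * c $ 5) * w $ i"
      by (simp_all add: algebra_simps)
    then have c0: "c $ m = 0" "c $ 5 = 0" using i(2) unfolding e by simp_all
    define b where "b = vec 5 (\<lambda>k. c $ k)"
    have "skew_apply (form_coords b) v = 0\<^sub>v 6"
    proof (rule eq_vecI)
      fix l assume "l < dim_vec (0\<^sub>v 6 :: 'k vec)"
      then have l: "l < 6" by simp
      have "0 = (\<Sum>r<6. ?N $$ (r, l) * c $ r)"
      proof -
        have "(?N\<^sup>T *\<^sub>v c) $ l = (\<Sum>r<6. ?N $$ (r, l) * c $ r)"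
          using l c(1) by (simp add: scalar_prod_def atLeast0LessThan chart_mat_def)
        then show ?thesis using c(3) l by simp
      qed
      also have "\<dots> = (\<Sum>k<5. b $ k * skew_apply (form_coords (unit_vec 5 k)) v $ l)"
        by (rule sum.mono_neutral_cong_right) (use l c0 in \<open>auto simp: b_def chart_mat_def not_less less_Suc_eq eval_nat_numeral\<close>)
      finally have "0 = (\<Sum>k<5. b $ k * skew_apply (form_coords (unit_vec 5 k)) v $ l)" .
      then show "skew_apply (form_coords b) v $ l = 0\<^sub>v 6 $ l"
        by (subst skew_apply_form_coords_sum[OF l]) (simp add: l)
    qed simp
    then obtain d where d: "b = d \<cdot>\<^sub>v a" using unique[of b] by (auto simp: b_def)
    have "b $ m = 0" using c0 m by (simp add: b_def)
    then have "d = 0" using d m a(1) by simp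
    have "c $ k = 0" if "k < 6" for k
    proof (cases "k < 5")
      case True
      have "b $ k = 0" using d \<open>d = 0\<close> True a(1) by simp
      then show ?thesis using True by (simp add: b_def)
    next
      case False
      then have "k = 5" using that by simp
      then show ?thesis using c0 by simp
    qed
    then have "c = 0\<^sub>v 6" using c(1) by auto
    with c(2) show False by simp
  qed
  then have "det ?N \<noteq> 0" using det_transpose[OF chart_mat_carrier] by metis
  then show ?thesis using vw a m i j unfolding chart_def by blast
qed

lemma adj_mat_entry:
  assumes "r < 6" "c < 6"
  shows "adj_mat (chart_mat m i j v) $$ (r, c) = (- 1) ^ (c + r) * det (mat_delete (chart_mat m i j v) c r)"
  using assms by (simp add: adj_mat_def cofactor_def chart_mat_def)

lemma chart_mat_delete_carrier: "mat_delete (chart_mat m i j v) c r \<in> carrier_mat 5 5"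
  using mat_delete_carrier[OF chart_mat_carrier, of m i j v c r] by simp

lemma chart_mat_delete_index:
  "p < 5 \<Longrightarrow> q < 5 \<Longrightarrow> mat_delete (chart_mat m i j v) c r $$ (p, q) =
    chart_mat m i j v $$ (if p < c then p else Suc p, if q < r then q else Suc q)"
  by (simp add: mat_delete_def chart_mat_def)

lemma poly2_chart_mat:
  assumes V: "\<And>l. l < 6 \<Longrightarrow> poly2 (\<lambda>s t. V s t $ l)" and rc: "r < 6" "c < 6"
  shows "poly2 (\<lambda>s t. chart_mat m i j (V s t) $$ (r, c))"
proof (cases "r = m \<or> r = 5")
  case True
  then show ?thesis using rc by (cases "r = m") (auto simp: chart_mat_def)
next
  case False
  have "poly2 (\<lambda>s t. skew_apply (form_coords (unit_vec 5 r)) (V s t) $ c)"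
    unfolding skew_apply_def using rc by (auto intro!: poly2_sum poly2_mult V)
  then show ?thesis using rc False by (simp add: chart_mat_def)
qed

lemma poly2_det_chart_mat:
  "(\<And>l. l < 6 \<Longrightarrow> poly2 (\<lambda>s t. V s t $ l)) \<Longrightarrow> poly2 (\<lambda>s t. det (chart_mat m i j (V s t)))"
  by (rule poly2_det[OF chart_mat_carrier]) (rule poly2_chart_mat)

lemma poly2_adj_chart_mat:
  assumes V: "\<And>l. l < 6 \<Longrightarrow> poly2 (\<lambda>s t. V s t $ l)" and "r < 6" "c < 6"
  shows "poly2 (\<lambda>s t. adj_mat (chart_mat m i j (V s t)) $$ (r, c))"
  unfolding adj_mat_entry[OF assms(2,3)]
proof (intro poly2_mult poly2_const poly2_det[OF chart_mat_delete_carrier])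
  fix p q assume pq: "p < (5::nat)" "q < (5::nat)"
  show "poly2 (\<lambda>s t. mat_delete (chart_mat m i j (V s t)) c r $$ (p, q))"
    unfolding chart_mat_delete_index[OF pq] by (rule poly2_chart_mat[OF V]) (use pq in auto)
qed

lemma poly2_partner:
  "(\<And>l. l < 6 \<Longrightarrow> poly2 (\<lambda>s t. V s t $ l)) \<Longrightarrow> m < 6 \<Longrightarrow> r < 6 \<Longrightarrow> poly2 (\<lambda>s t. partner m i j (V s t) $ r)"
  by (simp add: partner_def poly2_adj_chart_mat)

context
  fixes ns :: "nat list" and V :: "'k::field vec list \<Rightarrow> 'k vec" and D :: "nat \<Rightarrow> nat"
  assumes V: "\<And>l. l < 6 \<Longrightarrow> hompoly ns D (\<lambda>x. V x $ l)"
begin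

lemma hompoly_skew_apply_const: "l < 6 \<Longrightarrow> hompoly ns D (\<lambda>x. skew_apply u (V x) $ l)"
  unfolding skew_apply_def by (auto intro!: hompoly_sum hompoly_scale V)

text \<open>In the chart \<open>(4, 4, 5)\<close> the rows 0 to 3 are linear in the vector and the
  rows 4 and 5 are constant. Hence the degree 4 of the determinant, of the partner and of the
  killer.\<close>

lemma hompoly_chart_mat:
  assumes "r < 6" "c < 6"
  shows "hompoly ns (if r < 4 then D else (\<lambda>_. 0)) (\<lambda>x. chart_mat 4 4 5 (V x) $$ (r, c))"
proof (cases "r < 4")
  case True
  then show ?thesis using assms hompoly_skew_apply_const by (simp add: chart_mat_def)
next
  case False
  then show ?thesis using assms by (cases "r = 4") (auto simp: chart_mat_def intro: hompoly_const)
qed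

lemma hompoly_det_chart_mat: "hompoly ns (\<lambda>l. 4 * D l) (\<lambda>x. det (chart_mat 4 4 5 (V x)))"
  by (rule hompoly_cong[OF hompoly_det[OF chart_mat_carrier hompoly_chart_mat]])
    (simp_all add: atLeast0LessThan sum_lessThan_6)

lemma hompoly_adj_chart_mat:
  assumes "r < 6" "c < 6"
  shows "hompoly ns (\<lambda>l. (if c < 4 then 3 else 4) * D l) (\<lambda>x. adj_mat (chart_mat 4 4 5 (V x)) $$ (r, c))"
  unfolding adj_mat_entry[OF assms]
proof (rule hompoly_scale)
  have "hompoly ns (\<lambda>l. \<Sum>p\<in>{0..<5}. (if (if p < c then p else Suc p) < 4 then D else (\<lambda>_. 0)) l)
      (\<lambda>x. det (mat_delete (chart_mat 4 4 5 (V x)) c r))"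
  proof (rule hompoly_det[OF chart_mat_delete_carrier])
    fix p q assume pq: "p < (5::nat)" "q < (5::nat)"
    then show "hompoly ns (if (if p < c then p else Suc p) < 4 then D else (\<lambda>_. 0))
        (\<lambda>x. mat_delete (chart_mat 4 4 5 (V x)) c r $$ (p, q))"
      unfolding chart_mat_delete_index[OF pq] by (intro hompoly_chart_mat) auto
  qed
  then show "hompoly ns (\<lambda>l. (if c < 4 then 3 else 4) * D l) (\<lambda>x. det (mat_delete (chart_mat 4 4 5 (V x)) c r))"
    by (rule hompoly_cong)
      (use less_6_cases[OF assms(2)] in \<open>elim disjE; simp add: atLeast0LessThan sum_lessThan_5\<close>)+
qed

lemma hompoly_partner: "r < 6 \<Longrightarrow> hompoly ns (\<lambda>l. 4 * D l) (\<lambda>x. partner 4 4 5 (V x) $ r)"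
  using hompoly_adj_chart_mat[of r 4] by (simp add: partner_def)

lemma hompoly_killer:
  assumes "k < 5" shows "hompoly ns (\<lambda>l. 4 * D l) (\<lambda>x. killer 4 4 5 (V x) $ k)"
proof (cases "k = 4")
  case True
  then show ?thesis using hompoly_det_chart_mat by (simp add: killer_def)
next
  case False
  have "hompoly ns (\<lambda>l. 4 * D l) (\<lambda>x. - (\<Sum>l<6. skew_apply (form_coords (unit_vec 5 4)) (V x) $ l *
      adj_mat (chart_mat 4 4 5 (V x)) $$ (l, k)))"
    using False assms
    by (intro hompoly_uminus hompoly_sum hompoly_mult'[OF hompoly_skew_apply_const hompoly_adj_chart_mat]) auto
  then show ?thesis using False assms by (simp add: killer_def)
qed

end

section \<open>The correspondence between points of the two threefolds\<close>

definition tens :: "'k::field vec \<Rightarrow> 'k vec" where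
  "tens \<omega> = vec 6 (\<lambda>i. if i = 0 then \<omega> $ 0 else if i = 3 then \<omega> $ 1 else 0)"

text \<open>\<open>tens \<omega>\<close> is \<open>\<omega> \<otimes> e\<^sub>0\<close> in \<open>k\<^sup>2 \<otimes> k\<^sup>3\<close>. A point \<open>a\<close> of the cubic has the kernel of its form as a plane,
  and \<open>probe (pfaffian_adjoint (form_coords a)) \<omega>\<close> is the vector of that plane orthogonal to \<open>tens \<omega>\<close>.\<close>

definition probe :: "'k::field vec \<Rightarrow> 'k vec \<Rightarrow> 'k vec" where
  "probe u \<omega> = skew_apply u (tens \<omega>)"

definition plane :: "'k::field vec \<Rightarrow> 'k vec" where
  "plane v = coords (wedge v (partner 4 4 5 v))"

text \<open>All conditions for the correspondence in the single chart \<open>(4, 4, 5)\<close>. The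
  first two factors make it a chart; the third keeps the vector read off from the plane of
  \<open>v\<close> nonzero, and the fourth does the same for the vector read off from the form
  annihilating \<open>v\<close>.\<close>

definition admissible :: "'k::field vec \<Rightarrow> 'k vec \<Rightarrow> 'k" where
  "admissible v \<omega> = det (chart_mat 4 4 5 v) * v $ 5 * (partner 4 4 5 v \<bullet> tens \<omega>) *
     probe (pfaffian_adjoint (form_coords (killer 4 4 5 v))) \<omega> $ 5"

lemma tens_carrier [simp]: "tens \<omega> \<in> carrier_vec 6"
  by (simp add: tens_def)

lemma probe_carrier [simp]: "probe u \<omega> \<in> carrier_vec 6"
  by (simp add: probe_def)

lemma plane_carrier [simp]: "plane v \<in> carrier_vec 15"
  by (simp add: plane_def)

lemma pfaffian_adjoint_smult: "u \<in> carrier_vec 15 \<Longrightarrow> pfaffian_adjoint (c \<cdot>\<^sub>v u) = (c * c) \<cdot>\<^sub>v pfaffian_adjoint u"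
  by (rule vec_15_eqI) (simp_all add: pfaffian_adjoint_index algebra_simps)

lemma form_kills_probe:
  assumes "cubic a = 0"
  shows "skew_apply (form_coords a) (skew_apply (pfaffian_adjoint (form_coords a)) \<xi>) = 0\<^sub>v 6"
  unfolding skew_apply_pfaffian_adjoint pfaffian_form_coords using assms by (auto intro!: eq_vecI)

lemma cubic_zero_if_kernel:
  assumes "skew_apply (form_coords a) v = 0\<^sub>v 6" "v \<in> carrier_vec 6" "v \<noteq> 0\<^sub>v 6"
  shows "cubic a = 0"
proof -
  have "skew_apply (pfaffian_adjoint (form_coords a)) (skew_apply (form_coords a) v) = pfaffian (form_coords a) \<cdot>\<^sub>v v"
    by (rule vec_6_eqI)
      (use assms(2) in \<open>simp_all add: skew_apply_index pfaffian_adjoint_index pfaffian_def algebra_simps\<close>)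
  moreover have "skew_apply (pfaffian_adjoint (form_coords a)) (0\<^sub>v 6) = 0\<^sub>v 6"
    by (auto simp: skew_apply_def)
  ultimately have 0: "- cubic a \<cdot>\<^sub>v v = 0\<^sub>v 6" using assms(1) by (simp add: pfaffian_form_coords)
  obtain i where i: "i < 6" "v $ i \<noteq> 0" using assms(2,3) by (metis carrier_vecD eq_vecI index_zero_vec)
  have "(- cubic a \<cdot>\<^sub>v v) $ i = 0" using 0 i by simp
  then show ?thesis using i assms(2) by simp
qed

lemma admissibleD:
  assumes "admissible v \<omega> \<noteq> 0"
  shows "det (chart_mat 4 4 5 v) \<noteq> 0" "v $ 5 \<noteq> 0" "partner 4 4 5 v \<bullet> tens \<omega> \<noteq> 0"
    "probe (pfaffian_adjoint (form_coords (killer 4 4 5 v))) \<omega> $ 5 \<noteq> 0"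
  using assms by (auto simp: admissible_def)

lemma chartI_admissible:
  assumes "admissible v \<omega> \<noteq> 0" "v \<in> carrier_vec 6" "a \<in> carrier_vec 5" "a \<noteq> 0\<^sub>v 5"
    "skew_apply (form_coords a) v = 0\<^sub>v 6"
  shows "chart 4 4 5 v a"
  using admissibleD[OF assms(1)] assms(2-5) by unfold_locales auto

text \<open>\<open>v\<close> is orthogonal to \<open>tens \<omega>\<close>, so contracting the
  bivector of \<open>v\<close> and its partner with \<open>tens \<omega>\<close> leaves a multiple
  of \<open>v\<close>: the plane on the X side selects the same vector.\<close>

lemma cubic_to_planes:
  assumes a: "a \<in> carrier_vec 5" "a \<noteq> 0\<^sub>v 5" "cubic a = 0"
    and v: "v = probe (pfaffian_adjoint (form_coords a)) \<omega>" and adm: "admissible v \<omega> \<noteq> 0"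
  shows "chart 4 4 5 v a" "probe (plane v) \<omega> = (partner 4 4 5 v \<bullet> tens \<omega>) \<cdot>\<^sub>v v"
proof -
  have vc: "v \<in> carrier_vec 6" by (simp add: v)
  show "chart 4 4 5 v a"
    by (rule chartI_admissible[OF adm vc a(1,2)]) (simp add: v probe_def form_kills_probe[OF a(3)])
  have "tens \<omega> \<bullet> v = 0" unfolding v probe_def by (rule skew_apply_self_orthogonal) simp
  then have "v \<bullet> tens \<omega> = 0" using vc by (metis comm_scalar_prod tens_carrier)
  then show "probe (plane v) \<omega> = (partner 4 4 5 v \<bullet> tens \<omega>) \<cdot>\<^sub>v v"
    using vc by (auto simp: probe_def plane_def skew_apply_coords_wedge intro!: eq_vecI)
qed

lemma planes_to_cubic:
  assumes xy: "x \<in> carrier_vec 6" "y \<in> carrier_vec 6" "coords (wedge x y) \<noteq> 0\<^sub>v 15" "isotropic x y"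
    and v: "v = probe (coords (wedge x y)) \<omega>" and adm: "admissible v \<omega> \<noteq> 0"
  defines "a \<equiv> killer 4 4 5 v"
  shows "chart 4 4 5 v a" "a \<noteq> 0\<^sub>v 5" "cubic a = 0"
    "\<exists>c. c \<noteq> 0 \<and> probe (pfaffian_adjoint (form_coords a)) \<omega> = c \<cdot>\<^sub>v v"
    "\<exists>c. c \<noteq> 0 \<and> coords (wedge x y) = c \<cdot>\<^sub>v plane v" "isotropic x v" "isotropic y v"
proof -
  note adm' = admissibleD[OF adm]
  have vc: "v \<in> carrier_vec 6" by (simp add: v)
  have comb: "v = (y \<bullet> tens \<omega>) \<cdot>\<^sub>v x + (- (x \<bullet> tens \<omega>)) \<cdot>\<^sub>v y"
    unfolding v probe_def using xy by (auto simp: skew_apply_coords_wedge intro!: eq_vecI)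
  have iso: "isotropic x v" "isotropic y v"
    unfolding comb using xy by (auto intro!: isotropic_combine isotropic_self simp: isotropic_commute[of y x])
  then show "isotropic x v" "isotropic y v" .
  obtain b where b: "b \<in> carrier_vec 5" "b \<noteq> 0\<^sub>v 5" "skew_apply (form_coords b) v = 0\<^sub>v 6"
    using killer_exists[OF xy(1,2) vc xy(3) iso] by blast
  interpret chart 4 4 5 v b by (rule chartI_admissible[OF adm vc b])
  show a: "a \<noteq> 0\<^sub>v 5" unfolding a_def by (rule killer_nonzero)
  have kills: "skew_apply (form_coords a) v = 0\<^sub>v 6" unfolding a_def by (rule killer_kills)
  show "chart 4 4 5 v a" by (rule chartI_admissible[OF adm vc _ a kills]) (simp add: a_def)
  have v0: "v \<noteq> 0\<^sub>v 6" using adm'(2) by auto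
  show "cubic a = 0" by (rule cubic_zero_if_kernel[OF kills vc v0])
  show "\<exists>c. c \<noteq> 0 \<and> coords (wedge x y) = c \<cdot>\<^sub>v plane v"
  proof -
    obtain c where c: "coords (wedge x y) = c \<cdot>\<^sub>v plane v"
      using coords_wedge_partner[OF xy(1,2) iso] unfolding plane_def by blast
    moreover from this have "c \<noteq> 0" using xy(3) plane_carrier[of v] by (auto simp: vec_eq_iff)
    ultimately show ?thesis by blast
  qed
  let ?P = "skew_entry (pfaffian_adjoint (form_coords a))"
  let ?w = "probe (pfaffian_adjoint (form_coords a)) \<omega>"
  have "tens \<omega> \<bullet> v = 0" unfolding assms(5) probe_def by (rule skew_apply_self_orthogonal) simp
  then have ort: "v \<bullet> tens \<omega> = 0" using vc by (metis comm_scalar_prod tens_carrier)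
  \<comment> \<open>Both vectors lie in the kernel of the form \<open>a\<close> and are orthogonal
    to \<open>tens \<omega>\<close>. Contracting the three-term relation with
    \<open>tens \<omega>\<close> shows that they are proportional.\<close>
  have par: "?w $ j * v $ i = ?w $ i * v $ j" if ij: "i < 6" "j < 6" for i j
  proof -
    have w: "?w $ r = (\<Sum>k<6. ?P r k * tens \<omega> $ k)" if "r < 6" for r
      using that by (simp add: probe_def skew_apply_def)
    have "(\<Sum>k<6. (?P i j * v $ k + ?P j k * v $ i + ?P k i * v $ j) * tens \<omega> $ k) = 0"
      by (rule sum.neutral) (simp add: skew_entry_plucker[OF kills ij])
    moreover have "(\<Sum>k<6. (?P i j * v $ k + ?P j k * v $ i + ?P k i * v $ j) * tens \<omega> $ k)
      = ?P i j * (v \<bullet> tens \<omega>) + ?w $ j * v $ i - ?w $ i * v $ j"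
    proof -
      have sw: "?P k i = - ?P i k" for k by (rule skew_entry_swap)
      have "(\<Sum>k<6. (?P i j * v $ k + ?P j k * v $ i + ?P k i * v $ j) * tens \<omega> $ k)
          = (\<Sum>k<6. ?P i j * (v $ k * tens \<omega> $ k) + (?P j k * tens \<omega> $ k) * v $ i - (?P i k * tens \<omega> $ k) * v $ j)"
        by (intro sum.cong refl) (simp only: sw, simp add: algebra_simps)
      also have "\<dots> = ?P i j * (\<Sum>k<6. v $ k * tens \<omega> $ k) + (\<Sum>k<6. ?P j k * tens \<omega> $ k) * v $ i
          - (\<Sum>k<6. ?P i k * tens \<omega> $ k) * v $ j"
        by (simp only: sum.distrib sum_subtractf sum_distrib_left sum_distrib_right)
      also have "(\<Sum>k<6. v $ k * tens \<omega> $ k) = v \<bullet> tens \<omega>"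
        by (simp add: scalar_prod_def atLeast0LessThan tens_def)
      finally show ?thesis unfolding w[OF ij(1)] w[OF ij(2)] .
    qed
    ultimately show ?thesis using ort by simp
  qed
  have w5: "?w $ 5 \<noteq> 0" using adm'(4) by (simp add: a_def)
  have "?w = (?w $ 5 / v $ 5) \<cdot>\<^sub>v v"
  proof (rule eq_vecI)
    fix r assume "r < dim_vec ((?w $ 5 / v $ 5) \<cdot>\<^sub>v v)"
    then have r: "r < 6" using vc by simp
    show "?w $ r = ((?w $ 5 / v $ 5) \<cdot>\<^sub>v v) $ r" using par[of r 5] r vc adm'(2) by (simp add: field_simps)
  qed (use vc in \<open>simp add: probe_def\<close>)
  then show "\<exists>c. c \<noteq> 0 \<and> ?w = c \<cdot>\<^sub>v v" using w5 adm'(2) by (intro exI[of _ "?w $ 5 / v $ 5"]) simp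
qed

lemma hompoly_tens: "(\<And>i. i < 2 \<Longrightarrow> hompoly ns d (\<lambda>x. \<Omega> x $ i)) \<Longrightarrow> l < 6 \<Longrightarrow> hompoly ns d (\<lambda>x. tens (\<Omega> x) $ l)"
  by (cases "l = 0"; cases "l = 3") (simp_all add: tens_def)

lemma hompoly_skew_entry:
  assumes "\<And>l. l < 15 \<Longrightarrow> hompoly ns d (\<lambda>x. U x $ l)" "i < 6" "j < 6"
  shows "hompoly ns d (\<lambda>x. skew_entry (U x) i j)"
proof -
  consider "i < j" | "i = j" | "j < i" by linarith
  then show ?thesis unfolding skew_entry_def using assms index_pairs_nth(2)[of i j] index_pairs_nth(2)[of j i]
    by cases (simp_all add: hompoly_uminus)
qed

lemma hompoly_skew_apply:
  assumes "\<And>l. l < 15 \<Longrightarrow> hompoly ns d (\<lambda>x. U x $ l)" "\<And>l. l < 6 \<Longrightarrow> hompoly ns e (\<lambda>x. W x $ l)" "i < 6"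
  shows "hompoly ns (\<lambda>l. d l + e l) (\<lambda>x. skew_apply (U x) (W x) $ i)"
  using assms by (simp add: skew_apply_def) (intro hompoly_sum hompoly_mult hompoly_skew_entry, auto)

lemma hompoly_probe:
  assumes "\<And>l. l < 15 \<Longrightarrow> hompoly ns d (\<lambda>x. U x $ l)" "\<And>l. l < 2 \<Longrightarrow> hompoly ns e (\<lambda>x. \<Omega> x $ l)" "i < 6"
  shows "hompoly ns (\<lambda>l. d l + e l) (\<lambda>x. probe (U x) (\<Omega> x) $ i)"
  unfolding probe_def using assms by (intro hompoly_skew_apply hompoly_tens)

lemma hompoly_pfaffian_adjoint:
  assumes U: "\<And>l. l < 15 \<Longrightarrow> hompoly ns d (\<lambda>x. U x $ l)" and "i < 15"
  shows "hompoly ns (\<lambda>l. d l + d l) (\<lambda>x. pfaffian_adjoint (U x) $ i)"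
  using less_15_cases[OF assms(2)]
  by (elim disjE) (simp_all add: pfaffian_adjoint_index,
      (intro hompoly_add hompoly_diff hompoly_mult hompoly_uminus U; simp)+)

lemma hompoly_form_coords:
  assumes A: "\<And>l. l < 5 \<Longrightarrow> hompoly ns d (\<lambda>x. A x $ l)" and "i < 15"
  shows "hompoly ns d (\<lambda>x. form_coords (A x) $ i)"
  using less_15_cases[OF assms(2)]
  by (elim disjE) (simp_all add: form_coords_index,
      (intro hompoly_add hompoly_diff hompoly_uminus A; simp)+)

lemma hompoly_plane:
  assumes V: "\<And>l. l < 6 \<Longrightarrow> hompoly ns d (\<lambda>x. V x $ l)" and "i < 15"
  shows "hompoly ns (\<lambda>l. 5 * d l) (\<lambda>x. plane (V x) $ i)"
  unfolding plane_def using less_15_cases[OF assms(2)]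
  by (elim disjE) (simp_all add: coords_wedge_index,
      (intro hompoly_diff hompoly_mult'[OF V hompoly_partner[OF V]]; simp)+)

lemma hompoly_admissible:
  assumes V: "\<And>l. l < 6 \<Longrightarrow> hompoly ns d (\<lambda>x. V x $ l)" and \<Omega>: "\<And>l. l < 2 \<Longrightarrow> hompoly ns e (\<lambda>x. \<Omega> x $ l)"
  shows "hompoly ns (\<lambda>l. 17 * d l + 2 * e l) (\<lambda>x. admissible (V x) (\<Omega> x))"
proof -
  have 1: "hompoly ns (\<lambda>l. 5 * d l) (\<lambda>x. det (chart_mat 4 4 5 (V x)) * V x $ 5)"
    by (rule hompoly_mult'[OF hompoly_det_chart_mat[OF V] V]) simp_all
  have 2: "hompoly ns (\<lambda>l. 4 * d l + e l) (\<lambda>x. partner 4 4 5 (V x) \<bullet> tens (\<Omega> x))"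
    unfolding scalar_prod_def carrier_vecD[OF tens_carrier]
    by (intro hompoly_sum hompoly_mult hompoly_partner V hompoly_tens \<Omega>) simp_all
  have 3: "hompoly ns (\<lambda>l. (4 * d l + 4 * d l) + e l)
      (\<lambda>x. probe (pfaffian_adjoint (form_coords (killer 4 4 5 (V x)))) (\<Omega> x) $ 5)"
    by (intro hompoly_probe hompoly_pfaffian_adjoint hompoly_form_coords hompoly_killer V \<Omega>) simp_all
  show ?thesis unfolding admissible_def
    by (rule hompoly_mult'[OF hompoly_mult[OF 1 2] 3]) simp
qed

text \<open>\<open>admissible\<close> is bihomogeneous; regarding both arguments as blocks of sizes
  6 and 2 makes \<open>hompoly_rescale\<close> applicable.\<close>

lemma admissible_smult_left:
  fixes v :: "'k::field vec"
  assumes "v \<in> carrier_vec 6" "\<omega> \<in> carrier_vec 2" "c \<noteq> 0" "admissible v \<omega> \<noteq> 0"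
  shows "admissible (c \<cdot>\<^sub>v v) \<omega> \<noteq> 0"
proof -
  define d e :: "nat \<Rightarrow> nat" where "d l = (if l = 0 then 1 else 0)" and "e l = (if l = 1 then 1 else 0)" for l
  have H: "hompoly [6, 2] (\<lambda>l. 17 * d l + 2 * e l) (\<lambda>x. admissible (x ! 0) (x ! 1) :: 'k)"
    by (intro hompoly_admissible hompoly_coord) (auto simp: d_def e_def)
  have "admissible ([c \<cdot>\<^sub>v v, \<omega>] ! 0) ([c \<cdot>\<^sub>v v, \<omega>] ! 1) =
      (\<Prod>l<length [6::nat, 2]. (if l = 0 then c else 1) ^ (17 * d l + 2 * e l)) * admissible ([v, \<omega>] ! 0) ([v, \<omega>] ! 1)"
    by (rule hompoly_rescale[OF H]) (use assms in \<open>auto simp: carr_def less_Suc_eq\<close>)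
  moreover have "(\<Prod>l<length [6::nat, 2]. (if l = 0 then c else 1) ^ (17 * d l + 2 * e l)) \<noteq> 0"
    using assms(3) by simp
  ultimately show ?thesis using assms(4) by simp
qed

definition \<omega>0 :: "'k::field vec" where "\<omega>0 = vec 2 (\<lambda>i. if i = 0 then 1 else 0)"

definition good_vector :: "'k::field vec" where
  "good_vector = probe (pfaffian_adjoint (form_coords good_point)) \<omega>0"

lemma good_vector_index:
  shows "good_vector $ 0 = (0 :: 'k::field)" "good_vector $ Suc 0 = (- 2 :: 'k)" "good_vector $ 2 = (1 :: 'k)"
    "good_vector $ 3 = (2 :: 'k)" "good_vector $ 4 = (- 2 :: 'k)" "good_vector $ 5 = (- 1 :: 'k)"
  by (simp_all add: good_vector_def probe_def skew_apply_index tens_def \<omega>0_def pfaffian_adjoint_index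
      form_coords_index good_point_def)

lemma good_point_facts: "good_point \<in> carrier_vec 5" "good_point \<noteq> (0\<^sub>v 5 :: 'k::field vec)"
  "cubic (good_point :: 'k vec) = 0"
proof -
  show "good_point \<noteq> (0\<^sub>v 5 :: 'k::field vec)"
  proof
    assume "good_point = (0\<^sub>v 5 :: 'k vec)"
    from arg_cong[OF this, of "\<lambda>v. v $ 0"] show False by (simp add: good_point_def)
  qed
qed (simp_all add: good_point_def cubic_def)

lemma det_good_chart: "det (chart_mat 4 4 5 (good_vector :: 'k::field_char_0 vec)) \<noteq> 0"
proof
  let ?N = "chart_mat 4 4 5 (good_vector :: 'k vec)"
  assume "det ?N = 0"
  then obtain x where x: "x \<in> carrier_vec 6" "x \<noteq> 0\<^sub>v 6" "?N *\<^sub>v x = 0\<^sub>v 6"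
    using det_0_iff_vec_prod_zero_field[OF chart_mat_carrier] by blast
  have r: "(if r = 4 then x $ 4 else if r = 5 then x $ 5 else x \<bullet> skew_apply (form_coords (unit_vec 5 r)) good_vector) = 0"
    if "r < 6" for r
    using chart_mat_mult[OF x(1), of 4 5 r 4 good_vector] x(3) that by simp
  have x45: "x $ 4 = 0" "x $ 5 = 0" using r[of 4] r[of 5] by simp_all
  have "- 2 * x $ 0 - x $ 1 - x $ 2 + 2 * x $ 3 = x \<bullet> skew_apply (form_coords (unit_vec 5 0)) good_vector"
    "- x $ 0 + 2 * x $ 1 + 3 * x $ 2 + x $ 3 = x \<bullet> skew_apply (form_coords (unit_vec 5 1)) good_vector"
    "- x $ 0 + 3 * x $ 1 + 3 * x $ 3 = x \<bullet> skew_apply (form_coords (unit_vec 5 2)) good_vector"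
    "- x $ 1 - 2 * x $ 2 = x \<bullet> skew_apply (form_coords (unit_vec 5 3)) good_vector"
    unfolding scalar_prod_6[OF x(1) skew_apply_carrier]
    by (simp_all add: skew_apply_index form_coords_index good_vector_index x45 algebra_simps)
  then have e: "- 2 * x $ 0 - x $ 1 - x $ 2 + 2 * x $ 3 = 0" "- x $ 0 + 2 * x $ 1 + 3 * x $ 2 + x $ 3 = 0"
    "- x $ 0 + 3 * x $ 1 + 3 * x $ 3 = 0" "- x $ 1 - 2 * x $ 2 = 0"
    using r[of 0] r[of 1] r[of 2] r[of 3] by simp_all
  \<comment> \<open>Combinations of the four equations that isolate one coordinate each; the factors
    6, 3, 2, 6 are nonzero in characteristic zero.\<close>
  have "6 * x $ 1 = - 4 * (- 2 * x $ 0 - x $ 1 - x $ 2 + 2 * x $ 3) + 8 * (- x $ 0 + 2 * x $ 1 + 3 * x $ 2 + x $ 3)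
      + 14 * (- x $ 1 - 2 * x $ 2)"
    "3 * x $ 2 = (- 2 * x $ 0 - x $ 1 - x $ 2 + 2 * x $ 3) - 2 * (- x $ 0 + 2 * x $ 1 + 3 * x $ 2 + x $ 3)
      - 5 * (- x $ 1 - 2 * x $ 2)"
    "2 * x $ 0 = (- 2 * x $ 0 - x $ 1 - x $ 2 + 2 * x $ 3) - 5 * (- x $ 0 + 2 * x $ 1 + 3 * x $ 2 + x $ 3)
      + (- x $ 0 + 3 * x $ 1 + 3 * x $ 3) - 8 * (- x $ 1 - 2 * x $ 2)"
    "6 * x $ 3 = 5 * (- 2 * x $ 0 - x $ 1 - x $ 2 + 2 * x $ 3) - 13 * (- x $ 0 + 2 * x $ 1 + 3 * x $ 2 + x $ 3)
      + 3 * (- x $ 0 + 3 * x $ 1 + 3 * x $ 3) - 22 * (- x $ 1 - 2 * x $ 2)"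
    by (simp_all add: algebra_simps)
  note m = this[unfolded e, simplified]
  have "x = 0\<^sub>v 6" by (rule vec_6_eqI) (use x(1) x45 m in simp_all)
  with x(2) show False by simp
qed

text \<open>The isotropic vector with entries 1 and 0 at the normalising coordinates 4 and 5, hence
  a multiple of the partner. It replaces the evaluation of an adjugate.\<close>

lemma good_partner: "isotropic (vec 6 (\<lambda>i. [- 5, 3, - 2, - 5, 1, 0 :: 'k::field_char_0] ! i)) good_vector"
proof -
  let ?v = "good_vector :: 'k vec" and ?n = "vec 6 (\<lambda>i. [- 5, 3, - 2, - 5, 1, 0 :: 'k] ! i)"
  have nc: "?n \<in> carrier_vec 6" by simp
  show ?thesis
    unfolding isotropic_iff_unit[OF nc] scalar_prod_6[OF nc skew_apply_carrier]
  proof (intro allI impI)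
    fix k :: nat assume "k < 5"
    show "?n $ 0 * skew_apply (form_coords (unit_vec 5 k)) ?v $ 0 + ?n $ 1 * skew_apply (form_coords (unit_vec 5 k)) ?v $ 1
      + ?n $ 2 * skew_apply (form_coords (unit_vec 5 k)) ?v $ 2 + ?n $ 3 * skew_apply (form_coords (unit_vec 5 k)) ?v $ 3
      + ?n $ 4 * skew_apply (form_coords (unit_vec 5 k)) ?v $ 4 + ?n $ 5 * skew_apply (form_coords (unit_vec 5 k)) ?v $ 5 = 0"
      using less_5_cases[OF \<open>k < 5\<close>]
      by (elim disjE) (simp_all add: skew_apply_index form_coords_index good_vector_index)
  qed
qed

lemma good_vector_admissible: "admissible good_vector (\<omega>0 :: 'k::field_char_0 vec) \<noteq> 0"
proof -
  let ?v = "good_vector :: 'k vec"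
  have vc: "?v \<in> carrier_vec 6" by (simp add: good_vector_def)
  interpret chart 4 4 5 ?v good_point
  proof
    show "skew_apply (form_coords good_point) ?v = 0\<^sub>v 6"
      unfolding good_vector_def probe_def by (rule form_kills_probe) (rule good_point_facts)
  qed (use vc det_good_chart good_point_facts in \<open>simp_all add: good_vector_index\<close>)
  let ?n = "vec 6 (\<lambda>i. [- 5, 3, - 2, - 5, 1, 0 :: 'k] ! i)"
  obtain c d where cd: "?n = c \<cdot>\<^sub>v ?v + d \<cdot>\<^sub>v partner 4 4 5 ?v"
    using isotropic_in_span[OF _ good_partner] by auto
  have "?n $ 5 = c * ?v $ 5 + d * partner 4 4 5 ?v $ 5" unfolding cd using vc by simp
  then have "c = 0" using partner_j by (simp add: good_vector_index)
  have "?n $ 0 = c * ?v $ 0 + d * partner 4 4 5 ?v $ 0" unfolding cd using vc by simp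
  then have "partner 4 4 5 ?v $ 0 \<noteq> 0" using \<open>c = 0\<close> by auto
  moreover have "partner 4 4 5 ?v \<bullet> tens \<omega>0 = partner 4 4 5 ?v $ 0"
    by (simp add: scalar_prod_6 tens_def \<omega>0_def)
  moreover have "probe (pfaffian_adjoint (form_coords (killer 4 4 5 ?v))) \<omega>0 $ 5 \<noteq> 0"
  proof -
    define e where "e = det N / good_point $ 4"
    have "e \<noteq> 0" using det_good_chart b_m by (simp add: e_def)
    moreover have "probe (pfaffian_adjoint (form_coords (killer 4 4 5 ?v))) \<omega>0 = (e * e) \<cdot>\<^sub>v ?v"
      unfolding killer_eq unfolding e_def[symmetric] unfolding good_vector_def probe_def
      by (simp add: form_coords_smult good_point_facts pfaffian_adjoint_smult skew_apply_linear)
    ultimately show ?thesis using vc by (simp add: good_vector_index)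
  qed
  ultimately show ?thesis using det_good_chart by (simp add: admissible_def good_vector_index)
qed

section \<open>Birational maps given by polynomials\<close>

text \<open>The arbitrary representative does no harm: a change of representative multiplies each
  block of \<open>Q\<close> by one nonzero factor.\<close>

definition proj_map :: "nat list \<Rightarrow> ('k::field vec list \<Rightarrow> 'k vec list) \<Rightarrow> 'k point \<Rightarrow> 'k point" where
  "proj_map ns Q x = map line (Q (SOME v. v \<in> hom_coords ns \<and> map line v = x))"

lemma proj_map_line:
  assumes Q: "\<And>v. v \<in> carr ns \<Longrightarrow> Q v \<in> carr ns'"
    and comp: "\<And>j i. j < length ns' \<Longrightarrow> i < ns' ! j \<Longrightarrow> hompoly ns (\<delta> j) (\<lambda>v. (Q v ! j) $ i)"
    and v: "v \<in> hom_coords ns"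
  shows "proj_map ns Q (map line v) = map line (Q v)"
proof -
  define w where "w = (SOME w. w \<in> hom_coords ns \<and> map line w = map line v)"
  have w: "w \<in> hom_coords ns" "map line w = map line v"
    using someI[of "\<lambda>w. w \<in> hom_coords ns \<and> map line w = map line v" v] v by (auto simp: w_def)
  have "v \<in> carr ns" "w \<in> carr ns" using v w(1) hom_coords_subset_carr by blast+
  then have c: "Q v \<in> carr ns'" "Q w \<in> carr ns'" using Q by blast+
  have "map line (Q w) = map line (Q v)"
  proof (rule nth_equalityI)
    fix j assume "j < length (map line (Q w))"
    then have j: "j < length ns'" using c by (simp add: carr_def list_all2_conv_all_nth)
    obtain d where d: "d \<noteq> 0" "\<And>P. hompoly ns (\<delta> j) P \<Longrightarrow> P w = d * P v"
      using hom_coords_rescale[OF v w(1) w(2)[symmetric], of "\<delta> j"] by blast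
    have "Q w ! j \<in> carrier_vec (ns' ! j)" "Q v ! j \<in> carrier_vec (ns' ! j)"
      using c j by (auto simp: carr_def list_all2_conv_all_nth)
    then have "Q w ! j = d \<cdot>\<^sub>v (Q v ! j)"
      using d(2)[OF comp[OF j]] by (intro eq_vecI) auto
    then show "map line (Q w) ! j = map line (Q v) ! j"
      using c j d(1) by (simp add: line_smult carr_def list_all2_conv_all_nth)
  qed (use c in \<open>auto simp: carr_def list_all2_conv_all_nth\<close>)
  then show ?thesis by (simp add: proj_map_def w_def)
qed

lemma proj_map_morphism:
  assumes "Z \<subseteq> multiproj ns" "Z' \<subseteq> multiproj ns'"
    and Q: "\<And>v. v \<in> carr ns \<Longrightarrow> Q v \<in> carr ns'"
    and comp: "\<And>j i. j < length ns' \<Longrightarrow> i < ns' ! j \<Longrightarrow> hompoly ns (\<delta> j) (\<lambda>v. (Q v ! j) $ i)"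
    and into: "\<And>v. v \<in> hom_coords ns \<Longrightarrow> map line v \<in> Z \<Longrightarrow> Q v \<in> hom_coords ns' \<and> map line (Q v) \<in> Z'"
  shows "morphism ns Z ns' Z' (proj_map ns Q)"
  by (rule morphismI[OF assms(1,2) Q comp]) (use into proj_map_line[OF Q comp] in auto)

lemma poly2_hompoly:
  assumes "hompoly ns d P" "\<And>s t. X s t \<in> carr ns"
    "\<And>j i. j < length ns \<Longrightarrow> i < ns ! j \<Longrightarrow> poly2 (\<lambda>s t. (X s t ! j) $ i)"
  shows "poly2 (\<lambda>s t. P (X s t))"
proof -
  obtain p where p: "multihomogeneous ns d p" "\<And>v. v \<in> carr ns \<Longrightarrow> evaluate p v = P v"
    using assms(1) by (auto simp: hompoly_def)
  have "poly2 (\<lambda>s t. evaluate p (X s t))" by (rule poly2_evaluate[OF p(1) assms(3)])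
  then show ?thesis using p(2)[OF assms(2)] by simp
qed

lemma carr_Cons: "u # \<tau> \<in> carr (n # ms) \<longleftrightarrow> u \<in> carrier_vec n \<and> \<tau> \<in> carr ms"
  by (simp add: carr_def)

lemma carr_Nil: "[] \<in> carr []"
  by (simp add: carr_def)

lemma hom_coords_Cons: "u # \<tau> \<in> hom_coords (n # ms) \<longleftrightarrow> u \<in> carrier_vec n \<and> u \<noteq> 0\<^sub>v n \<and> \<tau> \<in> hom_coords ms"
  by (auto simp: hom_coords_def)

lemma hom_coords_ConsE:
  assumes "x \<in> hom_coords (n # ms)"
  obtains u \<tau> where "x = u # \<tau>" "u \<in> carrier_vec n" "u \<noteq> 0\<^sub>v n" "\<tau> \<in> hom_coords ms"
  using assms by (cases x) (auto simp: hom_coords_def)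

lemma carr_ConsE:
  assumes "x \<in> carr (n # ms)"
  obtains u \<tau> where "x = u # \<tau>" "u \<in> carrier_vec n" "\<tau> \<in> carr ms"
  using assms by (cases x) (auto simp: carr_def)

lemma poly2_skew_apply_pfaffian_adjoint:
  assumes "\<And>s t. A s t \<in> carrier_vec 5" "\<And>s t. W s t \<in> carrier_vec 6"
    "\<And>i. i < 5 \<Longrightarrow> poly2 (\<lambda>s t. A s t $ i)" "\<And>i. i < 6 \<Longrightarrow> poly2 (\<lambda>s t. W s t $ i)" "i < 6"
  shows "poly2 (\<lambda>s t. skew_apply (pfaffian_adjoint (form_coords (A s t))) (W s t) $ i)"
proof -
  define d e :: "nat \<Rightarrow> nat" where "d l = (if l = 0 then 1 else 0)" and "e l = (if l = 1 then 1 else 0)" for l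
  have "hompoly [5, 6] (\<lambda>l. (d l + d l) + e l) (\<lambda>x. skew_apply (pfaffian_adjoint (form_coords (x ! 0))) (x ! 1) $ i)"
    by (intro hompoly_skew_apply hompoly_pfaffian_adjoint hompoly_form_coords hompoly_coord)
      (use assms(5) in \<open>auto simp: d_def e_def\<close>)
  then have "poly2 (\<lambda>s t. skew_apply (pfaffian_adjoint (form_coords ([A s t, W s t] ! 0))) ([A s t, W s t] ! 1) $ i)"
    by (rule poly2_hompoly) (use assms in \<open>auto simp: carr_def less_Suc_eq\<close>)
  then show ?thesis by simp
qed

lemma poly2_admissible:
  assumes "\<And>s t. V s t \<in> carrier_vec 6" "\<And>s t. W s t \<in> carrier_vec 2"
    "\<And>i. i < 6 \<Longrightarrow> poly2 (\<lambda>s t. V s t $ i)" "\<And>i. i < 2 \<Longrightarrow> poly2 (\<lambda>s t. W s t $ i)"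
  shows "poly2 (\<lambda>s t. admissible (V s t) (W s t))"
proof -
  define d e :: "nat \<Rightarrow> nat" where "d l = (if l = 0 then 1 else 0)" and "e l = (if l = 1 then 1 else 0)" for l
  have "hompoly [6, 2] (\<lambda>l. 17 * d l + 2 * e l) (\<lambda>x. admissible (x ! 0) (x ! 1))"
    by (intro hompoly_admissible hompoly_coord) (auto simp: d_def e_def)
  then have "poly2 (\<lambda>s t. admissible ([V s t, W s t] ! 0) ([V s t, W s t] ! 1))"
    by (rule poly2_hompoly) (use assms in \<open>auto simp: carr_def less_Suc_eq\<close>)
  then show ?thesis by simp
qed

lemma poly2_coords_wedge:
  assumes "\<And>i. i < 6 \<Longrightarrow> poly2 (\<lambda>s t. V s t $ i)" "\<And>i. i < 6 \<Longrightarrow> poly2 (\<lambda>s t. W s t $ i)" "i < 15"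
  shows "poly2 (\<lambda>s t. coords (wedge (V s t) (W s t)) $ i)"
  using less_15_cases[OF assms(3)]
  by (elim disjE) (simp_all add: coords_wedge_index, (intro poly2_diff poly2_mult assms; simp)+)

lemma poly2_plane:
  assumes "\<And>i. i < 6 \<Longrightarrow> poly2 (\<lambda>s t. V s t $ i)" "i < 15"
  shows "poly2 (\<lambda>s t. plane (V s t) $ i)"
  unfolding plane_def by (rule poly2_coords_wedge[OF assms(1) poly2_partner[OF assms(1)] assms(2)]) auto

lemma poly2_tens: "(\<And>i. i < 2 \<Longrightarrow> poly2 (\<lambda>s t. W s t $ i)) \<Longrightarrow> l < 6 \<Longrightarrow> poly2 (\<lambda>s t. tens (W s t) $ l)"
  by (cases "l = 0"; cases "l = 3") (simp_all add: tens_def)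

lemma poly2_probe:
  assumes "\<And>l. l < 15 \<Longrightarrow> poly2 (\<lambda>s t. U s t $ l)" "\<And>l. l < 2 \<Longrightarrow> poly2 (\<lambda>s t. W s t $ l)" "i < 6"
  shows "poly2 (\<lambda>s t. probe (U s t) (W s t) $ i)"
proof -
  have "poly2 (\<lambda>s t. skew_entry (U s t) i j)" if "j < 6" for j
  proof -
    consider "i < j" | "i = j" | "j < i" by linarith
    then show ?thesis unfolding skew_entry_def
      using assms(1,3) that index_pairs_nth(2)[of i j] index_pairs_nth(2)[of j i]
      by cases (simp_all add: poly2_uminus)
  qed
  then show ?thesis using assms(3)
    by (simp add: probe_def skew_apply_def) (intro poly2_sum poly2_mult poly2_tens[OF assms(2)], auto)
qed

lemma Y_repE:
  fixes z :: "'k::field_char_0 vec"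
  assumes "[line z] \<in> Y_of form" "z \<in> carrier_vec 15" "z \<noteq> 0\<^sub>v 15"
  obtains a where "a \<in> carrier_vec 5" "a \<noteq> 0\<^sub>v 5" "cubic a = 0" "z = form_coords a"
proof -
  obtain a where a: "a \<in> carrier_vec 5" "a \<noteq> 0\<^sub>v 5" "cubic a = 0" "line z = line (form_coords a)"
    using assms(1) unfolding Y_of_form by auto
  obtain c where c: "c \<noteq> 0" "z = c \<cdot>\<^sub>v form_coords a" using line_eqD[OF a(4)[symmetric] assms(2,3)] by blast
  have "z = form_coords (c \<cdot>\<^sub>v a)" using c(2) a(1) by (simp add: form_coords_smult)
  moreover from this have "c \<cdot>\<^sub>v a \<noteq> 0\<^sub>v 5" using assms(3) by auto
  ultimately show ?thesis using a(1,3) by (intro that[of "c \<cdot>\<^sub>v a"]) (simp_all add: cubic_smult)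
qed

lemma isotropic_smult: "v \<in> carrier_vec 6 \<Longrightarrow> x \<in> carrier_vec 6 \<Longrightarrow> isotropic x v \<Longrightarrow> isotropic x (c \<cdot>\<^sub>v v)"
  by (simp add: isotropic_def skew_apply_linear scalar_prod_smult_distrib[of _ 6])

lemma X_repE:
  fixes u :: "'k::field_char_0 vec"
  assumes "[line u] \<in> X_of form" "u \<in> carrier_vec 15" "u \<noteq> 0\<^sub>v 15"
  obtains x y where "x \<in> carrier_vec 6" "y \<in> carrier_vec 6" "isotropic x y" "u = coords (wedge x y)"
proof -
  obtain x y where xy: "x \<in> carrier_vec 6" "y \<in> carrier_vec 6" "isotropic x y" "line u = line (coords (wedge x y))"
    using assms(1) unfolding X_of_form by auto
  obtain c where c: "c \<noteq> 0" "u = c \<cdot>\<^sub>v coords (wedge x y)" using line_eqD[OF xy(4)[symmetric] assms(2,3)] by blast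
  have "u = coords (wedge (1 \<cdot>\<^sub>v x) (c \<cdot>\<^sub>v y))" using c(2) coords_wedge_smult[OF xy(1,2), of 1 c] by simp
  then show ?thesis using xy isotropic_smult by (intro that[of x "c \<cdot>\<^sub>v y"]) auto
qed

lemma product_Cons:
  assumes "\<And>z. z \<in> Z \<Longrightarrow> length z = 1"
  shows "l # ls \<in> product Z W \<longleftrightarrow> [l] \<in> Z \<and> ls \<in> W"
proof
  assume "l # ls \<in> product Z W"
  then obtain z w where "z \<in> Z" "w \<in> W" "l # ls = z @ w" by (auto simp: product_def)
  moreover from this have "length z = 1" using assms by blast
  ultimately show "[l] \<in> Z \<and> ls \<in> W" by (cases z) auto
next
  assume "[l] \<in> Z \<and> ls \<in> W"
  then have "\<exists>z w. l # ls = z @ w \<and> z \<in> Z \<and> w \<in> W" by (intro exI[of _ "[l]"] exI[of _ ls]) simp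
  then show "l # ls \<in> product Z W" unfolding product_def by blast
qed

lemma length_Y_of: "z \<in> Y_of f \<Longrightarrow> length z = 1" and length_X_of: "z \<in> X_of f \<Longrightarrow> length z = 1"
  by (auto simp: Y_of_def X_of_def projectivization_def)

lemma Y_of_subset: "Y_of f \<subseteq> multiproj [15]" and X_of_subset: "X_of f \<subseteq> (multiproj [15] :: 'k::field point set)"
proof -
  have "projectivization 15 W \<subseteq> multiproj [15]" if "W \<subseteq> carrier_vec 15" for W :: "'k vec set"
  proof
    fix x assume "x \<in> projectivization 15 W"
    then obtain w where w: "x = [line w]" "w \<in> W" "w \<noteq> 0\<^sub>v 15" by (auto simp: projectivization_def)
    then have "[w] \<in> hom_coords [15]" using that by (auto simp: hom_coords_def)
    then show "x \<in> multiproj [15]" unfolding multiproj_def w(1) by (intro image_eqI[of _ _ "[w]"]) simp_all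
  qed
  moreover have "coords ` S \<subseteq> carrier_vec 15" for S :: "'k mat set" by auto
  ultimately show "Y_of f \<subseteq> multiproj [15]" "X_of f \<subseteq> (multiproj [15] :: 'k point set)"
    unfolding Y_of_def X_of_def pfaffian_cubic_def grassmannian_def by (meson inf.coboundedI2)+
qed

lemma product_subset_multiproj:
  assumes "Z \<subseteq> multiproj [n]" shows "product Z (multiproj ms) \<subseteq> multiproj (n # ms)"
proof
  fix x assume "x \<in> product Z (multiproj ms)"
  then obtain z w where x: "x = z @ w" "z \<in> multiproj [n]" "w \<in> multiproj ms"
    using assms by (auto simp: product_def)
  obtain \<tau> where \<tau>: "\<tau> \<in> hom_coords ms" "w = map line \<tau>" using x(3) by (auto simp: multiproj_def)
  obtain v where v: "v \<in> hom_coords [n]" "z = map line v" using x(2) by (auto simp: multiproj_def)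
  obtain u where "v = [u]" "u \<in> carrier_vec n" "u \<noteq> 0\<^sub>v n"
    using v(1) by (elim hom_coords_ConsE) (auto simp: hom_coords_def)
  then show "x \<in> multiproj (n # ms)"
    using x(1) v \<tau> by (auto simp: multiproj_def hom_coords_Cons intro!: image_eqI[of _ _ "u # \<tau>"])
qed

lemma product_line_iff:
  "u # \<tau> \<in> hom_coords (15 # ms) \<Longrightarrow> map line (u # \<tau>) \<in> product (Y_of f) (multiproj ms) \<longleftrightarrow> [line u] \<in> Y_of f"
  "u # \<tau> \<in> hom_coords (15 # ms) \<Longrightarrow> map line (u # \<tau>) \<in> product (X_of f) (multiproj ms) \<longleftrightarrow> [line u] \<in> X_of f"
  by (auto simp: product_Cons length_Y_of length_X_of hom_coords_Cons multiproj_def)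

text \<open>The construction is run twice: with constant \<open>\<Omega>\<close> for the
  birationality of the two threefolds, and with a projective line of parameters for the equivariant
  map. \<open>path\<close> moves a parameter polynomially to one with
  \<open>\<Omega> = \<omega>0\<close>, and it may leave \<open>hom_coords\<close> only where
  \<open>\<Omega>\<close> vanishes.\<close>

locale family =
  fixes ms :: "nat list" and \<Omega> :: "'k::{alg_closed_field, field_char_0} vec list \<Rightarrow> 'k vec" and e :: "nat \<Rightarrow> nat"
  assumes \<Omega>_carrier: "\<tau> \<in> carr ms \<Longrightarrow> \<Omega> \<tau> \<in> carrier_vec 2"
    and \<Omega>_hompoly: "i < 2 \<Longrightarrow> hompoly (15 # ms) e (\<lambda>x. \<Omega> (tl x) $ i)"
    and path: "\<tau> \<in> hom_coords ms \<Longrightarrow> \<exists>T. T 0 = \<tau> \<and> \<Omega> (T 1) = \<omega>0 \<and> (\<forall>s. T s \<in> carr ms) \<and>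
      (\<forall>s. \<Omega> (T s) \<noteq> 0\<^sub>v 2 \<longrightarrow> T s \<in> hom_coords ms) \<and> (\<forall>j<length ms. \<forall>i<ms ! j. poly2 (\<lambda>s t. (T s ! j) $ i)) \<and>
      (\<forall>i<2. poly2 (\<lambda>s t. \<Omega> (T s) $ i))"
begin

definition Y_vector :: "'k vec list \<Rightarrow> 'k vec" where
  "Y_vector x = probe (pfaffian_adjoint (x ! 0)) (\<Omega> (tl x))"

definition X_vector :: "'k vec list \<Rightarrow> 'k vec" where
  "X_vector x = probe (x ! 0) (\<Omega> (tl x))"

definition to_X :: "'k vec list \<Rightarrow> 'k vec list" where
  "to_X x = plane (Y_vector x) # tl x"

definition to_Y :: "'k vec list \<Rightarrow> 'k vec list" where
  "to_Y x = form_coords (killer 4 4 5 (X_vector x)) # tl x"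

abbreviation "ns \<equiv> 15 # ms"
abbreviation "YY \<equiv> product (Y_of (form :: 'k vec \<Rightarrow> 'k mat)) (multiproj ms)"
abbreviation "XX \<equiv> product (X_of (form :: 'k vec \<Rightarrow> 'k mat)) (multiproj ms)"

definition Y_open :: "'k point set" where
  "Y_open = YY \<inter> nonvanishing ns (\<lambda>x. admissible (Y_vector x) (\<Omega> (tl x)))"

definition X_open :: "'k point set" where
  "X_open = XX \<inter> nonvanishing ns (\<lambda>x. admissible (X_vector x) (\<Omega> (tl x)))"

lemma hompoly_first: "l < 15 \<Longrightarrow> hompoly ns (\<lambda>l. if l = 0 then 1 else 0) (\<lambda>x. (x ! 0) $ l)"
  by (rule hompoly_coord) auto

lemma hompoly_Y_vector:
  "i < 6 \<Longrightarrow> hompoly ns (\<lambda>l. ((if l = 0 then 1 else 0) + (if l = 0 then 1 else 0)) + e l) (\<lambda>x. Y_vector x $ i)"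
  unfolding Y_vector_def by (intro hompoly_probe hompoly_pfaffian_adjoint hompoly_first \<Omega>_hompoly)

lemma hompoly_X_vector: "i < 6 \<Longrightarrow> hompoly ns (\<lambda>l. (if l = 0 then 1 else 0) + e l) (\<lambda>x. X_vector x $ i)"
  unfolding X_vector_def by (intro hompoly_probe hompoly_first \<Omega>_hompoly)

lemmas hompoly_Y_open = hompoly_admissible[OF hompoly_Y_vector \<Omega>_hompoly]
lemmas hompoly_X_open = hompoly_admissible[OF hompoly_X_vector \<Omega>_hompoly]

lemma Y_open_iff: "x \<in> hom_coords ns \<Longrightarrow> map line x \<in> Y_open \<longleftrightarrow>
    map line x \<in> YY \<and> admissible (Y_vector x) (\<Omega> (tl x)) \<noteq> 0"
  unfolding Y_open_def using map_line_in_nonvanishing[OF hompoly_Y_open] by blast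

lemma X_open_iff: "x \<in> hom_coords ns \<Longrightarrow> map line x \<in> X_open \<longleftrightarrow>
    map line x \<in> XX \<and> admissible (X_vector x) (\<Omega> (tl x)) \<noteq> 0"
  unfolding X_open_def using map_line_in_nonvanishing[OF hompoly_X_open] by blast

lemma to_carr: "x \<in> carr ns \<Longrightarrow> to_X x \<in> carr ns" "x \<in> carr ns \<Longrightarrow> to_Y x \<in> carr ns"
  by (auto simp: to_X_def to_Y_def carr_Cons elim: carr_ConsE)

definition degs :: "(nat \<Rightarrow> nat) \<Rightarrow> nat \<Rightarrow> nat \<Rightarrow> nat" where
  "degs d j = (case j of 0 \<Rightarrow> d | Suc j' \<Rightarrow> (\<lambda>l. if l = Suc j' then 1 else 0))"

lemma hompoly_Cons_tl:
  assumes "\<And>i. i < 15 \<Longrightarrow> hompoly ns d (\<lambda>x. F x $ i)" "j < length ns" "i < ns ! j"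
  shows "hompoly ns (degs d j) (\<lambda>x. ((F x # tl x) ! j) $ i)"
proof (cases j)
  case (Suc j')
  have "hompoly ns (\<lambda>l. if l = Suc j' then 1 else 0) (\<lambda>x. (x ! Suc j') $ i)"
    by (rule hompoly_coord) (use assms Suc in auto)
  then have "hompoly ns (\<lambda>l. if l = Suc j' then 1 else 0) (\<lambda>x. (tl x ! j') $ i)"
    by (rule hompoly_cong) (auto simp: nth_tl elim: carr_ConsE)
  then show ?thesis by (simp add: degs_def Suc)
qed (use assms in \<open>simp add: degs_def\<close>)

lemmas hompoly_to_X = hompoly_Cons_tl[OF hompoly_plane[OF hompoly_Y_vector], folded to_X_def]
lemmas hompoly_to_Y = hompoly_Cons_tl[OF hompoly_form_coords[OF hompoly_killer[OF hompoly_X_vector]], folded to_Y_def]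

text \<open>The vector read off from the image is a nonzero multiple of the vector used at the
  source, so the same chart leads back to the form.\<close>

lemma to_X_Y_open:
  assumes x: "x \<in> hom_coords ns" "map line x \<in> Y_open"
  shows "to_X x \<in> hom_coords ns" "map line (to_X x) \<in> X_open" "map line (to_Y (to_X x)) = map line x"
proof -
  obtain z \<tau> where z: "x = z # \<tau>" "z \<in> carrier_vec 15" "z \<noteq> 0\<^sub>v 15" "\<tau> \<in> hom_coords ms"
    using x(1) by (rule hom_coords_ConsE)
  define v where "v = Y_vector x"
  have vc: "v \<in> carrier_vec 6" by (simp add: v_def Y_vector_def)
  have adm: "admissible v (\<Omega> \<tau>) \<noteq> 0" and Y: "[line z] \<in> Y_of form"
    using Y_open_iff[OF x(1)] x product_line_iff(1)[of z \<tau> ms] unfolding z(1) v_def by auto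
  have \<Omega>c: "\<Omega> \<tau> \<in> carrier_vec 2" using \<Omega>_carrier z(4) hom_coords_subset_carr by blast
  obtain a where a: "a \<in> carrier_vec 5" "a \<noteq> 0\<^sub>v 5" "cubic a = 0" "z = form_coords a"
    using Y_repE[OF Y z(2,3)] by blast
  have v: "v = probe (pfaffian_adjoint (form_coords a)) (\<Omega> \<tau>)" by (simp add: v_def Y_vector_def z(1) a(4))
  note c = cubic_to_planes[OF a(1-3) v adm]
  interpret chart 4 4 5 v a by (rule c(1))
  have plane: "plane v \<noteq> 0\<^sub>v 15" using wedge_partner by (simp add: plane_def)
  have toX: "to_X x = plane v # \<tau>" by (simp add: to_X_def v_def z(1))
  show hc: "to_X x \<in> hom_coords ns" using plane z(4) by (simp add: toX hom_coords_Cons)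
  define \<kappa> where "\<kappa> = partner 4 4 5 v \<bullet> tens (\<Omega> \<tau>)"
  have \<kappa>: "\<kappa> \<noteq> 0" using admissibleD(3)[OF adm] by (simp add: \<kappa>_def)
  have Xv: "X_vector (to_X x) = \<kappa> \<cdot>\<^sub>v v" using c(2) by (simp add: X_vector_def toX \<kappa>_def)
  have adm': "admissible (\<kappa> \<cdot>\<^sub>v v) (\<Omega> \<tau>) \<noteq> 0" by (rule admissible_smult_left[OF vc \<Omega>c \<kappa> adm])
  have "[line (plane v)] \<in> X_of form"
    unfolding X_of_form plane_def
    by (intro CollectI exI[of _ v] exI[of _ "partner 4 4 5 v"] conjI refl vc wedge_partner partner_carrier)
      (use isotropic_partner isotropic_commute[OF vc partner_carrier] in blast)
  then show "map line (to_X x) \<in> X_open"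
    unfolding X_open_iff[OF hc] using product_line_iff(2)[of "plane v" \<tau> ms] hc adm' Xv by (simp add: toX)
  have "chart 4 4 5 (\<kappa> \<cdot>\<^sub>v v) a"
    by (rule chartI_admissible[OF adm' _ a(1,2)]) (use vc b(3) in \<open>auto simp: skew_apply_linear\<close>)
  then interpret sc: chart 4 4 5 "\<kappa> \<cdot>\<^sub>v v" a .
  have "form_coords (killer 4 4 5 (\<kappa> \<cdot>\<^sub>v v)) = (det (chart_mat 4 4 5 (\<kappa> \<cdot>\<^sub>v v)) / a $ 4) \<cdot>\<^sub>v z"
    unfolding sc.killer_eq a(4) by (simp add: form_coords_smult a(1))
  then have "line (form_coords (killer 4 4 5 (\<kappa> \<cdot>\<^sub>v v))) = line z"
    using sc.det sc.b_m by (simp add: line_smult)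
  moreover have "to_Y (to_X x) = form_coords (killer 4 4 5 (\<kappa> \<cdot>\<^sub>v v)) # \<tau>"
    unfolding to_Y_def Xv by (simp add: toX)
  ultimately show "map line (to_Y (to_X x)) = map line x" by (simp add: z(1))
qed

lemma to_Y_X_open:
  assumes x: "x \<in> hom_coords ns" "map line x \<in> X_open"
  shows "to_Y x \<in> hom_coords ns" "map line (to_Y x) \<in> Y_open" "map line (to_X (to_Y x)) = map line x"
proof -
  obtain u \<tau> where u: "x = u # \<tau>" "u \<in> carrier_vec 15" "u \<noteq> 0\<^sub>v 15" "\<tau> \<in> hom_coords ms"
    using x(1) by (rule hom_coords_ConsE)
  define v where "v = X_vector x"
  have vc: "v \<in> carrier_vec 6" by (simp add: v_def X_vector_def)
  have adm: "admissible v (\<Omega> \<tau>) \<noteq> 0" and X: "[line u] \<in> X_of form"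
    using X_open_iff[OF x(1)] x product_line_iff(2)[of u \<tau> ms] unfolding u(1) v_def by auto
  have \<Omega>c: "\<Omega> \<tau> \<in> carrier_vec 2" using \<Omega>_carrier u(4) hom_coords_subset_carr by blast
  obtain p q where pq: "p \<in> carrier_vec 6" "q \<in> carrier_vec 6" "isotropic p q" "u = coords (wedge p q)"
    using X_repE[OF X u(2,3)] by blast
  have nz: "coords (wedge p q) \<noteq> 0\<^sub>v 15" using u(3) pq(4) by simp
  have v: "v = probe (coords (wedge p q)) (\<Omega> \<tau>)" by (simp add: v_def X_vector_def u(1) pq(4))
  define a where "a = killer 4 4 5 v"
  note c = planes_to_cubic[OF pq(1,2) nz pq(3) v adm, folded a_def]
  interpret chart 4 4 5 v a by (rule c(1))
  have toY: "to_Y x = form_coords a # \<tau>" by (simp add: to_Y_def a_def v_def u(1))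
  show hc: "to_Y x \<in> hom_coords ns"
    using form_coords_eq_zeroD[OF b(1)] c(2) u(4) by (auto simp: toY hom_coords_Cons)
  obtain \<kappa> where \<kappa>: "\<kappa> \<noteq> 0" "probe (pfaffian_adjoint (form_coords a)) (\<Omega> \<tau>) = \<kappa> \<cdot>\<^sub>v v" using c(4) by blast
  have Yv: "Y_vector (to_Y x) = \<kappa> \<cdot>\<^sub>v v" using \<kappa>(2) by (simp add: Y_vector_def toY)
  have adm': "admissible (\<kappa> \<cdot>\<^sub>v v) (\<Omega> \<tau>) \<noteq> 0" by (rule admissible_smult_left[OF vc \<Omega>c \<kappa>(1) adm])
  have "[line (form_coords a)] \<in> Y_of form"
    unfolding Y_of_form using b(1) c(2,3) by blast
  then show "map line (to_Y x) \<in> Y_open"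
    unfolding Y_open_iff[OF hc] using product_line_iff(1)[of "form_coords a" \<tau> ms] hc adm' Yv by (simp add: toY)
  have "chart 4 4 5 (\<kappa> \<cdot>\<^sub>v v) a"
    by (rule chartI_admissible[OF adm' _ b(1) c(2)]) (use vc b(3) in \<open>auto simp: skew_apply_linear\<close>)
  then interpret sc: chart 4 4 5 "\<kappa> \<cdot>\<^sub>v v" a .
  obtain d where d: "u = d \<cdot>\<^sub>v plane (\<kappa> \<cdot>\<^sub>v v)"
    using sc.coords_wedge_partner[OF pq(1,2) isotropic_smult isotropic_smult] vc pq(1,2) c(6,7)
    unfolding plane_def pq(4) by blast
  moreover have "d \<noteq> 0" using d u(3) plane_carrier[of "\<kappa> \<cdot>\<^sub>v v"] by (auto simp: vec_eq_iff)
  ultimately have "line (plane (\<kappa> \<cdot>\<^sub>v v)) = line u" by (simp add: line_smult)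
  moreover have "to_X (to_Y x) = plane (\<kappa> \<cdot>\<^sub>v v) # \<tau>"
    unfolding to_X_def Yv by (simp add: toY)
  ultimately show "map line (to_X (to_Y x)) = map line x" by (simp add: u(1))
qed

lemma Y_open_subset: "Y_open \<subseteq> multiproj ns" and X_open_subset: "X_open \<subseteq> multiproj ns"
  unfolding Y_open_def X_open_def using product_subset_multiproj[OF Y_of_subset] product_subset_multiproj[OF X_of_subset]
  by blast+

lemma to_X_line: "x \<in> hom_coords ns \<Longrightarrow> proj_map ns to_X (map line x) = map line (to_X x)"
  by (rule proj_map_line[OF to_carr(1) hompoly_to_X])

lemma to_Y_line: "x \<in> hom_coords ns \<Longrightarrow> proj_map ns to_Y (map line x) = map line (to_Y x)"
  by (rule proj_map_line[OF to_carr(2) hompoly_to_Y])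

lemma isomorphism_to_X: "isomorphism ns Y_open ns X_open (proj_map ns to_X)"
  unfolding isomorphism_def
proof (intro conjI exI[of _ "proj_map ns to_Y"] ballI)
  show "morphism ns Y_open ns X_open (proj_map ns to_X)"
    by (rule proj_map_morphism[OF Y_open_subset X_open_subset to_carr(1) hompoly_to_X]) (use to_X_Y_open in auto)
  show "morphism ns X_open ns Y_open (proj_map ns to_Y)"
    by (rule proj_map_morphism[OF X_open_subset Y_open_subset to_carr(2) hompoly_to_Y]) (use to_Y_X_open in auto)
  fix y assume "y \<in> Y_open"
  then obtain x where "x \<in> hom_coords ns" "y = map line x" using Y_open_subset by (auto simp: multiproj_def)
  then show "proj_map ns to_Y (proj_map ns to_X y) = y"
    using to_X_line to_Y_line to_X_Y_open \<open>y \<in> Y_open\<close> by metis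
next
  fix y assume "y \<in> X_open"
  then obtain x where "x \<in> hom_coords ns" "y = map line x" using X_open_subset by (auto simp: multiproj_def)
  then show "proj_map ns to_X (proj_map ns to_Y y) = y"
    using to_X_line to_Y_line to_Y_X_open \<open>y \<in> X_open\<close> by metis
qed

end

context family
begin

text \<open>The point of the cubic moves in a slice to \<open>good_point\<close> while the parameter
  moves along its path; \<open>P\<close> is nonzero at \<open>(0, 0)\<close> and
  \<open>admissible\<close> at \<open>(1, 0)\<close>.\<close>

lemma dense_Y:
  assumes x: "x \<in> hom_coords ns" "map line x \<in> YY" and P: "hompoly ns D P" "P x \<noteq> 0"
  shows "\<exists>w\<in>hom_coords ns. map line w \<in> YY \<and> P w \<noteq> 0 \<and> admissible (Y_vector w) (\<Omega> (tl w)) \<noteq> 0"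
proof -
  obtain z \<tau> where z: "x = z # \<tau>" "z \<in> carrier_vec 15" "z \<noteq> 0\<^sub>v 15" "\<tau> \<in> hom_coords ms"
    using x(1) by (rule hom_coords_ConsE)
  have "[line z] \<in> Y_of form" using x product_line_iff(1)[of z \<tau> ms] unfolding z(1) by auto
  then obtain a where a: "a \<in> carrier_vec 5" "a \<noteq> 0\<^sub>v 5" "cubic a = 0" "z = form_coords a"
    using Y_repE z(2,3) by blast
  obtain T where T: "T 0 = \<tau>" "\<Omega> (T 1) = \<omega>0" "\<And>s. T s \<in> carr ms" "\<And>s. \<Omega> (T s) \<noteq> 0\<^sub>v 2 \<Longrightarrow> T s \<in> hom_coords ms"
    "\<And>j i. j < length ms \<Longrightarrow> i < ms ! j \<Longrightarrow> poly2 (\<lambda>s t. (T s ! j) $ i)" "\<And>i. i < 2 \<Longrightarrow> poly2 (\<lambda>s t. \<Omega> (T s) $ i)"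
    using path[OF z(4)] by blast
  define V where "V s t = probe (pfaffian_adjoint (form_coords (slice a s t))) (\<Omega> (T s))" for s t
  have Vc: "V s t \<in> carrier_vec 6" for s t by (simp add: V_def)
  have Vp: "poly2 (\<lambda>s t. V s t $ i)" if "i < 6" for i
    unfolding V_def probe_def
    by (intro poly2_skew_apply_pfaffian_adjoint poly2_slice poly2_tens T(6) slice_carrier tens_carrier that)
  have h: "poly2 (\<lambda>s t. admissible (V s t) (\<Omega> (T s)))"
    by (intro poly2_admissible Vc Vp \<Omega>_carrier T)
  have h1: "admissible (V 1 0) (\<Omega> (T 1)) \<noteq> 0"
    using good_vector_admissible by (simp add: V_def slice_1_0 T(2) good_vector_def)
  have p: "poly2 (\<lambda>s t. P (form_coords (slice a s t) # T s))"
  proof (rule poly2_hompoly[OF P(1)])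
    show "form_coords (slice a s t) # T s \<in> carr ns" for s t by (simp add: carr_Cons T(3))
    fix j i assume ji: "j < length ns" "i < ns ! j"
    show "poly2 (\<lambda>s t. ((form_coords (slice a s t) # T s) ! j) $ i)"
    proof (cases j)
      case 0
      then have "i < 15" using ji by simp
      show ?thesis unfolding 0 using less_15_cases[OF \<open>i < 15\<close>]
        by (elim disjE) (simp_all add: form_coords_index, (intro poly2_add poly2_diff poly2_uminus poly2_slice; simp)+)
    next
      case (Suc j')
      then show ?thesis using T(5)[of j' i] ji by simp
    qed
  qed
  have p0: "P (form_coords (slice a 0 0) # T 0) \<noteq> 0" using P(2) z(1) a(4) by (simp add: slice_0_0[OF a(1)] T(1))
  obtain s t where st: "cubic (slice a s t) = 0" "P (form_coords (slice a s t) # T s) \<noteq> 0"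
    "admissible (V s t) (\<Omega> (T s)) \<noteq> 0"
    using cubic_slice[OF a(1,3) p p0 h h1] by blast
  have b0: "slice a s t \<noteq> 0\<^sub>v 5"
  proof
    assume "slice a s t = 0\<^sub>v 5"
    then have "V s t $ 5 = 0" by (simp add: V_def probe_def skew_apply_index pfaffian_adjoint_index)
    then show False using admissibleD(2)[OF st(3)] by simp
  qed
  have "\<Omega> (T s) \<noteq> 0\<^sub>v 2"
  proof
    assume "\<Omega> (T s) = 0\<^sub>v 2"
    then have "tens (\<Omega> (T s)) = 0\<^sub>v 6" by (auto simp: tens_def)
    then show False using admissibleD(3)[OF st(3)] by simp
  qed
  then have hc: "form_coords (slice a s t) # T s \<in> hom_coords ns"
    using T(4) form_coords_eq_zeroD[OF slice_carrier] b0 by (auto simp: hom_coords_Cons)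
  have "[line (form_coords (slice a s t))] \<in> Y_of form"
    unfolding Y_of_form using st(1) b0 slice_carrier by blast
  then have "map line (form_coords (slice a s t) # T s) \<in> YY" using product_line_iff(1)[OF hc] by blast
  moreover have "admissible (Y_vector (form_coords (slice a s t) # T s)) (\<Omega> (tl (form_coords (slice a s t) # T s))) \<noteq> 0"
    using st(3) by (simp add: Y_vector_def V_def)
  ultimately show ?thesis using hc st(2) by blast
qed

text \<open>X is not a hypersurface that could be sliced, so its points are deformed through
  vectors. A vector \<open>v\<close> of the plane that only \<open>a\<close> annihilates determines
  the plane by some chart \<open>(m, i, j)\<close>, and it is the adjoint of the form
  \<open>a\<close> applied to some \<open>\<xi>\<close>. Moving \<open>a\<close> in a slice and
  \<open>\<xi>\<close> to \<open>tens \<omega>0\<close> moves \<open>v\<close> to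
  \<open>good_vector\<close>.\<close>

lemma dense_X:
  assumes x: "x \<in> hom_coords ns" "map line x \<in> XX" and P: "hompoly ns D P" "P x \<noteq> 0"
  shows "\<exists>w\<in>hom_coords ns. map line w \<in> XX \<and> P w \<noteq> 0 \<and> admissible (X_vector w) (\<Omega> (tl w)) \<noteq> 0"
proof -
  obtain u \<tau> where u: "x = u # \<tau>" "u \<in> carrier_vec 15" "u \<noteq> 0\<^sub>v 15" "\<tau> \<in> hom_coords ms"
    using x(1) by (rule hom_coords_ConsE)
  have "[line u] \<in> X_of form" using x product_line_iff(2)[of u \<tau> ms] unfolding u(1) by auto
  then obtain y z where yz: "y \<in> carrier_vec 6" "z \<in> carrier_vec 6" "isotropic y z" "u = coords (wedge y z)"
    using X_repE u(2,3) by blast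
  have nz: "coords (wedge y z) \<noteq> 0\<^sub>v 15" using u(3) yz(4) by simp
  obtain c d a where cd: "c \<noteq> 0 \<or> d \<noteq> 0" and a: "a \<in> carrier_vec 5" "a \<noteq> 0\<^sub>v 5"
    "skew_apply (form_coords a) (c \<cdot>\<^sub>v y + d \<cdot>\<^sub>v z) = 0\<^sub>v 6"
    and uniq: "\<And>b. b \<in> carrier_vec 5 \<Longrightarrow> skew_apply (form_coords b) (c \<cdot>\<^sub>v y + d \<cdot>\<^sub>v z) = 0\<^sub>v 6 \<Longrightarrow> \<exists>c. b = c \<cdot>\<^sub>v a"
    using good_vector_exists[OF yz(1,2) nz yz(3)] by blast
  define v where "v = c \<cdot>\<^sub>v y + d \<cdot>\<^sub>v z"
  have vc: "v \<in> carrier_vec 6" using yz by (simp add: v_def)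
  have isov: "isotropic y v" "isotropic z v"
    unfolding v_def using yz by (auto intro!: isotropic_combine isotropic_self simp: isotropic_commute[of z y])
  have "\<exists>w. w \<in> carrier_vec 6 \<and> coords (wedge v w) \<noteq> 0\<^sub>v 15 \<and> isotropic v w"
  proof -
    have one: "1 \<cdot>\<^sub>v y + 0 \<cdot>\<^sub>v z = y" "0 \<cdot>\<^sub>v y + 1 \<cdot>\<^sub>v z = z" using yz(1,2) by auto
    have w: "coords (wedge v z) = c \<cdot>\<^sub>v coords (wedge y z)" "coords (wedge v y) = (- d) \<cdot>\<^sub>v coords (wedge y z)"
      using coords_wedge_combine[OF yz(1,2), of c d 0 1] coords_wedge_combine[OF yz(1,2), of c d 1 0]
      unfolding one v_def by simp_all
    obtain i where i: "i < 15" "coords (wedge y z) $ i \<noteq> 0"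
      using nz coords_carrier by (metis carrier_vecD eq_vecI index_zero_vec)
    have "coords (wedge v z) \<noteq> 0\<^sub>v 15" if "c \<noteq> 0"
    proof
      assume "coords (wedge v z) = 0\<^sub>v 15"
      then have "(c \<cdot>\<^sub>v coords (wedge y z)) $ i = 0" using w(1) i by simp
      then show False using that i by simp
    qed
    moreover have "coords (wedge v y) \<noteq> 0\<^sub>v 15" if "d \<noteq> 0"
    proof
      assume "coords (wedge v y) = 0\<^sub>v 15"
      then have "((- d) \<cdot>\<^sub>v coords (wedge y z)) $ i = 0" using w(2) i by simp
      then show False using that i by simp
    qed
    ultimately show ?thesis using cd isov yz(1,2) vc isotropic_commute by blast
  qed
  then obtain w where w: "w \<in> carrier_vec 6" "coords (wedge v w) \<noteq> 0\<^sub>v 15" "isotropic v w" by blast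
  obtain m i j where "chart m i j v a"
    using chart_exists[OF vc w a(1,2)] a(3) uniq unfolding v_def by blast
  then interpret c0: chart m i j v a .
  have "cubic a = 0"
  proof (rule cubic_zero_if_kernel[OF c0.b(3) vc])
    show "v \<noteq> 0\<^sub>v 6" using c0.vj c0.j by auto
  qed
  obtain \<xi> where \<xi>: "\<xi> \<in> carrier_vec 6" "v = skew_apply (pfaffian_adjoint (form_coords a)) \<xi>"
    using kernel_in_range_pfaffian_adjoint[OF c0.b(3) vc pfaffian_adjoint_form_nonzero[OF a(1,2)]] by blast
  obtain T where T: "T 0 = \<tau>" "\<Omega> (T 1) = \<omega>0" "\<And>s. T s \<in> carr ms" "\<And>s. \<Omega> (T s) \<noteq> 0\<^sub>v 2 \<Longrightarrow> T s \<in> hom_coords ms"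
    "\<And>j i. j < length ms \<Longrightarrow> i < ms ! j \<Longrightarrow> poly2 (\<lambda>s t. (T s ! j) $ i)" "\<And>i. i < 2 \<Longrightarrow> poly2 (\<lambda>s t. \<Omega> (T s) $ i)"
    using path[OF u(4)] by blast
  define \<Xi> where "\<Xi> s = vec 6 (\<lambda>l. \<xi> $ l + s * (tens \<omega>0 $ l - \<xi> $ l))" for s :: 'k
  have \<Xi>: "\<Xi> s \<in> carrier_vec 6" "\<Xi> 0 = \<xi>" "\<Xi> 1 = tens \<omega>0" for s
    using \<xi>(1) by (auto simp: \<Xi>_def tens_def)
  define V where "V s t = skew_apply (pfaffian_adjoint (form_coords (slice a s t))) (\<Xi> s)" for s t
  have Vc: "V s t \<in> carrier_vec 6" for s t by (simp add: V_def)
  have V00: "V 0 0 = v" by (simp add: V_def slice_0_0[OF a(1)] \<Xi> \<xi>(2))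
  have V10: "V 1 0 = good_vector" by (simp add: V_def slice_1_0 \<Xi> good_vector_def probe_def)
  have Vp: "poly2 (\<lambda>s t. V s t $ i)" if "i < 6" for i
    unfolding V_def
  proof (intro poly2_skew_apply_pfaffian_adjoint poly2_slice slice_carrier \<Xi>(1) that)
    show "poly2 (\<lambda>s t. \<Xi> s $ i)" if "i < 6" for i
      using that by (simp add: \<Xi>_def) (intro poly2_add poly2_mult poly2_const poly2_fst)
  qed
  define B where "B s t = coords (wedge (V s t) (partner m i j (V s t)))" for s t
  \<comment> \<open>The chart \<open>(m, i, j)\<close> of the given point enters \<open>p\<close>,
    and the fixed chart \<open>(4, 4, 5)\<close> enters \<open>h\<close> below. Where both are valid
    they describe the same plane up to a factor.\<close>
  define p where "p s t = P (B s t # T s) * (det (chart_mat m i j (V s t)) * V s t $ j)" for s t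
  have pp: "poly2 p"
    unfolding p_def
  proof (intro poly2_mult poly2_det_chart_mat Vp c0.j)
    show "poly2 (\<lambda>s t. P (B s t # T s))"
    proof (rule poly2_hompoly[OF P(1)])
      show "B s t # T s \<in> carr ns" for s t by (simp add: carr_Cons T(3) B_def)
      fix j' i' assume ji: "j' < length ns" "i' < ns ! j'"
      show "poly2 (\<lambda>s t. ((B s t # T s) ! j') $ i')"
      proof (cases j')
        case 0
        then show ?thesis using ji c0.m
          by (simp add: B_def) (rule poly2_coords_wedge[OF Vp poly2_partner[OF Vp]], auto)
      next
        case (Suc j'')
        then show ?thesis using T(5)[of j'' i'] ji by simp
      qed
    qed
  qed
  have p0: "p 0 0 \<noteq> 0"
  proof -
    obtain \<kappa> where \<kappa>: "coords (wedge y z) = \<kappa> \<cdot>\<^sub>v B 0 0"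
      using c0.coords_wedge_partner[OF yz(1,2) isov] by (auto simp: B_def V00)
    have "\<kappa> \<noteq> 0" using \<kappa> nz by (auto simp: B_def vec_eq_iff)
    have B0: "B 0 0 \<in> carrier_vec 15" by (simp add: B_def)
    have "x ! l = (if l = 0 then \<kappa> else 1) \<cdot>\<^sub>v ((B 0 0 # T 0) ! l)" if "l < length ns" for l
      using that \<kappa> yz(4) u(1) T(1) by (cases l) auto
    moreover have "length x = length ns" using x(1) by (auto simp: hom_coords_def list_all2_conv_all_nth)
    ultimately have "P x = (\<Prod>l<length ns. (if l = 0 then \<kappa> else 1) ^ D l) * P (B 0 0 # T 0)"
      using B0 T(3)[of 0] by (intro hompoly_rescale[OF P(1)]) (simp_all add: carr_Cons)
    then have "P (B 0 0 # T 0) \<noteq> 0" using P(2) by auto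
    then show ?thesis using c0.det c0.vj by (simp add: p_def V00)
  qed
  define h where "h s t = admissible (probe (plane (V s t)) (\<Omega> (T s))) (\<Omega> (T s)) *
      (det (chart_mat 4 4 5 (V s t)) * V s t $ 5)" for s t
  have hp: "poly2 h"
    unfolding h_def
    by (intro poly2_mult poly2_admissible poly2_det_chart_mat Vp probe_carrier \<Omega>_carrier T(3,6) poly2_probe poly2_plane)
      simp_all
  have "admissible good_vector (\<Omega> (T 1)) \<noteq> 0" unfolding T(2) by (rule good_vector_admissible)
  note good = cubic_to_planes[OF good_point_facts good_vector_def good_vector_admissible] admissibleD[OF good_vector_admissible]
  have gv: "good_vector \<in> carrier_vec 6" by (simp add: good_vector_def)
  have \<omega>0: "\<omega>0 \<in> carrier_vec 2" by (simp add: \<omega>0_def)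
  have h1: "h 1 0 \<noteq> 0"
    unfolding h_def V10 T(2) good(2)
    using admissible_smult_left[OF gv \<omega>0 good(5) good_vector_admissible] good(3,4) by simp
  obtain s t where st: "cubic (slice a s t) = 0" "p s t \<noteq> 0" "h s t \<noteq> 0"
    using cubic_slice[OF a(1) \<open>cubic a = 0\<close> pp p0 hp h1] by blast
  let ?b = "slice a s t" and ?v = "V s t" and ?\<omega> = "\<Omega> (T s)"
  have b0: "?b \<noteq> 0\<^sub>v 5"
  proof
    assume "?b = 0\<^sub>v 5"
    then have "?v $ 5 = 0" by (simp add: V_def skew_apply_index pfaffian_adjoint_index)
    then show False using st(3) by (simp add: h_def)
  qed
  have kb: "skew_apply (form_coords ?b) ?v = 0\<^sub>v 6" unfolding V_def by (rule form_kills_probe[OF st(1)])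
  interpret c1: chart m i j ?v ?b
    by unfold_locales (use st(2) b0 kb Vc c0.m c0.i c0.j in \<open>simp_all add: p_def\<close>)
  interpret c2: chart 4 4 5 ?v ?b
    by unfold_locales (use st(3) b0 kb Vc in \<open>simp_all add: h_def\<close>)
  have hadm: "admissible (probe (plane ?v) ?\<omega>) ?\<omega> \<noteq> 0" using st(3) by (simp add: h_def)
  have "?\<omega> \<noteq> 0\<^sub>v 2"
  proof
    assume "?\<omega> = 0\<^sub>v 2"
    then have "tens ?\<omega> = 0\<^sub>v 6" by (auto simp: tens_def)
    then show False using admissibleD(3)[OF hadm] by simp
  qed
  then have Ts: "T s \<in> hom_coords ms" by (rule T(4))
  have B: "B s t \<in> carrier_vec 15" "B s t \<noteq> 0\<^sub>v 15" using c1.wedge_partner by (simp_all add: B_def)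
  have hc: "B s t # T s \<in> hom_coords ns" using B Ts by (simp add: hom_coords_Cons)
  have "[line (B s t)] \<in> X_of form"
    unfolding X_of_form B_def
    by (intro CollectI exI[of _ ?v] exI[of _ "partner m i j ?v"] conjI refl Vc c1.wedge_partner partner_carrier)
      (use c1.isotropic_partner isotropic_commute[OF Vc partner_carrier] in blast)
  then have "map line (B s t # T s) \<in> XX" using product_line_iff(2)[OF hc] by blast
  moreover have "P (B s t # T s) \<noteq> 0" using st(2) by (simp add: p_def)
  moreover have "admissible (X_vector (B s t # T s)) (\<Omega> (tl (B s t # T s))) \<noteq> 0"
  proof -
    obtain \<kappa> where \<kappa>: "B s t = \<kappa> \<cdot>\<^sub>v plane ?v"
      using c2.coords_wedge_partner[OF Vc partner_carrier isotropic_self[OF Vc] c1.isotropic_partner]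
      unfolding B_def plane_def by blast
    moreover have "\<kappa> \<noteq> 0" using \<kappa> B(2) plane_carrier[of ?v] by (auto simp: vec_eq_iff)
    moreover have "probe (\<kappa> \<cdot>\<^sub>v plane ?v) ?\<omega> = \<kappa> \<cdot>\<^sub>v probe (plane ?v) ?\<omega>"
      by (simp add: probe_def skew_apply_linear)
    ultimately show ?thesis
      using admissible_smult_left[OF probe_carrier \<Omega>_carrier[OF T(3)] _ hadm] by (simp add: X_vector_def)
  qed
  ultimately show ?thesis using hc by blast
qed

lemma dense_open_Y: "dense_open ns YY Y_open"
  unfolding Y_open_def
  by (rule dense_openI[OF product_subset_multiproj[OF Y_of_subset] hompoly_Y_open dense_Y]) auto

lemma dense_open_X: "dense_open ns XX X_open"
  unfolding X_open_def
  by (rule dense_openI[OF product_subset_multiproj[OF X_of_subset] hompoly_X_open dense_X]) auto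

lemma birational_map_to_X: "birational_map ns YY ns XX Y_open (proj_map ns to_X)"
  unfolding birational_map_def using dense_open_Y dense_open_X isomorphism_to_X by blast

end

lemma family_constant: "family [] (\<lambda>_. \<omega>0 :: 'k::{alg_closed_field, field_char_0} vec) (\<lambda>_. 0)"
proof
  show "\<omega>0 \<in> carrier_vec 2" by (simp add: \<omega>0_def)
  show "\<exists>T. T 0 = \<tau> \<and> (\<omega>0 :: 'k vec) = \<omega>0 \<and> (\<forall>s. T (s :: 'k) \<in> carr []) \<and> (\<forall>s. \<omega>0 \<noteq> (0\<^sub>v 2 :: 'k vec) \<longrightarrow> T s \<in> hom_coords []) \<and>
    (\<forall>j<length []. \<forall>i<[] ! j. poly2 (\<lambda>s t. (T s ! j) $ i)) \<and> (\<forall>i<2. poly2 (\<lambda>s t. \<omega>0 $ i :: 'k))"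
    if "\<tau> \<in> hom_coords []" for \<tau> :: "'k vec list"
    using that by (intro exI[of _ "\<lambda>_. \<tau>"]) (auto simp: hom_coords_def carr_def)
qed (auto intro: hompoly_const)

lemma family_line:
  "family [2] (\<lambda>\<tau>. \<tau> ! 0 :: 'k::{alg_closed_field, field_char_0} vec) (\<lambda>l. if l = 1 then 1 else 0)"
proof
  fix \<tau> :: "'k vec list" assume "\<tau> \<in> carr [2]"
  then show "\<tau> ! 0 \<in> carrier_vec 2" by (auto simp: carr_Cons elim: carr_ConsE)
next
  fix i :: nat assume i: "i < 2"
  have "hompoly [15, 2] (\<lambda>l. if l = 1 then 1 else 0) (\<lambda>x. (x ! 1) $ i :: 'k)"
    by (rule hompoly_coord) (use i in auto)
  then show "hompoly [15, 2] (\<lambda>l. if l = 1 then 1 else 0) (\<lambda>x. (tl x ! 0) $ i :: 'k)"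
    by (rule hompoly_cong) (auto simp: nth_tl elim: carr_ConsE)
next
  fix \<tau> :: "'k vec list" assume "\<tau> \<in> hom_coords [2]"
  then obtain w where w: "\<tau> = [w]" "w \<in> carrier_vec 2" by (elim hom_coords_ConsE) (auto simp: hom_coords_def)
  \<comment> \<open>This segment may pass through the zero vector, which \<open>path\<close>
    permits.\<close>
  define T where "T s = vec 2 (\<lambda>l. w $ l + s * (\<omega>0 $ l - w $ l))" for s :: 'k
  have "T 0 = w" "T 1 = \<omega>0" using w(2) by (auto simp: T_def \<omega>0_def)
  moreover have "poly2 (\<lambda>s t. T s $ i)" if "i < 2" for i
    using that by (simp add: T_def) (intro poly2_add poly2_mult poly2_const poly2_fst)
  moreover have "T s \<in> carrier_vec 2" for s by (simp add: T_def)
  ultimately show "\<exists>T. T 0 = \<tau> \<and> T (1 :: 'k) ! 0 = \<omega>0 \<and> (\<forall>s. T s \<in> carr [2]) \<and>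
      (\<forall>s. T s ! 0 \<noteq> 0\<^sub>v 2 \<longrightarrow> T s \<in> hom_coords [2]) \<and> (\<forall>j<length [2]. \<forall>i<[2] ! j. poly2 (\<lambda>s t. (T s ! j) $ i)) \<and>
      (\<forall>i<2. poly2 (\<lambda>s t. (T s ! 0) $ i))"
    by (intro exI[of _ "\<lambda>s. [T s]"]) (auto simp: w(1) carr_def hom_coords_def)
qed

section \<open>The action of the Klein four-group\<close>

text \<open>The action on bivectors induced by \<open>repD\<close>, which changes the sign of the
  second copy of \<open>k^3\<close> in V. The matrices of \<open>repD\<close> and
  \<open>repT\<close> are orthogonal involutions, so forms transform by the same formulas as
  bivectors.\<close>

definition actD :: "'k::field vec \<Rightarrow> 'k vec" where
  "actD u = vec 15 (\<lambda>l. [u $ 0, u $ 1, - u $ 2, - u $ 3, - u $ 4, u $ 5, - u $ 6, - u $ 7, - u $ 8,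
     - u $ 9, - u $ 10, - u $ 11, u $ 12, u $ 13, u $ 14] ! l)"

definition actT :: "'k::field vec \<Rightarrow> 'k vec" where
  "actT u = vec 15 (\<lambda>l. [u $ 12, u $ 13, - u $ 2, - u $ 6, - u $ 9, u $ 14, - u $ 3, - u $ 7, - u $ 10,
     - u $ 4, - u $ 8, - u $ 11, u $ 0, u $ 1, u $ 5] ! l)"

definition repD :: "'k::field vec \<Rightarrow> 'k vec" where
  "repD v = vec 6 (\<lambda>l. [v $ 0, v $ 1, v $ 2, - v $ 3, - v $ 4, - v $ 5] ! l)"

definition repT :: "'k::field vec \<Rightarrow> 'k vec" where
  "repT v = vec 6 (\<lambda>l. [v $ 3, v $ 4, v $ 5, v $ 0, v $ 1, v $ 2] ! l)"

definition lineD :: "'k::field vec \<Rightarrow> 'k vec" where "lineD w = vec 2 (\<lambda>l. [w $ 0, - w $ 1] ! l)"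
definition lineT :: "'k::field vec \<Rightarrow> 'k vec" where "lineT w = vec 2 (\<lambda>l. [w $ 1, w $ 0] ! l)"

lemma actD_index: "actD u $ 0 = u $ 0" "actD u $ Suc 0 = u $ Suc 0" "actD u $ 2 = - u $ 2" "actD u $ 3 = - u $ 3"
  "actD u $ 4 = - u $ 4" "actD u $ 5 = u $ 5" "actD u $ 6 = - u $ 6" "actD u $ 7 = - u $ 7" "actD u $ 8 = - u $ 8"
  "actD u $ 9 = - u $ 9" "actD u $ 10 = - u $ 10" "actD u $ 11 = - u $ 11" "actD u $ 12 = u $ 12"
  "actD u $ 13 = u $ 13" "actD u $ 14 = u $ 14"
  by (simp_all add: actD_def)

lemma actT_index: "actT u $ 0 = u $ 12" "actT u $ Suc 0 = u $ 13" "actT u $ 2 = - u $ 2" "actT u $ 3 = - u $ 6"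
  "actT u $ 4 = - u $ 9" "actT u $ 5 = u $ 14" "actT u $ 6 = - u $ 3" "actT u $ 7 = - u $ 7" "actT u $ 8 = - u $ 10"
  "actT u $ 9 = - u $ 4" "actT u $ 10 = - u $ 8" "actT u $ 11 = - u $ 11" "actT u $ 12 = u $ 0"
  "actT u $ 13 = u $ Suc 0" "actT u $ 14 = u $ 5"
  by (simp_all add: actT_def)

lemma repD_index: "repD u $ 0 = u $ 0" "repD u $ Suc 0 = u $ Suc 0" "repD u $ 2 = u $ 2" "repD u $ 3 = - u $ 3"
  "repD u $ 4 = - u $ 4" "repD u $ 5 = - u $ 5"
  by (simp_all add: repD_def)

lemma repT_index: "repT u $ 0 = u $ 3" "repT u $ Suc 0 = u $ 4" "repT u $ 2 = u $ 5" "repT u $ 3 = u $ 0"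
  "repT u $ 4 = u $ Suc 0" "repT u $ 5 = u $ 2"
  by (simp_all add: repT_def)

lemma act_carrier [simp]: "actD u \<in> carrier_vec 15" "actT u \<in> carrier_vec 15" "repD v \<in> carrier_vec 6"
  "repT v \<in> carrier_vec 6" "lineD w \<in> carrier_vec 2" "lineT w \<in> carrier_vec 2"
  by (simp_all add: actD_def actT_def repD_def repT_def lineD_def lineT_def)

lemma act_dim [simp]: "dim_vec (actD u) = 15" "dim_vec (actT u) = 15" "dim_vec (repD v) = 6" "dim_vec (repT v) = 6"
  by (simp_all add: actD_def actT_def repD_def repT_def)

text \<open>What the equivariance of the construction uses of one group element: \<open>A\<close>
  acts on bivectors and forms, \<open>R\<close> is a lift to V, \<open>L\<close> acts on the
  parameters. The clause on single coordinates makes \<open>A\<close> preserve degrees. The factor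
  \<open>c\<close> of the adjoint is -1 for both generators, the determinant of the lift.\<close>

definition compatible :: "('k::field vec \<Rightarrow> 'k vec) \<Rightarrow> ('k vec \<Rightarrow> 'k vec) \<Rightarrow> ('k vec \<Rightarrow> 'k vec) \<Rightarrow> bool" where
  "compatible A R L \<longleftrightarrow>
     (\<forall>u\<in>carrier_vec 15. A u \<in> carrier_vec 15 \<and> A (A u) = u \<and> (\<forall>c. A (c \<cdot>\<^sub>v u) = c \<cdot>\<^sub>v A u)) \<and>
     (\<forall>l<15. \<exists>c m. m < 15 \<and> (\<forall>u\<in>carrier_vec 15. A u $ l = c * u $ m)) \<and>
     (\<forall>v\<in>carrier_vec 6. R v \<in> carrier_vec 6 \<and> (\<forall>c. R (c \<cdot>\<^sub>v v) = c \<cdot>\<^sub>v R v)) \<and>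
     (\<forall>w\<in>carrier_vec 2. L w \<in> carrier_vec 2 \<and> (w \<noteq> 0\<^sub>v 2 \<longrightarrow> L w \<noteq> 0\<^sub>v 2) \<and> (\<forall>c. L (c \<cdot>\<^sub>v w) = c \<cdot>\<^sub>v L w)) \<and>
     (\<forall>v\<in>carrier_vec 6. \<forall>w\<in>carrier_vec 6. coords (wedge (R v) (R w)) = A (coords (wedge v w)) \<and>
        (isotropic v w \<longrightarrow> isotropic (R v) (R w))) \<and>
     (\<forall>u\<in>carrier_vec 15. \<forall>v\<in>carrier_vec 6. skew_apply (A u) (R v) = R (skew_apply u v)) \<and>
     (\<forall>w\<in>carrier_vec 2. tens (L w) = R (tens w)) \<and>
     (\<forall>u\<in>carrier_vec 15. \<exists>c. c \<noteq> 0 \<and> pfaffian_adjoint (A u) = c \<cdot>\<^sub>v A (pfaffian_adjoint u)) \<and>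
     (\<forall>a\<in>carrier_vec 5. cubic a = 0 \<longrightarrow> (\<exists>a'\<in>carrier_vec 5. cubic a' = 0 \<and> A (form_coords a) = form_coords a'))"

text \<open>Each of the five basis forms is preserved up to sign.\<close>

lemma isotropic_repD:
  assumes vw: "v \<in> carrier_vec 6" "w \<in> carrier_vec 6" and "isotropic v w" shows "isotropic (repD v) (repD w)"
  unfolding isotropic_iff_unit[OF act_carrier(3)]
proof (intro allI impI)
  fix k :: nat assume k: "k < 5"
  have "repD v \<bullet> skew_apply (form_coords (unit_vec 5 k)) (repD w) = - (v \<bullet> skew_apply (form_coords (unit_vec 5 k)) w) \<or>
      repD v \<bullet> skew_apply (form_coords (unit_vec 5 k)) (repD w) = v \<bullet> skew_apply (form_coords (unit_vec 5 k)) w"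
    unfolding scalar_prod_6[OF vw(1) skew_apply_carrier] scalar_prod_6[OF act_carrier(3) skew_apply_carrier]
    using less_5_cases[OF k]
    by (elim disjE) (simp_all add: skew_apply_index form_coords_index repD_index algebra_simps)
  then show "repD v \<bullet> skew_apply (form_coords (unit_vec 5 k)) (repD w) = 0"
    using assms k by (simp add: isotropic_def)
qed

lemma isotropic_repT:
  assumes vw: "v \<in> carrier_vec 6" "w \<in> carrier_vec 6" and "isotropic v w" shows "isotropic (repT v) (repT w)"
  unfolding isotropic_iff_unit[OF act_carrier(4)]
proof (intro allI impI)
  fix k :: nat assume k: "k < 5"
  have "repT v \<bullet> skew_apply (form_coords (unit_vec 5 k)) (repT w) = - (v \<bullet> skew_apply (form_coords (unit_vec 5 k)) w) \<or>
      repT v \<bullet> skew_apply (form_coords (unit_vec 5 k)) (repT w) = v \<bullet> skew_apply (form_coords (unit_vec 5 k)) w"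
    unfolding scalar_prod_6[OF vw(1) skew_apply_carrier] scalar_prod_6[OF act_carrier(4) skew_apply_carrier]
    using less_5_cases[OF k]
    by (elim disjE) (simp_all add: skew_apply_index form_coords_index repT_index algebra_simps)
  then show "repT v \<bullet> skew_apply (form_coords (unit_vec 5 k)) (repT w) = 0"
    using assms k by (simp add: isotropic_def)
qed

lemma less_2_cases': "l < 2 \<Longrightarrow> l = 0 \<or> l = (1::nat)" by auto

lemma vec_2_eq_iff: "v \<in> carrier_vec 2 \<Longrightarrow> w \<in> carrier_vec 2 \<Longrightarrow> v = w \<longleftrightarrow> v $ 0 = w $ 0 \<and> v $ 1 = w $ (1::nat)"
  by (auto intro!: eq_vecI dest!: less_2_cases')

lemma compatibleD:
  assumes c: "compatible A R L"
  shows "u \<in> carrier_vec 15 \<Longrightarrow> A u \<in> carrier_vec 15" "u \<in> carrier_vec 15 \<Longrightarrow> A (A u) = u"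
    "u \<in> carrier_vec 15 \<Longrightarrow> A (k \<cdot>\<^sub>v u) = k \<cdot>\<^sub>v A u"
    "l < 15 \<Longrightarrow> \<exists>c m. m < 15 \<and> (\<forall>u\<in>carrier_vec 15. A u $ l = c * u $ m)"
    "v \<in> carrier_vec 6 \<Longrightarrow> R v \<in> carrier_vec 6" "v \<in> carrier_vec 6 \<Longrightarrow> R (k \<cdot>\<^sub>v v) = k \<cdot>\<^sub>v R v"
    "x \<in> carrier_vec 2 \<Longrightarrow> L x \<in> carrier_vec 2" "x \<in> carrier_vec 2 \<Longrightarrow> x \<noteq> 0\<^sub>v 2 \<Longrightarrow> L x \<noteq> 0\<^sub>v 2"
    "x \<in> carrier_vec 2 \<Longrightarrow> L (k \<cdot>\<^sub>v x) = k \<cdot>\<^sub>v L x"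
    "v \<in> carrier_vec 6 \<Longrightarrow> w \<in> carrier_vec 6 \<Longrightarrow> coords (wedge (R v) (R w)) = A (coords (wedge v w))"
    "v \<in> carrier_vec 6 \<Longrightarrow> w \<in> carrier_vec 6 \<Longrightarrow> isotropic v w \<Longrightarrow> isotropic (R v) (R w)"
    "u \<in> carrier_vec 15 \<Longrightarrow> v \<in> carrier_vec 6 \<Longrightarrow> skew_apply (A u) (R v) = R (skew_apply u v)"
    "x \<in> carrier_vec 2 \<Longrightarrow> tens (L x) = R (tens x)"
    "u \<in> carrier_vec 15 \<Longrightarrow> \<exists>c. c \<noteq> 0 \<and> pfaffian_adjoint (A u) = c \<cdot>\<^sub>v A (pfaffian_adjoint u)"
    "a \<in> carrier_vec 5 \<Longrightarrow> cubic a = 0 \<Longrightarrow> \<exists>a'\<in>carrier_vec 5. cubic a' = 0 \<and> A (form_coords a) = form_coords a'"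
proof -
  note d = c[unfolded compatible_def]
  note c1 = d[THEN conjunct1] and d1 = d[THEN conjunct2]
  note c2 = d1[THEN conjunct1] and d2 = d1[THEN conjunct2]
  note c3 = d2[THEN conjunct1] and d3 = d2[THEN conjunct2]
  note c4 = d3[THEN conjunct1] and d4 = d3[THEN conjunct2]
  note c5 = d4[THEN conjunct1] and d5 = d4[THEN conjunct2]
  note c6 = d5[THEN conjunct1] and d6 = d5[THEN conjunct2]
  note c7 = d6[THEN conjunct1] and d7 = d6[THEN conjunct2]
  note c8 = d7[THEN conjunct1] and c9 = d7[THEN conjunct2]
  show "u \<in> carrier_vec 15 \<Longrightarrow> A u \<in> carrier_vec 15" "u \<in> carrier_vec 15 \<Longrightarrow> A (A u) = u"
    "u \<in> carrier_vec 15 \<Longrightarrow> A (k \<cdot>\<^sub>v u) = k \<cdot>\<^sub>v A u" using c1 by blast+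
  show "l < 15 \<Longrightarrow> \<exists>c m. m < 15 \<and> (\<forall>u\<in>carrier_vec 15. A u $ l = c * u $ m)" using c2 by blast
  show "v \<in> carrier_vec 6 \<Longrightarrow> R v \<in> carrier_vec 6" "v \<in> carrier_vec 6 \<Longrightarrow> R (k \<cdot>\<^sub>v v) = k \<cdot>\<^sub>v R v"
    using c3 by blast+
  show "x \<in> carrier_vec 2 \<Longrightarrow> L x \<in> carrier_vec 2" "x \<in> carrier_vec 2 \<Longrightarrow> x \<noteq> 0\<^sub>v 2 \<Longrightarrow> L x \<noteq> 0\<^sub>v 2"
    "x \<in> carrier_vec 2 \<Longrightarrow> L (k \<cdot>\<^sub>v x) = k \<cdot>\<^sub>v L x" using c4 by blast+
  show "v \<in> carrier_vec 6 \<Longrightarrow> w \<in> carrier_vec 6 \<Longrightarrow> coords (wedge (R v) (R w)) = A (coords (wedge v w))"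
    "v \<in> carrier_vec 6 \<Longrightarrow> w \<in> carrier_vec 6 \<Longrightarrow> isotropic v w \<Longrightarrow> isotropic (R v) (R w)" using c5 by blast+
  show "u \<in> carrier_vec 15 \<Longrightarrow> v \<in> carrier_vec 6 \<Longrightarrow> skew_apply (A u) (R v) = R (skew_apply u v)" using c6 by blast
  show "x \<in> carrier_vec 2 \<Longrightarrow> tens (L x) = R (tens x)" using c7 by blast
  show "u \<in> carrier_vec 15 \<Longrightarrow> \<exists>c. c \<noteq> 0 \<and> pfaffian_adjoint (A u) = c \<cdot>\<^sub>v A (pfaffian_adjoint u)" using c8 by blast
  show "a \<in> carrier_vec 5 \<Longrightarrow> cubic a = 0 \<Longrightarrow> \<exists>a'\<in>carrier_vec 5. cubic a' = 0 \<and> A (form_coords a) = form_coords a'"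
    using c9 by blast
qed

lemma compatible_id: "compatible (\<lambda>u. u) (\<lambda>v. v) (\<lambda>w. w :: 'k::field vec)"
proof -
  have "\<exists>c m. m < 15 \<and> (\<forall>u\<in>carrier_vec 15. (u :: 'k vec) $ l = c * u $ m)" if "l < 15" for l
    by (rule exI[of _ 1], rule exI[of _ l]) (simp add: that)
  moreover have "\<exists>c. c \<noteq> 0 \<and> pfaffian_adjoint u = c \<cdot>\<^sub>v pfaffian_adjoint u" for u :: "'k vec"
    by (rule exI[of _ 1]) auto
  ultimately show ?thesis unfolding compatible_def by simp blast
qed

lemma compatible_D: "compatible actD repD (lineD :: 'k::field vec \<Rightarrow> 'k vec)"
  unfolding compatible_def
proof (intro conjI ballI allI impI)
  show "\<exists>c m. m < 15 \<and> (\<forall>u\<in>carrier_vec 15. actD u $ l = c * (u :: 'k vec) $ m)" if "l < 15" for l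
    by (rule exI[of _ "if l \<in> {0, 1, 5, 12, 13, 14} then 1 else - 1"], rule exI[of _ l])
      (use less_15_cases[OF that] in \<open>elim disjE; simp add: actD_index\<close>)
  show "\<exists>c. c \<noteq> 0 \<and> pfaffian_adjoint (actD u) = c \<cdot>\<^sub>v actD (pfaffian_adjoint u)" for u :: "'k vec"
    by (rule exI[of _ "- 1"]) (auto intro!: vec_15_eqI simp: actD_index pfaffian_adjoint_index)
  show "\<exists>a'\<in>carrier_vec 5. cubic a' = 0 \<and> actD (form_coords a) = form_coords a'"
    if "a \<in> carrier_vec 5" "cubic a = 0" for a :: "'k vec"
  proof
    let ?a = "vec 5 (\<lambda>i. [- a $ 0, - a $ 1, - a $ 2, a $ 3, a $ 4] ! i)"
    have "cubic ?a = - cubic a" by (simp add: cubic_def algebra_simps power2_eq_square power3_eq_cube)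
    then show "cubic ?a = 0 \<and> actD (form_coords a) = form_coords ?a"
      using that by (auto intro!: vec_15_eqI simp: actD_index form_coords_index)
  qed simp
  show "w \<noteq> 0\<^sub>v 2 \<Longrightarrow> lineD w \<noteq> 0\<^sub>v 2" if "w \<in> carrier_vec 2" for w :: "'k vec"
    using that by (auto simp: vec_2_eq_iff lineD_def)
  show "actD (actD u) = u" "actD (c \<cdot>\<^sub>v u) = c \<cdot>\<^sub>v actD u" if "u \<in> carrier_vec 15" for u :: "'k vec" and c
    using that by (intro vec_15_eqI; simp add: actD_index)+
  show "coords (wedge (repD v) (repD w)) = actD (coords (wedge v w))" for v w :: "'k vec"
    by (intro vec_15_eqI; simp add: actD_index repD_index coords_wedge_index algebra_simps)
qed (auto intro!: vec_6_eqI isotropic_repD simp: actD_index repD_index lineD_def vec_2_eq_iff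
    skew_apply_index tens_def algebra_simps)

lemma compatible_T: "compatible actT repT (lineT :: 'k::field vec \<Rightarrow> 'k vec)"
  unfolding compatible_def
proof (intro conjI ballI allI impI)
  show "\<exists>c m. m < 15 \<and> (\<forall>u\<in>carrier_vec 15. actT u $ l = c * (u :: 'k vec) $ m)" if "l < 15" for l
    by (rule exI[of _ "if l \<in> {0, 1, 5, 12, 13, 14} then 1 else - 1"],
        rule exI[of _ "[12, 13, 2, 6, 9, 14, 3, 7, 10, 4, 8, 11, 0, 1, 5] ! l"])
      (use less_15_cases[OF that] in \<open>elim disjE; simp add: actT_index\<close>)
  show "\<exists>c. c \<noteq> 0 \<and> pfaffian_adjoint (actT u) = c \<cdot>\<^sub>v actT (pfaffian_adjoint u)" for u :: "'k vec"
    by (rule exI[of _ "- 1"]) (auto intro!: vec_15_eqI simp: actT_index pfaffian_adjoint_index algebra_simps)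
  show "\<exists>a'\<in>carrier_vec 5. cubic a' = 0 \<and> actT (form_coords a) = form_coords a'"
    if "a \<in> carrier_vec 5" "cubic a = 0" for a :: "'k vec"
  proof
    let ?a = "vec 5 (\<lambda>i. [- a $ 0, - a $ 1, - a $ 2, - a $ 3, a $ 4] ! i)"
    have "cubic ?a = - cubic a" by (simp add: cubic_def algebra_simps power2_eq_square power3_eq_cube)
    then show "cubic ?a = 0 \<and> actT (form_coords a) = form_coords ?a"
      using that by (auto intro!: vec_15_eqI simp: actT_index form_coords_index)
  qed simp
  show "w \<noteq> 0\<^sub>v 2 \<Longrightarrow> lineT w \<noteq> 0\<^sub>v 2" if "w \<in> carrier_vec 2" for w :: "'k vec"
    using that by (auto simp: vec_2_eq_iff lineT_def)
  show "actT (actT u) = u" "actT (c \<cdot>\<^sub>v u) = c \<cdot>\<^sub>v actT u" if "u \<in> carrier_vec 15" for u :: "'k vec" and c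
    using that by (intro vec_15_eqI; simp add: actT_index)+
  show "coords (wedge (repT v) (repT w)) = actT (coords (wedge v w))" for v w :: "'k vec"
    by (intro vec_15_eqI; simp add: actT_index repT_index coords_wedge_index algebra_simps)
qed (auto intro!: vec_6_eqI isotropic_repT simp: actT_index repT_index lineT_def vec_2_eq_iff
    skew_apply_index tens_def algebra_simps)

lemma act_commute: "u \<in> carrier_vec 15 \<Longrightarrow> actD (actT u) = actT (actD u)"
  by (auto intro!: vec_15_eqI simp: actD_index actT_index)

text \<open>Commutation is asked for on bivectors only, where it makes the composite an involution;
  the lifts \<open>repD\<close> and \<open>repT\<close> anticommute.\<close>

lemma compatible_comp:
  fixes A :: "'k::field vec \<Rightarrow> 'k vec"
  assumes 1: "compatible A R L" and 2: "compatible A' R' L'"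
    and com: "\<And>u. u \<in> carrier_vec 15 \<Longrightarrow> A (A' u) = A' (A u)"
  shows "compatible (\<lambda>u. A (A' u)) (\<lambda>v. R (R' v)) (\<lambda>w. L (L' w))"
proof -
  note c1 = compatibleD[OF 1] and c2 = compatibleD[OF 2]
  show ?thesis
    unfolding compatible_def
  proof (intro conjI ballI allI impI)
    show "\<exists>c m. m < 15 \<and> (\<forall>u\<in>carrier_vec 15. A (A' u) $ l = c * u $ m)" if "l < 15" for l
    proof -
      obtain c m where m: "m < 15" "\<And>u. u \<in> carrier_vec 15 \<Longrightarrow> A u $ l = c * u $ m" using c1(4)[OF \<open>l < 15\<close>] by blast
      obtain c' m' where m': "m' < 15" "\<And>u. u \<in> carrier_vec 15 \<Longrightarrow> A' u $ m = c' * u $ m'" using c2(4)[OF m(1)] by blast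
      show ?thesis by (rule exI[of _ "c * c'"], rule exI[of _ m']) (simp add: m m' c2(1))
    qed
    show "\<exists>c. c \<noteq> 0 \<and> pfaffian_adjoint (A (A' u)) = c \<cdot>\<^sub>v A (A' (pfaffian_adjoint u))" if u: "u \<in> carrier_vec 15" for u
    proof -
      obtain c where c: "c \<noteq> 0" "pfaffian_adjoint (A (A' u)) = c \<cdot>\<^sub>v A (pfaffian_adjoint (A' u))" using c1(14)[OF c2(1)[OF u]] by blast
      obtain c' where c': "c' \<noteq> 0" "pfaffian_adjoint (A' u) = c' \<cdot>\<^sub>v A' (pfaffian_adjoint u)" using c2(14)[OF u] by blast
      have "pfaffian_adjoint (A (A' u)) = (c * c') \<cdot>\<^sub>v A (A' (pfaffian_adjoint u))"
        unfolding c(2) c'(2) by (simp add: c1(1,3) c2(1,3) smult_smult_assoc)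
      then show ?thesis using c(1) c'(1) by (intro exI[of _ "c * c'"]) simp
    qed
    show "\<exists>a'\<in>carrier_vec 5. cubic a' = 0 \<and> A (A' (form_coords x)) = form_coords a'"
      if "x \<in> carrier_vec 5" "cubic x = 0" for x
      using c2(15)[OF that] c1(15) by metis
    show "A (A' (A (A' u))) = u" if "u \<in> carrier_vec 15" for u
      using com[of "A (A' u)"] com[of u] that c1(1,2) c2(1,2) by (metis (no_types))
  qed (simp_all add: c1 c2)
qed

definition act :: "bool \<times> bool \<Rightarrow> 'k::field vec \<Rightarrow> 'k vec" where
  "act g u = (let u' = if snd g then actT u else u in if fst g then actD u' else u')"

definition rep :: "bool \<times> bool \<Rightarrow> 'k::field vec \<Rightarrow> 'k vec" where
  "rep g u = (let u' = if snd g then repT u else u in if fst g then repD u' else u')"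

definition act2 :: "bool \<times> bool \<Rightarrow> 'k::field vec \<Rightarrow> 'k vec" where
  "act2 g u = (let u' = if snd g then lineT u else u in if fst g then lineD u' else u')"

lemma compatible_act: "compatible (act g) (rep g) (act2 g :: 'k::field vec \<Rightarrow> 'k vec)"
proof -
  have fs: "act (i, j) = (if i then if j then (\<lambda>u. actD (actT u)) else actD else if j then actT else (\<lambda>u. u))"
    "rep (i, j) = (if i then if j then (\<lambda>u. repD (repT u)) else repD else if j then repT else (\<lambda>u. u))"
    "act2 (i, j) = (if i then if j then (\<lambda>u. lineD (lineT u)) else lineD else if j then lineT else (\<lambda>u. u))" for i j
    by (auto simp: act_def rep_def act2_def)
  have DT: "compatible (\<lambda>u. actD (actT u)) (\<lambda>v. repD (repT v)) (\<lambda>w. lineD (lineT w :: 'k vec))"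
    by (rule compatible_comp[OF compatible_D compatible_T]) (rule act_commute)
  obtain i j where "g = (i, j)" by (cases g)
  then show ?thesis
    unfolding \<open>g = (i, j)\<close> fs
    by (cases i; cases j) (simp_all add: compatible_D compatible_T compatible_id DT)
qed

definition xor2 :: "bool \<times> bool \<Rightarrow> bool \<times> bool \<Rightarrow> bool \<times> bool" where
  "xor2 g h = (fst g \<noteq> fst h, snd g \<noteq> snd h)"

lemma act_act:
  assumes u: "u \<in> carrier_vec 15" shows "act g (act h u) = act (xor2 g h) u"
proof -
  have 1: "actD (actD u) = u" "actT (actT u) = u" if "u \<in> carrier_vec 15" for u :: "'a vec"
    using compatibleD(2)[OF compatible_D] compatibleD(2)[OF compatible_T] that by blast+
  show ?thesis
    using u by (cases g; cases h) (simp add: act_def xor2_def Let_def 1 act_commute[symmetric])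
qed

lemma act_simps:
  assumes "u \<in> carrier_vec 15"
  shows "act g u \<in> carrier_vec 15" "act g (c \<cdot>\<^sub>v u) = c \<cdot>\<^sub>v act g u" "act g (act g u) = u"
  using compatibleD(1-3)[OF compatible_act] assms by blast+

lemma act_nonzero:
  assumes "u \<in> carrier_vec 15" "u \<noteq> 0\<^sub>v 15" shows "act g u \<noteq> (0\<^sub>v 15 :: 'k::field vec)"
proof
  assume "act g u = 0\<^sub>v 15"
  moreover have "0 \<cdot>\<^sub>v 0\<^sub>v 15 = (0\<^sub>v 15 :: 'k vec)" by auto
  ultimately have "u = act g (0 \<cdot>\<^sub>v 0\<^sub>v 15)" using act_simps(3)[OF assms(1), of g] by simp
  also have "\<dots> = 0 \<cdot>\<^sub>v act g (0\<^sub>v 15)" by (rule act_simps(2)) simp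
  also have "\<dots> = 0\<^sub>v 15" using act_simps(1)[of "0\<^sub>v 15 :: 'k vec" g] by auto
  finally show False using assms(2) by simp
qed

lemma image_line: "(\<And>c. A (c \<cdot>\<^sub>v u) = c \<cdot>\<^sub>v A u) \<Longrightarrow> A ` line u = line (A u)"
proof -
  assume A: "\<And>c. A (c \<cdot>\<^sub>v u) = c \<cdot>\<^sub>v A u"
  have "A ` line u = {A (c \<cdot>\<^sub>v u) | c. True}" unfolding line_def by blast
  then show ?thesis by (simp add: A line_def)
qed

definition point_act :: "bool \<times> bool \<Rightarrow> 'k::field point \<Rightarrow> 'k point" where
  "point_act g = map (image (act g))"

lemma point_act_line: "u \<in> carrier_vec 15 \<Longrightarrow> point_act g [line u] = [line (act g u)]"
  unfolding point_act_def using image_line[of "act g" u, OF act_simps(2)] by simp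

lemma Y_pointE:
  fixes x :: "'k::field_char_0 point"
  assumes "x \<in> Y_of form" obtains a where "a \<in> carrier_vec 5" "a \<noteq> 0\<^sub>v 5" "cubic a = 0" "x = [line (form_coords a)]"
  using assms unfolding Y_of_form by blast

lemma X_pointE:
  fixes x :: "'k::field_char_0 point"
  assumes "x \<in> X_of form" obtains v w where "v \<in> carrier_vec 6" "w \<in> carrier_vec 6" "coords (wedge v w) \<noteq> 0\<^sub>v 15"
    "isotropic v w" "x = [line (coords (wedge v w))]"
  using assms unfolding X_of_form by blast

lemma point_act_Y:
  fixes x :: "'k::field_char_0 point"
  assumes "x \<in> Y_of form" shows "point_act g x \<in> Y_of form"
proof -
  obtain a where a: "a \<in> carrier_vec 5" "a \<noteq> 0\<^sub>v 5" "cubic a = 0" "x = [line (form_coords a)]"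
    using assms by (rule Y_pointE)
  obtain a' where a': "a' \<in> carrier_vec 5" "cubic a' = 0" "act g (form_coords a) = form_coords a'"
    using compatibleD(15)[OF compatible_act] a by blast
  have "form_coords a \<noteq> 0\<^sub>v 15" using form_coords_eq_zeroD a by blast
  then have "a' \<noteq> 0\<^sub>v 5" using act_nonzero[of "form_coords a" g] a'(3) by auto
  then show ?thesis unfolding a(4) point_act_line[OF form_coords_carrier] Y_of_form using a' by auto
qed

lemma point_act_X:
  fixes x :: "'k::field_char_0 point"
  assumes "x \<in> X_of form" shows "point_act g x \<in> X_of form"
proof -
  obtain v w where vw: "v \<in> carrier_vec 6" "w \<in> carrier_vec 6" "coords (wedge v w) \<noteq> 0\<^sub>v 15"
    "isotropic v w" "x = [line (coords (wedge v w))]"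
    using assms by (rule X_pointE)
  have "rep g v \<in> carrier_vec 6" "rep g w \<in> carrier_vec 6" "coords (wedge (rep g v) (rep g w)) = act g (coords (wedge v w))"
    "isotropic (rep g v) (rep g w)"
    by (intro compatibleD(5,10,11)[OF compatible_act] vw)+
  moreover have "act g (coords (wedge v w)) \<noteq> 0\<^sub>v 15" by (rule act_nonzero) (use vw in auto)
  ultimately show ?thesis unfolding vw(5) point_act_line[OF coords_carrier] X_of_form
    by (intro CollectI exI[of _ "rep g v"] exI[of _ "rep g w"]) simp
qed

lemma point_act_act:
  assumes "x \<in> multiproj [15]" shows "point_act g (point_act h x) = point_act (xor2 g h) x"
    "point_act (False, False) x = x"
proof -
  obtain u where "u \<in> carrier_vec 15" "x = [line u]"
    using assms by (auto simp: multiproj_def hom_coords_def list_all2_Cons2)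
  then show "point_act g (point_act h x) = point_act (xor2 g h) x" "point_act (False, False) x = x"
    by (simp_all add: point_act_line act_act act_simps(1)) (simp add: act_def)
qed

lemma point_act_morphism:
  assumes Z: "Z \<subseteq> multiproj [15]" and inv: "\<And>x. x \<in> Z \<Longrightarrow> point_act g x \<in> (Z :: 'k::field point set)"
  shows "morphism [15] Z [15] Z (restrict (point_act g) Z)"
proof (rule morphismI[OF Z Z, where Q = "\<lambda>v. [act g (v ! 0)]" and \<delta> = "\<lambda>_ l. if l = 0 then 1 else 0"])
  show "[act g (v ! 0)] \<in> carr [15]" if "v \<in> carr [15]" for v :: "'k vec list"
    using that by (auto simp: carr_Cons carr_Nil act_simps elim!: carr_ConsE)
  fix j i :: nat assume ji: "j < length [15::nat]" "i < [15] ! j"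
  then obtain c m where m: "m < 15" "\<And>u. u \<in> carrier_vec 15 \<Longrightarrow> act g u $ i = c * (u :: 'k vec) $ m"
    using compatibleD(4)[OF compatible_act[of g], of i] by auto
  have "hompoly [15] (\<lambda>l. if l = 0 then 1 else 0) (\<lambda>v. c * (v ! 0) $ m :: 'k)"
    by (intro hompoly_scale hompoly_coord) (use m in auto)
  then show "hompoly [15] (\<lambda>l. if l = 0 then 1 else 0) (\<lambda>v. ([act g (v ! 0)] ! j) $ i :: 'k)"
    by (rule hompoly_cong) (use m ji in \<open>auto elim!: carr_ConsE\<close>)
next
  fix v :: "'k vec list" assume v: "v \<in> hom_coords [15]" "map line v \<in> Z"
  then obtain u where u: "v = [u]" "u \<in> carrier_vec 15" "u \<noteq> 0\<^sub>v 15"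
    by (elim hom_coords_ConsE) (auto simp: hom_coords_def)
  show "[act g (v ! 0)] \<in> hom_coords [15] \<and> restrict (point_act g) Z (map line v) = map line [act g (v ! 0)] \<and>
      map line [act g (v ! 0)] \<in> Z"
    using v(2) inv[of "[line u]"] act_nonzero[OF u(2,3)] act_simps(1)[OF u(2)]
    by (simp add: u point_act_line hom_coords_def)
qed

section \<open>Generic freeness of the two actions\<close>

lemma product_multiproj_Nil: "product Z (multiproj []) = (Z :: 'k::field point set)"
proof -
  have "multiproj [] = ({[]} :: 'k point set)" by (auto simp: multiproj_def hom_coords_def)
  then show ?thesis by (simp add: product_def)
qed

text \<open>On the cubic this is the product of x0, x1, y1 and y2 up to sign. The group acts on
  these coordinates by signs, and where all are nonzero no nontrivial element fixes the
  point.\<close>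

definition free_Y :: "'k::field vec list \<Rightarrow> 'k" where
  "free_Y x = ((x ! 0) $ 14 * (x ! 0) $ 1) * ((x ! 0) $ 2 * (x ! 0) $ 7)"

text \<open>\<open>T\<close> and \<open>DT\<close> exchange the entries 0 and 12, so an eigenvector
  has equal squares there; \<open>D\<close> fixes both entries and changes the sign of entry
  2.\<close>

definition free_X :: "'k::field vec list \<Rightarrow> 'k" where
  "free_X x = ((x ! 0) $ 0 * (x ! 0) $ 0 - (x ! 0) $ 12 * (x ! 0) $ 12) * (x ! 0) $ 2"

lemma hompoly_free: "hompoly [15] (\<lambda>l. 4 * (if l = 0 then 1 else 0)) free_Y"
  "hompoly [15] (\<lambda>l. 3 * (if l = 0 then 1 else 0)) free_X"
proof -
  have c: "hompoly [15] (\<lambda>l. if l = 0 then 1 else 0) (\<lambda>x. (x ! 0) $ i)" if "i < 15" for i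
    by (rule hompoly_coord) (use that in auto)
  have m: "hompoly [15] (\<lambda>l. 2 * (if l = 0 then 1 else 0)) (\<lambda>x. (x ! 0) $ i * (x ! 0) $ j)" if "i < 15" "j < 15" for i j
    by (rule hompoly_mult'[OF c c]) (use that in auto)
  show "hompoly [15] (\<lambda>l. 4 * (if l = 0 then 1 else 0)) free_Y"
    unfolding free_Y_def by (rule hompoly_mult'[OF m m]) auto
  show "hompoly [15] (\<lambda>l. 3 * (if l = 0 then 1 else 0)) free_X"
    unfolding free_X_def by (rule hompoly_mult'[OF hompoly_diff[OF m m] c]) auto
qed

lemma dense_free_Y:
  "dense_open [15] (Y_of (form :: 'k::{alg_closed_field, field_char_0} vec \<Rightarrow> 'k mat)) (Y_of form \<inter> nonvanishing [15] free_Y)"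
proof (rule dense_openI[OF Y_of_subset hompoly_free(1)])
  fix x and d and P :: "'k vec list \<Rightarrow> 'k"
  assume x: "x \<in> hom_coords [15]" "map line x \<in> Y_of form" and P: "hompoly [15] d P" "P x \<noteq> 0"
  obtain z where z: "x = [z]" "z \<in> carrier_vec 15" "z \<noteq> 0\<^sub>v 15"
    using x(1) by (auto simp: hom_coords_def list_all2_Cons2)
  obtain a where a: "a \<in> carrier_vec 5" "a \<noteq> 0\<^sub>v 5" "cubic a = 0" "z = form_coords a"
    using Y_repE[OF _ z(2,3)] x(2) z(1) by auto
  have f: "poly2 (\<lambda>s t. form_coords (slice a s t) $ i)" if "i < 15" for i
    using less_15_cases[OF that]
    by (elim disjE) (simp_all add: form_coords_index, (intro poly2_add poly2_diff poly2_uminus poly2_slice; simp)+)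
  have p: "poly2 (\<lambda>s t. P [form_coords (slice a s t)])"
    by (rule poly2_hompoly[OF P(1)]) (use f in \<open>auto simp: carr_def\<close>)
  have h: "poly2 (\<lambda>s t. free_Y [form_coords (slice a s t)])"
    by (rule poly2_hompoly[OF hompoly_free(1)]) (use f in \<open>auto simp: carr_def\<close>)
  have "\<exists>s t. cubic (slice a s t) = 0 \<and> P [form_coords (slice a s t)] \<noteq> 0 \<and> free_Y [form_coords (slice a s t)] \<noteq> 0"
    by (rule cubic_slice[OF a(1,3) p _ h])
      (use P(2) z(1) a(4) in \<open>simp_all add: slice_0_0[OF a(1)] slice_1_0 free_Y_def form_coords_index good_point_def\<close>)
  then obtain s t where st: "cubic (slice a s t) = 0" "P [form_coords (slice a s t)] \<noteq> 0"
    "free_Y [form_coords (slice a s t)] \<noteq> 0" by blast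
  have "form_coords (slice a s t) \<noteq> 0\<^sub>v 15" using st(3) by (auto simp: free_Y_def)
  moreover from this have "slice a s t \<noteq> 0\<^sub>v 5" by auto
  then have "map line [form_coords (slice a s t)] \<in> Y_of form"
    unfolding Y_of_form using st(1) slice_carrier by auto
  ultimately show "\<exists>w\<in>hom_coords [15]. map line w \<in> Y_of form \<and> P w \<noteq> 0 \<and> free_Y w \<noteq> 0"
    using st by (intro bexI[of _ "[form_coords (slice a s t)]"]) (auto simp: hom_coords_def)
qed

text \<open>The question is transported to the cubic: near the given point there are points of X
  that come from Y under the birational map with constant parameter, and their preimages can be
  moved in a slice.\<close>

lemma dense_free_X:
  "dense_open [15] (X_of (form :: 'k::{alg_closed_field, field_char_0} vec \<Rightarrow> 'k mat)) (X_of form \<inter> nonvanishing [15] free_X)"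
proof (rule dense_openI[OF X_of_subset hompoly_free(2)])
  fix x and d and P :: "'k vec list \<Rightarrow> 'k"
  assume x: "x \<in> hom_coords [15]" "map line x \<in> X_of form" and P: "hompoly [15] d P" "P x \<noteq> 0"
  interpret F: family "[]" "\<lambda>_. \<omega>0 :: 'k vec" "\<lambda>_. 0" by (rule family_constant)
  note prod = product_multiproj_Nil
  obtain w where w: "w \<in> hom_coords [15]" "map line w \<in> X_of form" "P w \<noteq> 0" "admissible (F.X_vector w) \<omega>0 \<noteq> 0"
    using F.dense_X[OF x(1) _ P] x(2) unfolding prod by blast
  have wX: "map line w \<in> F.X_open" using F.X_open_iff[OF w(1)] w unfolding prod by blast
  define y where "y = F.to_Y w"
  have y: "y \<in> hom_coords [15]" "map line y \<in> F.Y_open" "map line (F.to_X y) = map line w"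
    using F.to_Y_X_open[OF w(1) wX] by (simp_all add: y_def)
  have tX: "F.to_X y \<in> hom_coords [15]" by (rule F.to_X_Y_open(1)[OF y(1,2)])
  have Py: "P (F.to_X y) \<noteq> 0"
    using map_line_in_nonvanishing[OF P(1) tX] map_line_in_nonvanishing[OF P(1) w(1)] y(3) w(3) by auto
  have yY: "map line y \<in> Y_of form" "admissible (F.Y_vector y) \<omega>0 \<noteq> 0"
    using F.Y_open_iff[OF y(1)] y(2) unfolding prod by auto
  obtain z where z: "y = [z]" "z \<in> carrier_vec 15" "z \<noteq> 0\<^sub>v 15"
    using y(1) by (auto simp: hom_coords_def list_all2_Cons2)
  obtain a where a: "a \<in> carrier_vec 5" "a \<noteq> 0\<^sub>v 5" "cubic a = 0" "z = form_coords a"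
    using Y_repE[OF _ z(2,3)] yY(1) z(1) by auto
  define V where "V s t = probe (pfaffian_adjoint (form_coords (slice a s t))) \<omega>0" for s t
  have Yv: "F.Y_vector [form_coords (slice a s t)] = V s t" for s t by (simp add: F.Y_vector_def V_def)
  have toX: "F.to_X [form_coords (slice a s t)] = [plane (V s t)]" for s t by (simp add: F.to_X_def Yv)
  have Vc: "V s t \<in> carrier_vec 6" for s t by (simp add: V_def)
  have wc: "\<omega>0 \<in> (carrier_vec 2 :: 'k vec set)" by (simp add: \<omega>0_def)
  have Vp: "poly2 (\<lambda>s t. V s t $ i)" if "i < 6" for i
    unfolding V_def probe_def
    by (intro poly2_skew_apply_pfaffian_adjoint poly2_slice slice_carrier tens_carrier that poly2_const)
  have y_eq: "y = [form_coords (slice a 0 0)]" using z(1) a(4) by (simp add: slice_0_0[OF a(1)])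
  have p: "poly2 (\<lambda>s t. P [plane (V s t)] * admissible (V s t) \<omega>0)"
  proof (intro poly2_mult poly2_admissible Vc Vp wc poly2_const)
    show "poly2 (\<lambda>s t. P [plane (V s t)])"
      by (rule poly2_hompoly[OF P(1)]) (use poly2_plane[OF Vp] in \<open>auto simp: carr_def\<close>)
  qed
  have h: "poly2 (\<lambda>s t. free_X [plane (V s t)])"
    by (rule poly2_hompoly[OF hompoly_free(2)]) (use poly2_plane[OF Vp] in \<open>auto simp: carr_def\<close>)
  have p0: "P [plane (V 0 0)] * admissible (V 0 0) \<omega>0 \<noteq> 0"
    using Py yY(2) unfolding y_eq toX Yv by simp
  have h1: "free_X [plane (V 1 0)] \<noteq> 0"
  proof -
    have V: "V 1 0 = good_vector" by (simp add: V_def slice_1_0 good_vector_def)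
    interpret chart 4 4 5 good_vector "good_point :: 'k vec"
      by (rule cubic_to_planes(1)[OF good_point_facts good_vector_def good_vector_admissible])
    let ?n = "vec 6 (\<lambda>i. [- 5, 3, - 2, - 5, 1, 0 :: 'k] ! i)"
    have gv: "good_vector \<in> carrier_vec 6" by (simp add: good_vector_def)
    \<comment> \<open>The plane of \<open>good_vector\<close> is known up to a factor
      \<open>c\<close>, which suffices because \<open>free_X\<close> is homogeneous of degree
      3.\<close>
    obtain c where c: "coords (wedge good_vector ?n) = c \<cdot>\<^sub>v plane good_vector"
      using coords_wedge_partner[OF gv _ isotropic_self[OF gv] good_partner] unfolding plane_def by auto
    have "coords (wedge good_vector ?n) $ i = c * plane good_vector $ i" if "i < 15" for i
      unfolding c by (rule index_smult_vec(1)) (simp add: plane_def that)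
    from this[of 0] this[of 12] this[of 2]
    have e: "c * plane good_vector $ 0 = - 10" "c * plane good_vector $ 12 = - 8" "c * plane good_vector $ 2 = 10"
      by (simp_all add: coords_wedge_index good_vector_index)
    have "c * c * c * free_X [plane good_vector] = ((c * plane good_vector $ 0) * (c * plane good_vector $ 0)
        - (c * plane good_vector $ 12) * (c * plane good_vector $ 12)) * (c * plane good_vector $ 2)"
      by (simp add: free_X_def algebra_simps)
    also have "\<dots> \<noteq> 0" unfolding e by simp
    finally show ?thesis unfolding V by auto
  qed
  obtain s t where st: "cubic (slice a s t) = 0" "P [plane (V s t)] * admissible (V s t) \<omega>0 \<noteq> 0" "free_X [plane (V s t)] \<noteq> 0"
    using cubic_slice[OF a(1,3) p p0 h h1] by blast
  have b0: "slice a s t \<noteq> 0\<^sub>v 5"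
  proof
    assume "slice a s t = 0\<^sub>v 5"
    then have "V s t $ 5 = 0" by (simp add: V_def probe_def skew_apply_index pfaffian_adjoint_index)
    then show False using st(2) admissibleD(2)[of "V s t" \<omega>0] by auto
  qed
  then have "form_coords (slice a s t) \<noteq> 0\<^sub>v 15" using form_coords_eq_zeroD[OF slice_carrier] by blast
  then have hc: "[form_coords (slice a s t)] \<in> hom_coords [15]" by (simp add: hom_coords_def)
  have "map line [form_coords (slice a s t)] \<in> Y_of form"
    unfolding Y_of_form using st(1) b0 slice_carrier by auto
  then have "map line [form_coords (slice a s t)] \<in> F.Y_open"
    unfolding F.Y_open_iff[OF hc] prod Yv using st(2) by simp
  note t = F.to_X_Y_open(1,2)[OF hc this, unfolded toX]
  have "map line [plane (V s t)] \<in> X_of form" using t(2) F.X_open_iff[OF t(1)] unfolding prod by blast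
  then show "\<exists>w\<in>hom_coords [15]. map line w \<in> X_of form \<and> P w \<noteq> 0 \<and> free_X w \<noteq> 0"
    using st t(1) by (intro bexI[of _ "[plane (V s t)]"]) auto
qed

lemma birational_Y_X:
  "birational [15] (Y_of (form :: 'k::{alg_closed_field, field_char_0} vec \<Rightarrow> 'k mat)) [15] (X_of form)"
proof -
  interpret F: family "[]" "\<lambda>_. \<omega>0 :: 'k vec" "\<lambda>_. 0" by (rule family_constant)
  show ?thesis using F.birational_map_to_X unfolding product_multiproj_Nil birational_def by blast
qed

lemma point_act_line_fixedD:
  fixes u :: "'k::field vec"
  assumes "u \<in> carrier_vec 15" "u \<noteq> 0\<^sub>v 15" "point_act g [line u] = [line u]"
  obtains c where "c \<noteq> 0" "act g u = c \<cdot>\<^sub>v u"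
  using line_eqD[of u "act g u" 15] assms point_act_line[OF assms(1), of g] act_nonzero[OF assms(1,2), of g]
    act_simps(1)[OF assms(1), of g] by auto

lemma eq_uminus_self_iff: "x = - x \<longleftrightarrow> x = (0 :: 'k::field_char_0)" "- x = x \<longleftrightarrow> x = 0"
proof -
  have "x = - x \<longleftrightarrow> 2 * x = 0" by (simp only: eq_neg_iff_add_eq_0 mult_2)
  then show "x = - x \<longleftrightarrow> x = 0" by simp
  then show "- x = x \<longleftrightarrow> x = 0" by metis
qed

lemma free_point_Y:
  fixes x :: "'k::field_char_0 point"
  assumes "x \<in> Y_of form \<inter> nonvanishing [15] free_Y" "point_act g x = x" shows "g = (False, False)"
proof -
  obtain z where z: "z \<in> carrier_vec 15" "z \<noteq> 0\<^sub>v 15" "x = [line z]" "free_Y [z] \<noteq> 0"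
    using assms(1) by (auto simp: nonvanishing_def hom_coords_def list_all2_Cons2)
  obtain a where a: "a \<in> carrier_vec 5" "z = form_coords a" using Y_repE[OF _ z(1,2)] assms(1) z(3) by auto
  have nz: "a $ 3 \<noteq> 0" "a $ 4 \<noteq> 0" "a $ 1 \<noteq> 0" using z(4) by (auto simp: a(2) free_Y_def form_coords_index)
  obtain c where c: "act g z = c \<cdot>\<^sub>v z" using point_act_line_fixedD[OF z(1,2)] assms(2) z(3) by blast
  have e: "act g z $ i = c * z $ i" if "i < 15" for i unfolding c using that z(1) by simp
  note e' = e[of 14] e[of 1] e[of 2]
  obtain i j where g: "g = (i, j)" by (cases g)
  show ?thesis
  proof (cases j)
    case True
    then have "- a $ 3 = c * a $ 3" "a $ 4 = c * a $ 4"
      using e' by (auto simp: g act_def a(2) actD_index actT_index form_coords_index Let_def split: if_splits)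
    then have "- a $ 3 = 1 * a $ 3" using nz by (metis mult_cancel_right mult_1)
    then show ?thesis using nz eq_uminus_self_iff(2)[of "a $ 3"] by simp
  next
    case False
    then show ?thesis
      using e' nz by (cases i) (auto simp: g act_def a(2) actD_index form_coords_index Let_def eq_uminus_self_iff)
  qed
qed

lemma free_point_X:
  fixes x :: "'k::field_char_0 point"
  assumes "x \<in> X_of form \<inter> nonvanishing [15] free_X" "point_act g x = x" shows "g = (False, False)"
proof -
  obtain u where u: "u \<in> carrier_vec 15" "u \<noteq> 0\<^sub>v 15" "x = [line u]" "free_X [u] \<noteq> 0"
    using assms(1) by (auto simp: nonvanishing_def hom_coords_def list_all2_Cons2)
  have nz: "u $ 0 * u $ 0 \<noteq> u $ 12 * u $ 12" "u $ 2 \<noteq> 0" using u(4) by (auto simp: free_X_def)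
  obtain c where c: "act g u = c \<cdot>\<^sub>v u" using point_act_line_fixedD[OF u(1,2)] assms(2) u(3) by blast
  have e: "act g u $ i = c * u $ i" if "i < 15" for i unfolding c using that u(1) by simp
  note e' = e[of 0] e[of 12] e[of 2]
  obtain i j where g: "g = (i, j)" by (cases g)
  show ?thesis
  proof (cases j)
    case True
    then have "u $ 12 = c * u $ 0" "u $ 0 = c * u $ 12"
      using e' by (auto simp: g act_def actD_index actT_index Let_def split: if_splits)
    then have "u $ 0 * u $ 0 = u $ 12 * u $ 12" by (metis mult.assoc mult.commute)
    then show ?thesis using nz by simp
  next
    case False
    show ?thesis
    proof (cases i)
      case True
      then have "u $ 0 = c * u $ 0" "u $ 12 = c * u $ 12" "- u $ 2 = c * u $ 2"
        using e' False by (auto simp: g act_def actD_index Let_def)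
      moreover have "u $ 0 \<noteq> 0 \<or> u $ 12 \<noteq> 0" using nz by auto
      ultimately have "- u $ 2 = 1 * u $ 2" by (metis mult_cancel_right mult_1)
      then show ?thesis using nz eq_uminus_self_iff(2)[of "u $ 2"] by simp
    qed (use False g in simp)
  qed
qed

text \<open>\<open>\<kappa>\<close> labels the group elements by the exponents of the involutions D
  and T, so that the group law becomes \<open>xor2\<close>.\<close>

locale klein = group G for G :: "('g, 'b) monoid_scheme" (structure) +
  fixes \<kappa> :: "'g \<Rightarrow> bool \<times> bool"
  assumes bij: "bij_betw \<kappa> (carrier G) UNIV"
    and \<kappa>_mult: "g \<in> carrier G \<Longrightarrow> h \<in> carrier G \<Longrightarrow> \<kappa> (g \<otimes> h) = xor2 (\<kappa> g) (\<kappa> h)"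
begin

lemma \<kappa>_one: "\<kappa> \<one> = (False, False)"
  using \<kappa>_mult[of \<one> \<one>] by (simp add: xor2_def)

lemma \<kappa>_eq_one: "g \<in> carrier G \<Longrightarrow> \<kappa> g = (False, False) \<Longrightarrow> g = \<one>"
  using bij \<kappa>_one by (metis bij_betw_imp_inj_on inj_onD one_closed)

lemma regular_action_point_act:
  assumes Z: "Z \<subseteq> multiproj [15]" and inv: "\<And>g x. x \<in> Z \<Longrightarrow> point_act g x \<in> (Z :: 'k::field point set)"
  shows "regular_action G [15] Z (\<lambda>g. restrict (point_act (\<kappa> g)) Z)"
  unfolding regular_action_def
proof (intro conjI ballI)
  have aa: "point_act g (point_act h x) = point_act (xor2 g h) x" "point_act (False, False) x = x" if "x \<in> Z" for g h x
    using point_act_act that Z by blast+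
  have inv2: "point_act g (point_act g x) = x" if "x \<in> Z" for g x
    using aa[OF that] by (simp add: xor2_def)
  have bijZ: "restrict (point_act g) Z \<in> Bij Z" for g
  proof -
    have "bij_betw (restrict (point_act g) Z) Z Z"
      by (rule bij_betw_byWitness[where f' = "point_act g"]) (use inv[of _ g] inv2[of _ g] in auto)
    then show ?thesis by (simp add: Bij_def)
  qed
  show "group_action G Z (\<lambda>g. restrict (point_act (\<kappa> g)) Z)"
  proof (intro group_action.intro group_hom.intro group_hom_axioms.intro)
    show "(\<lambda>g. restrict (point_act (\<kappa> g)) Z) \<in> hom G (BijGroup Z)"
    proof (rule homI)
      show "restrict (point_act (\<kappa> g)) Z \<in> carrier (BijGroup Z)" for g
        using bijZ by (simp add: BijGroup_def)
      fix g h assume gh: "g \<in> carrier G" "h \<in> carrier G"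
      have "restrict (point_act (\<kappa> (g \<otimes> h))) Z = compose Z (restrict (point_act (\<kappa> g)) Z) (restrict (point_act (\<kappa> h)) Z)"
      proof (rule ext)
        fix x
        show "restrict (point_act (\<kappa> (g \<otimes> h))) Z x = compose Z (restrict (point_act (\<kappa> g)) Z) (restrict (point_act (\<kappa> h)) Z) x"
          by (cases "x \<in> Z") (simp_all add: \<kappa>_mult[OF gh] compose_def aa(1) inv)
      qed
      then show "restrict (point_act (\<kappa> (g \<otimes> h))) Z = restrict (point_act (\<kappa> g)) Z \<otimes>\<^bsub>BijGroup Z\<^esub> restrict (point_act (\<kappa> h)) Z"
        using bijZ by (simp add: BijGroup_def)
    qed
  qed (rule is_group group_BijGroup)+
  show "morphism [15] Z [15] Z (restrict (point_act (\<kappa> g)) Z)" for g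
    by (rule point_act_morphism[OF Z inv])
qed

lemma generically_free_point_act:
  assumes U: "dense_open [15] Z U" "U \<subseteq> Z" and free: "\<And>g x. x \<in> U \<Longrightarrow> point_act g x = x \<Longrightarrow> g = (False, False)"
    and Z: "Z \<subseteq> multiproj [15]"
  shows "generically_free G [15] Z (\<lambda>g. restrict (point_act (\<kappa> g)) Z)"
  unfolding generically_free_def
proof (intro exI[of _ U] conjI U(1) ballI)
  fix x assume x: "x \<in> U"
  then have "x \<in> Z" using U(2) by blast
  show "stabilizer G (\<lambda>g. restrict (point_act (\<kappa> g)) Z) x = {\<one>}"
  proof (intro equalityI subsetI)
    fix g assume "g \<in> stabilizer G (\<lambda>g. restrict (point_act (\<kappa> g)) Z) x"
    then have "g \<in> carrier G" "point_act (\<kappa> g) x = x" using \<open>x \<in> Z\<close> by (auto simp: stabilizer_def)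
    then show "g \<in> {\<one>}" using free[OF x] \<kappa>_eq_one by simp
  next
    fix g assume "g \<in> {\<one>}"
    then show "g \<in> stabilizer G (\<lambda>g. restrict (point_act (\<kappa> g)) Z) x"
      using point_act_act(2) \<open>x \<in> Z\<close> Z by (auto simp: stabilizer_def \<kappa>_one)
  qed
qed

text \<open>The twist: the two involutions anticommute on \<open>k\<^sup>2\<close>, so only a central extension of order 8 acts linearly.\<close>

definition ext_mult :: "bool \<times> bool \<times> bool \<Rightarrow> bool \<times> bool \<times> bool \<Rightarrow> bool \<times> bool \<times> bool" where
  "ext_mult a b = (case a of (s, i, j) \<Rightarrow> case b of (s', i', j') \<Rightarrow>
     ((s \<noteq> s') \<noteq> (j \<and> i'), i \<noteq> i', j \<noteq> j'))"

definition ext_group :: "nat monoid" where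
  "ext_group = \<lparr>carrier = range (to_nat :: bool \<times> bool \<times> bool \<Rightarrow> nat),
     monoid.mult = (\<lambda>a b. to_nat (ext_mult (from_nat a) (from_nat b))),
     one = to_nat (False, False, False)\<rparr>"

text \<open>The triple \<open>(s, i, j)\<close> stands for \<open>(-1)^s D^i T^j\<close>; the term
  \<open>j \<and> i'\<close> in \<open>ext_mult\<close> is the sign that arises when
  \<open>T^j\<close> is moved past \<open>D^i'\<close>.\<close>

definition ext_mat :: "bool \<times> bool \<times> bool \<Rightarrow> 'k::field mat" where
  "ext_mat a = (case a of (s, i, j) \<Rightarrow> mat 2 2 (\<lambda>(r, c). if (r = c) = j then 0
     else if s = (i \<and> r = 1) then 1 else - 1))"

lemma ext_mult_simps:
  "ext_mult a (False, False, False) = a" "ext_mult (False, False, False) a = a"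
  "ext_mult (ext_mult a b) c = ext_mult a (ext_mult b c)"
  "\<exists>b. ext_mult b a = (False, False, False)"
proof -
  obtain s i j where a: "a = (s, i, j)" by (cases a)
  show "\<exists>b. ext_mult b a = (False, False, False)"
    by (rule exI[of _ "(s \<noteq> (j \<and> i), i, j)"]) (auto simp: a ext_mult_def)
qed (auto simp: ext_mult_def split: prod.splits)

lemma group_ext: "group ext_group"
proof (rule groupI)
  fix x assume "x \<in> carrier ext_group"
  then obtain a where "x = to_nat (a :: bool \<times> bool \<times> bool)" by (auto simp: ext_group_def)
  moreover obtain b where "ext_mult b a = (False, False, False)" using ext_mult_simps(4) by blast
  ultimately show "\<exists>y\<in>carrier ext_group. y \<otimes>\<^bsub>ext_group\<^esub> x = \<one>\<^bsub>ext_group\<^esub>"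
    by (intro bexI[of _ "to_nat b"]) (auto simp: ext_group_def)
qed (auto simp: ext_group_def ext_mult_simps)

lemma ext_mat_carrier [simp]: "ext_mat a \<in> carrier_mat 2 2"
  by (cases a) (simp add: ext_mat_def)

lemma ext_mat_dim [simp]: "dim_row (ext_mat a) = 2" "dim_col (ext_mat a) = 2"
  by (rule carrier_matD[OF ext_mat_carrier])+

lemma ext_mat_index:
  "ext_mat (s, i, j) $$ (0, 0) = (if j then 0 else if s then - 1 else 1)"
  "ext_mat (s, i, j) $$ (0, Suc 0) = (if j then if s then - 1 else 1 else 0)"
  "ext_mat (s, i, j) $$ (Suc 0, 0) = (if j then if s = i then 1 else - 1 else 0)"
  "ext_mat (s, i, j) $$ (Suc 0, Suc 0) = (if j then 0 else if s = i then 1 else - 1)"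
  by (simp_all add: ext_mat_def)

lemma ext_mat_mult: "ext_mat (ext_mult a b) = ext_mat a * (ext_mat b :: 'k::field mat)"
proof (rule eq_matI)
  fix r c assume "r < dim_row (ext_mat a * (ext_mat b :: 'k mat))" "c < dim_col (ext_mat a * (ext_mat b :: 'k mat))"
  then have rc: "r < 2" "c < 2" by simp_all
  obtain s i j where a: "a = (s, i, j)" by (cases a)
  obtain s' i' j' where b: "b = (s', i', j')" by (cases b)
  have two: "{0..<2::nat} = {0, 1}" by auto
  have m: "(ext_mat a * (ext_mat b :: 'k mat)) $$ (r, c) =
      ext_mat a $$ (r, 0) * ext_mat b $$ (0, c) + ext_mat a $$ (r, 1) * ext_mat b $$ (1, c)"
    using rc by (simp add: scalar_prod_def two)
  have "r = 0 \<or> r = Suc 0" "c = 0 \<or> c = Suc 0" using rc by auto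
  then show "ext_mat (ext_mult a b) $$ (r, c) = (ext_mat a * (ext_mat b :: 'k mat)) $$ (r, c)"
    unfolding m unfolding a b ext_mult_def prod.case
    by (elim disjE; simp only: ext_mat_index One_nat_def; cases j; cases j'; cases s; cases s'; cases i; cases i'; simp)
qed simp_all

lemma ext_mat_one: "ext_mat (False, False, False) = (1\<^sub>m 2 :: 'k::field mat)"
  by (rule eq_matI) (auto simp: ext_mat_def)

lemma ext_mat_line:
  assumes "w \<in> carrier_vec 2" "w \<noteq> 0\<^sub>v 2"
  shows "act2 (i, j) ` line w = line (ext_mat (s, i, j) *\<^sub>v (w :: 'k::field vec))"
proof -
  have "act2 (i, j) ` line w = line (act2 (i, j) w)"
    by (rule image_line) (rule compatibleD(9)[OF compatible_act assms(1)])
  moreover have "ext_mat (s, i, j) *\<^sub>v w = (if s then - 1 else 1) \<cdot>\<^sub>v act2 (i, j) w"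
  proof (rule eq_vecI)
    have two: "{0..<2::nat} = {0, 1}" by auto
    fix r assume "r < dim_vec ((if s then - 1 else 1) \<cdot>\<^sub>v act2 (i, j) w)"
    then have r2: "r < 2" using compatibleD(7)[OF compatible_act assms(1), of "(i, j)"] by simp
    then have m: "(ext_mat (s, i, j) *\<^sub>v w) $ r = ext_mat (s, i, j) $$ (r, 0) * w $ 0 + ext_mat (s, i, j) $$ (r, 1) * w $ 1"
      using assms(1) by (simp add: scalar_prod_def two)
    have "r = 0 \<or> r = Suc 0" using r2 by auto
    then show "(ext_mat (s, i, j) *\<^sub>v w) $ r = ((if s then - 1 else 1) \<cdot>\<^sub>v act2 (i, j) w) $ r"
      unfolding m using assms(1)
      by (elim disjE; simp only: ext_mat_index One_nat_def; cases s; cases i; cases j;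
          simp add: act2_def lineD_def lineT_def)
  qed (use compatibleD(7)[OF compatible_act assms(1), of "(i, j)"] in \<open>auto simp: ext_mat_def\<close>)
  ultimately show ?thesis by (simp add: line_smult)
qed

text \<open>The extension is the dihedral group of order 8 in its two-dimensional representation.
  The sign \<open>s\<close> acts trivially on lines, and forgetting it is the surjection onto
  G.\<close>

lemma projectively_linear_act2:
  "projectively_linear_action G 2 (\<lambda>g. image (act2 (\<kappa> g) :: 'k::field vec \<Rightarrow> 'k vec))"
proof -
  define \<pi> where "\<pi> e = inv_into (carrier G) \<kappa> (snd (from_nat e :: bool \<times> bool \<times> bool))" for e
  define \<rho> where "\<rho> e = (ext_mat (from_nat e) :: 'k mat)" for e
  have inv: "inv_into (carrier G) \<kappa> p \<in> carrier G" "\<kappa> (inv_into (carrier G) \<kappa> p) = p" for p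
    using bij by (auto simp: bij_betw_def inv_into_into f_inv_into_f)
  have inv_\<kappa>: "inv_into (carrier G) \<kappa> (\<kappa> g) = g" if "g \<in> carrier G" for g
    using bij that by (auto simp: bij_betw_def)
  have \<pi>: "\<pi> \<in> epi ext_group G"
    unfolding epi_iff_subset
  proof (intro conjI homI subsetI)
    show "\<pi> e \<in> carrier G" for e by (simp add: \<pi>_def inv)
    fix e f assume ef: "e \<in> carrier ext_group" "f \<in> carrier ext_group"
    obtain a b :: "bool \<times> bool \<times> bool" where ab: "e = to_nat a" "f = to_nat b" using ef by (auto simp: ext_group_def)
    have "snd (ext_mult a b) = xor2 (snd a) (snd b)" by (cases a; cases b) (simp add: ext_mult_def xor2_def)
    also have "\<dots> = \<kappa> (\<pi> e \<otimes> \<pi> f)" by (simp add: \<kappa>_mult \<pi>_def inv ab)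
    finally have "\<pi> (e \<otimes>\<^bsub>ext_group\<^esub> f) = inv_into (carrier G) \<kappa> (\<kappa> (\<pi> e \<otimes> \<pi> f))"
      by (simp add: \<pi>_def ext_group_def ab)
    then show "\<pi> (e \<otimes>\<^bsub>ext_group\<^esub> f) = \<pi> e \<otimes> \<pi> f" by (simp add: inv_\<kappa> \<pi>_def inv)
  next
    fix g assume g: "g \<in> carrier G"
    show "g \<in> \<pi> ` carrier ext_group"
      by (rule image_eqI[of _ _ "to_nat (False, \<kappa> g)"]) (use g in \<open>auto simp: \<pi>_def inv_\<kappa> ext_group_def\<close>)
  qed
  have unit: "ext_mat a \<in> Units (ring_mat TYPE('k) 2 ())" for a
  proof -
    obtain b where b: "ext_mult b a = (False, False, False)" using ext_mult_simps(4) by blast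
    obtain c where c: "ext_mult c b = (False, False, False)" using ext_mult_simps(4) by blast
    have "c = a" using ext_mult_simps(1-3) b c by metis
    then have "ext_mat b * ext_mat a = (1\<^sub>m 2 :: 'k mat)" "ext_mat a * ext_mat b = (1\<^sub>m 2 :: 'k mat)"
      using b c ext_mat_mult ext_mat_one by metis+
    then show ?thesis unfolding Units_def ring_mat_def by (auto intro!: bexI[of _ "ext_mat b"])
  qed
  have \<rho>: "\<rho> \<in> hom ext_group (units_of (ring_mat TYPE('k) 2 ()))"
  proof (rule homI)
    show "\<rho> e \<in> carrier (units_of (ring_mat TYPE('k) 2 ()))" for e using unit by (simp add: \<rho>_def units_of_def)
    show "\<rho> (e \<otimes>\<^bsub>ext_group\<^esub> f) = \<rho> e \<otimes>\<^bsub>units_of (ring_mat TYPE('k) 2 ())\<^esub> \<rho> f" for e f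
      by (simp add: \<rho>_def units_of_def ext_group_def ext_mat_mult ring_mat_def)
  qed
  have "act2 (\<kappa> (\<pi> e)) ` line w = line (\<rho> e *\<^sub>v w)" if "w \<in> carrier_vec 2 - {0\<^sub>v 2}" for e and w :: "'k vec"
    using ext_mat_line[of w _ _ "fst (from_nat e :: bool \<times> bool \<times> bool)"] that
    by (metis DiffD1 DiffD2 \<pi>_def \<rho>_def insertI1 inv(2) prod.collapse)
  then show ?thesis unfolding projectively_linear_action_def using group_ext \<pi> \<rho> by blast
qed

lemma twisted_Y_X:
  "twisted_equivariantly_stably_birational G
    [15] (Y_of (form :: 'k::{alg_closed_field, field_char_0} vec \<Rightarrow> 'k mat)) (\<lambda>g. restrict (point_act (\<kappa> g)) (Y_of form))
    [15] (X_of form) (\<lambda>g. restrict (point_act (\<kappa> g)) (X_of form))"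
proof -
  interpret L: family "[2]" "\<lambda>\<tau>. \<tau> ! 0 :: 'k vec" "\<lambda>l. if l = 1 then 1 else 0" by (rule family_line)
  let ?\<beta> = "\<lambda>(j::nat) g. image (act2 (\<kappa> g) :: 'k vec \<Rightarrow> 'k vec)"
  let ?dY = "diagonal_action 1 (\<lambda>g. restrict (point_act (\<kappa> g)) (Y_of form)) ?\<beta>"
  let ?dX = "diagonal_action 1 (\<lambda>g. restrict (point_act (\<kappa> g)) (X_of form)) ?\<beta>"
  have diag: "diagonal_action 1 (\<lambda>g. restrict (point_act (\<kappa> g)) Z) ?\<beta> g (map line [u, \<omega>])
      = map line [act (\<kappa> g) u, act2 (\<kappa> g) \<omega>]"
    if "u \<in> carrier_vec 15" "\<omega> \<in> carrier_vec 2" "[line u] \<in> Z" for Z g and u \<omega> :: "'k vec"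
    using that image_line[of "act2 (\<kappa> g)" \<omega>, OF compatibleD(9)[OF compatible_act]]
    by (simp add: diagonal_action_def point_act_line)
  have equi: "proj_map [15, 2] L.to_X (?dY g x) = ?dX g (proj_map [15, 2] L.to_X x)"
    if x: "x \<in> L.Y_open" and gx: "?dY g x \<in> L.Y_open" for g x
  proof -
    obtain z where z: "z \<in> hom_coords [15, 2]" "x = map line z" using x L.Y_open_subset by (auto simp: multiproj_def)
    obtain u \<omega> where u: "z = [u, \<omega>]" "u \<in> carrier_vec 15" "u \<noteq> 0\<^sub>v 15" "\<omega> \<in> carrier_vec 2" "\<omega> \<noteq> 0\<^sub>v 2"
      using z(1) by (auto simp: hom_coords_def list_all2_Cons2)
    define v where "v = L.Y_vector [u, \<omega>]"
    have vc: "v \<in> carrier_vec 6" by (simp add: v_def L.Y_vector_def)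
    have hz: "[u, \<omega>] \<in> hom_coords [15, 2]" and xz: "map line [u, \<omega>] \<in> L.Y_open" using z u(1) x by auto
    have Y: "[line u] \<in> Y_of form" and adm: "admissible v \<omega> \<noteq> 0"
      using L.Y_open_iff[OF hz] xz product_line_iff(1)[OF hz] by (auto simp: v_def)
    let ?u = "act (\<kappa> g) u" and ?\<omega> = "act2 (\<kappa> g) \<omega>"
    note cd = compatibleD[OF compatible_act[of "\<kappa> g"]]
    have hz': "[?u, ?\<omega>] \<in> hom_coords [15, 2]"
      by (simp add: hom_coords_def u act_nonzero cd(1,7,8))
    have gx': "?dY g x = map line [?u, ?\<omega>]" unfolding z(2) u(1) by (rule diag[OF u(2,4) Y])
    have xz': "map line [?u, ?\<omega>] \<in> L.Y_open" using gx gx' by simp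
    define v' where "v' = L.Y_vector [?u, ?\<omega>]"
    have Y': "[line ?u] \<in> Y_of form" and adm': "admissible v' ?\<omega> \<noteq> 0"
      using L.Y_open_iff[OF hz'] xz' product_line_iff(1)[OF hz'] by (auto simp: v'_def)
    obtain c where c: "c \<noteq> 0" "pfaffian_adjoint ?u = c \<cdot>\<^sub>v act (\<kappa> g) (pfaffian_adjoint u)" using cd(14)[OF u(2)] by blast
    have v': "v' = c \<cdot>\<^sub>v rep (\<kappa> g) v"
      by (simp add: v'_def v_def L.Y_vector_def probe_def c(2) cd(1,12,13) u skew_apply_linear)
    obtain a' where a': "a' \<in> carrier_vec 5" "a' \<noteq> 0\<^sub>v 5" "cubic a' = 0" "?u = form_coords a'"
      using Y_repE[OF Y'] hz' by (auto simp: hom_coords_def)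
    have ch': "chart 4 4 5 v' a'"
      by (rule cubic_to_planes(1)[OF a'(1-3) _ adm']) (simp add: v'_def L.Y_vector_def a'(4))
    obtain a where a: "a \<in> carrier_vec 5" "a \<noteq> 0\<^sub>v 5" "cubic a = 0" "u = form_coords a"
      using Y_repE[OF Y u(2,3)] by blast
    have ch: "chart 4 4 5 v a"
      by (rule cubic_to_planes(1)[OF a(1-3) _ adm]) (simp add: v_def L.Y_vector_def a(4))
    interpret c0: chart 4 4 5 v a by (rule ch)
    interpret c1: chart 4 4 5 v' a' by (rule ch')
    let ?w = "partner 4 4 5 v"
    have r: "rep (\<kappa> g) v \<in> carrier_vec 6" "rep (\<kappa> g) ?w \<in> carrier_vec 6" by (simp_all add: cd(5) vc)
    \<comment> \<open>The group does not respect the chart \<open>(4, 4, 5)\<close>. But the plane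
      through \<open>v'\<close> consists of the vectors isotropic to \<open>v'\<close>, and the
      transported plane has this property, so it agrees with \<open>plane v'\<close> up to a
      factor.\<close>
    have iso: "isotropic (rep (\<kappa> g) v) v'" "isotropic (rep (\<kappa> g) ?w) v'"
      unfolding v' using isotropic_self[OF r(1)] cd(11)[OF partner_carrier vc c0.isotropic_partner] r
      by (auto intro: isotropic_smult)
    obtain d where d: "act (\<kappa> g) (plane v) = d \<cdot>\<^sub>v plane v'"
      using c1.coords_wedge_partner[OF r iso] cd(10)[OF vc partner_carrier] unfolding plane_def by auto
    have pl: "plane v \<noteq> 0\<^sub>v 15" using c0.wedge_partner by (simp add: plane_def)
    have "d \<noteq> 0" using d act_nonzero[OF plane_carrier pl, of "\<kappa> g"] plane_carrier[of v'] by (auto simp: vec_eq_iff)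
    then have line: "line (act (\<kappa> g) (plane v)) = line (plane v')" by (simp add: d line_smult)
    have toX: "L.to_X [u, \<omega>] = [plane v, \<omega>]" "L.to_X [?u, ?\<omega>] = [plane v', ?\<omega>]"
      by (simp_all add: L.to_X_def v_def v'_def)
    have "[plane v, \<omega>] \<in> hom_coords [15, 2]" "map line [plane v, \<omega>] \<in> L.X_open"
      using L.to_X_Y_open(1,2)[OF hz xz] unfolding toX by blast+
    then have X: "[line (plane v)] \<in> X_of form"
      using L.X_open_iff product_line_iff(2) by blast
    have "proj_map [15, 2] L.to_X (?dY g x) = map line [plane v', ?\<omega>]"
      unfolding gx' L.to_X_line[OF hz'] toX ..
    also have "\<dots> = map line [act (\<kappa> g) (plane v), ?\<omega>]" by (simp add: line)
    also have "\<dots> = ?dX g (map line [plane v, \<omega>])" by (rule diag[OF plane_carrier u(4) X, symmetric])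
    also have "map line [plane v, \<omega>] = proj_map [15, 2] L.to_X x"
      unfolding z(2) u(1) L.to_X_line[OF hz] toX ..
    finally show ?thesis .
  qed
  have "equivariantly_birational G ([15] @ [2]) (product (Y_of form) (multiproj [2])) ?dY
      ([15] @ [2]) (product (X_of form) (multiproj [2])) ?dX"
    unfolding equivariantly_birational_def append_Cons append_Nil
    using L.birational_map_to_X equi by blast
  then show ?thesis
    unfolding twisted_equivariantly_stably_birational_def
    by (intro exI[of _ "[2]"] exI[of _ ?\<beta>]) (simp add: projectively_linear_act2)
qed

end

lemma klein_exists:
  fixes G :: "('g, 'b) monoid_scheme"
  assumes "group G" "G \<cong> integer_mod_group 2 \<times>\<times> integer_mod_group 2"
  shows "\<exists>\<kappa>. klein G \<kappa>"
proof -
  obtain h where h: "h \<in> iso G (integer_mod_group 2 \<times>\<times> integer_mod_group 2)"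
    using assms(2) by (auto simp: is_iso_def)
  define b where "b p = (fst p = (1::int), snd p = (1::int))" for p
  have carr: "carrier (integer_mod_group 2 \<times>\<times> integer_mod_group 2) = {0, 1} \<times> {0, 1}"
    by (auto simp: carrier_integer_mod_group)
  have bij_b: "bij_betw b ({0, 1} \<times> {0, 1}) UNIV"
    unfolding bij_betw_def
  proof
    show "inj_on b ({0, 1} \<times> {0, 1})" by (auto simp: inj_on_def b_def)
    show "b ` ({0, 1} \<times> {0, 1}) = UNIV"
    proof (intro equalityI subsetI UNIV_I)
      fix p :: "bool \<times> bool"
      show "p \<in> b ` ({0, 1} \<times> {0, 1})"
        by (rule image_eqI[of _ _ "(if fst p then 1 else 0, if snd p then 1 else 0)"]) (auto simp: b_def prod_eq_iff)
    qed
  qed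
  have "klein G (b \<circ> h)"
  proof (intro klein.intro klein_axioms.intro assms(1))
    show "bij_betw (b \<circ> h) (carrier G) UNIV"
      using h bij_b unfolding iso_def carr by (auto intro: bij_betw_trans)
    fix x y assume xy: "x \<in> carrier G" "y \<in> carrier G"
    have "h x \<in> {0, 1} \<times> {0, 1}" "h y \<in> {0, 1} \<times> {0, 1}"
      using h xy unfolding iso_def hom_def carr by blast+
    moreover have "h (x \<otimes>\<^bsub>G\<^esub> y) = ((fst (h x) + fst (h y)) mod 2, (snd (h x) + snd (h y)) mod 2)"
      using h xy unfolding iso_def hom_def by (auto simp: DirProd_def split: prod.splits)
    ultimately show "(b \<circ> h) (x \<otimes>\<^bsub>G\<^esub> y) = xor2 ((b \<circ> h) x) ((b \<circ> h) y)"
      by (auto simp: b_def xor2_def)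
  qed
  then show ?thesis by blast
qed

section \<open>No equivariant birational map\<close>

text \<open>A local converse of \<open>morphismI\<close>. On the chart
  \<open>z $ i \<noteq> 0\<close> of the target the ratios of coordinates are regular, so their
  pullbacks are local quotients; multiplying by all denominators gives the polynomials
  \<open>P\<close>. Where \<open>R\<close> is nonzero, all these local descriptions are
  valid.\<close>

lemma morphism_locally_polynomial:
  fixes \<phi> :: "'k::field point \<Rightarrow> 'k point"
  assumes mor: "morphism [n] U [n'] U' \<phi>" and U: "openin (zariski_on [n] Y) U" "Y \<subseteq> multiproj [n]" and U': "U' \<subseteq> multiproj [n']"
    and v0: "v0 \<in> hom_coords [n]" "map line v0 \<in> U"
  shows "\<exists>d R P. hompoly [n] d R \<and> R v0 \<noteq> 0 \<and> (\<forall>j<n'. \<exists>e. hompoly [n] e (P j)) \<and>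
    (\<forall>v\<in>hom_coords [n]. map line v \<in> Y \<longrightarrow> R v \<noteq> 0 \<longrightarrow> map line v \<in> U \<and> vec n' (\<lambda>j. P j v) \<noteq> 0\<^sub>v n' \<and>
       \<phi> (map line v) = [line (vec n' (\<lambda>j. P j v))])"
proof -
  let ?c = "\<lambda>j v. (v ! 0) $ (j::nat) :: 'k"
  have UY: "U \<subseteq> Y" using openin_subset[OF U(1)] by simp
  have top: "topspace (zariski_on [n] U) = U" "topspace (zariski_on [n'] U') = U'" using UY U(2) U' by auto
  have into: "\<phi> x \<in> U'" if "x \<in> U" for x
    using mor that unfolding morphism_def continuous_map_def top by blast
  have hp: "hompoly [n'] (\<lambda>l. if l = 0 then 1 else 0) (?c j)" if "j < n'" for j
    by (rule hompoly_coord) (use that in auto)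
  obtain z0 where z0: "z0 \<in> carrier_vec n'" "z0 \<noteq> 0\<^sub>v n'" "\<phi> (map line v0) = map line [z0]"
    using into[OF v0(2)] U' by (auto simp: multiproj_def hom_coords_def list_all2_Cons2)
  obtain i where i: "i < n'" "z0 $ i \<noteq> 0" using z0(1,2) by (metis carrier_vecD eq_vecI index_zero_vec)
  define V where "V = U' \<inter> nonvanishing [n'] (?c i)"
  have V: "openin (zariski_on [n'] U') V" unfolding V_def by (rule openin_zariski_on_nonvanishing[OF hp[OF i(1)]])
  have z0h: "[z0] \<in> hom_coords [n']" using z0 by (simp add: hom_coords_def)
  have v0V: "\<phi> (map line v0) \<in> V"
    using into[OF v0(2)] i(2) map_line_in_nonvanishing[OF hp[OF i(1)] z0h] by (simp add: V_def z0(3))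
  define h where "h j x = (let z = (SOME z. z \<in> hom_coords [n'] \<and> map line z = x) in ?c j z / ?c i z)" for j x
  have h: "h j (map line z) = ?c j z / ?c i z" if z: "z \<in> hom_coords [n']" and j: "j < n'" for j z
  proof -
    define w where "w = (SOME w. w \<in> hom_coords [n'] \<and> map line w = map line z)"
    have w: "w \<in> hom_coords [n']" "map line w = map line z"
      using someI[of "\<lambda>w. w \<in> hom_coords [n'] \<and> map line w = map line z" z] z by (auto simp: w_def)
    obtain c where c: "c \<noteq> 0" "\<And>P. hompoly [n'] (\<lambda>l. if l = 0 then 1 else 0) P \<Longrightarrow> P w = c * P z"
      using hom_coords_rescale[OF z w(1) w(2)[symmetric]] by blast
    show ?thesis using c(1) c(2)[OF hp[OF j]] c(2)[OF hp[OF i(1)]] by (simp add: h_def Let_def w_def[symmetric])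
  qed
  have reg: "regular_function [n'] V (h j)" if j: "j < n'" for j
    unfolding regular_function_def
  proof
    fix x assume x: "x \<in> V"
    obtain a b where ab: "multihomogeneous [n'] (\<lambda>l. if l = 0 then 1 else 0) a" "\<And>v. v \<in> carr [n'] \<Longrightarrow> evaluate a v = ?c j v"
      "multihomogeneous [n'] (\<lambda>l. if l = 0 then 1 else 0) b" "\<And>v. v \<in> carr [n'] \<Longrightarrow> evaluate b v = ?c i v"
      using hp[OF j] hp[OF i(1)] unfolding hompoly_def by blast
    have "evaluate b v \<noteq> 0 \<and> h j (map line v) = evaluate a v / evaluate b v" if v: "v \<in> hom_coords [n']" "map line v \<in> V" for v
    proof -
      have "v \<in> carr [n']" using v(1) hom_coords_subset_carr by blast
      moreover have "?c i v \<noteq> 0" using v map_line_in_nonvanishing[OF hp[OF i(1)] v(1)] by (simp add: V_def)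
      ultimately show ?thesis using ab h[OF v(1) j] by simp
    qed
    moreover have "openin (zariski_on [n'] V) V" using openin_subtopology_self V_def U' openin_subset[OF V]
      by (metis inf.absorb_iff2 openin_topspace topspace_subtopology top(2) topspace_zariski inf.coboundedI2 order_trans)
    ultimately show "\<exists>W a b d. openin (zariski_on [n'] V) W \<and> x \<in> W \<and> multihomogeneous [n'] d a \<and> multihomogeneous [n'] d b \<and>
        (\<forall>v\<in>hom_coords [n']. map line v \<in> W \<longrightarrow> evaluate b v \<noteq> 0 \<and> h j (map line v) = evaluate a v / evaluate b v)"
      using x ab(1,3) by blast
  qed
  define Z where "Z = {x \<in> U. \<phi> x \<in> V}"
  have Z: "openin (zariski_on [n] U) Z"
    using mor V unfolding morphism_def continuous_map_def top Z_def by blast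
  have x0Z: "map line v0 \<in> Z" using v0 v0V by (simp add: Z_def)
  define loc where "loc j W a b d \<longleftrightarrow> openin (zariski_on [n] Z) W \<and> map line v0 \<in> W \<and>
      multihomogeneous [n] d a \<and> multihomogeneous [n] d b \<and>
      (\<forall>v\<in>hom_coords [n]. map line v \<in> W \<longrightarrow> evaluate b v \<noteq> 0 \<and> (h j \<circ> \<phi>) (map line v) = evaluate a v / evaluate b v)"
    for j W a b d
  have "\<exists>W a b d. loc j W a b d" if j: "j < n'" for j
  proof -
    have "regular_function [n] Z (h j \<circ> \<phi>)"
      using mor V reg[OF j] unfolding morphism_def Z_def by blast
    then show ?thesis using x0Z unfolding regular_function_def loc_def by blast
  qed
  then obtain W a b d where "\<And>j. j < n' \<Longrightarrow> loc j (W j) (a j) (b j) (d j)" by metis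
  then have W: "\<And>j. j < n' \<Longrightarrow> openin (zariski_on [n] Z) (W j)" "\<And>j. j < n' \<Longrightarrow> map line v0 \<in> W j"
    and ab: "\<And>j. j < n' \<Longrightarrow> multihomogeneous [n] (d j) (a j)" "\<And>j. j < n' \<Longrightarrow> multihomogeneous [n] (d j) (b j)"
    and q: "\<And>j v. j < n' \<Longrightarrow> v \<in> hom_coords [n] \<Longrightarrow> map line v \<in> W j \<Longrightarrow>
      evaluate (b j) v \<noteq> 0 \<and> (h j \<circ> \<phi>) (map line v) = evaluate (a j) v / evaluate (b j) v"
    unfolding loc_def by blast+
  obtain dU RU where RU: "hompoly [n] dU RU" "map line v0 \<in> nonvanishing [n] RU" "Y \<inter> nonvanishing [n] RU \<subseteq> U"
    using openin_zariski_onD[OF U(1) v0(2)] by blast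
  obtain dZ RZ where RZ: "hompoly [n] dZ RZ" "map line v0 \<in> nonvanishing [n] RZ" "U \<inter> nonvanishing [n] RZ \<subseteq> Z"
    using openin_zariski_onD[OF Z x0Z] by blast
  have "\<exists>e r. hompoly [n] e r \<and> map line v0 \<in> nonvanishing [n] r \<and> Z \<inter> nonvanishing [n] r \<subseteq> W j" if "j < n'" for j
    using openin_zariski_onD[OF W(1,2)[OF that]] by blast
  then obtain e r where r: "\<And>j. j < n' \<Longrightarrow> hompoly [n] (e j) (r j)" "\<And>j. j < n' \<Longrightarrow> map line v0 \<in> nonvanishing [n] (r j)"
    "\<And>j. j < n' \<Longrightarrow> Z \<inter> nonvanishing [n] (r j) \<subseteq> W j"
    by metis
  define R where "R v = (RU v * RZ v) * (\<Prod>j<n'. r j v)" for v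
  have hR: "hompoly [n] (\<lambda>l. (dU l + dZ l) + (\<Sum>j<n'. e j l)) R"
    unfolding R_def by (intro hompoly_mult RU(1) RZ(1) hompoly_prod r(1)) simp
  have R0: "R v0 \<noteq> 0"
    unfolding R_def using map_line_in_nonvanishing[OF RU(1) v0(1)] map_line_in_nonvanishing[OF RZ(1) v0(1)] RU(2) RZ(2)
      map_line_in_nonvanishing[OF r(1) v0(1)] r(2) by simp
  define P where "P j v = evaluate (a j) v * (\<Prod>k\<in>{..<n'} - {j}. evaluate (b k) v)" for j v
  have hP: "hompoly [n] (\<lambda>l. d j l + (\<Sum>k\<in>{..<n'} - {j}. d k l)) (P j)" if "j < n'" for j
    unfolding P_def by (intro hompoly_mult hompoly_prod hompolyI_multihomogeneous ab that) simp
  have main: "map line v \<in> U \<and> vec n' (\<lambda>j. P j v) \<noteq> 0\<^sub>v n' \<and> \<phi> (map line v) = [line (vec n' (\<lambda>j. P j v))]"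
    if v: "v \<in> hom_coords [n]" "map line v \<in> Y" "R v \<noteq> 0" for v
  proof -
    have "RU v \<noteq> 0" "RZ v \<noteq> 0" and rj: "\<And>j. j < n' \<Longrightarrow> r j v \<noteq> 0" using v(3) by (auto simp: R_def)
    then have vU: "map line v \<in> U" using RU(3) v(2) map_line_in_nonvanishing[OF RU(1) v(1)] by blast
    then have vZ: "map line v \<in> Z" using RZ(3) map_line_in_nonvanishing[OF RZ(1) v(1)] \<open>RZ v \<noteq> 0\<close> by blast
    have vW: "map line v \<in> W j" if "j < n'" for j
      using r(3)[OF that] vZ map_line_in_nonvanishing[OF r(1)[OF that] v(1)] rj[OF that] by blast
    obtain z where z: "z \<in> carrier_vec n'" "z \<noteq> 0\<^sub>v n'" "\<phi> (map line v) = map line [z]"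
      using into[OF vU] U' by (auto simp: multiproj_def hom_coords_def list_all2_Cons2)
    have zh: "[z] \<in> hom_coords [n']" using z by (simp add: hom_coords_def)
    have zi: "z $ i \<noteq> 0"
      using vZ map_line_in_nonvanishing[OF hp[OF i(1)] zh] z(3) by (simp add: Z_def V_def)
    define B where "B = (\<Prod>k<n'. evaluate (b k) v)"
    have bj: "evaluate (b j) v \<noteq> 0" if "j < n'" for j using q[OF that v(1) vW[OF that]] by blast
    then have B: "B \<noteq> 0" by (auto simp: B_def)
    have Pj: "P j v = B / z $ i * z $ j" if j: "j < n'" for j
    proof -
      have "z $ j / z $ i = evaluate (a j) v / evaluate (b j) v"
        using q[OF j v(1) vW[OF j]] h[OF zh j] z(3) by simp
      then have "evaluate (a j) v = z $ j / z $ i * evaluate (b j) v" using bj[OF j] by (simp add: field_simps)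
      moreover have "B = evaluate (b j) v * (\<Prod>k\<in>{..<n'} - {j}. evaluate (b k) v)"
        unfolding B_def by (rule prod.remove) (use j in auto)
      ultimately show ?thesis by (simp add: P_def)
    qed
    have vec: "vec n' (\<lambda>j. P j v) = (B / z $ i) \<cdot>\<^sub>v z" using z(1) Pj by (intro eq_vecI) auto
    have "vec n' (\<lambda>j. P j v) $ i \<noteq> 0" using i(1) Pj B zi by simp
    then have "vec n' (\<lambda>j. P j v) \<noteq> 0\<^sub>v n'" using i(1) by (metis index_zero_vec(1))
    moreover have "line (vec n' (\<lambda>j. P j v)) = line z" unfolding vec by (rule line_smult) (use B zi in simp)
    ultimately show ?thesis using vU z(3) by simp
  qed
  show ?thesis
    by (rule exI, rule exI[of _ R], rule exI[of _ P]) (use hR R0 hP main in blast)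
qed

section \<open>Limits of polynomial families and fixed points on X\<close>

lemma poly2_zero:
  fixes R :: "'k::field_char_0 poly poly"
  assumes "\<And>s t. poly (poly R [:t:]) s = 0" shows "R = 0"
proof (rule ccontr)
  assume "R \<noteq> 0"
  then have "finite {c. poly R c = 0}" by (rule poly_roots_finite)
  moreover have "range (\<lambda>t::'k. [:t:]) \<subseteq> {c. poly R c = 0}"
    using assms poly_all_0_iff_0 by blast
  moreover have "infinite (range (\<lambda>t::'k. [:t:]))"
    using infinite_UNIV_char_0[where 'a = 'k] by (simp add: finite_image_iff inj_on_def)
  ultimately show False using finite_subset by blast
qed

text \<open>Polynomials in two variables have no zero divisors: an identity that holds wherever
  \<open>g\<close> is nonzero holds everywhere.\<close>

lemma poly2_zero_product:
  fixes f g :: "'k::field_char_0 \<Rightarrow> 'k \<Rightarrow> 'k"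
  assumes "poly2 f" "poly2 g" "\<And>s t. g s t \<noteq> 0 \<Longrightarrow> f s t = 0" "g s0 t0 \<noteq> 0"
  shows "f s t = 0"
proof -
  obtain R S where R: "\<And>s t. f s t = poly (poly R [:t:]) s" and S: "\<And>s t. g s t = poly (poly S [:t:]) s"
    using assms(1,2) unfolding poly2_def by blast
  have "R * S = 0" by (rule poly2_zero) (use assms(3) R S in auto)
  moreover have "S \<noteq> 0" using assms(4) S by auto
  ultimately show ?thesis using R by simp
qed

lemma shift_lowest:
  fixes R :: "nat \<Rightarrow> 'a::idom poly"
  assumes "i < n" "R i \<noteq> 0"
  obtains r R' where "\<And>j. j < n \<Longrightarrow> R j = monom 1 r * R' j" "\<exists>j<n. coeff (R' j) 0 \<noteq> 0"
proof -
  define r where "r = (LEAST r. \<exists>j<n. coeff (R j) r \<noteq> 0)"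
  obtain r0 where "coeff (R i) r0 \<noteq> 0" using assms(2) by (metis leading_coeff_0_iff)
  then have ex: "\<exists>r. \<exists>j<n. coeff (R j) r \<noteq> 0" using assms(1) by blast
  have r: "\<exists>j<n. coeff (R j) r \<noteq> 0" unfolding r_def using LeastI_ex[OF ex] .
  have low: "coeff (R j) m = 0" if "j < n" "m < r" for j m
    using not_less_Least[of m "\<lambda>r. \<exists>j<n. coeff (R j) r \<noteq> 0"] that unfolding r_def by blast
  show ?thesis
  proof (rule that[of r "\<lambda>j. poly_shift r (R j)"])
    show "R j = monom 1 r * poly_shift r (R j)" if "j < n" for j
      by (rule poly_eqI) (use low[OF that] in \<open>auto simp: coeff_monom_mult coeff_poly_shift\<close>)
    show "\<exists>j<n. coeff (poly_shift r (R j)) 0 \<noteq> 0" using r by (simp add: coeff_poly_shift)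
  qed
qed

definition cone_X :: "'k::field vec set" where
  "cone_X = {coords (wedge v w) | v w. v \<in> carrier_vec 6 \<and> w \<in> carrier_vec 6 \<and> isotropic v w}"

lemma hompoly_first_coord: "l < 15 \<Longrightarrow> hompoly [15] (\<lambda>l. if l = 0 then 1 else 0) (\<lambda>x. (x ! 0) $ l)"
  by (rule hompoly_coord) auto

text \<open>The equations \<open>e\<close> say that the symmetric matrix \<open>b\<close> is
  orthogonal to all matrices of \<open>sm\<close>. Since the square of \<open>l\<close> is
  \<open>k\<close> times \<open>b\<close>, they give \<open>sm l l = 0\<close>.\<close>

lemma sm_self_zero_scaled:
  fixes l0 :: "'k::field_char_0"
  assumes "l0 * l0 = k * b00" "l0 * l1 = k * b01" "l0 * l2 = k * b02" "l1 * l1 = k * b11" "l1 * l2 = k * b12" "l2 * l2 = k * b22"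
    and e: "2 * b01 + b11 + 2 * b12 - b22 = 0" "b00 + 2 * b01 + 2 * b02 - b22 = 0" "2 * b01 - 2 * b02 - 2 * b12 = 0"
  shows "l0 = 0 \<and> l1 = 0 \<and> l2 = 0"
proof -
  have "fst (sm (l0, l1, l2) (l0, l1, l2)) = 2 * (l0 * l1) + l1 * l1 + 2 * (l1 * l2) - l2 * l2"
    "fst (snd (sm (l0, l1, l2) (l0, l1, l2))) = l0 * l0 + 2 * (l0 * l1) + 2 * (l0 * l2) - l2 * l2"
    "snd (snd (sm (l0, l1, l2) (l0, l1, l2))) = 2 * (l0 * l1) - 2 * (l0 * l2) - 2 * (l1 * l2)"
    by (simp_all add: algebra_simps)
  note a = this
  have "2 * (l0 * l1) + l1 * l1 + 2 * (l1 * l2) - l2 * l2 = k * (2 * b01 + b11 + 2 * b12 - b22)"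
    "l0 * l0 + 2 * (l0 * l1) + 2 * (l0 * l2) - l2 * l2 = k * (b00 + 2 * b01 + 2 * b02 - b22)"
    "2 * (l0 * l1) - 2 * (l0 * l2) - 2 * (l1 * l2) = k * (2 * b01 - 2 * b02 - 2 * b12)"
    unfolding assms(1-6) by (simp_all add: algebra_simps)
  note b = this
  have "fst (sm (l0, l1, l2) (l0, l1, l2)) = 0" "fst (snd (sm (l0, l1, l2) (l0, l1, l2))) = 0"
    "snd (snd (sm (l0, l1, l2) (l0, l1, l2))) = 0"
    unfolding a b e by simp_all
  then have "sm (l0, l1, l2) (l0, l1, l2) = 0" by (simp only: prod_eq_iff) simp
  then have "(l0, l1, l2) = 0" by (rule sm_self_eq_0D)
  then show ?thesis by (simp add: v3_zero)
qed

text \<open>Two kinds of equations of X enter: the quadrics \<open>pfaffian_adjoint = 0\<close> and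
  the five linear forms. A common eigenvector lives either on the two diagonal 3 by 3 blocks, which
  agree up to sign and are killed by the quadrics, or on the off-diagonal block. That block has
  vanishing 2 by 2 minors and is skew or symmetric; a skew one is zero, and a symmetric one is
  excluded by the linear forms.\<close>

lemma no_fixed_point:
  fixes w :: "'k::field_char_0 vec"
  assumes w: "w \<in> carrier_vec 15" "w \<noteq> 0\<^sub>v 15"
    and H: "\<And>d H. hompoly [15] d H \<Longrightarrow> (\<And>u. u \<in> cone_X \<Longrightarrow> H [u] = 0) \<Longrightarrow> H [w] = (0 :: 'k)"
    and fT: "act (False, True) w = c1 \<cdot>\<^sub>v w" and fDT: "act (True, True) w = c2 \<cdot>\<^sub>v w"
  shows False
proof -
  have pad: "pfaffian_adjoint w $ l = 0" if l: "l < 15" for l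
  proof -
    have "hompoly [15] (\<lambda>l. (if l = 0 then 1 else 0) + (if l = 0 then 1 else 0)) (\<lambda>x. pfaffian_adjoint (x ! 0) $ l :: 'k)"
      by (rule hompoly_pfaffian_adjoint[OF hompoly_first_coord l])
    note h = this
    have c: "pfaffian_adjoint (coords (wedge v y)) $ l = 0" for v y :: "'k vec"
      using less_15_cases[OF l]
      by (elim disjE) (simp_all add: pfaffian_adjoint_index coords_wedge_index algebra_simps)
    have "pfaffian_adjoint ([w] ! 0) $ l = 0" by (rule H[OF h]) (auto simp: cone_X_def c)
    then show ?thesis by simp
  qed
  have lin: "form_coords (unit_vec 5 k) \<bullet> w = 0" for k
  proof -
    have "hompoly [15] (\<lambda>l. if l = 0 then 1 else 0) (\<lambda>x. \<Sum>j<15. form_coords (unit_vec 5 k) $ j * (x ! 0) $ j :: 'k)"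
      by (intro hompoly_sum hompoly_scale hompoly_first_coord) auto
    then have h: "hompoly [15] (\<lambda>l. if l = 0 then 1 else 0) (\<lambda>x. form_coords (unit_vec 5 k) \<bullet> (x ! 0) :: 'k)"
      by (rule hompoly_cong) (auto simp: scalar_prod_15 elim!: carr_ConsE)
    have c: "form_coords (unit_vec 5 k) \<bullet> u = 0" if "u \<in> cone_X" for u :: "'k vec"
      using that by (auto simp: cone_X_def scalar_prod_coords_wedge isotropic_def)
    have "form_coords (unit_vec 5 k) \<bullet> ([w] ! 0) = 0" by (rule H[OF h]) (simp add: c)
    then show ?thesis by simp
  qed
  have T: "actT w $ i = c1 * w $ i" and DT: "actD (actT w) $ i = c2 * w $ i" if "i < 15" for i
    using arg_cong[OF fT, of "\<lambda>u. u $ i"] arg_cong[OF fDT, of "\<lambda>u. u $ i"] w(1) that by (simp_all add: act_def)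
  have "actT (actT w) = w" using compatibleD(2)[OF compatible_T w(1)] .
  moreover have "actT w = c1 \<cdot>\<^sub>v w" using fT by (simp add: act_def)
  ultimately have sq: "(c1 * c1) \<cdot>\<^sub>v w = w"
    using compatibleD(3)[OF compatible_T w(1), of c1] by (simp add: smult_smult_assoc)
  obtain i where i: "i < 15" "w $ i \<noteq> 0" using w by (metis carrier_vecD eq_vecI index_zero_vec)
  have "c1 * c1 * w $ i = w $ i" using arg_cong[OF sq, of "\<lambda>u. u $ i"] i(1) w(1) by simp
  then have "c1 * c1 = 1" using i(2) by simp
  then have c1: "c1 = 1 \<or> c1 = - 1" by (metis power2_eq_1_iff power2_eq_square)
  have nonzero: "\<exists>i<15. w $ i \<noteq> 0" using i by blast
  note t = T[of 0] T[of 1] T[of 2] T[of 3] T[of 4] T[of 5] T[of 6] T[of 7] T[of 8] T[of 9] T[of 10] T[of 11]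
  have t': "w $ 12 = c1 * w $ 0" "w $ 13 = c1 * w $ 1" "- w $ 2 = c1 * w $ 2" "- w $ 6 = c1 * w $ 3" "- w $ 9 = c1 * w $ 4"
    "w $ 14 = c1 * w $ 5" "- w $ 7 = c1 * w $ 7" "- w $ 10 = c1 * w $ 8" "- w $ 11 = c1 * w $ 11"
    using t by (simp_all add: actT_index)
  note p = pad[of 2] pad[of 3] pad[of 4] pad[of 6] pad[of 7] pad[of 8] pad[of 9] pad[of 10] pad[of 11]
  show False
  proof (cases "c1 = c2")
    case True
    have cross: "w $ i = 0" if "i \<in> {2, 3, 4, 6, 7, 8, 9, 10, 11}" for i
    proof -
      have "- (c1 * w $ i) = c1 * w $ i"
        using that DT[of i] T[of i] True by (auto simp: actD_index)
      then show ?thesis using c1 by (auto simp: eq_uminus_self_iff)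
    qed
    have "w $ 0 * w $ 12 = 0" using pad[of 11] cross[of 2] cross[of 3] by (simp add: pfaffian_adjoint_index)
    moreover have "w $ 1 * w $ 13 = 0" using pad[of 7] cross[of 2] cross[of 4] by (simp add: pfaffian_adjoint_index)
    moreover have "w $ 5 * w $ 14 = 0" using pad[of 2] cross[of 7] cross[of 8] by (simp add: pfaffian_adjoint_index)
    moreover have "c1 \<noteq> 0" using c1 by auto
    ultimately have z: "w $ 0 = 0" "w $ 1 = 0" "w $ 5 = 0" unfolding t'(1,2,6) by simp_all
    have "w $ i = 0" if "i < 15" for i
      using less_15_cases[OF that] by (elim disjE) (simp_all only: z t'(1,2,6), simp_all add: cross z[unfolded One_nat_def])
    then show False using nonzero by blast
  next
    case False
    have noncross: "w $ i = 0" if "i \<in> {0, 1, 5, 12, 13, 14}" for i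
      using that DT[of i] T[of i] False by (auto simp: actD_index)
    have m: "w $ 7 * w $ 11 - w $ 8 * w $ 10 = 0" "w $ 4 * w $ 10 = w $ 3 * w $ 11"
      "w $ 2 * w $ 11 - w $ 4 * w $ 9 = 0" "w $ 3 * w $ 8 - w $ 4 * w $ 7 = 0" "w $ 4 * w $ 6 = w $ 2 * w $ 8"
      "w $ 2 * w $ 7 - w $ 3 * w $ 6 = 0"
      using p noncross by (simp_all add: pfaffian_adjoint_index)
    have l: "w $ 3 + w $ 6 + w $ 7 + w $ 8 + w $ 10 - w $ 11 = 0" "w $ 2 + w $ 3 + w $ 4 + w $ 6 + w $ 9 - w $ 11 = 0"
      "w $ 3 - w $ 4 + w $ 6 - w $ 8 - w $ 9 - w $ 10 = 0"
      using lin[of 0] lin[of 1] lin[of 2]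
      by (simp_all add: scalar_prod_15[OF w(1)] sum_lessThan_15 form_coords_index)
    have diag: "w $ 2 = 0 \<and> w $ 7 = 0 \<and> w $ 11 = 0"
    proof (cases "c1 = 1")
      case True
      then show ?thesis using t'(3,7,9) by (simp add: eq_uminus_self_iff)
    next
      case False
      then have "c1 = - 1" using c1 by simp
      then have s: "w $ 6 = w $ 3" "w $ 9 = w $ 4" "w $ 10 = w $ 8" using t'(4,5,8) by simp_all
      note m' = m[unfolded s] and l' = l[unfolded s]
      have e: "2 * w $ 3 + w $ 7 + 2 * w $ 8 - w $ 11 = 0" "w $ 2 + 2 * w $ 3 + 2 * w $ 4 - w $ 11 = 0"
        "2 * w $ 3 - 2 * w $ 4 - 2 * w $ 8 = 0"
        using l' by (simp_all add: algebra_simps)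
      \<comment> \<open>For a symmetric block of rank at most one, the square of a row is its
        diagonal entry times the block; \<open>l\<close> runs through the three rows.\<close>
      have "w $ 2 = 0 \<and> w $ 3 = 0 \<and> w $ 4 = 0"
        by (rule sm_self_zero_scaled[where k = "w $ 2", OF _ _ _ _ _ _ e]) (use m' in \<open>simp_all add: mult.commute\<close>)
      moreover have "w $ 3 = 0 \<and> w $ 7 = 0 \<and> w $ 8 = 0"
        by (rule sm_self_zero_scaled[where k = "w $ 7", OF _ _ _ _ _ _ e]) (use m' in \<open>simp_all add: mult.commute\<close>)
      moreover have "w $ 4 = 0 \<and> w $ 8 = 0 \<and> w $ 11 = 0"
        by (rule sm_self_zero_scaled[where k = "w $ 11", OF _ _ _ _ _ _ e]) (use m' in \<open>simp_all add: mult.commute\<close>)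
      ultimately show ?thesis by blast
    qed
    have s: "w $ 6 = - (c1 * w $ 3)" "w $ 9 = - (c1 * w $ 4)" "w $ 10 = - (c1 * w $ 8)"
      unfolding t'(4,5,8)[symmetric] by simp_all
    have "w $ 3 * w $ 6 = 0" "w $ 4 * w $ 9 = 0" "w $ 8 * w $ 10 = 0" using m(6,3,1) diag by simp_all
    moreover have "c1 \<noteq> 0" using c1 by auto
    ultimately have z: "w $ 3 = 0" "w $ 4 = 0" "w $ 8 = 0" unfolding s by simp_all
    have n: "w $ 0 = 0" "w $ 1 = 0" "w $ 5 = 0" "w $ 12 = 0" "w $ 13 = 0" "w $ 14 = 0"
      by (simp_all add: noncross)
    have "w $ i = 0" if "i < 15" for i
      using less_15_cases[OF that] diag by (elim disjE) (simp_all only: n z s, simp_all)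
    then show False using nonzero by blast
  qed
qed

lemma poly2_compose:
  assumes f: "poly2 f" and u: "poly2 u" and w: "poly2 w"
  shows "poly2 (\<lambda>s t. f (u s t) (w s t))"
proof -
  obtain R where R: "\<And>s t. f s t = poly (poly R [:t:]) s" using f unfolding poly2_def by blast
  have "poly (poly R [:t:]) s = (\<Sum>i\<le>degree R. (\<Sum>j\<le>degree (coeff R i). coeff (coeff R i) j * s ^ j) * t ^ i)" for s t
    unfolding poly_altdef[of R] poly_sum poly_mult poly_power by (simp add: poly_altdef[of "coeff R _"])
  then show ?thesis unfolding R by (auto intro!: poly2_sum poly2_mult poly2_power poly2_const u w)
qed

text \<open>Division by the largest power of \<open>t\<close> common to all components; afterwards
  the family has a nonzero value on the line \<open>t = 0\<close>.\<close>

lemma strip_power: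
  fixes p :: "nat \<Rightarrow> 'k::field_char_0 \<Rightarrow> 'k \<Rightarrow> 'k"
  assumes p: "\<And>j. j < n \<Longrightarrow> poly2 (p j)" and nz: "j0 < n" "p j0 s0 t0 \<noteq> 0"
  obtains r p' s1 where "\<And>j. j < n \<Longrightarrow> poly2 (p' j)" "\<And>j s t. j < n \<Longrightarrow> p j s t = t ^ r * p' j s t" "\<exists>j<n. p' j s1 0 \<noteq> 0"
proof -
  obtain R where R: "\<And>j s t. j < n \<Longrightarrow> p j s t = poly (poly (R j) [:t:]) s"
    using p unfolding poly2_def by metis
  have "R j0 \<noteq> 0" using R[OF nz(1)] nz(2) by auto
  then obtain r R' where r: "\<And>j. j < n \<Longrightarrow> R j = monom 1 r * R' j" "\<exists>j<n. coeff (R' j) 0 \<noteq> 0"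
    using shift_lowest[OF nz(1), of R] by blast
  obtain j1 where j1: "j1 < n" "coeff (R' j1) 0 \<noteq> 0" using r(2) by blast
  then obtain s1 where s1: "poly (coeff (R' j1) 0) s1 \<noteq> 0" using poly_all_0_iff_0 by blast
  show ?thesis
  proof (rule that[of "\<lambda>j s t. poly (poly (R' j) [:t:]) s" r s1])
    show "poly2 (\<lambda>s t. poly (poly (R' j) [:t:]) s)" for j unfolding poly2_def by blast
    show "p j s t = t ^ r * poly (poly (R' j) [:t:]) s" if "j < n" for j s t
      unfolding R[OF that] r(1)[OF that] by (simp add: poly_monom)
    have "poly (R' j1) [:0:] = coeff (R' j1) 0" by (metis poly_0_coeff_0 pCons_0_0)
    then show "\<exists>j<n. poly (poly (R' j) [:0:]) s1 \<noteq> 0" using j1(1) s1 by auto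
  qed
qed

text \<open>Proportionality as vanishing of 2 by 2 minors: a polynomial condition, so it extends
  from a nonvanishing locus to all parameters.\<close>

definition par :: "'k::field vec \<Rightarrow> 'k vec \<Rightarrow> bool" where
  "par x y \<longleftrightarrow> (\<forall>j<15. \<forall>k<15. x $ j * y $ k = x $ k * y $ j)"

lemma par_smult_iff:
  assumes "x \<in> carrier_vec 15" "y \<in> carrier_vec 15" "c \<noteq> 0" "d \<noteq> 0"
  shows "par (c \<cdot>\<^sub>v x) (d \<cdot>\<^sub>v y) \<longleftrightarrow> par x y"
proof -
  have "c * x $ j * (d * y $ k) = c * x $ k * (d * y $ j) \<longleftrightarrow> x $ j * y $ k = x $ k * y $ j" for j k
  proof -
    have "c * x $ j * (d * y $ k) = c * d * (x $ j * y $ k)" "c * x $ k * (d * y $ j) = c * d * (x $ k * y $ j)"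
      by simp_all
    then show ?thesis using assms(3,4) by simp
  qed
  then show ?thesis using assms(1,2) by (simp add: par_def)
qed

lemma par_self: "par x x"
  by (simp add: par_def mult.commute)

lemma parE:
  assumes "x \<in> carrier_vec 15" "y \<in> carrier_vec 15" "x \<noteq> 0\<^sub>v 15" "par x y"
  obtains c where "y = c \<cdot>\<^sub>v x"
proof -
  obtain i where i: "i < 15" "x $ i \<noteq> 0" using assms(1,3) by (metis carrier_vecD eq_vecI index_zero_vec)
  have "y = (y $ i / x $ i) \<cdot>\<^sub>v x"
  proof (rule eq_vecI)
    fix j assume "j < dim_vec ((y $ i / x $ i) \<cdot>\<^sub>v x)"
    then have "j < 15" using assms(1) by simp
    then show "y $ j = ((y $ i / x $ i) \<cdot>\<^sub>v x) $ j"
      using assms i unfolding par_def by (simp add: field_simps)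
  qed (use assms in simp)
  then show ?thesis by (rule that)
qed

lemma poly2_par:
  fixes x y :: "'k::field_char_0 \<Rightarrow> 'k \<Rightarrow> 'k vec"
  assumes x: "\<And>j. j < 15 \<Longrightarrow> poly2 (\<lambda>s t. x s t $ j)" and y: "\<And>j. j < 15 \<Longrightarrow> poly2 (\<lambda>s t. y s t $ j)"
    and g: "poly2 g" "g s0 t0 \<noteq> 0" and par: "\<And>s t. g s t \<noteq> 0 \<Longrightarrow> par (x s t) (y s t)"
  shows "par (x s t) (y s t)"
  unfolding par_def
proof (intro allI impI)
  fix j k :: nat assume jk: "j < 15" "k < 15"
  have "x s t $ j * y s t $ k - x s t $ k * y s t $ j = 0"
  proof (rule poly2_zero_product[of "\<lambda>s t. x s t $ j * y s t $ k - x s t $ k * y s t $ j", OF _ g(1) _ g(2)])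
    show "poly2 (\<lambda>s t. x s t $ j * y s t $ k - x s t $ k * y s t $ j)" by (intro poly2_diff poly2_mult x y jk)
    show "x s t $ j * y s t $ k - x s t $ k * y s t $ j = 0" if "g s t \<noteq> 0" for s t
      using par[OF that] jk by (simp add: par_def)
  qed
  then show "x s t $ j * y s t $ k = x s t $ k * y s t $ j" by simp
qed

lemma poly2_act:
  fixes x :: "'k::field \<Rightarrow> 'k \<Rightarrow> 'k vec"
  assumes x: "\<And>j. j < 15 \<Longrightarrow> poly2 (\<lambda>s t. x s t $ j)" "\<And>s t. x s t \<in> carrier_vec 15" and k: "k < 15"
  shows "poly2 (\<lambda>s t. act g (x s t) $ k)"
proof -
  obtain c m where "m < 15" "\<And>u :: 'k vec. u \<in> carrier_vec 15 \<Longrightarrow> act g u $ k = c * u $ m"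
    using compatibleD(4)[OF compatible_act k] by blast
  then have "(\<lambda>s t. act g (x s t) $ k) = (\<lambda>s t. c * x s t $ m)" "poly2 (\<lambda>s t. x s t $ m)" using x by simp_all
  then show ?thesis by (simp add: poly2_mult)
qed

definition vanishing_X :: "('k::field vec list \<Rightarrow> 'k) \<Rightarrow> bool" where
  "vanishing_X H \<longleftrightarrow> (\<exists>d. hompoly [15] d H) \<and> (\<forall>u\<in>cone_X. H [u] = 0)"

lemma vanishing_X_smult:
  assumes "vanishing_X H" "x \<in> carrier_vec 15" "c \<noteq> 0" "H [c \<cdot>\<^sub>v x] = 0" shows "H [x] = 0"
proof -
  obtain d where d: "hompoly [15] d H" using assms(1) by (auto simp: vanishing_X_def)
  have "H [c \<cdot>\<^sub>v x] = (\<Prod>j<length [15::nat]. c ^ d j) * H [x]"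
    by (rule hompoly_rescale[OF d]) (use assms(2) in \<open>auto simp: carr_def\<close>)
  then show ?thesis using assms(3,4) by simp
qed

lemma poly2_vanishing_X:
  fixes x :: "'k::field_char_0 \<Rightarrow> 'k \<Rightarrow> 'k vec"
  assumes H: "vanishing_X H" and x: "\<And>j. j < 15 \<Longrightarrow> poly2 (\<lambda>s t. x s t $ j)" "\<And>s t. x s t \<in> carrier_vec 15"
    and g: "poly2 g" "g s0 t0 \<noteq> 0" and z: "\<And>s t. g s t \<noteq> 0 \<Longrightarrow> H [x s t] = 0"
  shows "H [x s t] = 0"
proof (rule poly2_zero_product[OF _ g(1) z g(2)])
  obtain d where d: "hompoly [15] d H" using H by (auto simp: vanishing_X_def)
  show "poly2 (\<lambda>s t. H [x s t])" by (rule poly2_hompoly[OF d]) (use x in \<open>auto simp: carr_def\<close>)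
qed

text \<open>An equivariant family of points of the threefold has an equivariant limit, spanned by the lowest
  coefficient; it is a fixed point.\<close>

lemma no_equivariant_family:
  fixes p :: "'k::field_char_0 \<Rightarrow> 'k \<Rightarrow> 'k vec"
  assumes p: "\<And>j. j < 15 \<Longrightarrow> poly2 (\<lambda>s t. p s t $ j)" "\<And>s t. p s t \<in> carrier_vec 15" "p s0 t0 \<noteq> 0\<^sub>v 15"
    and H: "\<And>H s t. vanishing_X H \<Longrightarrow> H [p s t] = 0"
    and T: "\<And>s t. par (p (- s) t) (act (False, True) (p s t))"
    and DT: "\<And>s t. par (p s (- t)) (act (True, True) (p s t))"
  shows False
proof -
  obtain j0 where j0: "j0 < 15" "p s0 t0 $ j0 \<noteq> 0" using p(2,3) by (metis carrier_vecD eq_vecI index_zero_vec)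
  obtain r p' s1 where p': "\<And>j. j < 15 \<Longrightarrow> poly2 (p' j)" "\<And>j s t. j < 15 \<Longrightarrow> p s t $ j = t ^ r * p' j s t"
    "\<exists>j<15. p' j s1 0 \<noteq> 0"
    by (rule strip_power[of 15 "\<lambda>j s t. p s t $ j", OF _ j0]) (rule p(1), assumption, rule that)
  define q where "q s t = vec 15 (\<lambda>j. p' j s t)" for s t
  have qc: "q s t \<in> carrier_vec 15" for s t by (simp add: q_def)
  have q2: "poly2 (\<lambda>s t. q s t $ j)" if "j < 15" for j using p'(1)[OF that] that by (simp add: q_def)
  have pq: "p s t = t ^ r \<cdot>\<^sub>v q s t" for s t
    by (rule eq_vecI) (use p(2)[of s t] p'(2) in \<open>auto simp: q_def\<close>)
  have nz: "t ^ r \<noteq> 0" if "t \<noteq> 0" for t :: 'k using that by simp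
  have qH: "H [q s t] = 0" if "vanishing_X H" for H s t
  proof (rule poly2_vanishing_X[OF that q2 qc poly2_snd])
    show "(1::'k) \<noteq> 0" by simp
    show "H [q s t] = 0" if "t \<noteq> 0" for s t
      by (rule vanishing_X_smult[OF \<open>vanishing_X H\<close> qc nz[OF that]]) (use H[OF \<open>vanishing_X H\<close>, of s t] in \<open>simp add: pq\<close>)
  qed
  have qT: "par (q (- s) t) (act (False, True) (q s t))" for s t
  proof (rule poly2_par[of "\<lambda>s t. q (- s) t", OF _ poly2_act[OF q2 qc] poly2_snd])
    show "(1::'k) \<noteq> 0" by simp
    show "poly2 (\<lambda>s t. q (- s) t $ j)" if "j < 15" for j
      by (rule poly2_compose[OF q2[OF that]]) (auto intro: poly2_uminus)
    show "par (q (- s) t) (act (False, True) (q s t))" if "t \<noteq> 0" for s t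
      using T[of s t] unfolding pq act_simps(2)[OF qc]
      by (subst (asm) par_smult_iff) (use qc act_simps(1)[OF qc] nz that in auto)
  qed
  have qDT: "par (q s (- t)) (act (True, True) (q s t))" for s t
  proof (rule poly2_par[of "\<lambda>s t. q s (- t)", OF _ poly2_act[OF q2 qc] poly2_snd])
    show "(1::'k) \<noteq> 0" by simp
    show "poly2 (\<lambda>s t. q s (- t) $ j)" if "j < 15" for j
      by (rule poly2_compose[OF q2[OF that]]) (auto intro: poly2_uminus)
    show "par (q s (- t)) (act (True, True) (q s t))" if "t \<noteq> 0" for s t
      using DT[of s t] unfolding pq act_simps(2)[OF qc]
      by (subst (asm) par_smult_iff) (use qc act_simps(1)[OF qc] nz[of t] nz[of "- t"] that in auto)
  qed
  \<comment> \<open>The second limit, along \<open>t = 0\<close>: the remaining variable becomes the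
    second argument, as \<open>strip_power\<close> expects. The first argument is a dummy, later
    frozen at \<open>s2\<close>.\<close>
  define f where "f j s t = q t 0 $ j" for j and s t :: 'k
  have f: "poly2 (f j)" if "j < 15" for j
    unfolding f_def by (rule poly2_compose[OF q2[OF that]]) auto
  obtain j1 where j1: "j1 < 15" "f j1 0 s1 \<noteq> 0" using p'(3) by (auto simp: f_def q_def)
  obtain r2 \<sigma> s2 where \<sigma>: "\<And>j. j < 15 \<Longrightarrow> poly2 (\<sigma> j)" "\<And>j s t. j < 15 \<Longrightarrow> f j s t = t ^ r2 * \<sigma> j s t"
    "\<exists>j<15. \<sigma> j s2 0 \<noteq> 0"
    by (rule strip_power[of 15 f, OF _ j1]) (rule f, assumption, rule that)
  define \<tau> where "\<tau> t = vec 15 (\<lambda>j. \<sigma> j s2 t)" for t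
  have \<tau>c: "\<tau> t \<in> carrier_vec 15" for t by (simp add: \<tau>_def)
  have \<tau>2: "poly2 (\<lambda>s t. \<tau> t $ j)" if "j < 15" for j
    using poly2_compose[OF \<sigma>(1)[OF that] poly2_const poly2_snd, of s2] that by (simp add: \<tau>_def)
  have q\<tau>: "q t 0 = t ^ r2 \<cdot>\<^sub>v \<tau> t" for t
    by (rule eq_vecI) (use qc[of t 0] \<sigma>(2)[of _ s2 t] in \<open>auto simp: \<tau>_def f_def\<close>)
  have nz2: "t ^ r2 \<noteq> 0" if "t \<noteq> 0" for t :: 'k using that by simp
  have H0: "H [\<tau> 0] = 0" if "vanishing_X H" for H
  proof (rule poly2_vanishing_X[OF that \<tau>2 \<tau>c poly2_snd])
    show "(1::'k) \<noteq> 0" by simp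
    show "H [\<tau> t] = 0" if "t \<noteq> 0" for t
      by (rule vanishing_X_smult[OF \<open>vanishing_X H\<close> \<tau>c nz2[OF that]]) (use qH[OF \<open>vanishing_X H\<close>, of t 0] in \<open>simp add: q\<tau>\<close>)
  qed
  have T0: "par (\<tau> (- t)) (act (False, True) (\<tau> t))" for t
  proof (rule poly2_par[of "\<lambda>s t. \<tau> (- t)" "\<lambda>s t. act (False, True) (\<tau> t)", OF _ poly2_act[OF \<tau>2 \<tau>c] poly2_snd])
    show "(1::'k) \<noteq> 0" by simp
    show "poly2 (\<lambda>s t. \<tau> (- t) $ j)" if "j < 15" for j
      by (rule poly2_compose[OF \<tau>2[OF that] poly2_fst]) (auto intro: poly2_uminus)
    show "par (\<tau> (- t)) (act (False, True) (\<tau> t))" if "t \<noteq> 0" for t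
      using qT[of t 0] unfolding q\<tau> act_simps(2)[OF \<tau>c]
      by (subst (asm) par_smult_iff) (use \<tau>c act_simps(1)[OF \<tau>c] nz2[of t] nz2[of "- t"] that in auto)
  qed
  \<comment> \<open>\<open>DT\<close> corresponds to the sign change of the variable that is already
    zero, so it fixes every line of the one-parameter family.\<close>
  have DT0: "par (\<tau> t) (act (True, True) (\<tau> t))" for t
  proof (rule poly2_par[of "\<lambda>s t. \<tau> t" "\<lambda>s t. act (True, True) (\<tau> t)", OF \<tau>2 poly2_act[OF \<tau>2 \<tau>c] poly2_snd])
    show "(1::'k) \<noteq> 0" by simp
    show "par (\<tau> t) (act (True, True) (\<tau> t))" if "t \<noteq> 0" for t
      using qDT[of t 0] unfolding minus_zero q\<tau> act_simps(2)[OF \<tau>c]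
      by (subst (asm) par_smult_iff) (use \<tau>c act_simps(1)[OF \<tau>c] nz2[of t] that in auto)
  qed
  have \<tau>0: "\<tau> 0 \<noteq> 0\<^sub>v 15" using \<sigma>(3) by (auto simp: \<tau>_def vec_eq_iff)
  obtain c1 where c1: "act (False, True) (\<tau> 0) = c1 \<cdot>\<^sub>v \<tau> 0"
    by (rule parE[OF \<tau>c act_simps(1)[OF \<tau>c] \<tau>0 T0[of 0, unfolded minus_zero]]) (rule that)
  obtain c2 where c2: "act (True, True) (\<tau> 0) = c2 \<cdot>\<^sub>v \<tau> 0"
    by (rule parE[OF \<tau>c act_simps(1)[OF \<tau>c] \<tau>0 DT0[of 0]]) (rule that)
  show False
    by (rule no_fixed_point[OF \<tau>c \<tau>0 _ c1 c2]) (use H0 in \<open>auto simp: vanishing_X_def\<close>)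
qed

text \<open>For \<open>x\<^sub>0 = a\<^sup>2\<close> and \<open>x\<^sub>1 = b\<^sup>2\<close> the equation of the cubic reads \<open>c = (a y\<^sub>2)\<^sup>2 - (b y\<^sub>1)\<^sup>2\<close>, which is solved
  rationally by \<open>m = b y\<^sub>1 - a y\<^sub>2\<close>. The sign changes of \<open>a\<close> and \<open>b\<close> induce the group action.\<close>

definition theta :: "'k::field \<Rightarrow> 'k \<Rightarrow> 'k \<Rightarrow> 'k \<Rightarrow> 'k vec" where
  "theta x m a b = (let c = (a ^ 2 + b ^ 2) ^ 3 + 6 * a ^ 2 * b ^ 2 * x + 2 * x ^ 3 in
     vec 5 (\<lambda>i. [2 * a * b * m * a ^ 2, 2 * a * b * m * b ^ 2, 2 * a * b * m * x, a * (m ^ 2 - c), - b * (m ^ 2 + c)] ! i))"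

lemma theta_carrier [simp]: "theta x m a b \<in> carrier_vec 5"
  by (simp add: theta_def Let_def)

lemma cubic_theta: "cubic (theta x m a b) = 0"
proof -
  define c where "c = (a ^ 2 + b ^ 2) ^ 3 + 6 * a ^ 2 * b ^ 2 * x + 2 * x ^ 3"
  define M A B where "M = 2 * a * b * m" and "A = a ^ 2" and "B = b ^ 2"
  have "cubic (theta x m a b) = (M * A + M * B) ^ 3 + 6 * (M * A) * (M * B) * (M * x) + 2 * (M * x) ^ 3
      + M * B * (a * (m ^ 2 - c)) ^ 2 - M * A * (- b * (m ^ 2 + c)) ^ 2"
    by (simp add: cubic_def theta_def Let_def c_def[symmetric] M_def A_def B_def)
  also have "\<dots> = M ^ 3 * ((A + B) ^ 3 + 6 * A * B * x + 2 * x ^ 3) - 4 * (M * A * B * (m ^ 2 * c))"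
    by (simp add: A_def[symmetric] B_def[symmetric] power_mult_distrib) (simp add: algebra_simps power2_eq_square power3_eq_cube)
  also have "(A + B) ^ 3 + 6 * A * B * x + 2 * x ^ 3 = c" by (simp add: c_def A_def B_def)
  also have "M ^ 3 * c - 4 * (M * A * B * (m ^ 2 * c)) = M * c * (M ^ 2 - 4 * (A * B * m ^ 2))"
    by (simp add: algebra_simps power2_eq_square power3_eq_cube)
  also have "M ^ 2 - 4 * (A * B * m ^ 2) = 0" by (simp add: M_def A_def B_def power_mult_distrib)
  finally show ?thesis by simp
qed

lemma theta_symmetry:
  "form_coords (theta x m (- a) b) = act (False, True) (form_coords (theta x m a b))"
  "form_coords (theta x m a (- b)) = (- 1) \<cdot>\<^sub>v act (True, True) (form_coords (theta x m a b))"
proof -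
  have i: "theta x m a b $ 0 = 2 * a * b * m * a ^ 2" "theta x m a b $ Suc 0 = 2 * a * b * m * b ^ 2"
    "theta x m a b $ 2 = 2 * a * b * m * x"
    "theta x m a b $ 3 = a * (m ^ 2 - ((a ^ 2 + b ^ 2) ^ 3 + 6 * a ^ 2 * b ^ 2 * x + 2 * x ^ 3))"
    "theta x m a b $ 4 = - b * (m ^ 2 + ((a ^ 2 + b ^ 2) ^ 3 + 6 * a ^ 2 * b ^ 2 * x + 2 * x ^ 3))" for a b
    by (simp_all add: theta_def Let_def)
  show "form_coords (theta x m (- a) b) = act (False, True) (form_coords (theta x m a b))"
    by (rule vec_15_eqI) (simp_all add: form_coords_index act_def actT_index i)
  show "form_coords (theta x m a (- b)) = (- 1) \<cdot>\<^sub>v act (True, True) (form_coords (theta x m a b))"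
    by (rule vec_15_eqI) (simp_all add: form_coords_index act_def actT_index actD_index i)
qed

text \<open>With square roots \<open>a\<close>, \<open>b\<close> of x0, x1 and
  \<open>m = b y1 - a y2\<close>, \<open>m' = b y1 + a y2\<close>, the equation of the cubic becomes
  \<open>c = - m m'\<close>. Substituting this into \<open>theta\<close> gives back the point times
  \<open>2 a b m\<close>.\<close>

lemma theta_hits:
  fixes y :: "'k::{alg_closed_field, field_char_0} vec"
  assumes y: "y \<in> carrier_vec 5" "cubic y = 0" "y $ 0 \<noteq> 0" "y $ 1 \<noteq> 0" "y $ 3 \<noteq> 0"
  obtains m a b c where "c \<noteq> 0" "m \<noteq> 0" "a \<noteq> 0" "b \<noteq> 0" "theta (y $ 2) m a b = c \<cdot>\<^sub>v y"
proof -
  have root: "\<exists>r. r ^ 2 = (z :: 'k)" for z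
    using alg_closed_imp_poly_has_root[of "[:- z, 0, 1:]"] by (auto simp: power2_eq_square)
  obtain a' where a': "a' ^ 2 = y $ 0" using root by blast
  obtain b where b: "b ^ 2 = y $ 1" using root by blast
  have b0: "b \<noteq> 0" using b y(4) by auto
  \<comment> \<open>The values of \<open>m\<close> for the two square roots of \<open>y $ 0\<close>
    add up to \<open>2 b y1\<close>, so they are not both zero.\<close>
  have "\<exists>a. a ^ 2 = y $ 0 \<and> b * y $ 3 - a * y $ 4 \<noteq> 0"
  proof (cases "b * y $ 3 - a' * y $ 4 = 0")
    case True
    have "b * y $ 3 - (- a') * y $ 4 \<noteq> 0"
    proof
      assume "b * y $ 3 - (- a') * y $ 4 = 0"
      then have "2 * (b * y $ 3) = 0" using True by (simp add: algebra_simps)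
      then show False using b0 y(5) by simp
    qed
    then show ?thesis using a' by (intro exI[of _ "- a'"]) simp
  qed (use a' in blast)
  then obtain a where a: "a ^ 2 = y $ 0" "b * y $ 3 - a * y $ 4 \<noteq> 0" by blast
  have a0: "a \<noteq> 0" using a(1) y(3) by auto
  define m where "m = b * y $ 3 - a * y $ 4"
  define m' where "m' = b * y $ 3 + a * y $ 4"
  define c where "c = (a ^ 2 + b ^ 2) ^ 3 + 6 * a ^ 2 * b ^ 2 * y $ 2 + 2 * y $ 2 ^ 3"
  have "c + m * m' = cubic y"
    by (simp add: c_def m_def m'_def cubic_def a(1)[symmetric] b[symmetric, unfolded One_nat_def])
      (simp add: algebra_simps power2_eq_square)
  then have c: "c = - (m * m')" using y(2) by (simp add: eq_neg_iff_add_eq_0)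
  have e: "m + m' = 2 * (b * y $ 3)" "m - m' = - (2 * (a * y $ 4))" by (simp_all add: m_def m'_def)
  have "a * (m ^ 2 - c) = a * m * (m + m')" "- b * (m ^ 2 + c) = - b * m * (m - m')"
    unfolding c by (simp_all add: power2_eq_square algebra_simps)
  then have f: "a * (m ^ 2 - c) = (2 * a * b * m) * y $ 3" "- b * (m ^ 2 + c) = (2 * a * b * m) * y $ 4"
    unfolding e by (simp_all add: mult_ac)
  have "theta (y $ 2) m a b = vec 5 (\<lambda>i. [2 * a * b * m * a ^ 2, 2 * a * b * m * b ^ 2, 2 * a * b * m * y $ 2,
      a * (m ^ 2 - c), - b * (m ^ 2 + c)] ! i)"
    by (simp only: theta_def Let_def c_def)
  also have "\<dots> = (2 * a * b * m) \<cdot>\<^sub>v y"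
    unfolding f a(1) b using y(1) by (intro vec_5_eqI) simp_all
  finally have "theta (y $ 2) m a b = (2 * a * b * m) \<cdot>\<^sub>v y" .
  then show ?thesis using a0 b0 a(2) by (intro that[of "2 * a * b * m" m a b]) (simp_all add: m_def)
qed

context klein
begin

text \<open>The domain of the map may miss a given surface, so the surface is drawn through a point
  of the domain: its parameters \<open>x\<close> and \<open>m\<close> are read off from a point with
  \<open>free_Y \<noteq> 0\<close>, which density provides.\<close>

lemma not_equivariantly_birational:
  "\<not> equivariantly_birational G
    [15] (Y_of (form :: 'k::{alg_closed_field, field_char_0} vec \<Rightarrow> 'k mat)) (\<lambda>g. restrict (point_act (\<kappa> g)) (Y_of form))
    [15] (X_of form) (\<lambda>g. restrict (point_act (\<kappa> g)) (X_of form))"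
proof
  let ?Y = "Y_of (form :: 'k vec \<Rightarrow> 'k mat)" and ?X = "X_of (form :: 'k vec \<Rightarrow> 'k mat)"
  assume "equivariantly_birational G [15] ?Y (\<lambda>g. restrict (point_act (\<kappa> g)) ?Y) [15] ?X (\<lambda>g. restrict (point_act (\<kappa> g)) ?X)"
  then obtain U \<phi> where bir: "birational_map [15] ?Y [15] ?X U \<phi>"
    and eq: "\<And>g x. g \<in> carrier G \<Longrightarrow> x \<in> U \<Longrightarrow> restrict (point_act (\<kappa> g)) ?Y x \<in> U \<Longrightarrow>
      \<phi> (restrict (point_act (\<kappa> g)) ?Y x) = restrict (point_act (\<kappa> g)) ?X (\<phi> x)"
    unfolding equivariantly_birational_def by blast
  obtain U' where U: "dense_open [15] ?Y U" and U': "dense_open [15] ?X U'" and mor: "morphism [15] U [15] U' \<phi>"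
    using bir unfolding birational_map_def isomorphism_def by blast
  have UY: "U \<subseteq> ?Y" and U'X: "U' \<subseteq> ?X"
    using U U' openin_subset unfolding dense_open_def by fastforce+
  have top: "topspace (zariski_on [15] U) = U" "topspace (zariski_on [15] U') = U'"
    using UY Y_of_subset[of form] U'X X_of_subset[of form] by auto
  have into: "\<phi> x \<in> ?X" if "x \<in> U" for x
    using mor that U'X unfolding morphism_def continuous_map_def top by blast
  have eqv: "\<phi> (point_act g x) = point_act g (\<phi> x)" if "x \<in> U" "point_act g x \<in> U" for g x
  proof -
    obtain h where "h \<in> carrier G" "\<kappa> h = g" using bij by (metis UNIV_I bij_betw_iff_bijections)
    then show ?thesis using eq[of h x] that into[of x] UY by auto
  qed
  have "form_coords good_point \<noteq> (0\<^sub>v 15 :: 'k vec)"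
    using form_coords_eq_zeroD good_point_facts by blast
  then have good: "[form_coords good_point :: 'k vec] \<in> hom_coords [15]" "map line [form_coords good_point :: 'k vec] \<in> ?Y"
    using good_point_facts by (auto simp: hom_coords_def Y_of_form)
  have gV: "map line [form_coords good_point] \<in> ?Y \<inter> nonvanishing [15] free_Y"
    using good map_line_in_nonvanishing[OF hompoly_free(1) good(1)]
    by (simp add: free_Y_def form_coords_index good_point_def)
  have "zariski_on [15] ?Y closure_of U = ?Y" using U by (simp add: dense_open_def)
  then have "map line [form_coords good_point] \<in> zariski_on [15] ?Y closure_of U" using gV by blast
  then have cl: "\<And>T. map line [form_coords good_point] \<in> T \<Longrightarrow> openin (zariski_on [15] ?Y) T \<Longrightarrow> \<exists>y. y \<in> U \<and> y \<in> T"
    unfolding in_closure_of by blast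
  have op: "openin (zariski_on [15] ?Y) (?Y \<inter> nonvanishing [15] free_Y)"
    using dense_free_Y by (auto simp: dense_open_def)
  from cl[OF gV op] obtain x where x: "x \<in> U" "x \<in> ?Y" "x \<in> nonvanishing [15] free_Y" by blast
  obtain u where u: "u \<in> carrier_vec 15" "u \<noteq> 0\<^sub>v 15" "x = [line u]" "free_Y [u] \<noteq> 0"
    using x(3) by (auto simp: nonvanishing_def hom_coords_def list_all2_Cons2)
  obtain y where y: "y \<in> carrier_vec 5" "y \<noteq> 0\<^sub>v 5" "cubic y = 0" "u = form_coords y"
    using Y_repE[OF _ u(1,2)] x(2) u(3) by auto
  have yn: "y $ 0 \<noteq> 0" "y $ 1 \<noteq> 0" "y $ 3 \<noteq> 0"
    using u(4) by (auto simp: free_Y_def y(4) form_coords_index)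
  obtain m a0 b0 c where c: "c \<noteq> 0" "m \<noteq> 0" "a0 \<noteq> 0" "b0 \<noteq> 0" "theta (y $ 2) m a0 b0 = c \<cdot>\<^sub>v y"
    by (rule theta_hits[OF y(1,3) yn]) (rule that)
  define \<Theta> where "\<Theta> a b = form_coords (theta (y $ 2) m a b)" for a b
  have \<Theta>c: "\<Theta> a b \<in> carrier_vec 15" for a b by (simp add: \<Theta>_def)
  have \<Theta>0: "\<Theta> a0 b0 = c \<cdot>\<^sub>v u" using c(5) y(1) by (simp add: \<Theta>_def y(4) form_coords_smult)
  have nz: "theta (y $ 2) m a b \<noteq> 0\<^sub>v 5" if "a \<noteq> 0" "b \<noteq> 0" for a b
  proof
    assume "theta (y $ 2) m a b = 0\<^sub>v 5"
    then have "theta (y $ 2) m a b $ 0 = 0" by simp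
    then show False using that c(2) by (simp add: theta_def Let_def)
  qed
  have \<Theta>h: "[\<Theta> a b] \<in> hom_coords [15]" and \<Theta>Y: "map line [\<Theta> a b] \<in> ?Y" if "a \<noteq> 0" "b \<noteq> 0" for a b
    using nz[OF that] form_coords_eq_zeroD[OF theta_carrier] cubic_theta[of "y $ 2" m a b] theta_carrier[of "y $ 2" m a b]
    by (auto simp: \<Theta>_def hom_coords_def Y_of_form)
  have x\<Theta>: "map line [\<Theta> a0 b0] \<in> U" using x(1) u(3) c(1) by (simp add: \<Theta>0 line_smult)
  have opU: "openin (zariski_on [15] ?Y) U" using U by (simp add: dense_open_def)
  obtain d R P where R: "hompoly [15] d R" "R [\<Theta> a0 b0] \<noteq> 0" and P: "\<forall>j<15. \<exists>e. hompoly [15] e (P j)"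
    and loc: "\<forall>v\<in>hom_coords [15]. map line v \<in> ?Y \<longrightarrow> R v \<noteq> 0 \<longrightarrow> map line v \<in> U \<and>
      vec 15 (\<lambda>j. P j v) \<noteq> 0\<^sub>v 15 \<and> \<phi> (map line v) = [line (vec 15 (\<lambda>j. P j v))]"
    using morphism_locally_polynomial[OF mor opU Y_of_subset order_trans[OF U'X X_of_subset] \<Theta>h[OF c(3,4)] x\<Theta>]
    by (elim exE conjE) (rule that)
  define p where "p a b = vec 15 (\<lambda>j. P j [\<Theta> a b])" for a b
  \<comment> \<open>Where \<open>Q\<close> is nonzero, the surface point is defined and the
    polynomials \<open>P\<close> represent the map.\<close>
  define Q where "Q a b = R [\<Theta> a b] * (a * b)" for a b
  have pc: "p a b \<in> carrier_vec 15" for a b by (simp add: p_def)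
  have th: "poly2 (\<lambda>s t. theta (y $ 2) m s t $ i)" if "i < 5" for i
    using less_5_cases[OF that]
    by (elim disjE) (simp_all add: theta_def Let_def,
      (intro poly2_add poly2_diff poly2_mult poly2_uminus poly2_power poly2_fst poly2_snd poly2_const)+)
  have \<Theta>2: "poly2 (\<lambda>s t. \<Theta> s t $ i)" if "i < 15" for i
    unfolding \<Theta>_def using less_15_cases[OF that]
    by (elim disjE) (simp_all add: form_coords_index, (intro poly2_add poly2_diff poly2_uminus th; simp)+)
  have h\<Theta>: "poly2 (\<lambda>s t. H [\<Theta> s t])" if "hompoly [15] e H" for e H
    by (rule poly2_hompoly[OF that]) (use \<Theta>2 \<Theta>c in \<open>auto simp: carr_def\<close>)
  have p2: "poly2 (\<lambda>s t. p s t $ j)" if j: "j < 15" for j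
    using P h\<Theta> j by (auto simp: p_def)
  have Q2: "poly2 Q" unfolding Q_def by (intro poly2_mult h\<Theta>[OF R(1)] poly2_fst poly2_snd)
  have Q0: "Q a0 b0 \<noteq> 0" using R(2) c(3,4) by (simp add: Q_def)
  have good_ab: "map line [\<Theta> a b] \<in> U" "p a b \<noteq> 0\<^sub>v 15" "\<phi> (map line [\<Theta> a b]) = [line (p a b)]" if "Q a b \<noteq> 0" for a b
    using bspec[OF loc \<Theta>h] \<Theta>Y that unfolding Q_def p_def by auto
  have pX: "p a b \<in> cone_X" if ab: "Q a b \<noteq> 0" for a b
  proof -
    have "[line (p a b)] \<in> ?X" using into[OF good_ab(1)[OF ab]] good_ab(3)[OF ab] by simp
    then obtain v w where "v \<in> carrier_vec 6" "w \<in> carrier_vec 6" "isotropic v w" "p a b = coords (wedge v w)"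
      by (rule X_repE[OF _ pc good_ab(2)[OF ab]]) (rule that)
    then show ?thesis unfolding cone_X_def by blast
  qed
  have sym: "par (p a' b') (act g (p a b))"
    if Q: "Q a b \<noteq> 0" "Q a' b' \<noteq> 0" and \<Theta>: "line (\<Theta> a' b') = line (act g (\<Theta> a b))" for a b a' b' g
  proof -
    have e: "map line [\<Theta> a' b'] = point_act g (map line [\<Theta> a b])" using \<Theta> point_act_line[OF \<Theta>c] by simp
    have "[line (p a' b')] = point_act g [line (p a b)]"
      using eqv[of "map line [\<Theta> a b]" g] good_ab[OF Q(1)] good_ab[OF Q(2)] e by simp
    then have "line (act g (p a b)) = line (p a' b')" using point_act_line[OF pc] by simp
    then obtain k where k: "k \<noteq> 0" "p a' b' = k \<cdot>\<^sub>v act g (p a b)"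
      using line_eqD[OF _ pc good_ab(2)[OF Q(2)]] by blast
    then show ?thesis
      using par_smult_iff[OF act_simps(1)[OF pc] act_simps(1)[OF pc], of k 1] by (simp add: par_self)
  qed
  have Qm: "poly2 (\<lambda>s t. Q (- s) t)" "poly2 (\<lambda>s t. Q s (- t))"
    by (rule poly2_compose[OF Q2]; auto intro: poly2_uminus)+
  \<comment> \<open>Equivariance can be used only where the representation is valid at a point and
    at its mirror image. \<open>Q\<close> and its reflection are nonzero polynomials, hence so is
    their product.\<close>
  have "\<exists>s t. Q s t * Q (- s) t \<noteq> 0"
  proof (rule ccontr)
    assume "\<not> ?thesis"
    then have "Q (- s) t = 0" if "Q s t \<noteq> 0" for s t using that by auto
    then have "Q (- (- a0)) b0 = 0"
      by (rule poly2_zero_product[of "\<lambda>s t. Q (- s) t" Q a0 b0 "- a0" b0, OF Qm(1) Q2 _ Q0])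
    then show False using Q0 by simp
  qed
  then obtain s1 t1 where 1: "Q s1 t1 * Q (- s1) t1 \<noteq> 0" by blast
  have "\<exists>s t. Q s t * Q s (- t) \<noteq> 0"
  proof (rule ccontr)
    assume "\<not> ?thesis"
    then have "Q s (- t) = 0" if "Q s t \<noteq> 0" for s t using that by auto
    then have "Q a0 (- (- b0)) = 0"
      by (rule poly2_zero_product[of "\<lambda>s t. Q s (- t)" Q a0 b0 a0 "- b0", OF Qm(2) Q2 _ Q0])
    then show False using Q0 by simp
  qed
  then obtain s2 t2 where 2: "Q s2 t2 * Q s2 (- t2) \<noteq> 0" by blast
  show False
  proof (rule no_equivariant_family[of p, OF p2 pc good_ab(2)[OF Q0]])
    show "H [p s t] = 0" if "vanishing_X H" for H s t
      by (rule poly2_vanishing_X[OF that p2 pc Q2 Q0]) (use that pX in \<open>auto simp: vanishing_X_def\<close>)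
    show "par (p (- s) t) (act (False, True) (p s t))" for s t
    proof (rule poly2_par[of "\<lambda>s t. p (- s) t", OF _ poly2_act[OF p2 pc] poly2_mult[OF Q2 Qm(1)] 1])
      show "poly2 (\<lambda>s t. p (- s) t $ j)" if "j < 15" for j
        by (rule poly2_compose[OF p2[OF that]]) (auto intro: poly2_uminus)
      show "par (p (- s) t) (act (False, True) (p s t))" if "Q s t * Q (- s) t \<noteq> 0" for s t
        by (rule sym) (use that in \<open>simp_all add: \<Theta>_def theta_symmetry(1)\<close>)
    qed
    show "par (p s (- t)) (act (True, True) (p s t))" for s t
    proof (rule poly2_par[of "\<lambda>s t. p s (- t)", OF _ poly2_act[OF p2 pc] poly2_mult[OF Q2 Qm(2)] 2])
      show "poly2 (\<lambda>s t. p s (- t) $ j)" if "j < 15" for j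
        by (rule poly2_compose[OF p2[OF that]]) (auto intro: poly2_uminus)
      show "par (p s (- t)) (act (True, True) (p s t))" if "Q s t * Q s (- t) \<noteq> 0" for s t
        by (rule sym) (use that in \<open>simp_all add: \<Theta>_def theta_symmetry(2) line_smult\<close>)
    qed
  qed
qed

end

theorem theorem1p2:
  fixes G :: "('g, 'b) monoid_scheme"
  assumes "group G"
    and "G \<cong> integer_mod_group 2 \<times>\<times> integer_mod_group 2"
  shows "\<exists>(Y :: 'k::{alg_closed_field, field_char_0} point set) X \<alpha> \<alpha>'.
    smooth_cubic_threefold 15 Y \<and> associated Y X \<and> birational [15] Y [15] X \<and>
    regular_action G [15] Y \<alpha> \<and> generically_free G [15] Y \<alpha> \<and>
    regular_action G [15] X \<alpha>' \<and> generically_free G [15] X \<alpha>' \<and>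
    \<not> equivariantly_birational G [15] Y \<alpha> [15] X \<alpha>' \<and>
    twisted_equivariantly_stably_birational G [15] Y \<alpha> [15] X \<alpha>'"
proof -
  obtain \<kappa> where "klein G \<kappa>" using klein_exists[OF assms] by blast
  then interpret klein G \<kappa> .
  let ?Y = "Y_of (form :: 'k vec \<Rightarrow> 'k mat)" and ?X = "X_of (form :: 'k vec \<Rightarrow> 'k mat)"
  show ?thesis
  proof (intro exI conjI)
    show "smooth_cubic_threefold 15 ?Y" by (rule smooth_cubic_threefold_Y_of_form)
    show "associated ?Y ?X" unfolding associated_def using regular_embedding_form by blast
    show "birational [15] ?Y [15] ?X" by (rule birational_Y_X)
    show "regular_action G [15] ?Y (\<lambda>g. restrict (point_act (\<kappa> g)) ?Y)"
      by (rule regular_action_point_act[OF Y_of_subset]) (rule point_act_Y)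
    show "regular_action G [15] ?X (\<lambda>g. restrict (point_act (\<kappa> g)) ?X)"
      by (rule regular_action_point_act[OF X_of_subset]) (rule point_act_X)
    show "generically_free G [15] ?Y (\<lambda>g. restrict (point_act (\<kappa> g)) ?Y)"
      by (rule generically_free_point_act[OF dense_free_Y Int_lower1 _ Y_of_subset]) (rule free_point_Y)
    show "generically_free G [15] ?X (\<lambda>g. restrict (point_act (\<kappa> g)) ?X)"
      by (rule generically_free_point_act[OF dense_free_X Int_lower1 _ X_of_subset]) (rule free_point_X)
  qed (rule not_equivariantly_birational twisted_Y_X)+
qed

end
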